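(* Let $f,g:\mathbb{R}\to\mathbb{R}$ be smooth. Consider a smooth non-characteristic traveling wave $(t,x)\mapsto \underline{u}(x-\sigma t)$ of $$\partial_t u+\partial_x(f(u))=g(u)\qquad (t\ge 0,\ x\in\mathbb{R}),$$ of profile $\underline u$ and speed $\sigma$, with endstates $u_-$ at $-\infty$ and $u_+$ at $+\infty$ such that $g'(u_-)<0<g'(u_+)$. Set $\kappa^+:=g'(u_+)/|f'(u_+)-\sigma|$. There exists a positive $\delta_0$, and for any sub-exponential weight $\rho$ there exist positive $C_\rho$ and $\theta_\rho$, such that if $u_0\in BUC^1(\mathbb{R})$ with $(u_0-\underline u)/\Omega_{\kappa^+}^+\in BUC^0(\mathbb{R})$, $\partial_x(u_0-\underline u)/\Omega_{\kappa^+}^+\in BUC^0(\mathbb{R})$ and $$E_{0,\kappa^+}:=\|u_0-\underline u\|_{W^{1,\infty}_{\kappa^+,+}}\le\delta_0,$$ then the solution $u$ to $\partial_t u+\partial_x(f(u))=g(u)$ starting from $u(0,\cdot)=u_0$ satisfies: 1. if $\displaystyle\lim_{x\to\infty}\exp(\kappa^+x)\,(u_0-\underline u,\partial_x(u_0-\underline u))(x)=(0,0)$ then $$\lim_{t\to\infty}\|u(t,\cdot+\sigma t)-\underline u\|_{W^{1,\infty}_{\kappa^+,+}}=0;$$ 2. if $\rho$ is a sub-exponential weight such that $E_0^{[\rho]}:=\|u_0-\underline u\|_{W^{1,\infty}_{+,\rho}}<+\infty$ then for any $t\ge 0$ $$\|u(t,\cdot+\sigma t)-\underline u\|_{W^{1,\infty}_{\kappa^+,+}}\le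 C_\rho\,E_0^{[\rho]}\,\rho(\theta_\rho\,t).$$
   Context: Solutions are Kružkov entropy solutions. A traveling wave is a solution of the form $u(t,x)=\underline u(x-\sigma t)$; its endstates are the limits of $\underline u$ at $\pm\infty$. The wave is non-characteristic if $f'(v)\neq\sigma$ for every value $v$ of $\underline u$ and for both endstates. $BUC^0(\mathbb{R})$ denotes the bounded uniformly continuous functions, $BUC^1(\mathbb{R})$ the $\mathcal{C}^1$ functions that are in $BUC^0(\mathbb{R})$ together with their first derivative. For $\kappa>0$, $\Omega^+_\kappa(x):=\exp(-\kappa x_+)$ where $x_+=\max(\{x,0\})$, and $\|v\|_{W^{1,\infty}_{\kappa,+}}:=\|(\Omega_\kappa^+)^{-1}(v,\partial_x v)\|_{L^\infty(\mathbb{R})}$. A sub-exponential weight is a positive non-increasing function $\rho:\mathbb{R}_+\to(0,\infty)$, converging to $0$ at $+\infty$, such that (i) there exist positive $\omega$ and $C$ such that for any $t\ge0$, $C\exp(-\omega t)\le\rho(t)$; (ii) there exist positive $\omega$ and $C$ such that for any $t\ge0$, $\int_0^t\exp(-\omega(t-s))\rho(s)\,\mathrm{d}s\le C\rho(t)$. With such a $\rho$ one associates $\rho^+(x):=\rho(x_+)$ for $x\in\mathbb{R}$ and $$\|v\|_{W^{1,\infty}_{+,\rho}}:=\|(\rho^+\,\Omega_{\kappa^+}^+)^{-1}(v,\partial_x v)\|_{L^\infty(\mathbb{R})}.$$ *)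

theory Defs
  imports "HOL-Analysis.Analysis" "HOL-Probability.Essential_Supremum"
begin

definition smooth :: "(real \<Rightarrow> real) \<Rightarrow> bool" where
  "smooth h \<longleftrightarrow> (\<forall>n x. (deriv ^^ n) h field_differentiable (at x))"

definition BUC0 :: "(real \<Rightarrow> real) \<Rightarrow> bool" where
  "BUC0 v \<longleftrightarrow> bounded (range v) \<and> uniformly_continuous_on UNIV v"

(* Continuity of the derivative is part of "BUC0 (deriv v)". *)
definition BUC1 :: "(real \<Rightarrow> real) \<Rightarrow> bool" where
  "BUC1 v \<longleftrightarrow> (\<forall>x. v field_differentiable (at x)) \<and> BUC0 v \<and> BUC0 (deriv v)"

section \<open>Kruzkov entropy solutions\<close>

(* phi is a nonnegative C^1 function of (t, x) with compact support in the open half-plane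
   t > 0, and phi_t, phi_x are its partial derivatives. *)
definition test_function ::
  "(real \<times> real \<Rightarrow> real) \<Rightarrow> (real \<times> real \<Rightarrow> real) \<Rightarrow> (real \<times> real \<Rightarrow> real) \<Rightarrow> bool" where
  "test_function \<phi> \<phi>_t \<phi>_x \<longleftrightarrow>
     (\<forall>p. 0 \<le> \<phi> p) \<and>
     (\<exists>K. compact K \<and> K \<subseteq> {0<..} \<times> UNIV \<and> (\<forall>p. p \<notin> K \<longrightarrow> \<phi> p = 0)) \<and>
     (\<forall>p. (\<phi> has_derivative (\<lambda>h. \<phi>_t p * fst h + \<phi>_x p * snd h)) (at p)) \<and>
     continuous_on UNIV \<phi>_t \<and> continuous_on UNIV \<phi>_x"

(* Global entropy solution of  u_t + f(u)_x = g(u)  on t >= 0 with initial value u0.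
   The time-continuous representative (with values in L^1_loc) is used, so that
   u t is well defined almost everywhere for each individual t >= 0; the values u t x
   with t < 0 play no role. *)
definition entropy_solution ::
  "(real \<Rightarrow> real) \<Rightarrow> (real \<Rightarrow> real) \<Rightarrow> (real \<Rightarrow> real) \<Rightarrow> (real \<Rightarrow> real \<Rightarrow> real) \<Rightarrow> bool" where
  "entropy_solution f g u0 u \<longleftrightarrow>
     set_borel_measurable borel ({0..} \<times> UNIV) (\<lambda>(t, x). u t x) \<and>
     (\<forall>T. \<exists>M. \<forall>t\<in>{0..T}. AE x in lborel. \<bar>u t x\<bar> \<le> M) \<and>
     (\<forall>t\<ge>0. \<forall>R. ((\<lambda>s. LINT x:{-R..R}|lborel. \<bar>u s x - u t x\<bar>) \<longlongrightarrow> 0) (at t within {0..})) \<and>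
     (AE x in lborel. u 0 x = u0 x) \<and>
     (\<forall>k \<phi> \<phi>_t \<phi>_x. test_function \<phi> \<phi>_t \<phi>_x \<longrightarrow>
        0 \<le> (LINT (t, x):{0..} \<times> UNIV|lborel.
                \<bar>u t x - k\<bar> * \<phi>_t (t, x)
                + sgn (u t x - k) * (f (u t x) - f k) * \<phi>_x (t, x)
                + sgn (u t x - k) * g (u t x) * \<phi> (t, x)))"

definition traveling_wave ::
  "(real \<Rightarrow> real) \<Rightarrow> (real \<Rightarrow> real) \<Rightarrow> real \<Rightarrow> (real \<Rightarrow> real) \<Rightarrow> bool" where
  "traveling_wave f g \<sigma> U \<longleftrightarrow> entropy_solution f g U (\<lambda>t x. U (x - \<sigma> * t))"

definition has_endstates :: "(real \<Rightarrow> real) \<Rightarrow> real \<Rightarrow> real \<Rightarrow> bool" where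
  "has_endstates U um up \<longleftrightarrow> (U \<longlongrightarrow> um) at_bot \<and> (U \<longlongrightarrow> up) at_top"

definition noncharacteristic ::
  "(real \<Rightarrow> real) \<Rightarrow> real \<Rightarrow> (real \<Rightarrow> real) \<Rightarrow> real \<Rightarrow> real \<Rightarrow> bool" where
  "noncharacteristic f \<sigma> U um up \<longleftrightarrow> (\<forall>v \<in> range U \<union> {um, up}. deriv f v \<noteq> \<sigma>)"

section \<open>Weighted norms\<close>

(* w is the distributional derivative of v, both being locally integrable. *)
definition weak_deriv :: "(real \<Rightarrow> real) \<Rightarrow> (real \<Rightarrow> real) \<Rightarrow> bool" where
  "weak_deriv v w \<longleftrightarrow>
     (\<forall>R. set_integrable lborel {-R..R} v \<and> set_integrable lborel {-R..R} w) \<and>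
     (\<forall>\<phi> \<phi>'. (\<forall>x. (\<phi> has_real_derivative \<phi>' x) (at x)) \<and> continuous_on UNIV \<phi>' \<and>
             (\<exists>R. \<forall>x. R < \<bar>x\<bar> \<longrightarrow> \<phi> x = 0) \<longrightarrow>
        (LINT x|lborel. v x * \<phi>' x) = - (LINT x|lborel. w x * \<phi> x))"

(* The L^infinity norm of (v, v') / W for a positive weight W. Weak derivatives are unique
   almost everywhere, so the infimum only selects v'; it is \<infinity> if v has no
   locally integrable weak derivative. The pair is measured in the Euclidean norm. *)
definition W1inf_norm :: "(real \<Rightarrow> real) \<Rightarrow> (real \<Rightarrow> real) \<Rightarrow> ereal" where
  "W1inf_norm W v =
     (INF w\<in>{w. weak_deriv v w}. esssup lborel (\<lambda>x. ereal (norm (v x, w x) / W x)))"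

definition exp_weight :: "real \<Rightarrow> real \<Rightarrow> real" where
  "exp_weight \<kappa> x = exp (- \<kappa> * max x 0)"

definition W1inf_exp_norm :: "real \<Rightarrow> (real \<Rightarrow> real) \<Rightarrow> ereal" where
  "W1inf_exp_norm \<kappa> = W1inf_norm (exp_weight \<kappa>)"

(* The function rho is relevant on [0, \<infinity>) only. *)
definition subexponential_weight :: "(real \<Rightarrow> real) \<Rightarrow> bool" where
  "subexponential_weight \<rho> \<longleftrightarrow>
     (\<forall>t\<ge>0. 0 < \<rho> t) \<and>
     antimono_on {0..} \<rho> \<and>
     (\<rho> \<longlongrightarrow> 0) at_top \<and>
     (\<exists>\<omega>>0. \<exists>C>0. \<forall>t\<ge>0. C * exp (- \<omega> * t) \<le> \<rho> t) \<and>
     (\<exists>\<omega>>0. \<exists>C>0. \<forall>t\<ge>0. integral {0..t} (\<lambda>s. exp (- \<omega> * (t - s)) * \<rho> s) \<le> C * \<rho> t)"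

definition W1inf_subexp_norm :: "real \<Rightarrow> (real \<Rightarrow> real) \<Rightarrow> (real \<Rightarrow> real) \<Rightarrow> ereal" where
  "W1inf_subexp_norm \<kappa> \<rho> = W1inf_norm (\<lambda>x. \<rho> (max x 0) * exp_weight \<kappa> x)"

end

theory Submission
  imports Defs
begin

text \<open>
  In the frame \<open>y = x - \<sigma> t\<close> put \<open>c = \<sigma> - f'\<close> and \<open>G = g / c\<close>. Then \<open>U' = -G(U)\<close> and the equation reads
  \<open>v_t - c(v) v_y = g(v)\<close>; the sign conditions force \<open>c > 0\<close>, so characteristics run from \<open>+\<infinity>\<close> to
  \<open>-\<infinity>\<close>. Along a characteristic \<open>dv/dy = -G(v)\<close>, so the solution is obtained from the scalar flow
  of \<open>G\<close>: the value at \<open>(t, y)\<close> is the flow over time \<open>Y - y\<close> of \<open>u0(Y)\<close>, where the foot \<open>Y\<close>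
  is determined by the travel time \<open>t = \<integral> ds / c\<close> along that orbit. The derivative of the flow with
  respect to its datum behaves like \<open>U'(y) / U'(Y)\<close>, that is like \<open>exp (\<kappa> (Y - y))\<close> for
  \<open>y \<ge> 0\<close>, and it decays exponentially in the region near the stable state \<open>um\<close>. Hence the travel time
  is strictly increasing in \<open>Y\<close> for small perturbations, the solution stays smooth, and the weighted
  perturbation at \<open>(t, y)\<close> is controlled by the one at \<open>Y\<close>, where either \<open>Y\<close> is at least of order \<open>t\<close>
  or there is an exponentially small factor. Both assertions follow; uniqueness among entropy solutions
  is obtained by comparing with the smooth solution through the relative entropy \<open>(u - v)\<^sup>2\<close>.
\<close>

section \<open>Flow of a scalar autonomous equation\<close>

text \<open>The weight is critical: for y \<ge> 0 the derivative of the flow grows at exactly the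
  rate that the weight compensates, so even an arbitrarily small loss in \<open>\<kappa>\<close>
  would be fatal and bounds up to constants are needed. They come from the autonomous structure. To
  the right, the tube allowed for the data is no wider than a multiple of \<bar>U'\<bar>, so every
  admissible value is a value of \<open>U\<close> at a phase shifted by at most 1, and the
  derivative of the flow there is a quotient of two values of U'; to the far left the contraction
  near \<open>um\<close> takes over. In the derivative of the travel time with respect to the foot,
  a positive term is corrected only by a multiple of u0' + G(u0), which vanishes on the profile.
  Weight and damping make this correction integrable along the whole orbit, so one smallness
  condition prevents shocks for all times. Since \<open>c\<close> may vanish away from the profile,
  \<open>G\<close> and 1 / c are composed with a bounded C^1 clamp that is the identity near the
  range of \<open>U\<close>; the solution never leaves that neighbourhood, where the modified
  equation is the original one.\<close>

lemma indefinite_integral_has_real_derivative: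
  fixes h :: "real \<Rightarrow> real"
  assumes "continuous_on {0..} h" "0 \<le> t"
  shows "((\<lambda>x. integral {0..x} h) has_real_derivative h t) (at t within {0..})"
proof -
  have "((\<lambda>x. integral {0..x} h) has_real_derivative h t) (at t within {0..t+1})"
    using assms by (intro integral_has_real_derivative) (auto intro: continuous_on_subset)
  moreover have "at t within {0..t+1} = at t within {0..}"
    by (rule at_within_nhd[where S="{t-1<..<t+1}"]) auto
  ultimately show ?thesis by simp
qed

text \<open>Moves the upper limit into the integrand: an integral with variable limit becomes a
  parameter integral over a fixed interval, which gives continuity jointly in the limit and a
  parameter.\<close>

lemma integral_rescale_unit:
  fixes h :: "real \<Rightarrow> real"
  assumes "continuous_on {0..r} h" "0 \<le> r"
  shows "integral {0..r} h = r * integral {0..1} (\<lambda>\<theta>. h (r * \<theta>))"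
proof (cases "r = 0")
  case False
  then have r: "r > 0" using assms by simp
  have "(h has_integral integral {0..r} h) {0..r}"
    using assms integrable_continuous_real integrable_integral by blast
  then have "((\<lambda>\<theta>. h (r * \<theta> + 0)) has_integral (1 / \<bar>r\<bar> ^ DIM(real)) *\<^sub>R integral {0..r} h)
     ((\<lambda>x. (1 / r) *\<^sub>R x + - ((1 / r) *\<^sub>R 0)) ` cbox 0 r)"
    using has_integral_affinity[of h "integral {0..r} h" 0 r r 0] False by simp
  moreover have "(\<lambda>x. (1 / r) *\<^sub>R x + - ((1 / r) *\<^sub>R (0::real))) ` cbox 0 r = {0..1}"
    using r image_divide_atLeastAtMost[OF r, of 0 r] by (simp add: divide_inverse mult.commute)
  ultimately have "integral {0..1} (\<lambda>\<theta>. h (r * \<theta>)) = integral {0..r} h / r"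
    using r by (simp add: integral_unique)
  then show ?thesis using r by simp
qed simp

lemma continuous_on_integral_upper_limit:
  fixes k :: "real \<Rightarrow> real \<Rightarrow> real"
  assumes "continuous_on ({0..} \<times> UNIV) (\<lambda>(s, w). k s w)"
  shows "continuous_on ({0..} \<times> UNIV) (\<lambda>(r, w). integral {0..r} (\<lambda>s. k s w))"
proof -
  have "continuous_on (({0..} \<times> UNIV) \<times> cbox 0 1) (\<lambda>x. (\<lambda>(s, w). k s w) (fst (fst x) * snd x, snd (fst x)))"
    by (intro continuous_on_compose2[OF assms] continuous_intros) auto
  then have "continuous_on ({0..} \<times> UNIV) (\<lambda>p. integral (cbox 0 1) (\<lambda>\<theta>. k (fst p * \<theta>) (snd p)))"
    by (intro integral_continuous_on_param) (simp add: split_beta)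
  then have "continuous_on ({0..} \<times> UNIV) (\<lambda>p. fst p * integral {0..1} (\<lambda>\<theta>. k (fst p * \<theta>) (snd p)))"
    by (intro continuous_intros) simp
  moreover have "integral {0..r} (\<lambda>s. k s w) = r * integral {0..1} (\<lambda>\<theta>. k (r * \<theta>) w)" if "0 \<le> r" for r w
  proof (rule integral_rescale_unit[OF _ that])
    show "continuous_on {0..r} (\<lambda>s. k s w)"
      using continuous_on_compose2[OF assms continuous_on_Pair[OF continuous_on_id continuous_on_const, of "{0..r}" w]] by (simp add: image_subset_iff)
  qed
  ultimately show ?thesis
    by (subst continuous_on_cong[OF refl, where g="\<lambda>p. fst p * integral {0..1} (\<lambda>\<theta>. k (fst p * \<theta>) (snd p))"]) auto
qed

text \<open>The integrating factor makes the product constant. This exact formula is used instead of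
  Gronwall's inequality because it preserves signs and expresses the derivative of the flow as a
  quotient of speeds.\<close>

lemma linear_ode_unique:
  fixes e a :: "real \<Rightarrow> real"
  assumes a: "continuous_on {0..} a"
    and e: "\<And>r. 0 \<le> r \<Longrightarrow> (e has_real_derivative a r * e r) (at r within {0..})"
    and "0 \<le> r"
  shows "e r = e 0 * exp (integral {0..r} a)"
proof -
  define E where "E r = e r * exp (- integral {0..r} a)" for r
  have "(E has_field_derivative 0) (at r within {0..})" if "r \<in> {0..}" for r
  proof -
    have "(E has_field_derivative a r * e r * exp (- integral {0..r} a)
        + (exp (- integral {0..r} a) * - a r) * e r) (at r within {0..})"
      unfolding E_def using that
      by (intro derivative_intros e indefinite_integral_has_real_derivative a) auto
    then show ?thesis by (simp add: algebra_simps)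
  qed
  then obtain c where "\<And>r. r \<in> {0..} \<Longrightarrow> E r = c"
    using has_field_derivative_zero_constant[of "{0..}" E] by auto
  then have "E r = E 0" using \<open>0 \<le> r\<close> by simp
  then show ?thesis by (simp add: E_def exp_minus field_simps)
qed

text \<open>Global bounds on \<open>G\<close> and \<open>G'\<close> exclude blow-up and allow one
  fixed point argument on the whole half-line. For the actual equation they are obtained by clamping
  the coefficients outside a neighbourhood of the profile.\<close>

locale scalar_field =
  fixes G G' :: "real \<Rightarrow> real" and L M :: real
  assumes G_deriv: "(G has_real_derivative G' w) (at w)"
    and G'_cont: "continuous_on UNIV G'"
    and G'_bound: "\<bar>G' w\<bar> \<le> L"
    and G_bound: "\<bar>G w\<bar> \<le> M"
    and L_pos: "0 < L"
begin

lemma G_cont: "continuous_on A G"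
  using G_deriv by (meson DERIV_isCont continuous_at_imp_continuous_on)

lemma M_nonneg: "0 \<le> M"
  using G_bound[of 0] by linarith

lemma G_lipschitz: "\<bar>G a - G b\<bar> \<le> L * \<bar>a - b\<bar>"
proof -
  have "norm (G a - G b) \<le> L * norm (a - b)"
    by (rule field_differentiable_bound[of UNIV G G']) (use G_deriv G'_bound in auto)
  then show ?thesis by simp
qed

text \<open>Picard iteration in the norm weighted by exp(-2 L s): with x(s) = w + exp(2 L s) z(s),
  the map for \<open>z\<close> halves distances of bounded continuous functions, so no gluing of
  short-time solutions is necessary. The factor 1/2 is the Lipschitz constant \<open>L\<close>
  divided by the exponent 2 L.\<close>

lemma solution_exists:
  "\<exists>x. x 0 = w \<and> (\<forall>r\<ge>0. (x has_real_derivative G (x r)) (at r within {0..}))"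
proof -
  define Phi where "Phi z r = integral {0..r} (\<lambda>s. G (w + exp (2*L * s) * z s))" for z r
  \<comment> \<open>The fixed point is sought among functions on the whole line;
    \<open>max r 0\<close> extends the integral operator constantly to negative times.\<close>
  define K where "K z r = exp (-2*L * max r 0) * Phi z (max r 0)" for z r
  have cont: "continuous_on {0..} (\<lambda>s. G (w + exp (2*L * s) * z s))" if "continuous_on UNIV z" for z
    by (intro continuous_on_compose2[OF G_cont[of UNIV]] continuous_intros continuous_on_subset[OF that]) auto
  have int: "(\<lambda>s. G (w + exp (2*L * s) * z s)) integrable_on {0..r}" if "continuous_on UNIV z" for z r
    by (intro integrable_continuous_real continuous_on_subset[OF cont[OF that]]) auto
  have Ider: "(Phi z has_real_derivative G (w + exp (2*L*r) * z r)) (at r within {0..})"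
    if "continuous_on UNIV z" "0 \<le> r" for z r
    unfolding Phi_def using indefinite_integral_has_real_derivative[OF cont[OF that(1)] that(2)] by simp
  have Icont: "continuous_on {0..} (Phi z)" if "continuous_on UNIV z" for z
    using Ider[OF that] by (intro DERIV_continuous_on) auto
  have Kcont: "continuous_on UNIV (K z)" if "continuous_on UNIV z" for z
    unfolding K_def by (intro continuous_intros continuous_on_compose2[OF Icont[OF that]]) auto
  have Kbd: "\<bar>K z r\<bar> \<le> M / (2*L)" if "continuous_on UNIV z" for z r
  proof -
    define p where "p = max r 0"
    have p: "p \<ge> 0" by (simp add: p_def)
    have "norm (Phi z p) \<le> M * (p - 0)"
      unfolding Phi_def by (rule integral_bound) (use p G_bound cont[OF that] in \<open>auto intro: continuous_on_subset\<close>)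
    also have "\<dots> \<le> M * (exp (2*L * p) / (2*L))"
    proof (intro mult_left_mono M_nonneg)
      have "1 + 2*L * p \<le> exp (2*L * p)" by (rule exp_ge_add_one_self)
      then have "2*L * p \<le> exp (2*L * p)" by linarith
      then show "p - 0 \<le> exp (2*L * p) / (2*L)" using L_pos by (simp add: field_simps)
    qed
    finally have "exp (-2*L * p) * \<bar>Phi z p\<bar> \<le> exp (-2*L * p) * (M * (exp (2*L * p) / (2*L)))"
      by (intro mult_left_mono) auto
    also have "\<dots> = M / (2*L)" by (simp add: exp_minus)
    finally show ?thesis unfolding K_def p_def by (simp add: abs_mult)
  qed
  have Kb: "K z \<in> bcontfun" if "continuous_on UNIV z" for z
    using Kcont[OF that] Kbd[OF that] by (auto simp: bcontfun_def bounded_iff)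
  define F where "F z = Bcontfun (K (apply_bcontfun z))" for z
  have czz: "continuous_on UNIV (apply_bcontfun z)" for z :: "real \<Rightarrow>\<^sub>C real"
    by simp
  have Fapp: "apply_bcontfun (F z) = K (apply_bcontfun z)" for z
    unfolding F_def by (simp add: Bcontfun_inverse Kb czz)
  have "dist (F z1) (F z2) \<le> (1/2) * dist z1 z2" for z1 z2
  proof (rule dist_bound)
    fix r :: real
    define p where "p = max r 0"
    have p: "p \<ge> 0" by (simp add: p_def)
    define d where "d = dist z1 z2"
    have d: "\<bar>apply_bcontfun z1 s - apply_bcontfun z2 s\<bar> \<le> d" for s
      using dist_bounded[of z1 s z2] by (simp add: dist_real_def d_def)
    have hi: "((\<lambda>s. L * (exp (2*L * s) * d)) has_integral (exp (2*L * p) * d / 2 - exp (2*L*0) * d / 2)) {0..p}"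
      by (rule fundamental_theorem_of_calculus[OF p])
         (auto intro!: derivative_eq_intros simp flip: has_real_derivative_iff_has_vector_derivative)
    have "\<bar>Phi z1 p - Phi z2 p\<bar> = norm (integral {0..p} (\<lambda>s. G (w + exp (2*L * s) * z1 s) - G (w + exp (2*L * s) * z2 s)))"
      unfolding Phi_def by (subst Henstock_Kurzweil_Integration.integral_diff[OF int int]) (auto simp: czz)
    also have "\<dots> \<le> integral {0..p} (\<lambda>s. L * (exp (2*L * s) * d))"
    proof (rule integral_norm_bound_integral)
      show "(\<lambda>s. G (w + exp (2*L * s) * z1 s) - G (w + exp (2*L * s) * z2 s)) integrable_on {0..p}"
        by (intro integrable_diff int czz)
      show "(\<lambda>s. L * (exp (2*L * s) * d)) integrable_on {0..p}" using hi by blast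
      fix s assume "s \<in> {0..p}"
      have "norm (G (w + exp (2*L * s) * z1 s) - G (w + exp (2*L * s) * z2 s)) \<le> L * \<bar>(w + exp (2*L * s) * z1 s) - (w + exp (2*L * s) * z2 s)\<bar>"
        unfolding real_norm_def by (rule G_lipschitz)
      also have "\<dots> = L * (exp (2*L * s) * \<bar>z1 s - z2 s\<bar>)"
        by (simp add: abs_mult flip: right_diff_distrib)
      also have "\<dots> \<le> L * (exp (2*L * s) * d)" using L_pos d by (intro mult_left_mono) auto
      finally show "norm (G (w + exp (2*L * s) * z1 s) - G (w + exp (2*L * s) * z2 s)) \<le> L * (exp (2*L * s) * d)" .
    qed
    also have "\<dots> = exp (2*L * p) * d / 2 - d / 2" using integral_unique[OF hi] by simp
    also have "\<dots> \<le> exp (2*L * p) * d / 2" by (simp add: d_def)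
    finally have *: "\<bar>Phi z1 p - Phi z2 p\<bar> \<le> exp (2*L * p) * d / 2" .
    have "\<bar>K z1 r - K z2 r\<bar> = exp (-2*L * p) * \<bar>Phi z1 p - Phi z2 p\<bar>"
      unfolding K_def p_def by (simp add: abs_mult flip: right_diff_distrib)
    also have "\<dots> \<le> exp (-2*L * p) * (exp (2*L * p) * d / 2)" by (intro mult_left_mono *) auto
    also have "\<dots> = d / 2" by (simp add: exp_minus)
    finally show "dist (apply_bcontfun (F z1) r) (apply_bcontfun (F z2) r) \<le> (1/2) * dist z1 z2"
      by (simp add: Fapp dist_real_def d_def)
  qed
  then obtain z where z: "F z = z" using banach_fix_type[of "1/2" F] by auto
  define x where "x r = w + Phi (apply_bcontfun z) r" for r
  have xe: "x r = w + exp (2*L*r) * z r" if "0 \<le> r" for r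
  proof -
    have "z r = K z r" using Fapp[of z] z by simp
    then show ?thesis using that by (simp add: K_def x_def exp_minus)
  qed
  have "(x has_real_derivative G (x r)) (at r within {0..})" if "0 \<le> r" for r
  proof -
    have "((\<lambda>r. w + Phi (apply_bcontfun z) r) has_real_derivative 0 + G (w + exp (2*L * r) * z r)) (at r within {0..})"
      by (intro DERIV_add DERIV_const Ider czz that)
    then show ?thesis unfolding xe[OF that] by (simp add: x_def[abs_def])
  qed
  moreover have "x 0 = w" by (simp add: x_def Phi_def)
  ultimately show ?thesis by blast
qed

section \<open>The flow and its dependence on time and datum\<close>

definition flow :: "real \<Rightarrow> real \<Rightarrow> real" where
  "flow r w = (SOME x. x 0 = w \<and> (\<forall>r\<ge>0. (x has_real_derivative G (x r)) (at r within {0..}))) r"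

lemma flow_0 [simp]: "flow 0 w = w"
  and flow_deriv: "0 \<le> r \<Longrightarrow> ((\<lambda>r. flow r w) has_real_derivative G (flow r w)) (at r within {0..})"
  using someI_ex[OF solution_exists[of w]] unfolding flow_def by auto

text \<open>The divided difference of \<open>G\<close>, written as an average of \<open>G'\<close>
  so that it is continuous up to the diagonal. With it the difference of two orbits satisfies a
  linear equation without remainder.\<close>

definition DG :: "real \<Rightarrow> real \<Rightarrow> real" where
  "DG a b = integral {0..1} (\<lambda>\<theta>. G' (a + \<theta> * (b - a)))"

lemma DG_cont: "continuous_on UNIV (\<lambda>p. DG (fst p) (snd p))"
proof -
  have "continuous_on (UNIV \<times> cbox 0 1)
      (\<lambda>(p, \<theta>). G' (fst p + \<theta> * (snd p - fst p)))"
    unfolding split_beta by (intro continuous_on_compose2[OF G'_cont] continuous_intros) auto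
  then show ?thesis unfolding DG_def
    using integral_continuous_on_param[of UNIV 0 1 "\<lambda>p \<theta>. G' (fst p + \<theta> * (snd p - fst p))"] by simp
qed

lemma continuous_on_DG [continuous_intros]:
  "continuous_on A a \<Longrightarrow> continuous_on A b \<Longrightarrow> continuous_on A (\<lambda>x. DG (a x) (b x))"
  using continuous_on_compose2[OF DG_cont continuous_on_Pair, of A a b] by simp

lemma DG_eq: "G b - G a = DG a b * (b - a)"
proof -
  have "((\<lambda>\<theta>. G' (a + \<theta> * (b - a)) * (b - a)) has_integral
      (G (a + 1 * (b - a)) - G (a + 0 * (b - a)))) {0..1}"
    by (rule fundamental_theorem_of_calculus)
       (auto intro!: derivative_eq_intros DERIV_chain2[OF G_deriv]
         simp flip: has_real_derivative_iff_has_vector_derivative)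
  then show ?thesis unfolding DG_def
    by (auto dest!: integral_unique)
qed

lemma DG_same [simp]: "DG a a = G' a"
  by (simp add: DG_def)

lemma DG_bound: "\<bar>DG a b\<bar> \<le> L"
proof -
  have "norm (DG a b) \<le> L * (1 - 0)" unfolding DG_def
    by (rule integral_bound) (auto intro!: continuous_on_compose2[OF G'_cont] continuous_intros G'_bound)
  then show ?thesis by simp
qed

lemma solution_cont:
  assumes "\<And>r. 0 \<le> r \<Longrightarrow> (x has_real_derivative G (x r)) (at r within {0..})"
  shows "continuous_on {0..} x"
  using assms by (intro DERIV_continuous_on) auto

text \<open>The difference e solves e' = DG e exactly, hence is its initial value times an
  exponential. Uniqueness, preservation of order, Lipschitz dependence and, as the second orbit
  tends to the first, differentiability in the datum are all read off from this formula.\<close>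

lemma solution_diff:
  assumes x: "\<And>r. 0 \<le> r \<Longrightarrow> (x has_real_derivative G (x r)) (at r within {0..})"
    and y: "\<And>r. 0 \<le> r \<Longrightarrow> (y has_real_derivative G (y r)) (at r within {0..})"
    and "0 \<le> r"
  shows "y r - x r = (y 0 - x 0) * exp (integral {0..r} (\<lambda>s. DG (x s) (y s)))"
proof (rule linear_ode_unique[where e="\<lambda>r. y r - x r", OF _ _ \<open>0 \<le> r\<close>])
  show "continuous_on {0..} (\<lambda>s. DG (x s) (y s))"
    using solution_cont[OF x] solution_cont[OF y] by (intro continuous_intros)
  fix r :: real assume "0 \<le> r"
  then show "((\<lambda>r. y r - x r) has_real_derivative DG (x r) (y r) * (y r - x r)) (at r within {0..})"
    using DERIV_diff[OF y x] by (simp add: DG_eq)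
qed

lemma flow_unique:
  assumes "\<And>r. 0 \<le> r \<Longrightarrow> (x has_real_derivative G (x r)) (at r within {0..})" "0 \<le> r"
  shows "x r = flow r (x 0)"
  using solution_diff[OF flow_deriv assms, of "x 0"] by simp

lemma flow_lipschitz_time: "0 \<le> r \<Longrightarrow> 0 \<le> r' \<Longrightarrow> \<bar>flow r w - flow r' w\<bar> \<le> M * \<bar>r - r'\<bar>"
  using field_differentiable_bound[of "{0..}" "\<lambda>r. flow r w" "\<lambda>r. G (flow r w)" M r r']
    flow_deriv G_bound by auto

lemma flow_diff:
  assumes "0 \<le> r"
  shows "flow r w' - flow r w = (w' - w) * exp (integral {0..r} (\<lambda>s. DG (flow s w) (flow s w')))"
  using solution_diff[OF flow_deriv[of _ w] flow_deriv[of _ w'] assms] by simp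

lemma flow_cont_time: "continuous_on {0..} (\<lambda>r. flow r w)"
  by (rule solution_cont[OF flow_deriv])

lemma flow_lipschitz_state:
  assumes "0 \<le> r"
  shows "\<bar>flow r w' - flow r w\<bar> \<le> exp (L * r) * \<bar>w' - w\<bar>"
proof -
  have "integral {0..r} (\<lambda>s. DG (flow s w) (flow s w')) \<le> norm (integral {0..r} (\<lambda>s. DG (flow s w) (flow s w')))"
    by simp
  also have "\<dots> \<le> L * (r - 0)"
  proof (rule integral_bound[OF assms])
    show "continuous_on {0..r} (\<lambda>s. DG (flow s w) (flow s w'))"
      by (intro continuous_intros continuous_on_subset[OF flow_cont_time]) auto
  qed (simp add: DG_bound)
  finally have "exp (integral {0..r} (\<lambda>s. DG (flow s w) (flow s w'))) \<le> exp (L * r)" by simp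
  then have "\<bar>w' - w\<bar> * exp (integral {0..r} (\<lambda>s. DG (flow s w) (flow s w'))) \<le> \<bar>w' - w\<bar> * exp (L * r)"
    by (intro mult_left_mono) auto
  then show ?thesis unfolding flow_diff[OF assms] by (simp add: abs_mult mult.commute)
qed

lemma flow_cont: "continuous_on ({0..} \<times> UNIV) (\<lambda>p. flow (fst p) (snd p))"
proof (rule continuous_onI)
  fix p :: "real \<times> real" and \<epsilon> :: real assume p: "p \<in> {0..} \<times> UNIV" and "0 < \<epsilon>"
  define D where "D = M + exp (L * (fst p + 1)) + 1"
  have D: "D > 0" using M_nonneg by (simp add: D_def add_nonneg_pos)
  have "dist (flow (fst q) (snd q)) (flow (fst p) (snd p)) \<le> \<epsilon>"
    if q: "q \<in> {0..} \<times> UNIV" and d: "dist q p < min 1 (\<epsilon> / D)" for q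
  proof -
    have 1: "\<bar>fst q - fst p\<bar> \<le> dist q p" "\<bar>snd q - snd p\<bar> \<le> dist q p"
      using dist_fst_le[of q p] dist_snd_le[of q p] by (auto simp: dist_real_def)
    have "\<bar>flow (fst q) (snd q) - flow (fst p) (snd p)\<bar> \<le>
      \<bar>flow (fst q) (snd q) - flow (fst q) (snd p)\<bar> + \<bar>flow (fst q) (snd p) - flow (fst p) (snd p)\<bar>" by simp
    also have "\<dots> \<le> exp (L * fst q) * \<bar>snd q - snd p\<bar> + M * \<bar>fst q - fst p\<bar>"
      using q p by (intro add_mono flow_lipschitz_state flow_lipschitz_time) auto
    also have "\<dots> \<le> exp (L * (fst p + 1)) * dist q p + M * dist q p"
      using 1 d L_pos M_nonneg by (intro add_mono mult_mono) auto
    also have "\<dots> \<le> D * dist q p" by (simp add: D_def algebra_simps)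
    also have "\<dots> \<le> \<epsilon>" using d D by (simp add: field_simps)
    finally show ?thesis by (simp add: dist_real_def)
  qed
  then show "\<exists>d>0. \<forall>x'\<in>{0..} \<times> UNIV. dist x' p < d \<longrightarrow>
      dist (flow (fst x') (snd x')) (flow (fst p) (snd p)) \<le> \<epsilon>"
    using D \<open>0 < \<epsilon>\<close> by (intro exI[of _ "min 1 (\<epsilon> / D)"]) auto
qed

lemma continuous_on_flow [continuous_intros]:
  assumes "continuous_on A r" "continuous_on A w" "\<And>x. x \<in> A \<Longrightarrow> 0 \<le> r x"
  shows "continuous_on A (\<lambda>x. flow (r x) (w x))"
  using continuous_on_compose2[OF flow_cont, of A "\<lambda>x. (r x, w x)"] assms
  by (auto intro!: continuous_intros)

text \<open>The solution of the variational equation along the orbit of \<open>w\<close>, that is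
  the derivative of the flow in its datum. The explicit formula gives positivity and joint
  continuity at once.\<close>

definition J :: "real \<Rightarrow> real \<Rightarrow> real" where
  "J r w = exp (integral {0..r} (\<lambda>s. G' (flow s w)))"

lemma J_pos: "0 < J r w" and J_0 [simp]: "J 0 w = 1"
  by (simp_all add: J_def)

lemma J_cont: "continuous_on ({0..} \<times> UNIV) (\<lambda>p. J (fst p) (snd p))"
proof -
  have "continuous_on ({0..} \<times> UNIV) (\<lambda>(r, w). integral {0..r} (\<lambda>s. G' (flow s w)))"
    by (intro continuous_on_integral_upper_limit)
       (auto simp: split_beta intro!: continuous_on_compose2[OF G'_cont] continuous_intros)
  then show ?thesis unfolding J_def by (auto simp: split_beta intro!: continuous_intros)
qed

lemma continuous_on_J [continuous_intros]:
  assumes "continuous_on A r" "continuous_on A w" "\<And>x. x \<in> A \<Longrightarrow> 0 \<le> r x"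
  shows "continuous_on A (\<lambda>x. J (r x) (w x))"
  using continuous_on_compose2[OF J_cont, of A "\<lambda>x. (r x, w x)"] assms
  by (auto intro!: continuous_intros)

text \<open>The exponential factor in \<open>flow_diff\<close> is a continuous function of the
  second datum with value \<open>J r w\<close> at \<open>w\<close>; this is Caratheodory's
  criterion.\<close>

lemma flow_deriv_state:
  assumes "0 \<le> r"
  shows "((\<lambda>w. flow r w) has_real_derivative J r w) (at w)"
proof -
  define E where "E w' = exp (integral {0..r} (\<lambda>s. DG (flow s w) (flow s w')))" for w'
  have "continuous_on (UNIV \<times> cbox 0 r) (\<lambda>x. DG (flow (snd x) w) (flow (snd x) (fst x)))"
    by (intro continuous_intros) auto
  then have "continuous_on UNIV (\<lambda>w'. integral (cbox 0 r) (\<lambda>s. DG (flow s w) (flow s w')))"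
    by (intro integral_continuous_on_param) (simp add: split_beta)
  then have "continuous_on UNIV E" unfolding E_def by (intro continuous_intros) simp
  then have "isCont E w" by (simp add: continuous_on_eq_continuous_at)
  moreover have "E w = J r w" by (simp add: E_def J_def)
  moreover have "\<forall>w'. flow r w' - flow r w = E w' * (w' - w)"
    using flow_diff[OF assms] by (simp add: E_def)
  ultimately show ?thesis unfolding DERIV_caratheodory_within[of _ _ w UNIV] CARAT_DERIV by blast
qed

text \<open>The velocity of an orbit solves the variational equation along it. On the profile this
  turns \<open>J\<close> into a quotient of speeds.\<close>

lemma G_flow:
  assumes "0 \<le> r"
  shows "G (flow r w) = G w * J r w"
proof -
  have "G (flow r w) = G (flow 0 w) * exp (integral {0..r} (\<lambda>s. G' (flow s w)))"
  proof (rule linear_ode_unique[where e="\<lambda>r. G (flow r w)", OF _ _ assms])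
    show "continuous_on {0..} (\<lambda>s. G' (flow s w))"
      by (intro continuous_on_compose2[OF G'_cont] flow_cont_time) auto
    fix r :: real assume "0 \<le> r"
    show "((\<lambda>r. G (flow r w)) has_real_derivative G' (flow r w) * G (flow r w)) (at r within {0..})"
      using DERIV_chain2[OF G_deriv flow_deriv[OF \<open>0 \<le> r\<close>]] .
  qed
  then show ?thesis by (simp add: J_def)
qed

end

section \<open>The wave profile and the linearized flow along it\<close>

lemma continuous_with_limits_bounded:
  fixes h :: "real \<Rightarrow> real"
  assumes h: "continuous_on UNIV h" and bot: "(h \<longlongrightarrow> l) at_bot" and top: "(h \<longlongrightarrow> r) at_top"
  shows "\<exists>B. \<forall>y. \<bar>h y\<bar> \<le> B"
proof -
  have "eventually (\<lambda>y. \<bar>h y - r\<bar> < 1) at_top" using tendstoD[OF top, of 1] by (simp add: dist_real_def)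
  then obtain b where b: "\<And>y. b \<le> y \<Longrightarrow> \<bar>h y - r\<bar> < 1" by (auto simp: eventually_at_top_linorder)
  have "eventually (\<lambda>y. \<bar>h y - l\<bar> < 1) at_bot" using tendstoD[OF bot, of 1] by (simp add: dist_real_def)
  then obtain a where a: "\<And>y. y \<le> a \<Longrightarrow> \<bar>h y - l\<bar> < 1" by (auto simp: eventually_at_bot_linorder)
  have "compact (h ` {a..b})" by (intro compact_continuous_image continuous_on_subset[OF h]) auto
  then have "bounded (h ` {a..b})" by (rule compact_imp_bounded)
  then obtain B where B: "\<And>y. y \<in> {a..b} \<Longrightarrow> \<bar>h y\<bar> \<le> B"
    unfolding bounded_iff by fastforce
  have "\<bar>h y\<bar> \<le> \<bar>B\<bar> + \<bar>l\<bar> + \<bar>r\<bar> + 1" for y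
    using a[of y] b[of y] B[of y] by (cases "y \<le> a"; cases "b \<le> y") auto
  then show ?thesis by blast
qed

text \<open>The Lipschitz type bound on \<open>G'\<close> at \<open>up\<close> makes
  \<open>G' (U y) - \<kappa>\<close> integrable at +\<infinity>; this is why the rate
  \<open>\<kappa>\<close> is attained up to constant factors and not only up to a small
  loss.\<close>

locale wave_profile = scalar_field +
  fixes U :: "real \<Rightarrow> real" and um up \<kappa> d K :: real
  assumes U_deriv: "(U has_real_derivative - G (U y)) (at y)"
    and U_bot: "(U \<longlongrightarrow> um) at_bot"
    and U_top: "(U \<longlongrightarrow> up) at_top"
    and um_neq_up: "um \<noteq> up"
    and G_um: "G um = 0" and G_up: "G up = 0"
    and G'_um: "G' um < 0"
    and \<kappa>_pos: "0 < \<kappa>"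
    and d_pos: "0 < d"
    and G'_near_up: "\<bar>w - up\<bar> \<le> d \<Longrightarrow> \<bar>G' w - \<kappa>\<bar> \<le> K * \<bar>w - up\<bar>"
begin

lemma U_cont: "continuous_on A U"
  using U_deriv by (meson DERIV_isCont continuous_at_imp_continuous_on)

text \<open>Since U' = -G(U), the flow runs through the profile backwards, at unit speed in the
  phase.\<close>

lemma flow_U:
  assumes "0 \<le> r"
  shows "flow r (U z) = U (z - r)"
proof -
  have "((\<lambda>r. U (z - r)) has_real_derivative G (U (z - r))) (at r within {0..})" for r
  proof -
    have "((\<lambda>r. U (z - r)) has_real_derivative - G (U (z - r)) * - 1) (at r within {0..})"
      by (rule DERIV_chain2[OF U_deriv]) (auto intro!: derivative_eq_intros)
    then show ?thesis by simp
  qed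
  from flow_unique[OF this assms] show ?thesis by simp
qed

definition speed :: "real \<Rightarrow> real" where
  "speed y = \<bar>G (U y)\<bar>"

lemma speed_J: "0 \<le> r \<Longrightarrow> speed (z - r) = speed z * J r (U z)"
  using G_flow[of r "U z"] J_pos[of r "U z"] by (simp add: flow_U speed_def abs_mult)

text \<open>Any two phases are linked by a positive factor \<open>J\<close>, so one zero of U' would
  make U' vanish identically, and a constant profile contradicts
  \<open>um \<noteq> up\<close>.\<close>

lemma speed_pos: "0 < speed y"
proof (rule ccontr)
  assume "\<not> 0 < speed y"
  then have 0: "speed y = 0" by (simp add: speed_def)
  have "speed z = 0" for z
  proof (cases "z \<le> y")
    case True
    then show ?thesis using speed_J[of "y - z" y] 0 by simp
  next
    case False
    then show ?thesis using speed_J[of "z - y" z] J_pos[of "z - y" "U z"] 0 by simp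
  qed
  then have "G (U z) = 0" for z by (simp add: speed_def)
  then have "(U has_real_derivative 0) (at z)" for z using U_deriv[of z] by simp
  then have const: "U z = U 0" for z using DERIV_isconst_all by blast
  have "um = U 0"
  proof (rule tendsto_unique[OF _ U_bot])
    show "(U \<longlongrightarrow> U 0) at_bot" by (rule Lim_transform_eventually[OF tendsto_const]) (intro always_eventually allI const[symmetric])
  qed simp
  moreover have "up = U 0"
  proof (rule tendsto_unique[OF _ U_top])
    show "(U \<longlongrightarrow> U 0) at_top" by (rule Lim_transform_eventually[OF tendsto_const]) (intro always_eventually allI const[symmetric])
  qed simp
  ultimately show False using um_neq_up by simp
qed

lemma J_bounds:
  assumes "0 \<le> r"
  shows "exp (- L * r) \<le> J r w" "J r w \<le> exp (L * r)"
proof -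
  have "norm (integral {0..r} (\<lambda>s. G' (flow s w))) \<le> L * (r - 0)"
    using assms G'_bound by (intro integral_bound continuous_on_compose2[OF G'_cont] continuous_intros) auto
  then show "exp (- L * r) \<le> J r w" "J r w \<le> exp (L * r)"
    by (auto simp: J_def)
qed

text \<open>The logarithmic derivative of the speed is bounded by \<open>L\<close>. Phase shifts of
  size at most 1 therefore cost only the constant factor exp L.\<close>

lemma speed_shift: "speed z \<le> exp (L * \<bar>z - y\<bar>) * speed y"
proof (cases "z \<le> y")
  case True
  then have "speed z = speed y * J (y - z) (U y)" using speed_J[of "y - z" y] by simp
  also have "\<dots> \<le> speed y * exp (L * (y - z))"
    using True speed_pos[of y] by (intro mult_left_mono J_bounds) auto
  finally show ?thesis using True by (simp add: mult.commute abs_if)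
next
  case False
  then have "speed y = speed z * J (z - y) (U z)" using speed_J[of "z - y" z] by simp
  also have "\<dots> \<ge> speed z * exp (- L * (z - y))"
    using False speed_pos[of z] by (intro mult_left_mono J_bounds) auto
  finally have "speed z * exp (- L * (z - y)) * exp (L * (z - y)) \<le> speed y * exp (L * (z - y))"
    by (intro mult_right_mono) auto
  moreover have "exp (- L * (z - y)) * exp (L * (z - y)) = 1"
    by (simp add: exp_add[symmetric])
  ultimately have "speed z \<le> speed y * exp (L * (z - y))" by (simp only: mult.assoc mult_1_right)
  then show ?thesis using False by (simp add: mult.commute)
qed

lemma speed_sign: "\<exists>s. (s = 1 \<or> s = -1) \<and> (\<forall>y. - G (U y) = s * speed y)"
proof -
  have c: "continuous_on UNIV (\<lambda>y. G (U y))"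
    by (intro continuous_on_compose2[OF G_cont[of UNIV]] U_cont) auto
  have nz: "G (U y) \<noteq> 0" for y using speed_pos[of y] by (auto simp: speed_def)
  have "(\<forall>y. 0 < G (U y)) \<or> (\<forall>y. G (U y) < 0)"
  proof (rule ccontr)
    assume "\<not> ?thesis"
    then obtain a b where ab: "G (U a) < 0" "0 < G (U b)" using nz by (metis linorder_neqE_linordered_idom)
    have "connected (range (\<lambda>y. G (U y)))" by (rule connected_continuous_image[OF c connected_UNIV])
    then have "{G (U a)..G (U b)} \<subseteq> range (\<lambda>y. G (U y))"
      by (rule connected_contains_Icc) auto
    moreover have "0 \<in> {G (U a)..G (U b)}" using ab by simp
    ultimately have "0 \<in> range (\<lambda>y. G (U y))" by blast
    then obtain y where "G (U y) = 0" by auto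
    then show False using nz by blast
  qed
  then show ?thesis
  proof
    assume *: "\<forall>y. 0 < G (U y)"
    have "\<forall>y. - G (U y) = -1 * speed y" using * by (auto simp: speed_def abs_of_pos)
    then show ?thesis by blast
  next
    assume *: "\<forall>y. G (U y) < 0"
    have "\<forall>y. - G (U y) = 1 * speed y" using * by (auto simp: speed_def abs_of_neg)
    then show ?thesis by blast
  qed
qed

section \<open>Rates of the profile at its two endstates\<close>

lemma U_bounded: "\<exists>B. \<forall>y. \<bar>U y\<bar> \<le> B"
  using continuous_with_limits_bounded[OF U_cont U_bot U_top] .

text \<open>Near \<open>up\<close> one has \<open>\<bar>U - up\<bar> \<le> C \<bar>U'\<bar>\<close>, so that \<open>ln \<bar>U'\<bar> + \<kappa> y \<plusminus> C U\<close> are monotone and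
  bounded: this gives the exact exponential rate without solving for \<open>U\<close>.\<close>

lemma speed_asymp:
  obtains a1 a2 where "0 < a1" "0 < a2"
    "\<And>y. -l \<le> y \<Longrightarrow> a1 * exp (- \<kappa> * y) \<le> speed y" "\<And>y. -l \<le> y \<Longrightarrow> speed y \<le> a2 * exp (- \<kappa> * y)"
proof -
  obtain s where s: "s = 1 \<or> s = -1" and sp: "\<And>y. - G (U y) = s * speed y" using speed_sign by blast
  have speed_eq: "speed y = - s * G (U y)" for y using s sp[of y] by auto
  have speed_der: "(speed has_real_derivative - G' (U y) * speed y) (at y)" for y
  proof -
    have "((\<lambda>y. - s * G (U y)) has_real_derivative - s * (G' (U y) * - G (U y))) (at y)"
      by (intro DERIV_cmult DERIV_chain2[OF G_deriv U_deriv])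
    moreover have "speed = (\<lambda>y. - s * G (U y))" using speed_eq by auto
    ultimately show ?thesis using speed_eq[of y] by (simp add: mult_ac)
  qed
  define H where "H y = ln (speed y) + \<kappa> * y" for y
  have H_der: "(H has_real_derivative \<kappa> - G' (U y)) (at y)" for y
  proof -
    have "(H has_real_derivative inverse (speed y) * (- G' (U y) * speed y) + \<kappa> * 1) (at y)"
      unfolding H_def
      by (intro DERIV_add DERIV_cmult DERIV_ident DERIV_chain2[OF DERIV_ln speed_der] speed_pos)
    then show ?thesis using speed_pos[of y] by (simp add: field_simps)
  qed
  have K: "K \<ge> 0" using G'_near_up[of "up + d"] d_pos by (smt (verit) zero_le_mult_iff abs_ge_zero)
  \<comment> \<open>On the ball of radius \<open>d'\<close> the slope of \<open>G\<close> stays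
    above \<open>\<kappa> / 2\<close>, so \<open>\<bar>G w\<bar>\<close> controls the distance to
    \<open>up\<close>; the summand 1 covers the case \<open>K = 0\<close>.\<close>
  define d' where "d' = min d (\<kappa> / (2 * (K + 1)))"
  have d': "0 < d'" "d' \<le> d" using d_pos \<kappa>_pos K by (auto simp: d'_def)
  have Kd: "K * d' \<le> \<kappa> / 2"
  proof -
    have "d' \<le> \<kappa> / (2 * (K + 1))" by (simp add: d'_def)
    then have "d' * (2 * (K + 1)) \<le> \<kappa>" using K by (simp add: pos_le_divide_eq)
    then show ?thesis using d' by (simp add: algebra_simps)
  qed
  have Glow: "\<bar>G w\<bar> \<ge> \<kappa> / 2 * \<bar>w - up\<bar>" if w: "\<bar>w - up\<bar> \<le> d'" for w
  proof -
    have 1: "G' z \<ge> \<kappa> / 2" if "\<bar>z - up\<bar> \<le> d'" for z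
    proof -
      have "\<bar>G' z - \<kappa>\<bar> \<le> K * \<bar>z - up\<bar>" using that d' by (intro G'_near_up) auto
      also have "\<dots> \<le> K * d'" using that K by (intro mult_left_mono) auto
      finally show ?thesis using Kd by linarith
    qed
    obtain z where z: "\<bar>z - up\<bar> \<le> d'" "G w - G up = G' z * (w - up)"
    proof (cases w up rule: linorder_cases)
      case less
      obtain z where "w < z" "z < up" "G up - G w = (up - w) * G' z" using MVT2[OF less G_deriv] by blast
      then show ?thesis using w by (intro that[of z]) (auto simp: algebra_simps)
    next
      case greater
      obtain z where "up < z" "z < w" "G w - G up = (w - up) * G' z" using MVT2[OF greater G_deriv] by blast
      then show ?thesis using w by (intro that[of z]) (auto simp: algebra_simps)
    qed (use d' in \<open>auto intro: that[of up]\<close>)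
    have "\<bar>G w\<bar> = G' z * \<bar>w - up\<bar>" using z 1[OF z(1)] \<kappa>_pos G_up by (simp add: abs_mult)
    moreover have "\<kappa> / 2 * \<bar>w - up\<bar> \<le> G' z * \<bar>w - up\<bar>" by (intro mult_right_mono 1 z) auto
    ultimately show ?thesis by simp
  qed
  have "eventually (\<lambda>y. \<bar>U y - up\<bar> < d') at_top" using tendstoD[OF U_top, of d'] d' by (simp add: dist_real_def)
  then obtain y1 where y1: "\<And>y. y1 \<le> y \<Longrightarrow> \<bar>U y - up\<bar> < d'" by (auto simp: eventually_at_top_linorder)
  \<comment> \<open>The deviation of \<open>G'\<close> from \<open>\<kappa>\<close> is at most
    \<open>K\<close> times the distance to \<open>up\<close>, and this distance is at most
    \<open>2 / \<kappa>\<close> times the speed.\<close>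
  define C where "C = K * 2 / \<kappa>"
  have C: "C \<ge> 0" using K \<kappa>_pos by (simp add: C_def)
  have est: "\<bar>\<kappa> - G' (U y)\<bar> \<le> C * speed y" if "y1 \<le> y" for y
  proof -
    have "\<bar>\<kappa> - G' (U y)\<bar> = \<bar>G' (U y) - \<kappa>\<bar>" by simp
    also have "\<dots> \<le> K * \<bar>U y - up\<bar>" using y1[OF that] d' by (intro G'_near_up) auto
    also have "\<dots> = C * (\<kappa> / 2 * \<bar>U y - up\<bar>)" using \<kappa>_pos by (simp add: C_def)
    also have "\<dots> \<le> C * speed y" unfolding speed_def
      using Glow[of "U y"] y1[OF that] C by (intro mult_left_mono) auto
    finally show ?thesis .
  qed
  obtain B where B: "\<And>y. \<bar>U y\<bar> \<le> B" using U_bounded by blast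
  have far: "\<bar>H y - H y1\<bar> \<le> 2 * C * B" if "y1 \<le> y" for y
  proof -
    have sU: "((\<lambda>y. s * U y) has_real_derivative speed y) (at y)" for y
      using DERIV_cmult[OF U_deriv, of s y] speed_eq[of y] by simp
    have 1: "H y1 - C * (s * U y1) \<ge> H y - C * (s * U y)"
    proof (rule DERIV_nonpos_imp_nonincreasing[OF that])
      fix x assume "y1 \<le> x" "x \<le> y"
      then show "\<exists>z. ((\<lambda>y. H y - C * (s * U y)) has_real_derivative z) (at x) \<and> z \<le> 0"
        using est[of x] by (intro exI[of _ "\<kappa> - G' (U x) - C * speed x"] conjI DERIV_diff H_der DERIV_cmult sU) auto
    qed
    have 2: "H y1 + C * (s * U y1) \<le> H y + C * (s * U y)"
    proof (rule DERIV_nonneg_imp_nondecreasing[OF that])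
      fix x assume "y1 \<le> x" "x \<le> y"
      then show "\<exists>z. ((\<lambda>y. H y + C * (s * U y)) has_real_derivative z) (at x) \<and> 0 \<le> z"
        using est[of x] by (intro exI[of _ "\<kappa> - G' (U x) + C * speed x"] conjI DERIV_add H_der DERIV_cmult sU) auto
    qed
    have 3: "C * (s * U y - s * U y1) \<le> C * (2 * B)"
      using s B[of y] B[of y1] C by (intro mult_left_mono) auto
    show ?thesis using 1 2 3 by (simp add: algebra_simps abs_le_iff)
  qed
  have "continuous_on {-l..y1} H"
    using H_der by (meson DERIV_isCont continuous_at_imp_continuous_on)
  then have "bounded (H ` {-l..y1})" by (intro compact_imp_bounded compact_continuous_image) auto
  then obtain B2 where "\<forall>x\<in>H ` {-l..y1}. norm x \<le> B2" unfolding bounded_iff by blast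
  then have B2: "\<And>y. -l \<le> y \<Longrightarrow> y \<le> y1 \<Longrightarrow> \<bar>H y\<bar> \<le> B2" by auto
  define B3 where "B3 = \<bar>B2\<bar> + \<bar>H y1\<bar> + 2 * C * B"
  have CB: "2 * C * B \<ge> 0" using C B[of 0] by simp
  have HB: "\<bar>H y\<bar> \<le> B3" if "-l \<le> y" for y
  proof (cases "y \<le> y1")
    case True
    then show ?thesis using B2[OF that True] CB unfolding B3_def by linarith
  next
    case False
    then show ?thesis using far[of y] unfolding B3_def by linarith
  qed
  have sexp: "speed y = exp (H y) * exp (- \<kappa> * y)" for y
    using speed_pos[of y] by (simp add: H_def exp_add[symmetric])
  show ?thesis
  proof
    show "exp (- B3) * exp (- \<kappa> * y) \<le> speed y" if "-l \<le> y" for y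
      unfolding sexp using HB[OF that] by (intro mult_right_mono) auto
    show "speed y \<le> exp B3 * exp (- \<kappa> * y)" if "-l \<le> y" for y
      unfolding sexp using HB[OF that] by (intro mult_right_mono) auto
  qed auto
qed

text \<open>A small interval around \<open>um\<close> is invariant under the flow, so
  \<open>G'\<close> stays below \<open>- \<mu>\<close>, half of its negative value at
  \<open>um\<close>, along the entire orbit, and the exponent in \<open>J\<close> is at most - \<mu>
  r.\<close>

lemma near_um:
  obtains \<mu> \<eta> where "0 < \<mu>" "0 < \<eta>"
    "\<And>w r. \<bar>w - um\<bar> \<le> \<eta> \<Longrightarrow> 0 \<le> r \<Longrightarrow> J r w \<le> exp (- \<mu> * r)"
proof -
  define \<mu> where "\<mu> = - G' um / 2"
  have \<mu>: "0 < \<mu>" using G'_um by (simp add: \<mu>_def)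
  have "isCont G' um" using G'_cont by (simp add: continuous_on_eq_continuous_at)
  then obtain \<eta>0 where \<eta>0: "0 < \<eta>0" "\<And>w. dist w um < \<eta>0 \<Longrightarrow> dist (G' w) (G' um) < \<mu>"
    using \<mu> unfolding continuous_at_eps_delta by blast
  define \<eta> where "\<eta> = \<eta>0 / 2"
  have \<eta>: "0 < \<eta>" using \<eta>0 by (simp add: \<eta>_def)
  have G'_le: "G' w \<le> - \<mu>" if "\<bar>w - um\<bar> \<le> \<eta>" for w
    using \<eta>0(2)[of w] that \<eta>0(1) by (auto simp: dist_real_def \<eta>_def \<mu>_def)
  have Gsign: "G w * (w - um) \<le> 0" if w: "\<bar>w - um\<bar> \<le> \<eta>" for w
  proof (cases w um rule: linorder_cases)
    case less
    obtain z where z: "w < z" "z < um" "G um - G w = (um - w) * G' z" using MVT2[OF less G_deriv] by blast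
    have "(um - w) * G' z \<le> 0" using G'_le[of z] z w \<mu> by (intro mult_nonneg_nonpos) auto
    then show ?thesis using z less G_um by (simp add: mult_nonneg_nonpos)
  next
    case greater
    obtain z where z: "um < z" "z < w" "G w - G um = (w - um) * G' z" using MVT2[OF greater G_deriv] by blast
    have "(w - um) * G' z \<le> 0" using G'_le[of z] z w \<mu> by (intro mult_nonneg_nonpos) auto
    then show ?thesis using z greater G_um by (simp add: mult_nonpos_nonneg)
  qed simp
  have flow_um: "flow r um = um" if "0 \<le> r" for r
    using flow_unique[of "\<lambda>_. um", OF _ that] G_um by simp
  \<comment> \<open>By the mean value theorem and \<open>G_flow\<close> the displacement has the
    sign of \<open>G w\<close>, which points towards \<open>um\<close>; comparison with the constant
    orbit \<open>um\<close> through \<open>flow_diff\<close> excludes crossing it. Hence the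
    distance to \<open>um\<close> cannot grow.\<close>
  have stay: "\<bar>flow r w - um\<bar> \<le> \<bar>w - um\<bar>" if w: "\<bar>w - um\<bar> \<le> \<eta>" and r: "0 \<le> r" for w r
  proof (cases "r = 0")
    case False
    then have r: "0 < r" using r by simp
    have "\<exists>x\<in>{0<..<r}. flow r w - flow 0 w = (\<lambda>h. h * G (flow x w)) (r - 0)"
    proof (rule mvt_simple[OF r])
      fix x assume "0 \<le> x" "x \<le> r"
      then show "((\<lambda>r. flow r w) has_derivative (\<lambda>h. h * G (flow x w))) (at x within {0..r})"
        using DERIV_subset[OF flow_deriv[of x w], of "{0..r}"]
        unfolding has_field_derivative_def by (simp add: mult_commute_abs)
    qed
    then obtain x where x: "0 < x" "flow r w - w = r * G (flow x w)" by auto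
    then have 1: "flow r w - w = G w * (r * J x w)" by (simp add: G_flow)
    have 2: "0 < r * J x w" using r J_pos by simp
    define e where "e = exp (integral {0..r} (\<lambda>s. DG (flow s um) (flow s w)))"
    have e: "0 < e" "flow r w - um = (w - um) * e"
      using flow_diff[of r w um] flow_um[of r] r by (auto simp: e_def)
    have 3: "G w * (w - um) \<le> 0" by (rule Gsign[OF w])
    show ?thesis
    proof (cases "w = um")
      case True then show ?thesis using e by simp
    next
      case False
      show ?thesis
      proof (cases "w > um")
        case True
        then have "G w \<le> 0" using 3 by (simp add: mult_le_0_iff)
        then have "G w * (r * J x w) \<le> 0" using 2 by (intro mult_nonpos_nonneg) auto
        moreover have "(w - um) * e > 0" using True e by simp
        ultimately show ?thesis using 1 e True by linarith
      next
        case F2: False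
        then have "G w \<ge> 0" using 3 False by (simp add: mult_le_0_iff)
        then have "G w * (r * J x w) \<ge> 0" using 2 by (metis mult_nonneg_nonneg less_imp_le)
        moreover have "(w - um) * e < 0" using False F2 e by (simp add: mult_less_0_iff)
        ultimately show ?thesis using 1 e F2 by linarith
      qed
    qed
  qed simp
  show ?thesis
  proof (rule that[OF \<mu> \<eta>])
    fix w r assume w: "\<bar>w - um\<bar> \<le> \<eta>" and r: "(0::real) \<le> r"
    have "integral {0..r} (\<lambda>s. G' (flow s w)) \<le> integral {0..r} (\<lambda>s. - \<mu>)"
    proof (rule integral_le)
      show "(\<lambda>s. G' (flow s w)) integrable_on {0..r}"
        by (intro integrable_continuous_real continuous_on_compose2[OF G'_cont] continuous_intros) auto
      fix s assume s: "s \<in> {0..r}"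
      show "G' (flow s w) \<le> - \<mu>" using stay[OF w, of s] s w by (intro G'_le) auto
    qed (rule integrable_const_ivl)
    then show "J r w \<le> exp (- \<mu> * r)" using r by (simp add: J_def mult.commute)
  qed
qed

text \<open>For \<open>s \<le> y0\<close> the exponent measures the part of the path from
  \<open>y0\<close> down to \<open>s\<close> that lies in the negative half-line, where the
  contraction at \<open>um\<close> acts.\<close>

definition decay :: "real \<Rightarrow> real \<Rightarrow> real \<Rightarrow> real" where
  "decay \<mu> s y0 = exp (- \<mu> * (min y0 0 - min s 0))"

text \<open>Within distance 1 of \<open>y\<close> the speed stays above exp(-L) times its value at
  \<open>y\<close>, so \<open>U\<close> sweeps at least this amount on each side of
  \<open>U y\<close>. A value so close to the profile is attained by the profile at a nearby
  phase.\<close>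

lemma phase_shift:
  assumes "\<bar>w - U y\<bar> \<le> exp (- L) * speed y"
  obtains h where "\<bar>h\<bar> \<le> 1" "w = U (y + h)"
proof -
  obtain s where s: "s = 1 \<or> s = -1" and sp: "\<And>y. - G (U y) = s * speed y" using speed_sign by blast
  have sU: "((\<lambda>y. s * U y) has_real_derivative speed y) (at y)" for y
    using DERIV_cmult[OF U_deriv, of s y] sp[of y] s by auto
  have low: "exp (- L) * speed y \<le> speed z" if "\<bar>y - z\<bar> \<le> 1" for z
  proof -
    have "speed y \<le> exp (L * \<bar>y - z\<bar>) * speed z" by (rule speed_shift)
    also have "\<dots> \<le> exp L * speed z"
      using that L_pos speed_pos[of z] by (intro mult_right_mono) (auto simp: mult_left_le)
    finally show ?thesis by (simp add: exp_minus field_simps)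
  qed
  obtain z1 where z1: "y < z1" "z1 < y + 1" "s * U (y + 1) - s * U y = (y + 1 - y) * speed z1"
    using MVT2[of y "y + 1" "\<lambda>y. s * U y" speed] sU by auto
  obtain z2 where z2: "y - 1 < z2" "z2 < y" "s * U y - s * U (y - 1) = (y - (y - 1)) * speed z2"
    using MVT2[of "y - 1" y "\<lambda>y. s * U y" speed] sU by auto
  have "\<bar>s * w - s * U y\<bar> \<le> exp (- L) * speed y" using assms s by auto
  then have "s * U (y - 1) \<le> s * w" "s * w \<le> s * U (y + 1)"
    using z1 z2 low[of z1] low[of z2] by auto
  moreover have "continuous_on {y - 1..y + 1} (\<lambda>y. s * U y)" by (intro continuous_intros U_cont)
  ultimately obtain z where "y - 1 \<le> z" "z \<le> y + 1" "s * U z = s * w"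
    using IVT'[of "\<lambda>y. s * U y" "y - 1" "s * w" "y + 1"] by auto
  then show ?thesis using s by (intro that[of "z - y"]) auto
qed

text \<open>Transport from \<open>y0\<close> to \<open>y0 - r\<close> enlarges a weighted
  perturbation at most by a constant and gains the damping. Far to the left the whole orbit stays in
  the contraction zone of \<open>um\<close>. Otherwise \<open>w\<close> lies on the profile by
  \<open>phase_shift\<close>, and \<open>J\<close> is the quotient of the speeds at two shifted
  phases; undoing the two shifts costs exp L each.\<close>

lemma J_weighted_bound:
  obtains \<delta> C \<mu> where "0 < \<delta>" "1 \<le> C" "0 < \<mu>"
    "\<And>y0 w r. 0 \<le> r \<Longrightarrow> \<bar>w - U y0\<bar> \<le> \<delta> * exp_weight \<kappa> y0 \<Longrightarrow>
       J r w * exp_weight \<kappa> y0 \<le> C * exp_weight \<kappa> (y0 - r) * decay \<mu> (y0 - r) y0"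
proof -
  obtain \<mu> \<eta> where \<mu>: "0 < \<mu>" and \<eta>: "0 < \<eta>"
    and Jn: "\<And>w r. \<bar>w - um\<bar> \<le> \<eta> \<Longrightarrow> 0 \<le> r \<Longrightarrow> J r w \<le> exp (- \<mu> * r)"
    using near_um by blast
  have "eventually (\<lambda>y. \<bar>U y - um\<bar> < \<eta> / 2) at_bot"
    using tendstoD[OF U_bot, of "\<eta> / 2"] \<eta> by (simp add: dist_real_def)
  then obtain l0 where l0: "\<And>y. y \<le> l0 \<Longrightarrow> \<bar>U y - um\<bar> < \<eta> / 2" by (auto simp: eventually_at_bot_linorder)
  define l where "l = max 0 (- l0)"
  have l: "0 \<le> l" "\<And>y. y \<le> - l \<Longrightarrow> \<bar>U y - um\<bar> < \<eta> / 2" using l0 by (auto simp: l_def)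
  obtain a1 a2 where a: "0 < a1" "0 < a2"
    and a1: "\<And>y. -l \<le> y \<Longrightarrow> a1 * exp (- \<kappa> * y) \<le> speed y"
    and a2: "\<And>y. -l \<le> y \<Longrightarrow> speed y \<le> a2 * exp (- \<kappa> * y)"
    using speed_asymp[of l] by metis
  \<comment> \<open>One upper bound for the speed on the whole line: the exact rate for
    \<open>0 \<le> s\<close>, constants depending on \<open>l\<close> on the transition interval,
    and the contraction near \<open>um\<close> to the left of \<open>- l\<close>. The three summands
    belong to the transition, left and right ranges, in this order.\<close>
  define a3 where "a3 = a2 * exp (\<kappa> * l) * exp (\<mu> * l) + speed (- l) * exp (\<mu> * l) + a2"
  have p1: "0 < a2 * exp (\<kappa> * l) * exp (\<mu> * l)" "0 < speed (- l) * exp (\<mu> * l)"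
    using a speed_pos by auto
  have a3: "speed s \<le> a3 * exp_weight \<kappa> s * exp (\<mu> * min s 0)" for s
  proof -
    consider "0 \<le> s" | "-l \<le> s" "s < 0" | "s < -l" by linarith
    then show ?thesis
    proof cases
      case 1
      have "speed s \<le> a2 * exp (- \<kappa> * s)" using 1 l by (intro a2) auto
      also have "\<dots> \<le> a3 * exp (- \<kappa> * s)" using p1 by (intro mult_right_mono) (auto simp: a3_def)
      finally show ?thesis using 1 by (simp add: exp_weight_def)
    next
      case 2
      have "speed s \<le> a2 * exp (- \<kappa> * s)" using 2 by (intro a2) auto
      also have "\<dots> \<le> a2 * (exp (\<kappa> * l) * (exp (\<mu> * l) * exp (\<mu> * s)))"
      proof (intro mult_left_mono)
        have "exp (- \<kappa> * s) \<le> exp (\<kappa> * l)" using mult_left_mono[of "- s" l \<kappa>] 2 \<kappa>_pos by simp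
        moreover have "1 \<le> exp (\<mu> * l) * exp (\<mu> * s)"
          using 2 \<mu> by (simp add: exp_add[symmetric] distrib_left[symmetric])
        ultimately show "exp (- \<kappa> * s) \<le> exp (\<kappa> * l) * (exp (\<mu> * l) * exp (\<mu> * s))"
          using mult_mono[of "exp (- \<kappa> * s)" "exp (\<kappa> * l)" 1 "exp (\<mu> * l) * exp (\<mu> * s)"] by simp
      qed (use a in auto)
      also have "\<dots> = (a2 * exp (\<kappa> * l) * exp (\<mu> * l)) * exp (\<mu> * s)" by simp
      also have "\<dots> \<le> a3 * exp (\<mu> * s)" using p1 a by (intro mult_right_mono) (auto simp: a3_def)
      finally show ?thesis using 2 by (simp add: exp_weight_def)
    next
      case 3
      have "speed (- l - (- l - s)) = speed (- l) * J (- l - s) (U (- l))" using 3 by (intro speed_J) auto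
      also have "\<dots> \<le> speed (- l) * exp (- \<mu> * (- l - s))"
        using 3 l(2)[of "- l"] speed_pos[of "- l"] \<eta> by (intro mult_left_mono Jn) auto
      also have "\<dots> = (speed (- l) * exp (\<mu> * l)) * exp (\<mu> * s)" by (simp add: algebra_simps exp_add)
      also have "\<dots> \<le> a3 * exp (\<mu> * s)" using p1 a by (intro mult_right_mono) (auto simp: a3_def)
      finally show ?thesis using 3 l by (simp add: exp_weight_def)
    qed
  qed
  \<comment> \<open>The first entry keeps \<open>w\<close> in the contraction zone of
    \<open>um\<close> when \<open>y0 \<le> - l\<close>; the second brings \<open>w\<close> within
    reach of \<open>phase_shift\<close> when \<open>y0\<close> lies further right.\<close>
  define \<delta> where "\<delta> = min (\<eta> / 2) (a1 * exp (- L))"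
  define C where "C = 1 + exp (2 * L) * a3 / a1"
  have a3_pos: "0 < a3" unfolding a3_def by (intro add_pos_pos p1 a)
  have C1: "1 \<le> C" "exp (2 * L) * a3 / a1 \<le> C" using a3_pos a by (auto simp: C_def)
  show ?thesis
  proof (rule that[of \<delta> C \<mu>])
    show "0 < \<delta>" using \<eta> a by (simp add: \<delta>_def)
    fix y0 w r assume r: "(0::real) \<le> r" and w: "\<bar>w - U y0\<bar> \<le> \<delta> * exp_weight \<kappa> y0"
    have Om: "0 < exp_weight \<kappa> y" "exp_weight \<kappa> y \<le> 1" for y
      using \<kappa>_pos by (auto simp: exp_weight_def)
    show "J r w * exp_weight \<kappa> y0 \<le> C * exp_weight \<kappa> (y0 - r) * decay \<mu> (y0 - r) y0"
    proof (cases "y0 \<le> - l")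
      case True
      have y0: "y0 \<le> 0" using True l by auto
      then have [simp]: "exp_weight \<kappa> y0 = 1" "exp_weight \<kappa> (y0 - r) = 1" using r by (auto simp: exp_weight_def)
      have "\<delta> \<le> \<eta> / 2" by (simp add: \<delta>_def)
      moreover have "\<bar>w - U y0\<bar> \<le> \<delta>" using w by simp
      ultimately have "\<bar>w - um\<bar> \<le> \<eta>" using l(2)[OF True] by linarith
      then have "J r w \<le> exp (- \<mu> * r)" using r by (intro Jn)
      also have "exp (- \<mu> * r) = decay \<mu> (y0 - r) y0" using y0 r by (simp add: decay_def)
      also have "\<dots> \<le> C * decay \<mu> (y0 - r) y0" using C1 by (simp add: decay_def)
      finally show ?thesis by simp
    next
      case False
      then have y0: "- l \<le> y0" by simp
      have Oy: "exp_weight \<kappa> y0 \<le> exp (- \<kappa> * y0)" using \<kappa>_pos by (simp add: exp_weight_def)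
      have Os: "a1 * exp_weight \<kappa> y0 \<le> speed y0"
        using a1[OF y0] mult_left_mono[OF Oy, of a1] a by linarith
      have "\<delta> * exp_weight \<kappa> y0 \<le> (a1 * exp (- L)) * exp_weight \<kappa> y0"
        using Om[of y0] by (intro mult_right_mono) (auto simp: \<delta>_def)
      also have "\<dots> = exp (- L) * (a1 * exp_weight \<kappa> y0)" by simp
      also have "\<dots> \<le> exp (- L) * speed y0" using Os by (intro mult_left_mono) auto
      finally obtain h where h: "\<bar>h\<bar> \<le> 1" "w = U (y0 + h)" using phase_shift[of w y0] w by auto
      have e: "exp (L * \<bar>h\<bar>) * speed z \<le> exp L * speed z" for z
        using speed_pos[of z] by (intro mult_right_mono) (use h L_pos in \<open>auto simp: mult_left_le\<close>)
      have s1: "speed y0 \<le> exp L * speed (y0 + h)"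
        using speed_shift[of y0 "y0 + h"] e[of "y0 + h"] by simp
      have s2: "speed (y0 - r + h) \<le> exp L * speed (y0 - r)"
        using speed_shift[of "y0 - r + h" "y0 - r"] e[of "y0 - r"] by simp
      have sJ: "speed (y0 - r + h) = speed (y0 + h) * J r w"
        using speed_J[OF r, of "y0 + h"] h by (simp add: algebra_simps)
      have "a1 * (J r w * exp_weight \<kappa> y0) = J r w * (a1 * exp_weight \<kappa> y0)" by simp
      also have "\<dots> \<le> J r w * (exp L * speed (y0 + h))" using Os s1 J_pos[of r w] by (intro mult_left_mono) auto
      also have "\<dots> = exp L * speed (y0 - r + h)" using sJ by simp
      also have "\<dots> \<le> exp L * (exp L * speed (y0 - r))" using s2 by (intro mult_left_mono) auto
      also have "\<dots> = exp (2 * L) * speed (y0 - r)" by (simp add: exp_add[symmetric] mult.assoc[symmetric])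
      also have "\<dots> \<le> exp (2 * L) * (a3 * exp_weight \<kappa> (y0 - r) * exp (\<mu> * min (y0 - r) 0))"
        by (intro mult_left_mono a3) auto
      also have "\<dots> \<le> exp (2 * L) * (a3 * exp_weight \<kappa> (y0 - r) * decay \<mu> (y0 - r) y0)"
      proof (intro mult_left_mono)
        have "\<mu> * min y0 0 \<le> 0" using \<mu> by (intro mult_nonneg_nonpos) auto
        then show "exp (\<mu> * min (y0 - r) 0) \<le> decay \<mu> (y0 - r) y0"
          by (simp add: decay_def algebra_simps)
      qed (intro mult_nonneg_nonneg less_imp_le[OF a3_pos] less_imp_le[OF Om(1)], simp)
      finally have "J r w * exp_weight \<kappa> y0 \<le> (exp (2 * L) * a3 / a1) * (exp_weight \<kappa> (y0 - r) * decay \<mu> (y0 - r) y0)"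
        using a by (simp add: field_simps)
      also have "\<dots> \<le> C * (exp_weight \<kappa> (y0 - r) * decay \<mu> (y0 - r) y0)"
        using C1 Om[of "y0 - r"] by (intro mult_right_mono mult_nonneg_nonneg) (auto simp: decay_def)
      finally show ?thesis by (simp add: mult.assoc)
    qed
  qed (use C1 \<mu> in auto)
qed

end

section \<open>Solving by characteristics\<close>

lemma has_derivative_partials_half_plane:
  fixes F Fr Fw :: "real \<Rightarrow> real \<Rightarrow> real"
  assumes r: "\<And>r w. 0 < r \<Longrightarrow> ((\<lambda>r. F r w) has_real_derivative Fr r w) (at r)"
    and w: "\<And>r w. 0 < r \<Longrightarrow> ((\<lambda>w. F r w) has_real_derivative Fw r w) (at w)"
    and c: "continuous_on ({0<..} \<times> UNIV) (\<lambda>p. Fw (fst p) (snd p))"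
    and "0 < r"
  shows "((\<lambda>p. F (fst p) (snd p)) has_derivative (\<lambda>h. Fr r w * fst h + Fw r w * snd h)) (at (r, w))"
proof -
  have op: "open ({0<..} \<times> UNIV :: (real \<times> real) set)" by (intro open_Times) auto
  have mem: "(r, w) \<in> {0<..} \<times> UNIV" using \<open>0 < r\<close> by simp
  have "((\<lambda>(x, y). F x y) has_derivative
      (\<lambda>(tx, ty). Fr r w * tx + blinfun_mult_right (Fw r w) ty)) (at (r, w) within {0<..} \<times> UNIV)"
  proof (rule has_derivative_partialsI)
    show "((\<lambda>x. F x w) has_derivative (*) (Fr r w)) (at r within {0<..})"
      using r[OF \<open>0 < r\<close>, of w] unfolding has_field_derivative_def by (rule has_derivative_at_withinI)
    show "((\<lambda>y. F x y) has_derivative blinfun_mult_right (Fw x y)) (at y within UNIV)" if "x \<in> {0<..}" for x y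
      using w[of x y] that unfolding has_field_derivative_def by simp
    have "continuous_on ({0<..} \<times> UNIV) (\<lambda>p. blinfun_mult_right (Fw (fst p) (snd p)))"
      by (intro continuous_intros c)
    then show "continuous (at (r, w) within {0<..} \<times> UNIV) (\<lambda>(x, y). blinfun_mult_right (Fw x y))"
      using mem unfolding continuous_on_eq_continuous_within split_beta by blast
  qed auto
  then show ?thesis
    unfolding at_within_open[OF mem op] split_beta blinfun_mult_right.rep_eq .
qed

text \<open>\<open>b\<close> stands for the slowness 1 / c, the time a characteristic needs per unit
  of \<open>y\<close> in the moving frame. Its two positive bounds make travel times comparable to
  distances.\<close>

locale wave_data = wave_profile +
  fixes b b' :: "real \<Rightarrow> real" and b0 b1 Lb :: real
  assumes b_deriv: "(b has_real_derivative b' w) (at w)"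
    and b'_cont: "continuous_on UNIV b'"
    and b'_bound: "\<bar>b' w\<bar> \<le> Lb"
    and b_bounds: "b0 \<le> b w" "b w \<le> b1"
    and b0_pos: "0 < b0"
begin

lemma b_cont: "continuous_on A b"
  using b_deriv by (meson DERIV_isCont continuous_at_imp_continuous_on)

text \<open>Time needed by the characteristic that carries the value \<open>w\<close> at its foot to
  advance to the left by the distance \<open>r\<close>; \<open>\<tau>w\<close> is the derivative of
  this time in \<open>w\<close>.\<close>

definition \<tau> :: "real \<Rightarrow> real \<Rightarrow> real" where
  "\<tau> r w = integral {0..r} (\<lambda>s. b (flow s w))"

definition \<tau>w :: "real \<Rightarrow> real \<Rightarrow> real" where
  "\<tau>w r w = integral {0..r} (\<lambda>s. b' (flow s w) * J s w)"

lemma continuous_on_b [continuous_intros]: "continuous_on A h \<Longrightarrow> continuous_on A (\<lambda>x. b (h x))"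
  by (rule continuous_on_compose2[OF b_cont[of UNIV]]) auto

lemma continuous_on_b' [continuous_intros]: "continuous_on A h \<Longrightarrow> continuous_on A (\<lambda>x. b' (h x))"
  by (rule continuous_on_compose2[OF b'_cont]) auto

lemma continuous_on_\<tau> [continuous_intros]:
  assumes "continuous_on A r" "continuous_on A w" "\<And>x. x \<in> A \<Longrightarrow> 0 \<le> r x"
  shows "continuous_on A (\<lambda>x. \<tau> (r x) (w x))"
proof -
  have "continuous_on ({0..} \<times> UNIV) (\<lambda>(r, w). integral {0..r} (\<lambda>s. b (flow s w)))"
    by (intro continuous_on_integral_upper_limit) (auto simp: split_beta intro!: continuous_intros)
  then have "continuous_on ({0..} \<times> UNIV) (\<lambda>(r, w). \<tau> r w)" by (simp add: \<tau>_def)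
  from continuous_on_compose2[OF this continuous_on_Pair[OF assms(1,2)]] show ?thesis
    using assms(3) by (auto simp: image_subset_iff)
qed

lemma continuous_on_\<tau>w [continuous_intros]:
  assumes "continuous_on A r" "continuous_on A w" "\<And>x. x \<in> A \<Longrightarrow> 0 \<le> r x"
  shows "continuous_on A (\<lambda>x. \<tau>w (r x) (w x))"
proof -
  have "continuous_on ({0..} \<times> UNIV) (\<lambda>(r, w). integral {0..r} (\<lambda>s. b' (flow s w) * J s w))"
    by (intro continuous_on_integral_upper_limit) (auto simp: split_beta intro!: continuous_intros)
  then have "continuous_on ({0..} \<times> UNIV) (\<lambda>(r, w). \<tau>w r w)" by (simp add: \<tau>w_def)
  from continuous_on_compose2[OF this continuous_on_Pair[OF assms(1,2)]] show ?thesis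
    using assms(3) by (auto simp: image_subset_iff)
qed

lemma \<tau>_0 [simp]: "\<tau> 0 w = 0"
  by (simp add: \<tau>_def)

lemma \<tau>_deriv_time:
  "0 \<le> r \<Longrightarrow> ((\<lambda>r. \<tau> r w) has_real_derivative b (flow r w)) (at r within {0..})"
  unfolding \<tau>_def by (rule indefinite_integral_has_real_derivative) (auto intro!: continuous_intros)

lemma deriv_within_imp_at:
  assumes "(h has_real_derivative D) (at r within {0..})" "0 < r"
  shows "(h has_real_derivative D) (at r)"
proof -
  have "(h has_real_derivative D) (at r within {0<..})"
    by (rule DERIV_subset[OF assms(1)]) auto
  then show ?thesis using at_within_open[of r "{0<..}"] assms(2) by simp
qed

lemma \<tau>_deriv_state:
  assumes "0 \<le> r"
  shows "((\<lambda>w. \<tau> r w) has_real_derivative \<tau>w r w) (at w)"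
proof -
  have "((\<lambda>w. integral (cbox 0 r) (\<lambda>s. b (flow s w))) has_field_derivative
      integral (cbox 0 r) (\<lambda>s. b' (flow s w) * J s w)) (at w within UNIV)"
  proof (rule leibniz_rule_field_derivative)
    show "((\<lambda>w. b (flow s w)) has_field_derivative b' (flow s w) * J s w) (at w within UNIV)"
      if "s \<in> cbox 0 r" for w s
      using that by (intro DERIV_chain2[OF b_deriv] flow_deriv_state) auto
    show "(\<lambda>s. b (flow s w)) integrable_on cbox 0 r" for w
      by (intro integrable_continuous continuous_intros) auto
    show "continuous_on (UNIV \<times> cbox 0 r) (\<lambda>(w, s). b' (flow s w) * J s w)"
      by (auto simp: split_beta intro!: continuous_intros)
  qed auto
  then show ?thesis by (simp add: \<tau>_def \<tau>w_def)
qed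

text \<open>Along an orbit \<open>b\<close> changes at the rate b' G, and \<open>G_flow\<close>
  pulls the constant \<open>G w\<close> out, leaving the integrand of \<open>\<tau>w\<close>. This
  identity later replaces u0' by the small quantity u0' + G(u0) in the derivative of the travel
  time.\<close>

lemma b_flow:
  assumes "0 \<le> r"
  shows "b (flow r w) = b w + G w * \<tau>w r w"
proof -
  have "((\<lambda>s. G w * (b' (flow s w) * J s w)) has_integral (b (flow r w) - b (flow 0 w))) {0..r}"
  proof (rule fundamental_theorem_of_calculus[OF assms])
    fix s assume s: "s \<in> {0..r}"
    have "((\<lambda>s. b (flow s w)) has_real_derivative b' (flow s w) * G (flow s w)) (at s within {0..r})"
      using s by (intro DERIV_chain2[OF b_deriv] DERIV_subset[OF flow_deriv]) auto
    then show "((\<lambda>s. b (flow s w)) has_vector_derivative G w * (b' (flow s w) * J s w)) (at s within {0..r})"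
      using s by (simp add: G_flow has_real_derivative_iff_has_vector_derivative mult_ac)
  qed
  from integral_unique[OF this] show ?thesis by (simp add: \<tau>w_def)
qed

lemma \<tau>_bounds:
  assumes "0 \<le> r"
  shows "b0 * r \<le> \<tau> r w" "\<tau> r w \<le> b1 * r"
proof -
  have i: "(\<lambda>s. b (flow s w)) integrable_on {0..r}"
    by (intro integrable_continuous_real continuous_intros) auto
  have "integral {0..r} (\<lambda>s. b0) \<le> \<tau> r w"
    unfolding \<tau>_def by (intro integral_le i b_bounds integrable_const_ivl)
  moreover have "\<tau> r w \<le> integral {0..r} (\<lambda>s. b1)"
    unfolding \<tau>_def by (intro integral_le i b_bounds integrable_const_ivl)
  ultimately show "b0 * r \<le> \<tau> r w" "\<tau> r w \<le> b1 * r" using assms by (simp_all add: mult.commute)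
qed

end

text \<open>The part of the path in the positive half-line contributes at most 1 / \<kappa> through
  the weight, the part in the negative half-line at most 1 / \<mu> through the damping. The bound
  depends neither on the foot nor on the length of the path, so smallness of the data does not
  deteriorate in time.\<close>

lemma weight_decay_integral:
  fixes \<kappa> \<mu> y0 r :: real
  assumes "0 < \<kappa>" "0 < \<mu>" "0 \<le> r"
  defines "h \<equiv> \<lambda>s. exp_weight \<kappa> (y0 - s) * exp (- \<mu> * (min y0 0 - min (y0 - s) 0))"
  shows "h integrable_on {0..r}" "integral {0..r} h \<le> 1 / \<kappa> + 1 / \<mu>"
proof -
  \<comment> \<open>An explicit primitive, glued at \<open>s = y0\<close>, the single point excepted
    in the fundamental theorem below.\<close>
  define P where "P s = - exp (- \<mu> * min y0 0) *
    (exp (\<mu> * min (y0 - s) 0) / \<mu> + (1 - exp (- \<kappa> * max (y0 - s) 0)) / \<kappa>)" for s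
  have "(h has_integral (P r - P 0)) {0..r}"
  proof (rule fundamental_theorem_of_calculus_interior_strong[of "{y0}"])
    show "continuous_on {0..r} P"
      unfolding P_def using assms by (intro continuous_intros) auto
    fix s assume s: "s \<in> {0<..<r} - {y0}"
    show "(P has_vector_derivative h s) (at s)"
    proof (cases "s < y0")
      case True
      have "((\<lambda>s. - exp (- \<mu> * min y0 0) * (1 / \<mu> + (1 - exp (- \<kappa> * (y0 - s))) / \<kappa>)) has_real_derivative h s) (at s)"
        using True assms by (auto intro!: derivative_eq_intros simp: h_def exp_weight_def)
      moreover have "eventually (\<lambda>x. x < y0) (nhds s)"
        using True by (intro eventually_nhds_in_open[of "{..<y0}", simplified]) auto
      ultimately show ?thesis
        unfolding has_real_derivative_iff_has_vector_derivative[symmetric]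
        by (subst DERIV_cong_ev[OF refl _ refl]) (auto elim!: eventually_mono simp: P_def)
    next
      case False
      then have "y0 < s" using s by auto
      then have "((\<lambda>s. - exp (- \<mu> * min y0 0) * (exp (\<mu> * (y0 - s)) / \<mu>)) has_real_derivative h s) (at s)"
        using assms by (auto intro!: derivative_eq_intros simp: h_def exp_weight_def exp_add[symmetric] algebra_simps)
      moreover have "eventually (\<lambda>x. y0 < x) (nhds s)"
        using \<open>y0 < s\<close> by (intro eventually_nhds_in_open[of "{y0<..}", simplified]) auto
      ultimately show ?thesis
        unfolding has_real_derivative_iff_has_vector_derivative[symmetric]
        by (subst DERIV_cong_ev[OF refl _ refl]) (auto elim!: eventually_mono simp: P_def)
    qed
  qed (use assms in auto)
  then show "h integrable_on {0..r}" and "integral {0..r} h \<le> 1 / \<kappa> + 1 / \<mu>"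
  proof -
    assume i: "(h has_integral (P r - P 0)) {0..r}"
    then show "h integrable_on {0..r}" by blast
    have "P r \<le> 0" unfolding P_def using assms
      by (intro mult_nonpos_nonneg add_nonneg_nonneg divide_nonneg_pos) auto
    moreover have "- P 0 \<le> 1 / \<kappa> + 1 / \<mu>"
    proof (cases "y0 \<le> 0")
      case True
      then show ?thesis using assms by (simp add: P_def exp_add[symmetric] mult.commute)
    next
      case False
      then show ?thesis using assms by (simp add: P_def divide_right_mono)
    qed
    ultimately show "integral {0..r} h \<le> 1 / \<kappa> + 1 / \<mu>"
      using integral_unique[OF i] by linarith
  qed
qed

text \<open>The third bound on \<open>\<epsilon>\<close> says that the perturbation, integrated
  along a whole orbit with the help of \<open>weight_decay_integral\<close>, changes the derivative
  of the travel time by at most half of the minimal slowness \<open>b0\<close>.\<close>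

locale wave_solution = wave_data +
  fixes \<delta> C \<mu> \<epsilon> :: real and u0 u0' :: "real \<Rightarrow> real"
  assumes C_ge1: "1 \<le> C" and \<mu>_pos: "0 < \<mu>"
    and J_weighted: "0 \<le> r \<Longrightarrow> \<bar>w - U y0\<bar> \<le> \<delta> * exp_weight \<kappa> y0 \<Longrightarrow>
       J r w * exp_weight \<kappa> y0 \<le> C * exp_weight \<kappa> (y0 - r) * decay \<mu> (y0 - r) y0"
    and u0_deriv: "(u0 has_real_derivative u0' y) (at y)"
    and u0'_cont: "continuous_on UNIV u0'"
    and \<epsilon>: "0 < \<epsilon>" "\<epsilon> \<le> \<delta>" "Lb * (C * ((1 + L) * \<epsilon>)) * (1 / \<kappa> + 1 / \<mu>) \<le> b0 / 2"
    and u0_close: "\<bar>u0 y - U y\<bar> + \<bar>u0' y + G (U y)\<bar> \<le> \<epsilon> * exp_weight \<kappa> y"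
begin

abbreviation \<Omega> :: "real \<Rightarrow> real" where "\<Omega> \<equiv> exp_weight \<kappa>"

definition D :: "real \<Rightarrow> real" where
  "D y = \<bar>u0 y - U y\<bar> + \<bar>u0' y + G (U y)\<bar>"

text \<open>The defect of the datum in the profile equation U' = -G(U). It is the rate at which the
  datum moves across orbits, and it is of first order in the perturbation.\<close>

definition q :: "real \<Rightarrow> real" where
  "q y = u0' y + G (u0 y)"

lemma \<Omega>_pos: "0 < \<Omega> y"
  by (simp add: exp_weight_def)

lemma decay_bounds: "0 < decay \<mu> s y" "s \<le> y \<Longrightarrow> decay \<mu> s y \<le> 1"
  using \<mu>_pos by (auto simp: decay_def min_def)

lemma u0_cont: "continuous_on A u0"
  using u0_deriv by (meson DERIV_isCont continuous_at_imp_continuous_on)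

lemma continuous_on_u0 [continuous_intros]: "continuous_on A h \<Longrightarrow> continuous_on A (\<lambda>x. u0 (h x))"
  by (rule continuous_on_compose2[OF u0_cont[of UNIV]]) auto

lemma continuous_on_G [continuous_intros]: "continuous_on A h \<Longrightarrow> continuous_on A (\<lambda>x. G (h x))"
  by (rule continuous_on_compose2[OF G_cont[of UNIV]]) auto

lemma continuous_on_q [continuous_intros]: "continuous_on A h \<Longrightarrow> continuous_on A (\<lambda>x. q (h x))"
  unfolding q_def by (intro continuous_intros continuous_on_compose2[OF u0'_cont]) auto

lemma q_bound: "\<bar>q y\<bar> \<le> (1 + L) * D y"
proof -
  have "\<bar>q y\<bar> \<le> \<bar>u0' y + G (U y)\<bar> + \<bar>G (u0 y) - G (U y)\<bar>" by (simp add: q_def)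
  also have "\<dots> \<le> \<bar>u0' y + G (U y)\<bar> + L * \<bar>u0 y - U y\<bar>" using G_lipschitz by simp
  also have "\<dots> \<le> (1 + L) * D y" using L_pos by (simp add: D_def algebra_simps)
  finally show ?thesis .
qed

lemma D_bounds: "0 \<le> D y" "D y \<le> \<epsilon> * \<Omega> y"
  using u0_close[of y] by (auto simp: D_def)

lemma u0_in_tube: "\<bar>u0 y - U y\<bar> \<le> \<delta> * \<Omega> y"
proof -
  have "\<bar>u0 y - U y\<bar> \<le> D y" by (simp add: D_def)
  also have "\<dots> \<le> \<epsilon> * \<Omega> y" by (rule D_bounds)
  also have "\<dots> \<le> \<delta> * \<Omega> y" using \<epsilon>(2) \<Omega>_pos[of y] by (intro mult_right_mono) auto
  finally show ?thesis .
qed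

lemma J_u0:
  assumes "0 \<le> r"
  shows "J r (u0 y0) \<le> C * \<Omega> (y0 - r) * decay \<mu> (y0 - r) y0 / \<Omega> y0"
  using J_weighted[OF assms u0_in_tube] \<Omega>_pos by (simp add: pos_le_divide_eq)

lemma Z_bound:
  assumes "0 \<le> r"
  shows "\<bar>J r (u0 y0) * q y0\<bar> \<le> C * ((1 + L) * (D y0 / \<Omega> y0)) * (\<Omega> (y0 - r) * decay \<mu> (y0 - r) y0)"
proof -
  have "\<bar>J r (u0 y0) * q y0\<bar> = J r (u0 y0) * \<bar>q y0\<bar>" using J_pos[of r "u0 y0"] by (simp add: abs_mult)
  also have "\<dots> \<le> (C * \<Omega> (y0 - r) * decay \<mu> (y0 - r) y0 / \<Omega> y0) * ((1 + L) * D y0)"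
    using assms J_pos[of r "u0 y0"] by (intro mult_mono J_u0 q_bound) (auto intro: order_trans[OF less_imp_le J_u0])
  finally show ?thesis by (simp add: mult_ac)
qed

section \<open>Travel time and foot of a characteristic\<close>

definition T :: "real \<Rightarrow> real \<Rightarrow> real" where
  "T y y0 = \<tau> (y0 - y) (u0 y0)"

text \<open>The derivative of \<open>T y\<close> at the foot \<open>y0\<close>. Differentiation
  yields the slowness at the end of the orbit plus \<tau>w u0'; \<open>b_flow\<close> moves the
  slowness to the foot and completes u0' to \<open>q\<close>.\<close>

definition m :: "real \<Rightarrow> real \<Rightarrow> real" where
  "m y y0 = b (u0 y0) + \<tau>w (y0 - y) (u0 y0) * q y0"

text \<open>The correction to \<open>b (u0 y0)\<close> is an integral along the orbit whose
  integrand is dominated by \<open>\<epsilon>\<close> times weight and damping, hence at most b0 / 2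
  for every length. The resulting positivity says that characteristics never cross.\<close>

lemma m_lower:
  assumes "y \<le> y0"
  shows "b0 / 2 \<le> m y y0"
proof -
  define r where "r = y0 - y"
  have r: "0 \<le> r" using assms by (simp add: r_def)
  define h where "h s = \<Omega> (y0 - s) * exp (- \<mu> * (min y0 0 - min (y0 - s) 0))" for s
  have h: "h integrable_on {0..r}" "integral {0..r} h \<le> 1 / \<kappa> + 1 / \<mu>"
    unfolding h_def using weight_decay_integral[OF \<kappa>_pos \<mu>_pos r] by auto
  have Lb: "0 \<le> Lb" using b'_bound[of 0] by simp
  have "\<bar>\<tau>w r (u0 y0) * q y0\<bar> = norm (integral {0..r} (\<lambda>s. b' (flow s (u0 y0)) * (J s (u0 y0) * q y0)))"
    by (simp add: \<tau>w_def mult.assoc flip: integral_mult_left)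
  also have "\<dots> \<le> integral {0..r} (\<lambda>s. Lb * (C * ((1 + L) * \<epsilon>)) * h s)"
  proof (rule integral_norm_bound_integral)
    show "(\<lambda>s. b' (flow s (u0 y0)) * (J s (u0 y0) * q y0)) integrable_on {0..r}"
      by (intro integrable_continuous_real continuous_intros) auto
    show "(\<lambda>s. Lb * (C * ((1 + L) * \<epsilon>)) * h s) integrable_on {0..r}"
      by (intro integrable_on_mult_right h)
    fix s assume s: "s \<in> {0..r}"
    have "\<bar>J s (u0 y0) * q y0\<bar> \<le> C * ((1 + L) * (D y0 / \<Omega> y0)) * (\<Omega> (y0 - s) * decay \<mu> (y0 - s) y0)"
      using s by (intro Z_bound) auto
    also have "\<dots> \<le> C * ((1 + L) * \<epsilon>) * (\<Omega> (y0 - s) * decay \<mu> (y0 - s) y0)"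
      using C_ge1 L_pos D_bounds[of y0] \<Omega>_pos[of y0] \<Omega>_pos[of "y0 - s"] decay_bounds(1)[of "y0 - s" y0]
      by (intro mult_right_mono mult_left_mono) (auto simp: pos_divide_le_eq)
    also have "\<dots> = C * ((1 + L) * \<epsilon>) * h s" by (simp add: h_def decay_def)
    finally have "Lb * \<bar>J s (u0 y0) * q y0\<bar> \<le> Lb * (C * ((1 + L) * \<epsilon>) * h s)"
      by (intro mult_left_mono Lb)
    moreover have "\<bar>b' (flow s (u0 y0))\<bar> * \<bar>J s (u0 y0) * q y0\<bar> \<le> Lb * \<bar>J s (u0 y0) * q y0\<bar>"
      by (intro mult_right_mono b'_bound) auto
    ultimately show "norm (b' (flow s (u0 y0)) * (J s (u0 y0) * q y0)) \<le> Lb * (C * ((1 + L) * \<epsilon>)) * h s"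
      by (simp add: abs_mult mult.assoc)
  qed
  also have "\<dots> = Lb * (C * ((1 + L) * \<epsilon>)) * integral {0..r} h" by simp
  also have "\<dots> \<le> Lb * (C * ((1 + L) * \<epsilon>)) * (1 / \<kappa> + 1 / \<mu>)"
    using Lb C_ge1 L_pos \<epsilon> by (intro mult_left_mono h) auto
  also have "\<dots> \<le> b0 / 2" by (rule \<epsilon>)
  finally have "\<bar>\<tau>w r (u0 y0) * q y0\<bar> \<le> b0 / 2" by simp
  then show ?thesis using b_bounds(1)[of "u0 y0"] by (simp add: m_def r_def)
qed

lemma m_pos: "y \<le> y0 \<Longrightarrow> 0 < m y y0"
  using m_lower[of y y0] b0_pos by linarith

lemma T_has_derivative:
  assumes "y < y0"
  shows "((\<lambda>p. T (fst p) (snd p)) has_derivative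
      (\<lambda>k. - b (flow (y0 - y) (u0 y0)) * fst k + m y y0 * snd k)) (at (y, y0))"
proof -
  have inner: "((\<lambda>p. (snd p - fst p, u0 (snd p))) has_derivative
      (\<lambda>k. (snd k - fst k, u0' y0 * snd k))) (at (y, y0))"
    by (auto intro!: derivative_eq_intros has_derivative_compose[OF _ u0_deriv[unfolded has_field_derivative_def], where f="\<lambda>p. snd p"])
  have outer: "((\<lambda>p. \<tau> (fst p) (snd p)) has_derivative
      (\<lambda>h. b (flow (y0 - y) (u0 y0)) * fst h + \<tau>w (y0 - y) (u0 y0) * snd h)) (at (y0 - y, u0 y0))"
    using assms
    by (intro has_derivative_partials_half_plane[where Fr="\<lambda>r w. b (flow r w)"] deriv_within_imp_at[OF \<tau>_deriv_time] \<tau>_deriv_state)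
       (auto intro!: continuous_intros)
  from has_derivative_compose[OF inner, unfolded fst_conv snd_conv, OF outer]
  have "((\<lambda>p. T (fst p) (snd p)) has_derivative
      (\<lambda>k. b (flow (y0 - y) (u0 y0)) * (snd k - fst k) + \<tau>w (y0 - y) (u0 y0) * (u0' y0 * snd k))) (at (y, y0))"
    by (simp add: T_def)
  then show ?thesis
    by (rule has_derivative_eq_rhs)
       (use assms in \<open>simp add: fun_eq_iff m_def q_def b_flow algebra_simps\<close>)
qed

lemma W_has_derivative:
  assumes "y < y0"
  shows "((\<lambda>p. flow (snd p - fst p) (u0 (snd p))) has_derivative
      (\<lambda>k. - G (flow (y0 - y) (u0 y0)) * fst k + J (y0 - y) (u0 y0) * q y0 * snd k)) (at (y, y0))"
proof -
  have inner: "((\<lambda>p. (snd p - fst p, u0 (snd p))) has_derivative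
      (\<lambda>k. (snd k - fst k, u0' y0 * snd k))) (at (y, y0))"
    by (auto intro!: derivative_eq_intros has_derivative_compose[OF _ u0_deriv[unfolded has_field_derivative_def], where f="\<lambda>p. snd p"])
  have outer: "((\<lambda>p. flow (fst p) (snd p)) has_derivative
      (\<lambda>h. G (flow (y0 - y) (u0 y0)) * fst h + J (y0 - y) (u0 y0) * snd h)) (at (y0 - y, u0 y0))"
    using assms
    by (intro has_derivative_partials_half_plane[where Fr="\<lambda>r w. G (flow r w)"] deriv_within_imp_at[OF flow_deriv] flow_deriv_state)
       (auto intro!: continuous_intros)
  from has_derivative_compose[OF inner, unfolded fst_conv snd_conv, OF outer]
  have "((\<lambda>p. flow (snd p - fst p) (u0 (snd p))) has_derivative
      (\<lambda>k. G (flow (y0 - y) (u0 y0)) * (snd k - fst k) + J (y0 - y) (u0 y0) * (u0' y0 * snd k))) (at (y, y0))"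
    by simp
  then show ?thesis
    by (rule has_derivative_eq_rhs)
       (use assms in \<open>simp add: fun_eq_iff q_def G_flow algebra_simps\<close>)
qed

lemma T_cont: "continuous_on {y..} (T y)"
  unfolding T_def by (intro continuous_intros) auto

lemma T_increase:
  assumes "y \<le> p" "p \<le> p'"
  shows "(b0 / 2) * (p' - p) \<le> T y p' - T y p"
proof (cases "p = p'")
  case False
  then have lt: "p < p'" using assms by simp
  have der: "(T y has_derivative (\<lambda>k. m y x * k)) (at x)" if "y < x" for x
  proof -
    have "((\<lambda>x. (y, x)) has_derivative (\<lambda>k. (0, k))) (at x)" by (auto intro!: derivative_eq_intros)
    from has_derivative_compose[OF this T_has_derivative[OF that]]
    show ?thesis by simp
  qed
  obtain x where x: "x \<in> {p<..<p'}" "T y p' - T y p = m y x * (p' - p)"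
    using mvt[OF lt continuous_on_subset[OF T_cont], of y "\<lambda>x k. m y x * k"] der assms by auto
  then show ?thesis using m_lower[of y x] assms by (auto intro!: mult_right_mono)
qed simp

lemma T_bounds: "y \<le> y0 \<Longrightarrow> b0 * (y0 - y) \<le> T y y0" "y \<le> y0 \<Longrightarrow> T y y0 \<le> b1 * (y0 - y)"
  using \<tau>_bounds[of "y0 - y" "u0 y0"] by (simp_all add: T_def)

lemma T_lipschitz_left:
  assumes "y \<le> y0" "y' \<le> y0"
  shows "\<bar>T y y0 - T y' y0\<bar> \<le> b1 * \<bar>y - y'\<bar>"
proof -
  have "norm (\<tau> (y0 - y) (u0 y0) - \<tau> (y0 - y') (u0 y0)) \<le> b1 * norm ((y0 - y) - (y0 - y'))"
  proof (rule field_differentiable_bound[of "{0..}" _ "\<lambda>r. b (flow r (u0 y0))"])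
    show "norm (b (flow r (u0 y0))) \<le> b1" for r
      using b_bounds[of "flow r (u0 y0)"] b0_pos by simp
  qed (use assms \<tau>_deriv_time in auto)
  moreover have "(y0 - y) - (y0 - y') = - (y - y')" by simp
  ultimately show ?thesis unfolding T_def real_norm_def by (simp only: abs_minus_cancel)
qed

lemma foot_ex1: "0 \<le> t \<Longrightarrow> \<exists>!y0. y \<le> y0 \<and> T y y0 = t"
proof (rule ex_ex1I)
  assume t: "0 \<le> t"
  have "t \<le> T y (y + t / b0)" using T_bounds(1)[of y "y + t / b0"] t b0_pos by simp
  moreover have "T y y \<le> t" using t by (simp add: T_def)
  ultimately obtain x where "y \<le> x" "T y x = t"
    using IVT'[of "T y" y t "y + t / b0"] t b0_pos continuous_on_subset[OF T_cont, of "{y..y + t / b0}" y] by force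
  then show "\<exists>y0. y \<le> y0 \<and> T y y0 = t" by blast
next
  fix p p' assume *: "y \<le> p \<and> T y p = t" "y \<le> p' \<and> T y p' = t"
  show "p = p'"
    using T_increase[of y p p'] T_increase[of y p' p] * b0_pos
    by (cases "p \<le> p'") (auto simp: mult_le_0_iff)
qed

definition foot :: "real \<Rightarrow> real \<Rightarrow> real" where
  "foot t y = (THE y0. y \<le> y0 \<and> T y y0 = t)"

lemma foot_ge: "0 \<le> t \<Longrightarrow> y \<le> foot t y" and T_foot: "0 \<le> t \<Longrightarrow> T y (foot t y) = t"
  using theI'[OF foot_ex1[of t y]] unfolding foot_def by auto

lemma foot_unique: "0 \<le> t \<Longrightarrow> y \<le> y0 \<Longrightarrow> T y y0 = t \<Longrightarrow> foot t y = y0"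
  using foot_ex1[of t y] foot_ge[of t y] T_foot[of t y] by blast

lemma foot_0 [simp]: "foot 0 y = y"
  by (rule foot_unique) (auto simp: T_def)

lemma b1_pos: "0 < b1"
  using b_bounds[of 0] b0_pos by linarith

lemma foot_time: "0 \<le> t \<Longrightarrow> t / b1 \<le> foot t y - y"
  using T_bounds(2)[OF foot_ge, of t y] T_foot[of t y] b1_pos by (simp add: pos_divide_le_eq mult.commute)

lemma foot_gt: "0 < t \<Longrightarrow> y < foot t y"
  using foot_time[of t y] b1_pos by (smt (verit) divide_pos_pos)

text \<open>Supplies the continuity of the inverse map that differentiation of the foot presupposes,
  and continuity of the solution up to time 0. After ordering y \<le> y', both feet are compared
  through the travel times to y', provided that the foot of \<open>y\<close> lies to the right of
  y'.\<close>

lemma foot_lipschitz: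
  assumes "0 \<le> t" "0 \<le> t'"
  shows "\<bar>foot t y - foot t' y'\<bar> \<le> (2 / b0) * \<bar>t - t'\<bar> + (1 + 2 * b1 / b0) * \<bar>y - y'\<bar>"
  using assms
proof (induction y y' arbitrary: t t' rule: linorder_wlog)
  case (sym y y')
  then show ?case using sym(1)[of t' t] by (simp add: abs_minus_commute)
next
  case (le y y')
  define p p' where "p = foot t y" and "p' = foot t' y'"
  have p: "y \<le> p" "T y p = t" and p': "y' \<le> p'" "T y' p' = t'"
    using foot_ge T_foot le by (auto simp: p_def p'_def)
  have key: "\<bar>p - p'\<bar> \<le> (2 / b0) * \<bar>t - t'\<bar> + (2 * b1 / b0) * \<bar>y - y'\<bar>" if "y' \<le> p"
  proof -
    have "(b0 / 2) * \<bar>p - p'\<bar> \<le> \<bar>T y' p - T y' p'\<bar>"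
    proof (cases "p \<le> p'")
      case True
      have "b0 / 2 * \<bar>p - p'\<bar> = b0 / 2 * (p' - p)" using True by simp
      then show ?thesis using T_increase[OF that True] by linarith
    next
      case False
      have "b0 / 2 * \<bar>p - p'\<bar> = b0 / 2 * (p - p')" using False by simp
      then show ?thesis using T_increase[OF p'(1), of p] False by linarith
    qed
    also have "\<dots> \<le> \<bar>t - t'\<bar> + \<bar>T y p - T y' p\<bar>" using p p' by simp
    also have "\<dots> \<le> \<bar>t - t'\<bar> + b1 * \<bar>y - y'\<bar>" using T_lipschitz_left[OF p(1) that] by simp
    finally show ?thesis using b0_pos by (simp add: field_simps)
  qed
  show ?case
  proof (cases "y' \<le> p")
    case True
    have "\<bar>p - p'\<bar> \<le> (2 / b0) * \<bar>t - t'\<bar> + (2 * b1 / b0) * \<bar>y - y'\<bar>" by (rule key[OF True])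
    then show ?thesis by (simp add: p_def p'_def distrib_right)
  next
    \<comment> \<open>Here the foot \<open>p\<close> is to the left of \<open>y'\<close>, and the
      travel time from \<open>p\<close> to \<open>y'\<close> makes no sense. But then
      \<open>p - y\<close>, and with it \<open>t\<close>, is bounded by a multiple of the distance
      of \<open>y\<close> and \<open>y'\<close>, and \<open>p' - y'\<close> is at most t' /
      b0.\<close>
    case False
    have "b0 * (p' - y') \<le> t'" using T_bounds(1)[OF p'(1)] p'(2) by simp
    moreover have "t \<le> b1 * (p - y)" using T_bounds(2)[OF p(1)] p(2) by simp
    moreover have "b1 * (p - y) \<le> b1 * \<bar>y - y'\<bar>" using False le b1_pos by (intro mult_left_mono) auto
    ultimately have "b0 * (p' - y') \<le> \<bar>t - t'\<bar> + b1 * \<bar>y - y'\<bar>" by linarith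
    then have "p' - y' \<le> (1 / b0) * \<bar>t - t'\<bar> + (b1 / b0) * \<bar>y - y'\<bar>" using b0_pos by (simp add: field_simps)
    moreover have "(1 / b0) * \<bar>t - t'\<bar> \<le> (2 / b0) * \<bar>t - t'\<bar>" "(b1 / b0) * \<bar>y - y'\<bar> \<le> (2 * b1 / b0) * \<bar>y - y'\<bar>"
      using b0_pos b1_pos by (intro mult_right_mono divide_right_mono; simp)+
    moreover have "\<bar>p - p'\<bar> = p' - p" "p' - p \<le> (p' - y') + \<bar>y - y'\<bar>" using False p p' le by auto
    ultimately show ?thesis unfolding p_def[symmetric] p'_def[symmetric] distrib_right by linarith
  qed
qed

lemma foot_cont: "continuous_on ({0..} \<times> UNIV) (\<lambda>p. foot (fst p) (snd p))"
proof (rule continuous_onI)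
  fix p :: "real \<times> real" and e :: real assume p: "p \<in> {0..} \<times> UNIV" and e: "0 < e"
  define Q where "Q = (2 / b0) + (1 + 2 * b1 / b0)"
  have Q: "0 < Q" "0 \<le> 2 / b0" "0 \<le> 1 + 2 * b1 / b0" using b0_pos b1_pos by (auto simp: Q_def add_pos_pos)
  have "dist (foot (fst x) (snd x)) (foot (fst p) (snd p)) \<le> e"
    if x: "x \<in> {0..} \<times> UNIV" "dist x p < e / Q" for x
  proof -
    have d: "\<bar>fst x - fst p\<bar> \<le> dist x p" "\<bar>snd x - snd p\<bar> \<le> dist x p"
      using dist_fst_le[of x p] dist_snd_le[of x p] by (auto simp: dist_real_def)
    have "\<bar>foot (fst x) (snd x) - foot (fst p) (snd p)\<bar> \<le>
      (2 / b0) * \<bar>fst x - fst p\<bar> + (1 + 2 * b1 / b0) * \<bar>snd x - snd p\<bar>"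
      using x p by (intro foot_lipschitz) auto
    also have "\<dots> \<le> (2 / b0) * dist x p + (1 + 2 * b1 / b0) * dist x p"
      by (intro add_mono mult_left_mono d Q)
    also have "\<dots> = Q * dist x p" by (simp add: Q_def distrib_right)
    also have "\<dots> \<le> e" using x Q by (simp add: pos_less_divide_eq mult.commute)
    finally show ?thesis by (simp add: dist_real_def)
  qed
  then show "\<exists>d>0. \<forall>x\<in>{0..} \<times> UNIV. dist x p < d \<longrightarrow>
      dist (foot (fst x) (snd x)) (foot (fst p) (snd p)) \<le> e"
    using Q e by (intro exI[of _ "e / Q"]) auto
qed

section \<open>The solution carried by the characteristics\<close>

definition v :: "real \<Rightarrow> real \<Rightarrow> real" where
  "v t y = flow (foot t y - y) (u0 (foot t y))"

text \<open>Implicit differentiation of the travel time: at fixed \<open>y\<close> the foot moves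
  with velocity 1 / m, and the transported value changes by J q per unit displacement of the
  foot.\<close>

definition vt :: "real \<Rightarrow> real \<Rightarrow> real" where
  "vt t y = J (foot t y - y) (u0 (foot t y)) * q (foot t y) / m y (foot t y)"

text \<open>The equation b v_t - v_y = G(v) solved for v_y. The equation thus holds by definition,
  and the content lies in \<open>v_has_derivative\<close>.\<close>

definition vy :: "real \<Rightarrow> real \<Rightarrow> real" where
  "vy t y = - G (v t y) + b (v t y) * vt t y"

lemma v_0 [simp]: "v 0 y = u0 y"
  by (simp add: v_def)

lemma vy_0: "vy 0 y = u0' y"
  using m_pos[of y y] b_bounds(1)[of "u0 y"] b0_pos by (simp add: vy_def vt_def m_def q_def \<tau>w_def)

lemma v_cont: "continuous_on ({0..} \<times> UNIV) (\<lambda>p. v (fst p) (snd p))"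
  unfolding v_def using foot_ge by (intro continuous_intros foot_cont) auto

lemma vt_cont: "continuous_on ({0..} \<times> UNIV) (\<lambda>p. vt (fst p) (snd p))"
proof -
  have m0: "m y (foot t y) \<noteq> 0" if "0 \<le> t" for t y using m_pos[OF foot_ge[OF that]] by (simp add: less_imp_neq[symmetric])
  have "continuous_on ({0..} \<times> UNIV) (\<lambda>p. m (snd p) (foot (fst p) (snd p)))"
    unfolding m_def using foot_ge by (intro continuous_intros foot_cont) auto
  then show ?thesis
    unfolding vt_def using foot_ge m0 by (intro continuous_intros foot_cont) auto
qed

lemma vy_cont: "continuous_on ({0..} \<times> UNIV) (\<lambda>p. vy (fst p) (snd p))"
  unfolding vy_def by (intro continuous_intros v_cont vt_cont)

text \<open>The map \<open>S\<close> sends (y, foot) to (time, y); its inverse \<open>g\<close> is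
  already known and continuous, and the derivative of \<open>S\<close> is invertible because
  \<open>m\<close> is nonzero. The elementary rule for derivatives of inverses therefore applies,
  and composition with the value map gives both partial derivatives.\<close>

lemma v_has_derivative:
  assumes t: "0 < t"
  shows "((\<lambda>p. v (fst p) (snd p)) has_derivative (\<lambda>h. vt t y * fst h + vy t y * snd h)) (at (t, y))"
proof -
  define p where "p = foot t y"
  define B where "B = b (flow (p - y) (u0 p))"
  have yp: "y < p" using foot_gt[OF t] by (simp add: p_def)
  have m0: "m y p \<noteq> 0" using m_pos[of y p] yp by simp
  define g where "g z = (snd z, foot (fst z) (snd z))" for z :: "real \<times> real"
  define S where "S z = (T (fst z) (snd z), fst z)" for z :: "real \<times> real"
  have op: "open ({0<..} \<times> UNIV :: (real \<times> real) set)" by (intro open_Times) auto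
  have gc: "continuous_on ({0<..} \<times> UNIV) g"
    unfolding g_def by (intro continuous_intros continuous_on_subset[OF foot_cont]) auto
  have gy: "g (t, y) = (y, p)" by (simp add: g_def p_def)
  have "(g has_derivative (\<lambda>h. (snd h, (fst h + B * snd h) / m y p))) (at (t, y))"
  proof (rule has_derivative_inverse_basic[of S _ g, OF _ _ _ _ op])
    show "(S has_derivative (\<lambda>k. (- B * fst k + m y p * snd k, fst k))) (at (g (t, y)))"
      unfolding gy S_def B_def
      by (intro has_derivative_Pair T_has_derivative[OF yp] has_derivative_fst has_derivative_ident)
    show "bounded_linear (\<lambda>h. (snd h, (fst h + B * snd h) / m y p))"
      by (intro bounded_linear_Pair bounded_linear_snd bounded_linear_compose[OF bounded_linear_divide]
           bounded_linear_add bounded_linear_fst bounded_linear_const_mult)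
    show "(\<lambda>h. (snd h, (fst h + B * snd h) / m y p)) \<circ> (\<lambda>k. (- B * fst k + m y p * snd k, fst k)) = id"
      using m0 by (auto simp: fun_eq_iff)
    show "continuous (at (t, y)) g"
      using gc t op by (simp add: continuous_on_eq_continuous_at)
    show "(t, y) \<in> {0<..} \<times> UNIV" using t by simp
    show "S (g z) = z" if "z \<in> {0<..} \<times> UNIV" for z
      using that by (auto simp: S_def g_def T_foot)
  qed
  from has_derivative_compose[OF this, unfolded gy, OF W_has_derivative[OF yp]]
  have "((\<lambda>z. v (fst z) (snd z)) has_derivative
     (\<lambda>h. - G (v t y) * snd h + J (p - y) (u0 p) * q p * ((fst h + B * snd h) / m y p))) (at (t, y))"
    by (simp add: g_def v_def p_def)
  then show ?thesis
    by (rule has_derivative_eq_rhs)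
       (use m0 in \<open>simp add: fun_eq_iff vt_def vy_def B_def p_def[symmetric] v_def field_simps\<close>)
qed

definition C2 :: real where
  "C2 = C * ((1 + L) + 2 * b1 / b0 * (1 + L))"

text \<open>Both differences carry a factor \<open>J\<close> evaluated in the tube at the foot: for
  the value by the mean value theorem over all data allowed there, started against the profile orbit
  itself; for the derivative through J q / m with the lower bound on \<open>m\<close>.\<close>

lemma v_estimate:
  assumes t: "0 \<le> t"
  shows "\<bar>v t y - U y\<bar> + \<bar>vy t y + G (U y)\<bar> \<le> C2 * \<Omega> y * (decay \<mu> y (foot t y) * (D (foot t y) / \<Omega> (foot t y)))"
proof -
  define p where "p = foot t y"
  define r where "r = p - y"
  have r: "0 \<le> r" "y \<le> p" using foot_ge[OF t] by (auto simp: r_def p_def)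
  have yr: "p - r = y" by (simp add: r_def)
  define A where "A = C * \<Omega> y * decay \<mu> y p * (D p / \<Omega> p)"
  have A0: "0 \<le> A" using C_ge1 \<Omega>_pos[of y] \<Omega>_pos[of p] decay_bounds(1)[of y p] D_bounds[of p] by (simp add: A_def)
  have "norm (flow r (u0 p) - flow r (U p)) \<le> (C * \<Omega> y * decay \<mu> y p / \<Omega> p) * norm (u0 p - U p)"
  proof (rule field_differentiable_bound[of "cball (U p) (\<delta> * \<Omega> p)" _ "J r"])
    fix w assume "w \<in> cball (U p) (\<delta> * \<Omega> p)"
    then have "J r w * \<Omega> p \<le> C * \<Omega> y * decay \<mu> y p"
      using J_weighted[OF r(1), of w p] by (simp add: yr dist_real_def abs_minus_commute)
    then show "norm (J r w) \<le> C * \<Omega> y * decay \<mu> y p / \<Omega> p"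
      using \<Omega>_pos[of p] J_pos[of r w] by (simp add: pos_le_divide_eq)
    show "(flow r has_field_derivative J r w) (at w within cball (U p) (\<delta> * \<Omega> p))"
      using flow_deriv_state[OF r(1)] by (rule has_field_derivative_at_within)
  qed (use u0_in_tube[of p] \<epsilon> \<Omega>_pos[of p] in \<open>auto simp: dist_real_def abs_minus_commute\<close>)
  also have "\<dots> \<le> (C * \<Omega> y * decay \<mu> y p / \<Omega> p) * D p"
    using C_ge1 \<Omega>_pos[of y] \<Omega>_pos[of p] decay_bounds(1)[of y p] by (intro mult_left_mono) (auto simp: D_def)
  finally have 1: "\<bar>v t y - U y\<bar> \<le> A"
    using flow_U[OF r(1), of p] by (simp add: v_def p_def[symmetric] r_def[symmetric] yr A_def)
  have "\<bar>J r (u0 p) * q p\<bar> \<le> (1 + L) * A"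
    using Z_bound[OF r(1), of p] by (simp add: yr A_def mult_ac)
  then have "\<bar>J r (u0 p) * q p\<bar> / m y p \<le> (1 + L) * A / (b0 / 2)"
    using m_lower[OF r(2)] b0_pos A0 L_pos by (intro frac_le) auto
  then have 2: "\<bar>vt t y\<bar> \<le> 2 / b0 * (1 + L) * A"
    using m_pos[OF r(2)] by (simp add: vt_def p_def[symmetric] r_def[symmetric] mult_ac)
  have "\<bar>vy t y + G (U y)\<bar> \<le> \<bar>G (v t y) - G (U y)\<bar> + \<bar>b (v t y)\<bar> * \<bar>vt t y\<bar>"
    unfolding vy_def abs_mult[symmetric] by linarith
  also have "\<dots> \<le> L * A + b1 * (2 / b0 * (1 + L) * A)"
  proof (intro add_mono mult_mono 2)
    show "\<bar>G (v t y) - G (U y)\<bar> \<le> L * A"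
      using G_lipschitz 1 L_pos by (meson mult_left_mono less_imp_le order_trans)
    show "\<bar>b (v t y)\<bar> \<le> b1" using b_bounds[of "v t y"] b0_pos by simp
  qed (use b1_pos in auto)
  finally have "\<bar>v t y - U y\<bar> + \<bar>vy t y + G (U y)\<bar> \<le> A + (L * A + b1 * (2 / b0 * (1 + L) * A))"
    using 1 by linarith
  also have "\<dots> = ((1 + L) + 2 * b1 / b0 * (1 + L)) * A"
    by (simp add: algebra_simps)
  also have "\<dots> = C2 * \<Omega> y * (decay \<mu> y p * (D p / \<Omega> p))"
    by (simp add: C2_def A_def mult_ac)
  finally show ?thesis by (simp add: p_def)
qed

text \<open>In time \<open>t\<close> a characteristic covers at least the distance t / b1. If its
  foot is left of t / (2 b1), at least half of this distance is spent in the negative half-line,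
  which produces the damping.\<close>

lemma foot_dichotomy:
  assumes t: "0 \<le> t"
  shows "t / (2 * b1) \<le> foot t y \<or> decay \<mu> y (foot t y) \<le> exp (- (\<mu> / (2 * b1)) * t)"
proof (rule disjCI)
  define p where "p = foot t y"
  assume n': "\<not> decay \<mu> y (foot t y) \<le> exp (- (\<mu> / (2 * b1)) * t)"
  show "t / (2 * b1) \<le> foot t y"
  proof (rule ccontr)
    assume n: "\<not> t / (2 * b1) \<le> foot t y"
    have e: "t / b1 = 2 * (t / (2 * b1))" by simp
    have t0: "0 \<le> t / (2 * b1)" using t b1_pos by simp
    have y: "y < - (t / (2 * b1))" using foot_time[OF t, of y] n e by linarith
    have "t / (2 * b1) \<le> min p 0 - min y 0"
      using foot_time[OF t, of y] y t0 e unfolding p_def by linarith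
    then have "\<mu> * (t / (2 * b1)) \<le> \<mu> * (min p 0 - min y 0)" using \<mu>_pos by (intro mult_left_mono) auto
    then show False using n' by (simp add: decay_def p_def)
  qed
qed

end

section \<open>Smooth solutions are entropy solutions\<close>

text \<open>A C^1 function is carried as a triple with its partial derivatives, so chain and product
  rules become closure properties and the integrands below can name the derivatives.\<close>

definition half_plane_C1 ::
  "(real \<times> real \<Rightarrow> real) \<Rightarrow> (real \<times> real \<Rightarrow> real) \<Rightarrow> (real \<times> real \<Rightarrow> real) \<Rightarrow> bool" where
  "half_plane_C1 A At Ax \<longleftrightarrow>
     (\<forall>p\<in>{0<..} \<times> UNIV. (A has_derivative (\<lambda>h. At p * fst h + Ax p * snd h)) (at p)) \<and>
     continuous_on ({0<..} \<times> UNIV) At \<and> continuous_on ({0<..} \<times> UNIV) Ax"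

text \<open>The partial derivatives are required to vanish outside \<open>K\<close> as well, so
  integrability is reduced to continuity on \<open>K\<close>. For a test function this vanishing is
  automatic.\<close>

definition compact_C1 ::
  "(real \<times> real) set \<Rightarrow> (real \<times> real \<Rightarrow> real) \<Rightarrow> (real \<times> real \<Rightarrow> real) \<Rightarrow> (real \<times> real \<Rightarrow> real) \<Rightarrow> bool" where
  "compact_C1 K F Ft Fx \<longleftrightarrow>
     compact K \<and> K \<subseteq> {0<..} \<times> UNIV \<and> (\<forall>p. p \<notin> K \<longrightarrow> F p = 0 \<and> Ft p = 0 \<and> Fx p = 0) \<and>
     (\<forall>p. (F has_derivative (\<lambda>h. Ft p * fst h + Fx p * snd h)) (at p)) \<and>
     continuous_on UNIV Ft \<and> continuous_on UNIV Fx"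

lemma open_half_plane: "open ({0<..} \<times> UNIV :: (real \<times> real) set)"
  by (intro open_Times) auto

lemma half_plane_C1D:
  assumes "half_plane_C1 A At Ax" "p \<in> {0<..} \<times> UNIV"
  shows "(A has_derivative (\<lambda>h. At p * fst h + Ax p * snd h)) (at p)"
  using assms unfolding half_plane_C1_def by blast

lemma half_plane_C1_cont:
  assumes "half_plane_C1 A At Ax"
  shows "continuous_on ({0<..} \<times> UNIV) A"
proof (rule continuous_at_imp_continuous_on, rule ballI)
  fix p :: "real \<times> real" assume "p \<in> {0<..} \<times> UNIV"
  then show "isCont A p"
    using assms unfolding half_plane_C1_def by (meson has_derivative_continuous)
qed

lemma half_plane_C1_comp:
  assumes A: "half_plane_C1 A At Ax"
    and h: "\<And>z. (h has_real_derivative h' z) (at z)" "continuous_on UNIV h'"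
  shows "half_plane_C1 (\<lambda>p. h (A p)) (\<lambda>p. h' (A p) * At p) (\<lambda>p. h' (A p) * Ax p)"
  unfolding half_plane_C1_def
proof (intro conjI ballI)
  fix p :: "real \<times> real" assume "p \<in> {0<..} \<times> UNIV"
  then have "(A has_derivative (\<lambda>k. At p * fst k + Ax p * snd k)) (at p)"
    by (rule half_plane_C1D[OF A])
  from has_derivative_compose[OF this h(1)[unfolded has_field_derivative_def]]
  show "((\<lambda>p. h (A p)) has_derivative (\<lambda>k. h' (A p) * At p * fst k + h' (A p) * Ax p * snd k)) (at p)"
    by (rule has_derivative_eq_rhs) (simp add: algebra_simps)
qed (use A half_plane_C1_cont[OF A] continuous_on_compose2[OF h(2), of "{0<..} \<times> UNIV" A] in
   \<open>auto simp: half_plane_C1_def intro!: continuous_intros\<close>)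

lemma half_plane_C1_mult:
  assumes A: "half_plane_C1 A At Ax" and B: "half_plane_C1 B Bt Bx"
  shows "half_plane_C1 (\<lambda>p. A p * B p) (\<lambda>p. At p * B p + A p * Bt p) (\<lambda>p. Ax p * B p + A p * Bx p)"
  unfolding half_plane_C1_def
proof (intro conjI ballI)
  fix p :: "real \<times> real" assume p: "p \<in> {0<..} \<times> UNIV"
  show "((\<lambda>p. A p * B p) has_derivative
     (\<lambda>k. (At p * B p + A p * Bt p) * fst k + (Ax p * B p + A p * Bx p) * snd k)) (at p)"
    by (rule has_derivative_eq_rhs[OF has_derivative_mult[OF half_plane_C1D[OF A p] half_plane_C1D[OF B p]]])
       (auto simp: algebra_simps)
qed (use A B half_plane_C1_cont[OF A] half_plane_C1_cont[OF B] in
   \<open>auto simp: half_plane_C1_def intro!: continuous_intros\<close>)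

lemma half_plane_C1_const: "half_plane_C1 (\<lambda>_. c) (\<lambda>_. 0) (\<lambda>_. 0)"
  by (simp add: half_plane_C1_def)

lemma half_plane_C1_add:
  assumes A: "half_plane_C1 A At Ax" and B: "half_plane_C1 B Bt Bx"
  shows "half_plane_C1 (\<lambda>p. A p + B p) (\<lambda>p. At p + Bt p) (\<lambda>p. Ax p + Bx p)"
  unfolding half_plane_C1_def
proof (intro conjI ballI)
  fix p :: "real \<times> real" assume p: "p \<in> {0<..} \<times> UNIV"
  show "((\<lambda>p. A p + B p) has_derivative (\<lambda>k. (At p + Bt p) * fst k + (Ax p + Bx p) * snd k)) (at p)"
    by (rule has_derivative_eq_rhs[OF has_derivative_add[OF half_plane_C1D[OF A p] half_plane_C1D[OF B p]]])
       (auto simp: algebra_simps)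
qed (use A B in \<open>auto simp: half_plane_C1_def intro!: continuous_intros\<close>)

lemma compact_C1_imp_half_plane: "compact_C1 K F Ft Fx \<Longrightarrow> half_plane_C1 F Ft Fx"
  unfolding compact_C1_def half_plane_C1_def by (auto intro: continuous_on_subset)

lemma zero_off_open_imp_derivative_zero:
  fixes F :: "real \<times> real \<Rightarrow> real"
  assumes "(F has_derivative (\<lambda>h. a * fst h + c * snd h)) (at p)" "open S" "p \<in> S" "\<And>z. z \<in> S \<Longrightarrow> F z = 0"
  shows "a = 0 \<and> c = 0"
proof -
  have "(F has_derivative (\<lambda>h. 0)) (at p)"
    by (rule has_derivative_transform_within_open[OF has_derivative_const[of 0] assms(2,3)]) (use assms(4) in auto)
  from has_derivative_unique[OF assms(1) this] have *: "\<And>h. a * fst h + c * snd h = 0" by meson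
  show ?thesis using *[of "(1, 0)"] *[of "(0, 1)"] by simp
qed

lemma test_function_compact_C1:
  assumes "test_function \<phi> \<phi>t \<phi>x"
  obtains K where "compact_C1 K \<phi> \<phi>t \<phi>x"
proof -
  obtain K where K: "compact K" "K \<subseteq> {0<..} \<times> UNIV" "\<And>p. p \<notin> K \<Longrightarrow> \<phi> p = 0"
    using assms unfolding test_function_def by blast
  have der: "\<And>p. (\<phi> has_derivative (\<lambda>h. \<phi>t p * fst h + \<phi>x p * snd h)) (at p)"
    using assms unfolding test_function_def by blast
  have "\<phi>t p = 0 \<and> \<phi>x p = 0" if "p \<notin> K" for p
    by (rule zero_off_open_imp_derivative_zero[OF der, of "- K"])
       (use K that compact_imp_closed in \<open>auto simp: closed_def\<close>)
  then have "compact_C1 K \<phi> \<phi>t \<phi>x"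
    using K der assms unfolding compact_C1_def test_function_def by blast
  then show ?thesis by (rule that)
qed

lemma compact_C1_test_function:
  assumes "compact_C1 K \<phi> \<phi>t \<phi>x" "\<And>p. 0 \<le> \<phi> p"
  shows "test_function \<phi> \<phi>t \<phi>x"
  using assms unfolding compact_C1_def test_function_def by blast

lemma continuous_zero_off_compact:
  fixes h :: "real \<times> real \<Rightarrow> real"
  assumes "compact K" "K \<subseteq> {0<..} \<times> UNIV" "continuous_on ({0<..} \<times> UNIV) h" "\<And>p. p \<notin> K \<Longrightarrow> h p = 0"
  shows "continuous_on UNIV h"
proof -
  have "continuous_on (- K) h"
    by (rule continuous_on_eq[OF continuous_on_const[of _ 0]]) (use assms(4) in auto)
  moreover have "open (- K)" using assms(1) compact_imp_closed by blast
  ultimately have "continuous_on ({0<..} \<times> UNIV \<union> - K) h"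
    using assms(3) by (intro continuous_on_open_Un open_half_plane) auto
  moreover have "{0<..} \<times> UNIV \<union> - K = UNIV" using assms(2) by blast
  ultimately show ?thesis by simp
qed

lemma compact_C1_mult:
  assumes A: "half_plane_C1 A At Ax" and F: "compact_C1 K F Ft Fx"
  shows "compact_C1 K (\<lambda>p. A p * F p) (\<lambda>p. At p * F p + A p * Ft p) (\<lambda>p. Ax p * F p + A p * Fx p)"
proof -
  have K: "compact K" "K \<subseteq> {0<..} \<times> UNIV" and z: "\<And>p. p \<notin> K \<Longrightarrow> F p = 0 \<and> Ft p = 0 \<and> Fx p = 0"
    using F unfolding compact_C1_def by blast+
  note AF = half_plane_C1_mult[OF A compact_C1_imp_half_plane[OF F]]
  have "((\<lambda>p. A p * F p) has_derivative (\<lambda>k. (At p * F p + A p * Ft p) * fst k + (Ax p * F p + A p * Fx p) * snd k)) (at p)" for p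
  proof (cases "p \<in> K")
    case True
    then show ?thesis using AF K(2) unfolding half_plane_C1_def by blast
  next
    case False
    have "((\<lambda>p. A p * F p) has_derivative (\<lambda>h. 0)) (at p)"
      by (rule has_derivative_transform_within_open[OF has_derivative_const[of 0], of "- K"])
         (use K z False compact_imp_closed in \<open>auto simp: closed_def\<close>)
    then show ?thesis using z[OF False] by simp
  qed
  moreover have "continuous_on UNIV (\<lambda>p. At p * F p + A p * Ft p)" "continuous_on UNIV (\<lambda>p. Ax p * F p + A p * Fx p)"
    using AF z unfolding half_plane_C1_def by (auto intro!: continuous_zero_off_compact[OF K])
  ultimately show ?thesis using K z unfolding compact_C1_def by simp
qed

section \<open>Integration by parts with compact support\<close>

lemma integrable_continuous_on_compact:
  fixes h :: "real \<times> real \<Rightarrow> real"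
  assumes "compact K" "continuous_on K h" "\<And>p. p \<notin> K \<Longrightarrow> h p = 0"
  shows "integrable lborel h"
proof -
  have "integrable lborel (\<lambda>p. indicator K p *\<^sub>R h p)" by (rule borel_integrable_compact[OF assms(1,2)])
  moreover have "(\<lambda>p. indicator K p *\<^sub>R h p) = h" using assms(3) by (auto simp: indicator_def fun_eq_iff)
  ultimately show ?thesis by simp
qed

lemma integral_deriv_compact_support:
  fixes F F' :: "real \<Rightarrow> real"
  assumes "\<And>t. (F has_real_derivative F' t) (at t)" "continuous_on UNIV F'"
    and "0 \<le> R" "\<And>t. R < \<bar>t\<bar> \<Longrightarrow> F t = 0 \<and> F' t = 0"
  shows "(LINT t|lborel. F' t) = 0"
proof -
  define a where "a = R + 1"
  have "(\<integral>t. F' t * indicator {-a..a} t \<partial>lborel) = F a - F (-a)"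
    using assms by (intro integral_FTC_Icc_real) (auto simp: a_def continuous_on_eq_continuous_at)
  moreover have "F' t * indicator {-a..a} t = F' t" for t
    using assms(4)[of t] by (cases "R < \<bar>t\<bar>") (auto simp: indicator_def a_def)
  moreover have "F a = 0" "F (-a) = 0" using assms(3,4) by (auto simp: a_def)
  ultimately show ?thesis by simp
qed

lemma compact_C1_integral:
  assumes F: "compact_C1 K F Ft Fx"
  shows "integrable lborel Ft" "integrable lborel Fx"
    "(LINT p|lborel. Ft p) = 0" "(LINT p|lborel. Fx p) = 0"
proof -
  have K: "compact K" and z: "\<And>p. p \<notin> K \<Longrightarrow> F p = 0 \<and> Ft p = 0 \<and> Fx p = 0"
    and der: "\<And>p. (F has_derivative (\<lambda>h. Ft p * fst h + Fx p * snd h)) (at p)"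
    and c: "continuous_on UNIV Ft" "continuous_on UNIV Fx"
    using F unfolding compact_C1_def by blast+
  show i: "integrable lborel Ft" "integrable lborel Fx"
    using z c by (auto intro!: integrable_continuous_on_compact[OF K] intro: continuous_on_subset)
  obtain R0 where R0: "\<And>p. p \<in> K \<Longrightarrow> norm p \<le> R0"
    using compact_imp_bounded[OF K] unfolding bounded_iff by blast
  define R where "R = \<bar>R0\<bar>"
  have R: "p \<notin> K" if "R < \<bar>fst p\<bar> \<or> R < \<bar>snd p\<bar>" for p
  proof
    assume "p \<in> K"
    moreover have "\<bar>fst p\<bar> \<le> norm p" "\<bar>snd p\<bar> \<le> norm p"
      using norm_fst_le[of "fst p" "snd p"] norm_snd_le[of "snd p" "fst p"] by auto
    ultimately show False using R0[of p] that by (auto simp: R_def)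
  qed
  have dt: "((\<lambda>t. F (t, x)) has_real_derivative Ft (t, x)) (at t)" for t x
  proof -
    have "((\<lambda>t. (t, x)) has_derivative (\<lambda>h. (h, 0))) (at t)" by (auto intro!: derivative_eq_intros)
    from has_derivative_compose[OF this der] show ?thesis
      by (simp add: has_field_derivative_def)
  qed
  have dx: "((\<lambda>x. F (t, x)) has_real_derivative Fx (t, x)) (at x)" for t x
  proof -
    have "((\<lambda>x. (t, x)) has_derivative (\<lambda>h. (0, h))) (at x)" by (auto intro!: derivative_eq_intros)
    from has_derivative_compose[OF this der] show ?thesis
      by (simp add: has_field_derivative_def)
  qed
  have ct: "continuous_on UNIV (\<lambda>t. Ft (t, x))" for x
    by (intro continuous_on_compose2[OF c(1)] continuous_intros) auto
  have cx: "continuous_on UNIV (\<lambda>x. Fx (t, x))" for t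
    by (intro continuous_on_compose2[OF c(2)] continuous_intros) auto
  have t0: "(LINT t|lborel. Ft (t, x)) = 0" for x
    by (rule integral_deriv_compact_support[OF dt ct, of "\<bar>R\<bar>"]) (use R z in \<open>auto simp: R_def\<close>)
  have x0: "(LINT x|lborel. Fx (t, x)) = 0" for t
    by (rule integral_deriv_compact_support[OF dx cx, of "\<bar>R\<bar>"]) (use R z in \<open>auto simp: R_def\<close>)
  have "(LINT x|lborel. (LINT t|lborel. Ft (t, x))) = (LINT p|(lborel \<Otimes>\<^sub>M lborel). (case p of (t, x) \<Rightarrow> Ft (t, x)))"
    by (rule lborel_pair.integral_snd) (use i in \<open>simp add: lborel_prod\<close>)
  then show "(LINT p|lborel. Ft p) = 0" by (simp add: t0 lborel_prod)
  have "(LINT t|lborel. (LINT x|lborel. Fx (t, x))) = (LINT p|(lborel \<Otimes>\<^sub>M lborel). Fx p)"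
    by (rule lborel_pair.integral_fst') (use i in \<open>simp add: lborel_prod\<close>)
  then show "(LINT p|lborel. Fx p) = 0" by (simp add: x0 lborel_prod)
qed

lemma half_plane_C1_divergence:
  assumes A: "half_plane_C1 A At Ax" and F: "compact_C1 K F Ft Fx"
  shows "integrable lborel (\<lambda>p. At p * F p + A p * Ft p)" "(LINT p|lborel. At p * F p + A p * Ft p) = 0"
    "integrable lborel (\<lambda>p. Ax p * F p + A p * Fx p)" "(LINT p|lborel. Ax p * F p + A p * Fx p) = 0"
  using compact_C1_integral[OF compact_C1_mult[OF A F]] by auto

lemma set_integral_half_plane:
  fixes h :: "real \<Rightarrow> real \<Rightarrow> real"
  assumes "K \<subseteq> {0<..} \<times> UNIV" "\<And>t x. (t, x) \<notin> K \<Longrightarrow> h t x = 0"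
  shows "(LINT (t, x):{0..} \<times> UNIV|lborel. h t x) = (LINT p|lborel. h (fst p) (snd p))"
  unfolding set_lebesgue_integral_def
proof (rule Bochner_Integration.integral_cong[OF refl])
  fix p :: "real \<times> real"
  show "indicator ({0..} \<times> UNIV) p *\<^sub>R (case p of (t, x) \<Rightarrow> h t x) = h (fst p) (snd p)"
    using assms by (cases p; cases "p \<in> K") (auto simp: indicator_def)
qed

lemma C1_locally_lipschitz:
  fixes f f' :: "real \<Rightarrow> real"
  assumes "\<And>z. (f has_real_derivative f' z) (at z)" "continuous_on UNIV f'"
  obtains C where "0 \<le> C" "\<And>x y. \<bar>x\<bar> \<le> B \<Longrightarrow> \<bar>y\<bar> \<le> B \<Longrightarrow> \<bar>f x - f y\<bar> \<le> C * \<bar>x - y\<bar>"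
proof -
  have "bounded (f' ` {-B..B})"
    by (intro compact_imp_bounded compact_continuous_image continuous_on_subset[OF assms(2)]) auto
  then obtain C where "\<forall>x\<in>f' ` {-B..B}. norm x \<le> C" unfolding bounded_iff by blast
  have C: "\<bar>f' z\<bar> \<le> \<bar>C\<bar>" if "\<bar>z\<bar> \<le> B" for z
  proof -
    have "f' z \<in> f' ` {-B..B}" using that by (intro imageI) auto
    then have "norm (f' z) \<le> C" using \<open>\<forall>x\<in>f' ` {-B..B}. norm x \<le> C\<close> by blast
    then show ?thesis by simp
  qed
  have "norm (f x - f y) \<le> \<bar>C\<bar> * norm (x - y)" if "\<bar>x\<bar> \<le> B" "\<bar>y\<bar> \<le> B" for x y
    by (rule field_differentiable_bound[of "{-B..B}" f f'])
       (use C that assms(1) in \<open>auto intro: has_field_derivative_at_within\<close>)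
  then show ?thesis by (intro that[of "\<bar>C\<bar>"]) auto
qed

text \<open>The modulus is regularized to \<open>N n s = sqrt (s\<^sup>2 + (e n)\<^sup>2)\<close>,
  with derivative \<open>S n\<close>. The flux S (f(V) - f(k)) is not the exact flux for this
  entropy; the mismatch S' (f(V) - f(k)) V_x tends to 0 and stays bounded, since
  \<open>\<bar>S' n s\<bar> * \<bar>s\<bar> \<le> 1\<close> and \<open>f\<close> is Lipschitz on the
  relevant range. For a classical solution nothing is lost, so an equality results.\<close>

lemma classical_entropy_equality:
  assumes V: "half_plane_C1 V Vt Vx"
    and f: "\<And>z. (f has_real_derivative f' z) (at z)" "continuous_on UNIV f'" and g: "continuous_on UNIV g"
    and pde: "\<And>p. p \<in> {0<..} \<times> UNIV \<Longrightarrow> Vt p + f' (V p) * Vx p = g (V p)"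
    and F: "compact_C1 K \<phi> \<phi>t \<phi>x"
  shows "(LINT p|lborel. \<bar>V p - k\<bar> * \<phi>t p + sgn (V p - k) * (f (V p) - f k) * \<phi>x p
      + sgn (V p - k) * g (V p) * \<phi> p) = 0"
proof -
  define e where "e n = 1 / real (Suc n)" for n
  have e: "0 < e n" "e n \<le> 1" for n by (auto simp: e_def)
  define N where "N n s = sqrt (s\<^sup>2 + (e n)\<^sup>2)" for n s
  define S where "S n s = s / N n s" for n s
  define S' where "S' n s = (e n)\<^sup>2 / (N n s)^3" for n s
  have pos: "0 < s\<^sup>2 + (e n)\<^sup>2" for n s using e[of n] by (simp add: add_nonneg_pos)
  have Npos: "0 < N n s" for n s using pos by (simp add: N_def)
  have Nsq: "(N n s)\<^sup>2 = s\<^sup>2 + (e n)\<^sup>2" for n s using pos[of s n] by (simp add: N_def)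
  have Nder: "(N n has_real_derivative S n s) (at s)" for n s
    unfolding N_def[abs_def] S_def using pos[of s n]
    by (auto intro!: derivative_eq_intros simp: N_def field_simps)
  have Sder: "(S n has_real_derivative S' n s) (at s)" for n s
  proof -
    have "(S n has_real_derivative (1 * N n s - s * S n s) / (N n s * N n s)) (at s)"
      unfolding S_def[abs_def] using Npos[of n s] Nder
      by (intro DERIV_divide DERIV_ident) (auto simp: S_def[symmetric])
    moreover have "(1 * N n s - s * S n s) / (N n s * N n s) = S' n s"
    proof -
      have "1 * N n s - s * S n s = ((N n s)\<^sup>2 - s\<^sup>2) / N n s"
        using Npos[of n s] by (simp add: S_def field_simps power2_eq_square)
      also have "\<dots> = (e n)\<^sup>2 / N n s" by (simp add: Nsq)
      finally have "(1 * N n s - s * S n s) / (N n s * N n s) = (e n)\<^sup>2 / N n s / (N n s * N n s)" by (rule arg_cong)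
      then show ?thesis by (simp add: S'_def power3_eq_cube mult.assoc)
    qed
    ultimately show ?thesis by simp
  qed
  have Ncont: "continuous_on UNIV (N n)" for n unfolding N_def by (intro continuous_intros)
  have Scont: "continuous_on UNIV (S n)" for n unfolding S_def
    using Npos Ncont by (intro continuous_intros) (auto simp: less_imp_neq[symmetric])
  have S'cont: "continuous_on UNIV (S' n)" for n unfolding S'_def
    using Npos Ncont by (intro continuous_intros) (auto simp: less_imp_neq[symmetric])
  have sN: "\<bar>s\<bar> \<le> N n s" for n s unfolding N_def by (rule real_le_rsqrt) simp
  have eN: "e n \<le> N n s" for n s unfolding N_def by (rule real_le_rsqrt) simp
  have S1: "\<bar>S n s\<bar> \<le> 1" for n s using sN[of s n] Npos[of n s] by (simp add: S_def abs_div)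
  have N1: "\<bar>N n s\<bar> \<le> \<bar>s\<bar> + 1" for n s
  proof -
    have "N n s \<le> \<bar>s\<bar> + \<bar>e n\<bar>" unfolding N_def by (rule sqrt_sum_squares_le_sum_abs)
    then show ?thesis using e[of n] Npos[of n s] by simp
  qed
  have S'1: "\<bar>S' n s\<bar> * \<bar>s\<bar> \<le> 1" for n s
  proof -
    have "(e n)\<^sup>2 * \<bar>s\<bar> \<le> (N n s)\<^sup>2 * N n s"
      using e[of n] eN[of n s] sN[of s n] by (intro mult_mono power_mono) auto
    then have "(e n)\<^sup>2 * \<bar>s\<bar> \<le> (N n s)^3" by (simp add: power3_eq_cube power2_eq_square)
    then show ?thesis using Npos[of n s] by (simp add: S'_def)
  qed
  have K: "compact K" "K \<subseteq> {0<..} \<times> UNIV" and z: "\<And>p. p \<notin> K \<Longrightarrow> \<phi> p = 0 \<and> \<phi>t p = 0 \<and> \<phi>x p = 0"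
    and c\<phi>: "continuous_on UNIV \<phi>t" "continuous_on UNIV \<phi>x"
    using F unfolding compact_C1_def by blast+
  have c\<phi>0: "continuous_on UNIV \<phi>"
    using F unfolding compact_C1_def by (meson has_derivative_continuous continuous_at_imp_continuous_on)
  have fcont: "continuous_on UNIV f" using f(1) by (meson DERIV_isCont continuous_at_imp_continuous_on)
  have VK: "continuous_on K V" "continuous_on K Vx"
    using half_plane_C1_cont[OF V] V K(2) unfolding half_plane_C1_def by (auto intro: continuous_on_subset)
  have "bounded (V ` K)" by (intro compact_imp_bounded compact_continuous_image VK K)
  then obtain B0 where B0: "\<And>p. p \<in> K \<Longrightarrow> \<bar>V p\<bar> \<le> B0" unfolding bounded_iff by auto
  define B where "B = \<bar>B0\<bar> + \<bar>k\<bar>"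
  have B: "\<bar>V p\<bar> \<le> B" "\<bar>k\<bar> \<le> B" if "p \<in> K" for p using B0[OF that] by (auto simp: B_def)
  obtain C where C: "0 \<le> C" "\<And>x y. \<bar>x\<bar> \<le> B \<Longrightarrow> \<bar>y\<bar> \<le> B \<Longrightarrow> \<bar>f x - f y\<bar> \<le> C * \<bar>x - y\<bar>"
    using C1_locally_lipschitz[OF f, of B] by metis
  \<comment> \<open>The regularized integrand; its last term is the mismatch of the flux. By the
    equation it is the sum of a time and a space divergence, so its integral vanishes for each
    \<open>n\<close>.\<close>
  define s where "s n p = N n (V p - k) * \<phi>t p + S n (V p - k) * (f (V p) - f k) * \<phi>x p
     + S n (V p - k) * g (V p) * \<phi> p + S' n (V p - k) * (f (V p) - f k) * Vx p * \<phi> p" for n p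
  define h where "h p = \<bar>V p - k\<bar> * \<phi>t p + sgn (V p - k) * (f (V p) - f k) * \<phi>x p
      + sgn (V p - k) * g (V p) * \<phi> p" for p
  define w where "w p = (\<bar>V p - k\<bar> + 1) * \<bar>\<phi>t p\<bar> + \<bar>f (V p) - f k\<bar> * \<bar>\<phi>x p\<bar>
     + \<bar>g (V p)\<bar> * \<bar>\<phi> p\<bar> + C * \<bar>Vx p\<bar> * \<bar>\<phi> p\<bar>" for p
  note cc = VK continuous_on_subset[OF c\<phi>(1)] continuous_on_subset[OF c\<phi>(2)] continuous_on_subset[OF c\<phi>0]
    continuous_on_compose2[OF fcont] continuous_on_compose2[OF g] continuous_on_compose2[OF Ncont]
    continuous_on_compose2[OF Scont] continuous_on_compose2[OF S'cont]
  have sint: "integrable lborel (s n)" for n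
    unfolding s_def by (rule integrable_continuous_on_compact[OF K(1)]) (use z in \<open>auto intro!: continuous_intros cc\<close>)
  have wint: "integrable lborel w"
    unfolding w_def by (rule integrable_continuous_on_compact[OF K(1)]) (use z in \<open>auto intro!: continuous_intros cc\<close>)
  have s0: "(LINT p|lborel. s n p) = 0" for n
  proof -
    have Vk: "half_plane_C1 (\<lambda>p. V p - k) Vt Vx"
      using half_plane_C1_add[OF V half_plane_C1_const[of "- k"]] by simp
    have fk: "half_plane_C1 (\<lambda>p. f (V p) - f k) (\<lambda>p. f' (V p) * Vt p) (\<lambda>p. f' (V p) * Vx p)"
      using half_plane_C1_add[OF half_plane_C1_comp[OF V f] half_plane_C1_const[of "- f k"]] by simp
    note A = half_plane_C1_divergence[OF half_plane_C1_comp[OF Vk Nder[of n] Scont[of n]] F]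
    note Bx = half_plane_C1_divergence[OF half_plane_C1_mult[OF half_plane_C1_comp[OF Vk Sder[of n] S'cont[of n]] fk] F]
    have "s n p = (S n (V p - k) * Vt p * \<phi> p + N n (V p - k) * \<phi>t p) +
      ((S' n (V p - k) * Vx p * (f (V p) - f k) + S n (V p - k) * (f' (V p) * Vx p)) * \<phi> p +
        S n (V p - k) * (f (V p) - f k) * \<phi>x p)" for p
    proof (cases "p \<in> K")
      case True
      then have "p \<in> {0<..} \<times> UNIV" using K(2) by blast
      then have g: "g (V p) = Vt p + f' (V p) * Vx p" using pde[of p] by linarith
      show ?thesis unfolding s_def g by (simp only: distrib_left distrib_right mult_ac add_ac)
    qed (use z in \<open>simp add: s_def\<close>)
    then show ?thesis using A(1,2) Bx(3,4) by (simp add: Bochner_Integration.integral_add)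
  qed
  have e0: "e \<longlonglongrightarrow> 0" unfolding e_def by (rule LIMSEQ_inverse_real_of_nat[unfolded inverse_eq_divide])
  have Nlim: "(\<lambda>n. N n r) \<longlonglongrightarrow> \<bar>r\<bar>" for r
  proof -
    have "(\<lambda>n. sqrt (r\<^sup>2 + (e n)\<^sup>2)) \<longlonglongrightarrow> sqrt (r\<^sup>2 + 0\<^sup>2)" by (intro tendsto_intros e0)
    then show ?thesis by (simp add: N_def)
  qed
  have Slim: "(\<lambda>n. S n r) \<longlonglongrightarrow> sgn r" for r
  proof (cases "r = 0")
    case False
    then have "(\<lambda>n. r / N n r) \<longlonglongrightarrow> r / \<bar>r\<bar>" by (intro tendsto_intros Nlim) auto
    then show ?thesis using False by (simp add: S_def sgn_real_def abs_if split: if_splits)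
  qed (simp add: S_def)
  have S'lim: "(\<lambda>n. S' n r) \<longlonglongrightarrow> 0" if "r \<noteq> 0" for r
  proof -
    have "(\<lambda>n. (e n)\<^sup>2 / (N n r)^3) \<longlonglongrightarrow> 0\<^sup>2 / \<bar>r\<bar>^3" using that by (intro tendsto_intros Nlim e0) auto
    then show ?thesis by (simp add: S'_def)
  qed
  have lim: "(\<lambda>n. s n p) \<longlonglongrightarrow> h p" for p
  proof -
    \<comment> \<open>At \<open>V p = k\<close> the factor \<open>S' n 0 = 1 / e n\<close> is
      unbounded, but there \<open>f (V p) - f k\<close> is zero for every \<open>n\<close>.\<close>
    have "(\<lambda>n. S' n (V p - k) * (f (V p) - f k)) \<longlonglongrightarrow> 0"
    proof (cases "V p = k")
      case False
      then show ?thesis using tendsto_mult[OF S'lim[of "V p - k"] tendsto_const[of "f (V p) - f k"]] by simp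
    qed simp
    then have "(\<lambda>n. s n p) \<longlonglongrightarrow> \<bar>V p - k\<bar> * \<phi>t p + sgn (V p - k) * (f (V p) - f k) * \<phi>x p
      + sgn (V p - k) * g (V p) * \<phi> p + 0 * Vx p * \<phi> p"
      unfolding s_def by (intro tendsto_intros Nlim Slim)
    then show ?thesis by (simp add: h_def)
  qed
  have dom: "\<bar>s n p\<bar> \<le> w p" for n p
  proof (cases "p \<in> K")
    case True
    have 1: "\<bar>N n (V p - k) * \<phi>t p\<bar> \<le> (\<bar>V p - k\<bar> + 1) * \<bar>\<phi>t p\<bar>"
      unfolding abs_mult by (intro mult_right_mono N1) auto
    have 2: "\<bar>S n (V p - k) * (f (V p) - f k) * \<phi>x p\<bar> \<le> \<bar>f (V p) - f k\<bar> * \<bar>\<phi>x p\<bar>"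
      unfolding abs_mult using S1[of n "V p - k"] by (intro mult_right_mono mult_left_le_one_le) auto
    have 3: "\<bar>S n (V p - k) * g (V p) * \<phi> p\<bar> \<le> \<bar>g (V p)\<bar> * \<bar>\<phi> p\<bar>"
      unfolding abs_mult using S1[of n "V p - k"] by (intro mult_right_mono mult_left_le_one_le) auto
    have "\<bar>S' n (V p - k)\<bar> * \<bar>f (V p) - f k\<bar> \<le> \<bar>S' n (V p - k)\<bar> * (C * \<bar>V p - k\<bar>)"
      using C(2) B[OF True] by (intro mult_left_mono) auto
    also have "\<dots> \<le> C" using mult_left_mono[OF S'1[of n "V p - k"] C(1)] by (simp add: mult_ac)
    finally have 4: "\<bar>S' n (V p - k) * (f (V p) - f k) * Vx p * \<phi> p\<bar> \<le> C * \<bar>Vx p\<bar> * \<bar>\<phi> p\<bar>"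
      unfolding abs_mult by (intro mult_right_mono) auto
    have "\<bar>a + b + c + d\<bar> \<le> A + B + C + D"
      if "\<bar>a\<bar> \<le> A" "\<bar>b\<bar> \<le> B" "\<bar>c\<bar> \<le> C" "\<bar>d\<bar> \<le> D" for a b c d A B C D :: real
      using that by linarith
    from this[OF 1 2 3 4] show ?thesis unfolding s_def w_def .
  qed (use z in \<open>simp add: s_def w_def\<close>)
  have "h \<in> borel_measurable lborel"
    by (rule borel_measurable_LIMSEQ_real[OF lim]) (use sint in auto)
  then have "(\<lambda>n. LINT p|lborel. s n p) \<longlonglongrightarrow> (LINT p|lborel. h p)"
    by (intro integral_dominated_convergence[where w=w] wint AE_I2 lim) (use sint dom in auto)
  then have "(\<lambda>n. 0) \<longlonglongrightarrow> (LINT p|lborel. h p)" using s0 by simp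
  then show ?thesis using LIMSEQ_unique[OF tendsto_const] unfolding h_def by fastforce
qed

lemma classical_imp_entropy_solution:
  fixes u :: "real \<Rightarrow> real \<Rightarrow> real"
  assumes V: "half_plane_C1 (\<lambda>p. u (fst p) (snd p)) Vt Vx"
    and f: "\<And>z. (f has_real_derivative f' z) (at z)" "continuous_on UNIV f'" and g: "continuous_on UNIV g"
    and pde: "\<And>p. p \<in> {0<..} \<times> UNIV \<Longrightarrow> Vt p + f' (u (fst p) (snd p)) * Vx p = g (u (fst p) (snd p))"
    and cont: "continuous_on ({0..} \<times> UNIV) (\<lambda>p. u (fst p) (snd p))"
    and bdd: "\<And>t x. 0 \<le> t \<Longrightarrow> \<bar>u t x\<bar> \<le> M"
    and lip: "\<And>s t x. 0 \<le> s \<Longrightarrow> 0 \<le> t \<Longrightarrow> \<bar>u s x - u t x\<bar> \<le> B * \<bar>s - t\<bar>"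
    and init: "\<And>x. u 0 x = u0 x"
  shows "entropy_solution f g u0 u"
  unfolding entropy_solution_def
proof (intro conjI allI impI)
  have cl: "closed ({0..} \<times> UNIV :: (real \<times> real) set)" by (intro closed_Times) auto
  show "set_borel_measurable borel ({0..} \<times> UNIV) (\<lambda>(t, x). u t x)"
    unfolding set_borel_measurable_def using cont cl
    by (intro borel_measurable_continuous_on_indicator) (auto simp: split_beta)
  show "\<exists>M. \<forall>t\<in>{0..T}. AE x in lborel. \<bar>u t x\<bar> \<le> M" for T using bdd by (intro exI[of _ M]) auto
  show "AE x in lborel. u 0 x = u0 x" using init by simp
  show "((\<lambda>s. LINT x:{-R..R}|lborel. \<bar>u s x - u t x\<bar>) \<longlongrightarrow> 0) (at t within {0..})" if t: "0 \<le> t" for t R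
  proof (rule Lim_null_comparison)
    have ux: "continuous_on A (\<lambda>x. u s x)" if "0 \<le> s" for s A
      using that continuous_on_compose2[OF cont continuous_on_Pair[OF continuous_on_const continuous_on_id], where s=A]
      by (simp add: image_subset_iff)
    have i: "set_integrable lborel {-R..R} (\<lambda>x. \<bar>u s x - u t x\<bar>)" if "0 \<le> s" for s
      using that t by (intro borel_integrable_atLeastAtMost' continuous_intros ux)
    have "norm (LINT x:{-R..R}|lborel. \<bar>u s x - u t x\<bar>) \<le> (B * \<bar>s - t\<bar>) * (2 * \<bar>R\<bar>)" if "0 \<le> s" for s
    proof -
      have "(LINT x:{-R..R}|lborel. \<bar>u s x - u t x\<bar>) \<le> (LINT x:{-R..R}|lborel. B * \<bar>s - t\<bar>)"
        using i[OF that] lip[OF that t] by (intro set_integral_mono) (auto simp: borel_integrable_atLeastAtMost')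
      also have "\<dots> = (B * \<bar>s - t\<bar>) * measure lborel {-R..R}"
        by (simp add: set_integral_const)
      also have "\<dots> \<le> (B * \<bar>s - t\<bar>) * (2 * \<bar>R\<bar>)"
        using order_trans[OF abs_ge_zero lip[OF that t, of 0]] by (intro mult_left_mono) (cases "0 \<le> R"; auto)
      finally show ?thesis
        by (simp add: set_lebesgue_integral_def Bochner_Integration.integral_nonneg)
    qed
    then show "\<forall>\<^sub>F s in at t within {0..}. norm (LINT x:{-R..R}|lborel. \<bar>u s x - u t x\<bar>) \<le> (B * \<bar>s - t\<bar>) * (2 * \<bar>R\<bar>)"
      by (simp add: eventually_at_filter)
    have "((\<lambda>s. (B * \<bar>s - t\<bar>) * (2 * \<bar>R\<bar>)) \<longlongrightarrow> (B * \<bar>t - t\<bar>) * (2 * \<bar>R\<bar>)) (at t within {0..})"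
      by (intro tendsto_intros)
    then show "((\<lambda>s. (B * \<bar>s - t\<bar>) * (2 * \<bar>R\<bar>)) \<longlongrightarrow> 0) (at t within {0..})" by simp
  qed
  fix k \<phi> \<phi>t \<phi>x assume "test_function \<phi> \<phi>t \<phi>x"
  then obtain K where F: "compact_C1 K \<phi> \<phi>t \<phi>x" by (rule test_function_compact_C1)
  have "(LINT (t, x):{0..} \<times> UNIV|lborel. \<bar>u t x - k\<bar> * \<phi>t (t, x)
                + sgn (u t x - k) * (f (u t x) - f k) * \<phi>x (t, x)
                + sgn (u t x - k) * g (u t x) * \<phi> (t, x)) = (LINT p|lborel. \<bar>u (fst p) (snd p) - k\<bar> * \<phi>t (fst p, snd p)
                + sgn (u (fst p) (snd p) - k) * (f (u (fst p) (snd p)) - f k) * \<phi>x (fst p, snd p)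
                + sgn (u (fst p) (snd p) - k) * g (u (fst p) (snd p)) * \<phi> (fst p, snd p))"
    by (rule set_integral_half_plane[of K]) (use F in \<open>auto simp: compact_C1_def\<close>)
  also have "\<dots> = 0" using classical_entropy_equality[OF V f g pde F, of k] by simp
  finally show "0 \<le> (LINT (t, x):{0..} \<times> UNIV|lborel. \<bar>u t x - k\<bar> * \<phi>t (t, x)
                + sgn (u t x - k) * (f (u t x) - f k) * \<phi>x (t, x)
                + sgn (u t x - k) * g (u t x) * \<phi> (t, x))" by simp
qed

section \<open>Weak-strong uniqueness\<close>

lemma compact_C1_I:
  assumes F: "half_plane_C1 F Ft Fx" and K: "compact K" "K \<subseteq> {0<..} \<times> UNIV"
    and z: "\<And>p. p \<notin> K \<Longrightarrow> F p = 0 \<and> Ft p = 0 \<and> Fx p = 0"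
  shows "compact_C1 K F Ft Fx"
proof -
  have "(F has_derivative (\<lambda>k. Ft p * fst k + Fx p * snd k)) (at p)" for p
  proof (cases "p \<in> K")
    case True
    then show ?thesis using F K(2) unfolding half_plane_C1_def by blast
  next
    case False
    have "(F has_derivative (\<lambda>h. 0)) (at p)"
      by (rule has_derivative_transform_within_open[OF has_derivative_const[of 0], of "- K"])
         (use K z False compact_imp_closed in \<open>auto simp: closed_def\<close>)
    then show ?thesis using z[OF False] by simp
  qed
  moreover have "continuous_on UNIV Ft" "continuous_on UNIV Fx"
    using F z unfolding half_plane_C1_def by (auto intro!: continuous_zero_off_compact[OF K])
  ultimately show ?thesis using K z unfolding compact_C1_def by simp
qed

lemma abs_mult_scaled_abs: "\<bar>a\<bar> * (C * \<bar>a\<bar>) = C * (a::real)\<^sup>2"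
  by (cases "0 \<le> a") (auto simp: power2_eq_square)

lemma compact_C1_cont: "compact_C1 K F Ft Fx \<Longrightarrow> continuous_on UNIV F"
  unfolding compact_C1_def by (meson has_derivative_continuous continuous_at_imp_continuous_on)

lemma first_order_remainder:
  fixes F f :: "real \<Rightarrow> real"
  assumes F: "\<And>z. (F has_real_derivative f z) (at z)"
    and C: "\<And>x y. \<bar>x\<bar> \<le> B \<Longrightarrow> \<bar>y\<bar> \<le> B \<Longrightarrow> \<bar>f x - f y\<bar> \<le> C * \<bar>x - y\<bar>" "0 \<le> C"
    and xy: "\<bar>x\<bar> \<le> B" "\<bar>y\<bar> \<le> B"
  shows "\<bar>F y - F x - f x * (y - x)\<bar> \<le> C * (y - x)\<^sup>2"
proof -
  obtain \<xi> where \<xi>: "\<bar>\<xi>\<bar> \<le> B" "\<bar>\<xi> - x\<bar> \<le> \<bar>y - x\<bar>" "F y - F x = (y - x) * f \<xi>"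
  proof (cases x y rule: linorder_cases)
    case less
    obtain z where "x < z" "z < y" "F y - F x = (y - x) * f z" using MVT2[OF less F] by blast
    then show ?thesis using xy by (intro that[of z]) auto
  next
    case greater
    obtain z where "y < z" "z < x" "F x - F y = (x - y) * f z" using MVT2[OF greater F] by blast
    then show ?thesis using xy by (intro that[of z]) (auto simp: algebra_simps)
  qed (use xy in \<open>auto intro: that[of x]\<close>)
  have "\<bar>f \<xi> - f x\<bar> \<le> C * \<bar>\<xi> - x\<bar>" by (rule C(1)[OF \<xi>(1) xy(1)])
  also have "\<dots> \<le> C * \<bar>y - x\<bar>" by (rule mult_left_mono[OF \<xi>(2) C(2)])
  finally have "\<bar>y - x\<bar> * \<bar>f \<xi> - f x\<bar> \<le> \<bar>y - x\<bar> * (C * \<bar>y - x\<bar>)" by (rule mult_left_mono) simp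
  moreover have "F y - F x - f x * (y - x) = (y - x) * (f \<xi> - f x)" using \<xi>(3) by (simp add: algebra_simps)
  ultimately show ?thesis by (simp add: abs_mult abs_mult_scaled_abs)
qed

text \<open>The sign jumps once, at \<open>k = a\<close>, so the primitive \<open>H\<close> enters
  with opposite signs on the two sides; the values at \<open>M\<close> and \<open>- M\<close> do not
  depend on \<open>a\<close>.\<close>

lemma integral_sgn_kernel:
  fixes H h :: "real \<Rightarrow> real"
  assumes H: "\<And>k. (H has_real_derivative h k) (at k)" "continuous_on UNIV h" and a: "\<bar>a\<bar> \<le> M"
  shows "(LINT k|lborel. indicator {-M..M} k * (sgn (a - k) * h k)) = 2 * H a - H M - H (- M)"
proof -
  have 1: "(LINT k|lborel. h k * indicator {-M..a} k) = H a - H (-M)"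
    using a H by (intro integral_FTC_Icc_real) (auto simp: continuous_on_eq_continuous_at)
  have 2: "(LINT k|lborel. h k * indicator {a..M} k) = H M - H a"
    using a H by (intro integral_FTC_Icc_real) (auto simp: continuous_on_eq_continuous_at)
  have i: "integrable lborel (\<lambda>k. h k * indicator {l..r} k)" for l r
    using borel_integrable_atLeastAtMost'[of l r h] continuous_on_subset[OF H(2)]
    by (simp add: set_integrable_def mult.commute)
  have [measurable]: "h \<in> borel_measurable borel" using H(2) by (rule borel_measurable_continuous_onI)
  have "(LINT k|lborel. indicator {-M..M} k * (sgn (a - k) * h k)) =
      (LINT k|lborel. h k * indicator {-M..a} k - h k * indicator {a..M} k)"
  proof (rule integral_cong_AE)
    show "AE k in lborel. indicator {-M..M} k * (sgn (a - k) * h k) = h k * indicator {-M..a} k - h k * indicator {a..M} k"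
    proof (rule AE_mp[OF AE_lborel_singleton[of a]], rule AE_I2, rule impI)
      fix k assume "k \<noteq> a"
      then show "indicator {-M..M} k * (sgn (a - k) * h k) = h k * indicator {-M..a} k - h k * indicator {a..M} k"
        using a by (auto simp: indicator_def sgn_real_def)
    qed
  qed measurable
  also have "\<dots> = (H a - H (-M)) - (H M - H a)" using i 1 2 by simp
  finally show ?thesis by simp
qed

lemma integrable_bounded_compact:
  fixes h :: "'a::euclidean_space \<Rightarrow> real"
  assumes [measurable]: "h \<in> borel_measurable borel" and "compact K"
    and "\<And>p. p \<in> K \<Longrightarrow> \<bar>h p\<bar> \<le> B" "\<And>p. p \<notin> K \<Longrightarrow> h p = 0"
  shows "integrable lborel h"
proof (rule Bochner_Integration.integrable_bound)
  show "integrable lborel (\<lambda>p. indicator K p *\<^sub>R B)"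
    by (rule borel_integrable_compact[OF assms(2)]) auto
  show "AE p in lborel. norm (h p) \<le> norm (indicator K p *\<^sub>R B)"
    using assms(3,4) by (intro AE_I2) (force simp: indicator_def)
qed simp

section \<open>Quadratic splines for bumps and cutoffs\<close>

definition ramp2 :: "real \<Rightarrow> real" where
  "ramp2 r = (max r 0)\<^sup>2"

lemma ramp2_deriv: "(ramp2 has_real_derivative 2 * max r 0) (at r)"
proof (cases r "0::real" rule: linorder_cases)
  case less
  have "((\<lambda>_. 0) has_real_derivative 2 * max r 0) (at r)" using less by simp
  then show ?thesis
    by (rule has_field_derivative_transform_within_open[of _ _ _ "{..<0}"])
       (use less in \<open>auto simp: ramp2_def\<close>)
next
  case greater
  have "((\<lambda>r. r\<^sup>2) has_real_derivative 2 * max r 0) (at r)" using greater by (auto intro!: derivative_eq_intros)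
  then show ?thesis
    by (rule has_field_derivative_transform_within_open[of _ _ _ "{0<..}"])
       (use greater in \<open>auto simp: ramp2_def\<close>)
next
  case equal
  have "((\<lambda>h. (ramp2 (0 + h) - ramp2 0) / h) \<longlongrightarrow> 0) (at 0)"
  proof (rule Lim_null_comparison)
    show "\<forall>\<^sub>F h in at 0. norm ((ramp2 (0 + h) - ramp2 0) / h) \<le> \<bar>h\<bar>"
      by (intro always_eventually allI) (auto simp: ramp2_def max_def power2_eq_square)
    show "((\<lambda>h::real. \<bar>h\<bar>) \<longlongrightarrow> 0) (at 0)" by (intro tendsto_eq_intros) auto
  qed
  then show ?thesis using equal by (simp add: DERIV_def)
qed

text \<open>A quadratic spline rising from 0 to 1 on [0, 1], whose derivative \<open>hat\<close> is
  a tent. Test functions need only be C^1, so splines replace smooth mollifiers.\<close>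

definition step2 :: "real \<Rightarrow> real" where
  "step2 r = 2 * ramp2 r - 4 * ramp2 (r - 1 / 2) + 2 * ramp2 (r - 1)"

definition hat :: "real \<Rightarrow> real" where
  "hat r = 4 * max r 0 - 8 * max (r - 1 / 2) 0 + 4 * max (r - 1) 0"

lemma hat_cont: "continuous_on A hat"
  unfolding hat_def by (intro continuous_intros)

lemma hat_nonneg: "0 \<le> hat r" and hat_zero: "r \<le> 0 \<or> 1 \<le> r \<Longrightarrow> hat r = 0"
  by (auto simp: hat_def max_def)

lemma step2_deriv: "(step2 has_real_derivative hat r) (at r)"
proof -
  have "(step2 has_real_derivative 2 * (2 * max r 0) - 4 * (2 * max (r - 1 / 2) 0 * (1 - 0)) + 2 * (2 * max (r - 1) 0 * (1 - 0))) (at r)"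
    unfolding step2_def[abs_def]
    by (intro DERIV_add DERIV_diff DERIV_cmult ramp2_deriv DERIV_chain2[OF ramp2_deriv] DERIV_ident DERIV_const)
  then show ?thesis by (simp add: hat_def)
qed

lemma step2_low: "r \<le> 0 \<Longrightarrow> step2 r = 0"
  by (simp add: step2_def ramp2_def)

lemma step2_high: "1 \<le> r \<Longrightarrow> step2 r = 1"
  by (simp add: step2_def ramp2_def power2_eq_square algebra_simps)

lemma step2_mono: "r \<le> r' \<Longrightarrow> step2 r \<le> step2 r'"
  by (rule DERIV_nonneg_imp_nondecreasing) (use step2_deriv hat_nonneg in blast)+

lemma hat_scaled_integral:
  assumes "0 < \<epsilon>"
  shows "integrable lborel (\<lambda>t. hat ((t - a) / \<epsilon>) / \<epsilon>)" "(LINT t|lborel. hat ((t - a) / \<epsilon>) / \<epsilon>) = 1"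
proof -
  have d: "((\<lambda>t. step2 ((t - a) / \<epsilon>)) has_real_derivative hat ((t - a) / \<epsilon>) / \<epsilon>) (at t)" for t
  proof -
    have "((\<lambda>t. step2 ((t - a) / \<epsilon>)) has_real_derivative hat ((t - a) / \<epsilon>) * (1 / \<epsilon>)) (at t)"
      by (rule DERIV_chain2[OF step2_deriv]) (use assms in \<open>auto intro!: derivative_eq_intros\<close>)
    then show ?thesis by simp
  qed
  have c: "continuous_on A (\<lambda>t. hat ((t - a) / \<epsilon>) / \<epsilon>)" for A
    by (intro continuous_intros continuous_on_compose2[OF hat_cont[of UNIV]]) (use assms in auto)
  have e: "hat ((t - a) / \<epsilon>) / \<epsilon> * indicator {a..a + \<epsilon>} t = hat ((t - a) / \<epsilon>) / \<epsilon>" for t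
  proof (cases "t \<in> {a..a + \<epsilon>}")
    case False
    then have "(t - a) / \<epsilon> \<le> 0 \<or> 1 \<le> (t - a) / \<epsilon>" using assms by (auto simp: divide_le_0_iff)
    from hat_zero[OF this] show ?thesis by simp
  qed simp
  show "integrable lborel (\<lambda>t. hat ((t - a) / \<epsilon>) / \<epsilon>)"
  proof -
    have "indicator {a..a + \<epsilon>} t *\<^sub>R (hat ((t - a) / \<epsilon>) / \<epsilon>) = hat ((t - a) / \<epsilon>) / \<epsilon>" for t
      using e[of t] by (simp add: mult.commute)
    then show ?thesis
      using borel_integrable_atLeastAtMost'[OF c, of a "a + \<epsilon>"] unfolding set_integrable_def by (simp only:)
  qed
  have "(LINT t|lborel. hat ((t - a) / \<epsilon>) / \<epsilon> * indicator {a..a + \<epsilon>} t) = step2 ((a + \<epsilon> - a) / \<epsilon>) - step2 ((a - a) / \<epsilon>)"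
    using assms d c[of UNIV] by (intro integral_FTC_Icc_real) (auto simp: continuous_on_eq_continuous_at)
  then show "(LINT t|lborel. hat ((t - a) / \<epsilon>) / \<epsilon>) = 1"
    using assms by (simp add: e step2_low step2_high del: times_divide_eq_left)
qed

lemma entropy_solution_slice_measurable:
  assumes u: "entropy_solution f g u0 u" and t: "0 \<le> t"
  shows "(\<lambda>x. u t x) \<in> borel_measurable borel"
proof -
  have m: "(\<lambda>p. indicator ({0..} \<times> UNIV) p *\<^sub>R u (fst p) (snd p)) \<in> borel_measurable borel"
    using u unfolding entropy_solution_def set_borel_measurable_def by (simp add: split_beta)
  have "(\<lambda>x. (\<lambda>p. indicator ({0..} \<times> UNIV) p *\<^sub>R u (fst p) (snd p)) (t, x)) \<in> borel_measurable borel"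
    by (rule measurable_compose[OF _ m]) (auto intro!: borel_measurable_continuous_onI continuous_intros)
  then show ?thesis using t by simp
qed

text \<open>\<open>F\<close> is a primitive of the flux: the entropy z^2 has the flux 2 z f(z) - 2
  F(z). The Lipschitz bound of \<open>v\<close> in time serves the continuity of the energy, the
  bound on \<open>vx\<close> the Gronwall constant.\<close>

locale weak_strong =
  fixes f f' f'' g g' F u0 :: "real \<Rightarrow> real" and u v :: "real \<Rightarrow> real \<Rightarrow> real"
    and vt vx :: "real \<times> real \<Rightarrow> real" and Mv Bx Bt :: real
  assumes u: "entropy_solution f g u0 u"
    and F: "\<And>z. (F has_real_derivative f z) (at z)"
    and f: "\<And>z. (f has_real_derivative f' z) (at z)"
    and f': "\<And>z. (f' has_real_derivative f'' z) (at z)" and f''_cont: "continuous_on UNIV f''"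
    and g: "\<And>z. (g has_real_derivative g' z) (at z)" and g'_cont: "continuous_on UNIV g'"
    and v_C1: "half_plane_C1 (\<lambda>p. v (fst p) (snd p)) vt vx"
    and pde: "\<And>p. p \<in> {0<..} \<times> UNIV \<Longrightarrow> vt p + f' (v (fst p) (snd p)) * vx p = g (v (fst p) (snd p))"
    and v_cont: "continuous_on ({0..} \<times> UNIV) (\<lambda>p. v (fst p) (snd p))"
    and v_bound: "\<And>t x. 0 \<le> t \<Longrightarrow> \<bar>v t x\<bar> \<le> Mv"
    and vx_bound: "\<And>p. p \<in> {0<..} \<times> UNIV \<Longrightarrow> \<bar>vx p\<bar> \<le> Bx"
    and v_lipschitz: "\<And>s t x. 0 \<le> s \<Longrightarrow> 0 \<le> t \<Longrightarrow> \<bar>v s x - v t x\<bar> \<le> Bt * \<bar>s - t\<bar>"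
    and v_init: "\<And>x. v 0 x = u0 x"
begin

lemma conts: "continuous_on A f" "continuous_on A f'" "continuous_on A g" "continuous_on A F"
  using F f f' g by (meson DERIV_isCont continuous_at_imp_continuous_on)+

lemma meas [measurable]: "f \<in> borel_measurable borel" "f' \<in> borel_measurable borel"
  "g \<in> borel_measurable borel" "F \<in> borel_measurable borel"
  using conts[of UNIV] by (auto intro: borel_measurable_continuous_onI)

text \<open>Continuous extension to negative times, so that \<open>V\<close> is Borel on the whole
  plane and no indicator functions enter the integrals.\<close>

definition V :: "real \<times> real \<Rightarrow> real" where
  "V p = v (max 0 (fst p)) (snd p)"

lemma V_eq: "0 \<le> fst p \<Longrightarrow> V p = v (fst p) (snd p)"
  by (simp add: V_def)

lemma V_bound: "\<bar>V p\<bar> \<le> Mv"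
  by (simp add: V_def v_bound)

lemma V_meas [measurable]: "V \<in> borel_measurable borel"
proof -
  have "continuous_on UNIV (\<lambda>p. (\<lambda>p. v (fst p) (snd p)) (max 0 (fst p), snd p))"
    by (rule continuous_on_compose2[OF v_cont]) (auto intro!: continuous_intros)
  then show ?thesis by (intro borel_measurable_continuous_onI) (simp add: V_def[abs_def])
qed

lemma V_C1: "half_plane_C1 V vt vx"
proof -
  have "(V has_derivative (\<lambda>h. vt p * fst h + vx p * snd h)) (at p)" if p: "p \<in> {0<..} \<times> UNIV" for p
    by (rule has_derivative_transform_within_open[OF half_plane_C1D[OF v_C1 p] open_half_plane p])
       (auto simp: V_def)
  then show ?thesis using v_C1 unfolding half_plane_C1_def by blast
qed

lemma pde_V: "p \<in> {0<..} \<times> UNIV \<Longrightarrow> vt p + f' (V p) * vx p = g (V p)"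
  using pde[of p] by (auto simp: V_def)

end

text \<open>On \<open>[0, T]\<close> the solution \<open>u\<close> is replaced by its truncation \<open>z\<close>, an everywhere bounded Borel
  function; \<open>z\<close> and \<open>u\<close> agree almost everywhere there.\<close>

locale weak_strong_slab = weak_strong +
  fixes M T :: real
  assumes Mv_le: "Mv \<le> M" and M_pos: "0 < M" and T_pos: "0 < T"
    and u_bound: "\<And>t. 0 \<le> t \<Longrightarrow> t \<le> T \<Longrightarrow> AE x in lborel. \<bar>u t x\<bar> \<le> M"
begin

definition ue :: "real \<times> real \<Rightarrow> real" where
  "ue p = indicator ({0..} \<times> UNIV) p *\<^sub>R u (fst p) (snd p)"

definition z :: "real \<times> real \<Rightarrow> real" where
  "z p = max (- M) (min M (ue p))"

lemma z_bound: "\<bar>z p\<bar> \<le> M"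
  using M_pos by (auto simp: z_def)

lemma VM: "\<bar>V p\<bar> \<le> M"
  using V_bound[of p] Mv_le by linarith

lemma ue_eq: "0 \<le> fst p \<Longrightarrow> ue p = u (fst p) (snd p)"
  by (simp add: ue_def mem_Times_iff)

lemma ue_meas [measurable]: "ue \<in> borel_measurable borel"
  using u unfolding entropy_solution_def set_borel_measurable_def ue_def[abs_def] by (simp add: split_beta)

lemma z_meas [measurable]: "z \<in> borel_measurable borel"
  unfolding z_def by measurable

lemma u_slice_meas: "0 \<le> t \<Longrightarrow> (\<lambda>x. u t x) \<in> borel_measurable borel"
  by (rule entropy_solution_slice_measurable[OF u])

lemma z_slice: "0 \<le> t \<Longrightarrow> t \<le> T \<Longrightarrow> AE x in lborel. z (t, x) = u t x"
  using u_bound[of t] by (auto simp: z_def ue_eq elim!: eventually_mono)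

text \<open>The bound on \<open>u\<close> is given separately for each time. Fubini turns it into a
  statement about almost all points of the plane, which requires the exceptional set to be
  measurable.\<close>

lemma z_AE: "AE p in lborel. 0 \<le> fst p \<and> fst p \<le> T \<longrightarrow> z p = ue p"
proof -
  let ?P = "\<lambda>p::real \<times> real. 0 \<le> fst p \<and> fst p \<le> T \<longrightarrow> z p = ue p"
  have "{p. ?P p} = (- {0..T}) \<times> UNIV \<union> {p. z p = ue p}" by (auto simp: mem_Times_iff)
  moreover have "open ((- {0..T}) \<times> UNIV :: (real \<times> real) set)" by (intro open_Times) auto
  moreover have "{p \<in> space borel. z p = ue p} \<in> sets borel" by measurable
  ultimately have "{p. ?P p} \<in> sets borel" using sets.Un[OF borel_open] by simp
  then have m: "{p \<in> space (lborel \<Otimes>\<^sub>M lborel). ?P p} \<in> sets (lborel \<Otimes>\<^sub>M lborel :: (real \<times> real) measure)"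
    unfolding lborel_prod by simp
  have "AE t in lborel. AE x in lborel. ?P (t, x)"
  proof (rule AE_I2)
    fix t :: real
    show "AE x in lborel. ?P (t, x)"
    proof (cases "0 \<le> t \<and> t \<le> T")
      case True
      then show ?thesis using z_slice[of t] by (auto simp: ue_eq elim!: eventually_mono)
    qed auto
  qed
  from lborel_pair.AE_pair_measure[OF m this] show ?thesis unfolding lborel_prod .
qed

section \<open>From Kruzkov's inequalities to the relative entropy\<close>

definition admissible where
  "admissible K \<phi> \<phi>t \<phi>x \<longleftrightarrow> compact_C1 K \<phi> \<phi>t \<phi>x \<and> K \<subseteq> {0<..T} \<times> UNIV \<and> (\<forall>p. 0 \<le> \<phi> p)"

lemma admissibleD:
  assumes "admissible K \<phi> \<phi>t \<phi>x"
  shows "compact K" "p \<notin> K \<Longrightarrow> \<phi> p = 0" "p \<notin> K \<Longrightarrow> \<phi>t p = 0" "p \<notin> K \<Longrightarrow> \<phi>x p = 0"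
    "p \<in> K \<Longrightarrow> p \<in> {0<..} \<times> UNIV" "p \<in> K \<Longrightarrow> 0 < fst p \<and> fst p \<le> T" "0 \<le> \<phi> p"
    "continuous_on UNIV \<phi>" "continuous_on UNIV \<phi>t" "continuous_on UNIV \<phi>x" "compact_C1 K \<phi> \<phi>t \<phi>x"
proof -
  show "continuous_on UNIV \<phi>"
    using assms unfolding admissible_def compact_C1_def by (meson has_derivative_continuous continuous_at_imp_continuous_on)
qed (use assms in \<open>auto simp: admissible_def compact_C1_def simp del: split_paired_All\<close>)

lemma integrable_weighted:
  assumes "compact K" "continuous_on UNIV \<phi>" "\<And>p. p \<notin> K \<Longrightarrow> \<phi> p = 0"
    and [measurable]: "h \<in> borel_measurable borel" and b: "\<And>p. p \<in> K \<Longrightarrow> \<bar>h p\<bar> \<le> B"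
  shows "integrable lborel (\<lambda>p. h p * \<phi> p :: real)"
proof -
  have [measurable]: "\<phi> \<in> borel_measurable borel" using assms(2) by (rule borel_measurable_continuous_onI)
  have "bounded (\<phi> ` K)"
    by (intro compact_imp_bounded compact_continuous_image continuous_on_subset[OF assms(2)] assms(1)) auto
  then obtain D where "\<forall>x\<in>\<phi> ` K. norm x \<le> D" unfolding bounded_iff by blast
  then have D: "\<And>p. p \<in> K \<Longrightarrow> \<bar>\<phi> p\<bar> \<le> D" by auto
  show ?thesis
  proof (rule integrable_bounded_compact[OF _ assms(1)])
    fix p assume p: "p \<in> K"
    show "\<bar>h p * \<phi> p\<bar> \<le> B * D"
      unfolding abs_mult using b[OF p] D[OF p] by (intro mult_mono) auto
  qed (use assms(3) in auto)
qed

lemma continuous_bounded_on_interval: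
  fixes h :: "real \<Rightarrow> real"
  assumes "continuous_on UNIV h"
  obtains B where "\<And>x. \<bar>x\<bar> \<le> M + 1 \<Longrightarrow> \<bar>h x\<bar> \<le> B"
proof -
  have "bounded (h ` {-(M+1)..M+1})"
    by (intro compact_imp_bounded compact_continuous_image continuous_on_subset[OF assms]) auto
  then obtain B where "\<forall>x\<in>h ` {-(M+1)..M+1}. norm x \<le> B" unfolding bounded_iff by blast
  then have "\<And>x. \<bar>x\<bar> \<le> M + 1 \<Longrightarrow> \<bar>h x\<bar> \<le> B" by (auto simp: abs_le_iff)
  then show ?thesis by (rule that)
qed

lemma integrable_z:
  assumes "compact K" "continuous_on UNIV \<phi>" "\<And>p. p \<notin> K \<Longrightarrow> \<phi> p = 0" "continuous_on UNIV h"
  shows "integrable lborel (\<lambda>p. h (z p) * \<phi> p :: real)"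
proof -
  obtain B where B: "\<And>x. \<bar>x\<bar> \<le> M + 1 \<Longrightarrow> \<bar>h x\<bar> \<le> B" using continuous_bounded_on_interval[OF assms(4)] by blast
  have [measurable]: "h \<in> borel_measurable borel" using assms(4) by (rule borel_measurable_continuous_onI)
  show ?thesis
  proof (rule integrable_weighted[OF assms(1-3)])
    show "\<bar>h (z p)\<bar> \<le> B" for p using B[of "z p"] z_bound[of p] by simp
  qed (auto intro: assms)
qed

lemma entropy_ineq:
  assumes a: "admissible K \<phi> \<phi>t \<phi>x"
  shows "0 \<le> (LINT p|lborel. sgn (z p - k) * ((z p - k) * \<phi>t p + (f (z p) - f k) * \<phi>x p + g (z p) * \<phi> p))"
proof -
  note A = admissibleD[OF a]
  have [measurable]: "\<phi> \<in> borel_measurable borel" "\<phi>t \<in> borel_measurable borel" "\<phi>x \<in> borel_measurable borel"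
    using A by (auto intro: borel_measurable_continuous_onI)
  have tf: "test_function \<phi> \<phi>t \<phi>x" by (rule compact_C1_test_function[OF A(11,7)])
  let ?w = ue
  have KT: "K \<subseteq> {0<..} \<times> UNIV" using A(5) by blast
  have "0 \<le> (LINT (t, x):{0..} \<times> UNIV|lborel.
                \<bar>u t x - k\<bar> * \<phi>t (t, x)
                + sgn (u t x - k) * (f (u t x) - f k) * \<phi>x (t, x)
                + sgn (u t x - k) * g (u t x) * \<phi> (t, x))"
    using u tf unfolding entropy_solution_def by blast
  also have "\<dots> = (LINT p|lborel. \<bar>u (fst p) (snd p) - k\<bar> * \<phi>t (fst p, snd p)
                + sgn (u (fst p) (snd p) - k) * (f (u (fst p) (snd p)) - f k) * \<phi>x (fst p, snd p)
                + sgn (u (fst p) (snd p) - k) * g (u (fst p) (snd p)) * \<phi> (fst p, snd p))"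
    by (rule set_integral_half_plane[OF KT]) (use A in auto)
  also have "\<dots> = (LINT p|lborel. sgn (?w p - k) * ((?w p - k) * \<phi>t p + (f (?w p) - f k) * \<phi>x p + g (?w p) * \<phi> p))"
  proof (rule Bochner_Integration.integral_cong[OF refl])
    fix p
    show "\<bar>u (fst p) (snd p) - k\<bar> * \<phi>t (fst p, snd p)
                + sgn (u (fst p) (snd p) - k) * (f (u (fst p) (snd p)) - f k) * \<phi>x (fst p, snd p)
                + sgn (u (fst p) (snd p) - k) * g (u (fst p) (snd p)) * \<phi> (fst p, snd p) =
        sgn (?w p - k) * ((?w p - k) * \<phi>t p + (f (?w p) - f k) * \<phi>x p + g (?w p) * \<phi> p)"
    proof (cases "p \<in> K")
      case True
      then have "?w p = u (fst p) (snd p)" using A(6)[OF True] by (simp add: ue_eq)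
      then show ?thesis by (simp add: abs_sgn distrib_left mult_ac)
    qed (use A in simp)
  qed
  also have "\<dots> = (LINT p|lborel. sgn (z p - k) * ((z p - k) * \<phi>t p + (f (z p) - f k) * \<phi>x p + g (z p) * \<phi> p))"
  proof (rule integral_cong_AE)
    show "AE p in lborel. sgn (?w p - k) * ((?w p - k) * \<phi>t p + (f (?w p) - f k) * \<phi>x p + g (?w p) * \<phi> p)
       = sgn (z p - k) * ((z p - k) * \<phi>t p + (f (z p) - f k) * \<phi>x p + g (z p) * \<phi> p)"
      using z_AE
    proof eventually_elim
      case (elim p)
      show ?case
      proof (cases "p \<in> K")
        case True
        then show ?thesis using elim A(6)[OF True] by simp
      qed (use A in simp)
    qed
  qed measurable
  finally show ?thesis .
qed

text \<open>For \<open>k = - M - 1\<close> and \<open>k = M + 1\<close> the sign is constant on the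
  range of \<open>z\<close>, and the terms with \<open>k\<close> integrate to zero; the two entropy
  inequalities become the two halves of the weak equation.\<close>

lemma weak_form:
  assumes a: "admissible K \<phi> \<phi>t \<phi>x"
  shows "(LINT p|lborel. z p * \<phi>t p + f (z p) * \<phi>x p + g (z p) * \<phi> p) = 0"
proof -
  note A = admissibleD[OF a]
  note iz = integrable_z[OF A(1)]
  have i: "integrable lborel (\<lambda>p. z p * \<phi>t p)" "integrable lborel (\<lambda>p. f (z p) * \<phi>x p)" "integrable lborel (\<lambda>p. g (z p) * \<phi> p)"
    using iz[OF A(9,3), of "\<lambda>x. x"] iz[OF A(10,4), of f] iz[OF A(8,2), of g] conts by auto
  note ci = compact_C1_integral[OF A(11)]
  let ?I = "LINT p|lborel. z p * \<phi>t p + f (z p) * \<phi>x p + g (z p) * \<phi> p"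
  have dec: "(LINT p|lborel. (z p * \<phi>t p + f (z p) * \<phi>x p + g (z p) * \<phi> p) - k * \<phi>t p - f k * \<phi>x p) = ?I" for k
    using i ci by simp
  have "0 \<le> (LINT p|lborel. sgn (z p - (- M - 1)) * ((z p - (- M - 1)) * \<phi>t p + (f (z p) - f (- M - 1)) * \<phi>x p + g (z p) * \<phi> p))"
    by (rule entropy_ineq[OF a])
  also have "\<dots> = (LINT p|lborel. (z p * \<phi>t p + f (z p) * \<phi>x p + g (z p) * \<phi> p) - (- M - 1) * \<phi>t p - f (- M - 1) * \<phi>x p)"
  proof (rule Bochner_Integration.integral_cong[OF refl])
    fix p
    have "sgn (z p - (- M - 1)) = 1" using z_bound[of p] by (simp add: sgn_real_def)
    then show "sgn (z p - (- M - 1)) * ((z p - (- M - 1)) * \<phi>t p + (f (z p) - f (- M - 1)) * \<phi>x p + g (z p) * \<phi> p)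
      = (z p * \<phi>t p + f (z p) * \<phi>x p + g (z p) * \<phi> p) - (- M - 1) * \<phi>t p - f (- M - 1) * \<phi>x p"
      by (simp only:) (simp add: algebra_simps)
  qed
  finally have 1: "0 \<le> ?I" unfolding dec .
  have "0 \<le> (LINT p|lborel. sgn (z p - (M + 1)) * ((z p - (M + 1)) * \<phi>t p + (f (z p) - f (M + 1)) * \<phi>x p + g (z p) * \<phi> p))"
    by (rule entropy_ineq[OF a])
  also have "\<dots> = (LINT p|lborel. - ((z p * \<phi>t p + f (z p) * \<phi>x p + g (z p) * \<phi> p) - (M + 1) * \<phi>t p - f (M + 1) * \<phi>x p))"
  proof (rule Bochner_Integration.integral_cong[OF refl])
    fix p
    have "z p - (M + 1) < 0" using z_bound[of p] by linarith
    then have "sgn (z p - (M + 1)) = - 1" by simp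
    then show "sgn (z p - (M + 1)) * ((z p - (M + 1)) * \<phi>t p + (f (z p) - f (M + 1)) * \<phi>x p + g (z p) * \<phi> p)
      = - ((z p * \<phi>t p + f (z p) * \<phi>x p + g (z p) * \<phi> p) - (M + 1) * \<phi>t p - f (M + 1) * \<phi>x p)"
      by (simp only:) (simp add: algebra_simps)
  qed
  finally have "0 \<le> - ?I" unfolding Bochner_Integration.integral_minus dec .
  with 1 show ?thesis by simp
qed

text \<open>Integrating Kruzkov's inequalities over \<open>k \<in> [-M, M]\<close> produces the entropy \<open>z\<^sup>2 + M\<^sup>2\<close>.\<close>

lemma quadratic_entropy_ineq:
  assumes a: "admissible K \<phi> \<phi>t \<phi>x"
  shows "0 \<le> (LINT p|lborel. (z p)\<^sup>2 * \<phi>t p + (2 * z p * f (z p) - 2 * F (z p)) * \<phi>x p + 2 * z p * g (z p) * \<phi> p)"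
proof -
  note A = admissibleD[OF a]
  have [measurable]: "\<phi> \<in> borel_measurable borel" "\<phi>t \<in> borel_measurable borel" "\<phi>x \<in> borel_measurable borel"
    using A by (auto intro: borel_measurable_continuous_onI)
  define h where "h p k = (z p - k) * \<phi>t p + (f (z p) - f k) * \<phi>x p + g (z p) * \<phi> p" for p k
  define Q where "Q p k = indicator {-M..M} k * (sgn (z p - k) * h p k)" for p and k :: real
  have bd: "\<exists>B. \<forall>p\<in>K. \<bar>\<psi> p\<bar> \<le> B" if "continuous_on UNIV \<psi>" for \<psi> :: "real \<times> real \<Rightarrow> real"
  proof -
    have "bounded (\<psi> ` K)"
      by (intro compact_imp_bounded compact_continuous_image continuous_on_subset[OF that] A(1)) auto
    then show ?thesis unfolding bounded_iff by auto
  qed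
  obtain B1 B2 B3 where B: "\<And>p. p \<in> K \<Longrightarrow> \<bar>\<phi>t p\<bar> \<le> B1" "\<And>p. p \<in> K \<Longrightarrow> \<bar>\<phi>x p\<bar> \<le> B2" "\<And>p. p \<in> K \<Longrightarrow> \<bar>\<phi> p\<bar> \<le> B3"
    using bd[OF A(9)] bd[OF A(10)] bd[OF A(8)] by blast
  obtain Bf where Bf: "\<And>x. \<bar>x\<bar> \<le> M + 1 \<Longrightarrow> \<bar>f x\<bar> \<le> Bf" using continuous_bounded_on_interval[OF conts(1)] by blast
  obtain Bg where Bg: "\<And>x. \<bar>x\<bar> \<le> M + 1 \<Longrightarrow> \<bar>g x\<bar> \<le> Bg" using continuous_bounded_on_interval[OF conts(3)] by blast
  have "integrable lborel (\<lambda>(p, k). Q p k)"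
  proof (rule integrable_bounded_compact[of _ "K \<times> {-M..M}"])
    have "(\<lambda>(p, k). Q p k) \<in> borel_measurable ((borel :: (real \<times> real) measure) \<Otimes>\<^sub>M (borel :: real measure))"
      unfolding Q_def h_def by measurable
    then show "(\<lambda>(p, k). Q p k) \<in> borel_measurable borel" by (simp add: borel_prod)
    show "compact (K \<times> {-M..M})" by (intro compact_Times A) auto
    fix x assume x: "x \<in> K \<times> {-M..M}"
    obtain p k where [simp]: "x = (p, k)" and p: "p \<in> K" and k: "\<bar>k\<bar> \<le> M" using x by (cases x) auto
    have "\<bar>h p k\<bar> \<le> \<bar>z p - k\<bar> * \<bar>\<phi>t p\<bar> + \<bar>f (z p) - f k\<bar> * \<bar>\<phi>x p\<bar> + \<bar>g (z p)\<bar> * \<bar>\<phi> p\<bar>"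
      unfolding h_def abs_mult[symmetric] by linarith
    also have "\<dots> \<le> (2 * M) * B1 + (2 * Bf) * B2 + Bg * B3"
    proof (intro add_mono mult_mono B p)
      show "\<bar>z p - k\<bar> \<le> 2 * M" using z_bound[of p] k by linarith
      show "\<bar>f (z p) - f k\<bar> \<le> 2 * Bf" using Bf[of "z p"] Bf[of k] z_bound[of p] k by linarith
      show "\<bar>g (z p)\<bar> \<le> Bg" using Bg[of "z p"] z_bound[of p] by linarith
      show "0 \<le> 2 * M" using M_pos by simp
      show "0 \<le> 2 * Bf" using Bf[of 0] M_pos by simp
      show "0 \<le> Bg" using Bg[of 0] M_pos by simp
    qed auto
    finally have hb: "\<bar>h p k\<bar> \<le> (2 * M) * B1 + (2 * Bf) * B2 + Bg * B3" .
    have "\<bar>Q p k\<bar> \<le> \<bar>h p k\<bar>"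
      unfolding Q_def by (auto simp: indicator_def sgn_real_def abs_mult)
    then show "\<bar>case x of (p, k) \<Rightarrow> Q p k\<bar> \<le> (2 * M) * B1 + (2 * Bf) * B2 + Bg * B3" using hb by simp
  next
    fix x :: "(real \<times> real) \<times> real" assume "x \<notin> K \<times> {-M..M}"
    then show "(case x of (p, k) \<Rightarrow> Q p k) = 0"
      using A by (cases x; cases "fst x \<in> K") (auto simp: Q_def h_def)
  qed
  then have Qi: "integrable (lborel \<Otimes>\<^sub>M lborel) (\<lambda>(p, k). Q p k)" by (simp add: lborel_prod)
  have swap: "(LINT k|lborel. (LINT p|lborel. Q p k)) = (LINT p|lborel. (LINT k|lborel. Q p k))"
    by (rule lborel_pair.Fubini_integral[OF Qi])
  have "0 \<le> (LINT k|lborel. (LINT p|lborel. Q p k))"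
  proof (rule Bochner_Integration.integral_nonneg)
    fix k :: real
    have "(LINT p|lborel. Q p k) = indicator {-M..M} k * (LINT p|lborel. sgn (z p - k) * h p k)"
      unfolding Q_def by (rule integral_mult_right_zero)
    then show "0 \<le> (LINT p|lborel. Q p k)"
      using entropy_ineq[OF a, of k] by (simp add: h_def)
  qed
  also note swap
  also have "(LINT p|lborel. (LINT k|lborel. Q p k)) = (LINT p|lborel.
      ((z p)\<^sup>2 * \<phi>t p + (2 * z p * f (z p) - 2 * F (z p)) * \<phi>x p + 2 * z p * g (z p) * \<phi> p)
      + M\<^sup>2 * \<phi>t p + (F M + F (- M)) * \<phi>x p)"
  proof (rule Bochner_Integration.integral_cong[OF refl])
    fix p
    \<comment> \<open>A primitive in \<open>k\<close> of the Kruzkov integrand without its sign. The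
      contributions of \<open>M\<close> and \<open>- M\<close> contain no \<open>z\<close> and are
      derivatives of the test function times constants, so they integrate to zero
      afterwards.\<close>
    define H where "H k = (z p * k - k\<^sup>2 / 2) * \<phi>t p + (f (z p) * k - F k) * \<phi>x p + g (z p) * k * \<phi> p" for k
    have "(H has_real_derivative h p k) (at k)" for k
      unfolding H_def h_def by (auto intro!: derivative_eq_intros F simp: algebra_simps)
    moreover have "continuous_on UNIV (h p)" unfolding h_def by (intro continuous_intros conts)
    ultimately have "(LINT k|lborel. Q p k) = 2 * H (z p) - H M - H (- M)"
      unfolding Q_def using z_bound by (rule integral_sgn_kernel)
    then show "(LINT k|lborel. Q p k) = ((z p)\<^sup>2 * \<phi>t p + (2 * z p * f (z p) - 2 * F (z p)) * \<phi>x p + 2 * z p * g (z p) * \<phi> p)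
      + M\<^sup>2 * \<phi>t p + (F M + F (- M)) * \<phi>x p"
      by (simp add: H_def power2_eq_square algebra_simps)
  qed
  also have "\<dots> = (LINT p|lborel. (z p)\<^sup>2 * \<phi>t p + (2 * z p * f (z p) - 2 * F (z p)) * \<phi>x p + 2 * z p * g (z p) * \<phi> p)"
  proof -
    note iz = integrable_z[OF A(1)]
    have c: "continuous_on UNIV (\<lambda>x::real. x\<^sup>2)" "continuous_on UNIV (\<lambda>x. 2 * x * f x - 2 * F x)"
      "continuous_on UNIV (\<lambda>x. 2 * x * g x)"
      by (intro continuous_intros conts)+
    note iq = iz[OF A(9,3) c(1)] iz[OF A(10,4) c(2)] iz[OF A(8,2) c(3)]
    show ?thesis using iq compact_C1_integral[OF A(11)] by simp
  qed
  finally show ?thesis .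
qed

text \<open>Admissible test functions are nonnegative while \<open>V\<close> may change sign. The
  weak equation is therefore tested with (M + V) times the test function, and \<open>M\<close> times
  the original identity is subtracted.\<close>

lemma weak_form_V:
  assumes a: "admissible K \<phi> \<phi>t \<phi>x"
  shows "(LINT p|lborel. z p * (vt p * \<phi> p + V p * \<phi>t p) + f (z p) * (vx p * \<phi> p + V p * \<phi>x p) + g (z p) * (V p * \<phi> p)) = 0"
proof -
  note A = admissibleD[OF a]
  have VM': "half_plane_C1 (\<lambda>p. M + V p) vt vx"
    using half_plane_C1_add[OF half_plane_C1_const[of M] V_C1] by simp
  have a': "admissible K (\<lambda>p. (M + V p) * \<phi> p) (\<lambda>p. vt p * \<phi> p + (M + V p) * \<phi>t p) (\<lambda>p. vx p * \<phi> p + (M + V p) * \<phi>x p)"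
    unfolding admissible_def
  proof (intro conjI allI)
    show "compact_C1 K (\<lambda>p. (M + V p) * \<phi> p) (\<lambda>p. vt p * \<phi> p + (M + V p) * \<phi>t p) (\<lambda>p. vx p * \<phi> p + (M + V p) * \<phi>x p)"
      by (rule compact_C1_mult[OF VM' A(11)])
    show "0 \<le> (M + V p) * \<phi> p" for p using VM[of p] A(7)[of p] by (intro mult_nonneg_nonneg) auto
  qed (use a in \<open>auto simp: admissible_def\<close>)
  have int: "integrable lborel (\<lambda>p. z p * \<psi>t p + f (z p) * \<psi>x p + g (z p) * \<psi> p)" if "admissible K \<psi> \<psi>t \<psi>x" for \<psi> \<psi>t \<psi>x
  proof -
    note B = admissibleD[OF that]
    note iz = integrable_z[OF B(1)]
    show ?thesis
      using iz[OF B(9,3), of "\<lambda>x. x"] iz[OF B(10,4), of f] iz[OF B(8,2), of g] conts by auto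
  qed
  have "(LINT p|lborel. z p * (vt p * \<phi> p + V p * \<phi>t p) + f (z p) * (vx p * \<phi> p + V p * \<phi>x p) + g (z p) * (V p * \<phi> p))
    = (LINT p|lborel. (z p * (vt p * \<phi> p + (M + V p) * \<phi>t p) + f (z p) * (vx p * \<phi> p + (M + V p) * \<phi>x p) + g (z p) * ((M + V p) * \<phi> p))
       - M * (z p * \<phi>t p + f (z p) * \<phi>x p + g (z p) * \<phi> p))"
    by (rule Bochner_Integration.integral_cong[OF refl]) (simp add: algebra_simps)
  also have "\<dots> = 0" using weak_form[OF a] weak_form[OF a'] int[OF a] int[OF a'] by simp
  finally show ?thesis .
qed

text \<open>Expansion of (z - V)^2: the quadratic entropy inequality for \<open>z\<close>, minus
  twice the weak equation tested with \<open>V\<close>, plus the divergence identities for V^2 and 2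
  F(V). The classical equation for \<open>V\<close> removes the terms linear in z - V, and only
  quadratic remainders survive.\<close>

lemma relative_entropy_ineq:
  assumes a: "admissible K \<phi> \<phi>t \<phi>x"
  shows "integrable lborel (\<lambda>p. (z p - V p)\<^sup>2 * \<phi>t p + (2 * (z p - V p) * f (z p) - 2 * (F (z p) - F (V p))) * \<phi>x p
      + (2 * (z p - V p) * (g (z p) - g (V p)) - 2 * (f (z p) - f (V p) - f' (V p) * (z p - V p)) * vx p) * \<phi> p)" (is "integrable _ ?R")
    and "0 \<le> (LINT p|lborel. (z p - V p)\<^sup>2 * \<phi>t p + (2 * (z p - V p) * f (z p) - 2 * (F (z p) - F (V p))) * \<phi>x p
      + (2 * (z p - V p) * (g (z p) - g (V p)) - 2 * (f (z p) - f (V p) - f' (V p) * (z p - V p)) * vx p) * \<phi> p)"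
proof -
  note A = admissibleD[OF a]
  have sq: "half_plane_C1 (\<lambda>p. (V p)\<^sup>2) (\<lambda>p. 2 * V p * vt p) (\<lambda>p. 2 * V p * vx p)"
    by (rule half_plane_C1_comp[OF V_C1]) (auto intro!: derivative_eq_intros continuous_intros)
  have FV: "half_plane_C1 (\<lambda>p. 2 * F (V p)) (\<lambda>p. 2 * f (V p) * vt p) (\<lambda>p. 2 * f (V p) * vx p)"
    by (rule half_plane_C1_comp[OF V_C1, of "\<lambda>x. 2 * F x"]) (auto intro!: derivative_eq_intros continuous_intros F conts)
  note d1 = half_plane_C1_divergence[OF sq A(11)]
  note d2 = half_plane_C1_divergence[OF FV A(11)]
  define q where "q p = (z p)\<^sup>2 * \<phi>t p + (2 * z p * f (z p) - 2 * F (z p)) * \<phi>x p + 2 * z p * g (z p) * \<phi> p" for p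
  define l where "l p = z p * (vt p * \<phi> p + V p * \<phi>t p) + f (z p) * (vx p * \<phi> p + V p * \<phi>x p) + g (z p) * (V p * \<phi> p)" for p
  note B = compact_C1_mult[OF V_C1 A(11)]
  have cont: "continuous_on UNIV (\<lambda>p. vt p * \<phi> p + V p * \<phi>t p)" "continuous_on UNIV (\<lambda>p. vx p * \<phi> p + V p * \<phi>x p)"
    "continuous_on UNIV (\<lambda>p. V p * \<phi> p)"
    using B compact_C1_cont[OF B] unfolding compact_C1_def by auto
  note iz = integrable_z[OF A(1)]
  have qi: "integrable lborel q"
  proof -
    have c: "continuous_on UNIV (\<lambda>x::real. x\<^sup>2)" "continuous_on UNIV (\<lambda>x. 2 * x * f x - 2 * F x)"
      "continuous_on UNIV (\<lambda>x. 2 * x * g x)"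
      by (intro continuous_intros conts)+
    note iq = iz[OF A(9,3) c(1)] iz[OF A(10,4) c(2)] iz[OF A(8,2) c(3)]
    show ?thesis unfolding q_def using iq by auto
  qed
  have li: "integrable lborel l"
  proof -
    have "integrable lborel (\<lambda>p. z p * (vt p * \<phi> p + V p * \<phi>t p))"
      using iz[OF cont(1), of "\<lambda>x. x"] A(2,3) by simp
    moreover have "integrable lborel (\<lambda>p. f (z p) * (vx p * \<phi> p + V p * \<phi>x p))"
      using iz[OF cont(2), of f] A(2,4) conts by simp
    moreover have "integrable lborel (\<lambda>p. g (z p) * (V p * \<phi> p))"
      using iz[OF cont(3), of g] A(2) conts by simp
    ultimately show ?thesis unfolding l_def by auto
  qed
  have eq: "?R p = q p - 2 * l p + (2 * V p * vt p * \<phi> p + (V p)\<^sup>2 * \<phi>t p) + (2 * f (V p) * vx p * \<phi> p + 2 * F (V p) * \<phi>x p)" for p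
  proof (cases "p \<in> K")
    case True
    then have vt: "vt p = g (V p) - f' (V p) * vx p" using pde_V[OF A(5)[OF True]] by linarith
    show ?thesis unfolding q_def l_def vt by (simp add: power2_eq_square algebra_simps)
  qed (use A in \<open>simp add: q_def l_def\<close>)
  show "integrable lborel ?R" unfolding eq using qi li d1(1) d2(3) by auto
  have "(LINT p|lborel. ?R p) = (LINT p|lborel. q p)"
    unfolding eq using qi li d1(1,2) d2(3,4) weak_form_V[OF a] unfolding l_def[symmetric] by simp
  also have "0 \<le> \<dots>" unfolding q_def by (rule quadratic_entropy_ineq[OF a])
  finally show "0 \<le> (LINT p|lborel. ?R p)" .
qed

text \<open>All coefficients in the relative entropy inequality are Taylor remainders, hence
  multiples of (z - V)^2 on the bounded range. \<open>\<Lambda>\<close> then bounds the propagation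
  speed and comes from the Lipschitz constant of \<open>f\<close>; \<open>C\<close> is the growth
  rate and comes from those of \<open>g\<close> and, multiplied by the bound on \<open>vx\<close>,
  of \<open>f'\<close>.\<close>

lemma relative_entropy_bound:
  obtains \<Lambda> C where "0 \<le> \<Lambda>" "0 \<le> C"
    "\<And>K \<phi> \<phi>t \<phi>x. admissible K \<phi> \<phi>t \<phi>x \<Longrightarrow> 0 \<le> (LINT p|lborel. (z p - V p)\<^sup>2 * (\<phi>t p + \<Lambda> * \<bar>\<phi>x p\<bar> + C * \<phi> p))"
proof -
  obtain C1 where C1: "0 \<le> C1" "\<And>x y. \<bar>x\<bar> \<le> M \<Longrightarrow> \<bar>y\<bar> \<le> M \<Longrightarrow> \<bar>f x - f y\<bar> \<le> C1 * \<bar>x - y\<bar>"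
    using C1_locally_lipschitz[OF f conts(2), of M] by metis
  obtain C2 where C2: "0 \<le> C2" "\<And>x y. \<bar>x\<bar> \<le> M \<Longrightarrow> \<bar>y\<bar> \<le> M \<Longrightarrow> \<bar>f' x - f' y\<bar> \<le> C2 * \<bar>x - y\<bar>"
    using C1_locally_lipschitz[OF f' f''_cont, of M] by metis
  obtain C3 where C3: "0 \<le> C3" "\<And>x y. \<bar>x\<bar> \<le> M \<Longrightarrow> \<bar>y\<bar> \<le> M \<Longrightarrow> \<bar>g x - g y\<bar> \<le> C3 * \<bar>x - y\<bar>"
    using C1_locally_lipschitz[OF g g'_cont, of M] by metis
  define \<Lambda> where "\<Lambda> = 2 * C1"
  define C where "C = 2 * C3 + 2 * C2 * \<bar>Bx\<bar>"
  have pos: "0 \<le> \<Lambda>" "0 \<le> C" using C1 C2 C3 by (auto simp: \<Lambda>_def C_def)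
  have "0 \<le> (LINT p|lborel. (z p - V p)\<^sup>2 * (\<phi>t p + \<Lambda> * \<bar>\<phi>x p\<bar> + C * \<phi> p))"
    if a: "admissible K \<phi> \<phi>t \<phi>x" for K \<phi> \<phi>t \<phi>x
  proof -
    note A = admissibleD[OF a]
    note R = relative_entropy_ineq[OF a]
    have c: "continuous_on UNIV (\<lambda>p. \<phi>t p + \<Lambda> * \<bar>\<phi>x p\<bar> + C * \<phi> p)" by (intro continuous_intros A)
    have sqb: "\<bar>(z p - V p)\<^sup>2\<bar> \<le> (2 * M)\<^sup>2" for p
      using z_bound[of p] VM[of p] power_mono[of "\<bar>z p - V p\<bar>" "2 * M" 2] by simp
    have i: "integrable lborel (\<lambda>p. (z p - V p)\<^sup>2 * (\<phi>t p + \<Lambda> * \<bar>\<phi>x p\<bar> + C * \<phi> p))"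
      by (rule integrable_weighted[OF A(1) c _ _ sqb]) (use A in auto)
    note R(2)
    also have "(LINT p|lborel. (z p - V p)\<^sup>2 * \<phi>t p + (2 * (z p - V p) * f (z p) - 2 * (F (z p) - F (V p))) * \<phi>x p
      + (2 * (z p - V p) * (g (z p) - g (V p)) - 2 * (f (z p) - f (V p) - f' (V p) * (z p - V p)) * vx p) * \<phi> p)
      \<le> (LINT p|lborel. (z p - V p)\<^sup>2 * (\<phi>t p + \<Lambda> * \<bar>\<phi>x p\<bar> + C * \<phi> p))"
    proof (rule integral_mono[OF R(1) i])
      fix p
      show "(z p - V p)\<^sup>2 * \<phi>t p + (2 * (z p - V p) * f (z p) - 2 * (F (z p) - F (V p))) * \<phi>x p
      + (2 * (z p - V p) * (g (z p) - g (V p)) - 2 * (f (z p) - f (V p) - f' (V p) * (z p - V p)) * vx p) * \<phi> p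
      \<le> (z p - V p)\<^sup>2 * (\<phi>t p + \<Lambda> * \<bar>\<phi>x p\<bar> + C * \<phi> p)"
      proof (cases "p \<in> K")
        case True
        define d where "d = (z p - V p)\<^sup>2"
        have d0: "0 \<le> d" by (simp add: d_def)
        note zb = z_bound[of p] and Vb = VM[of p]
        have "\<bar>F (V p) - F (z p) - f (z p) * (V p - z p)\<bar> \<le> C1 * d"
          using first_order_remainder[OF F C1(2,1) zb Vb] by (simp add: d_def power2_commute)
        then have q1: "\<bar>2 * (z p - V p) * f (z p) - 2 * (F (z p) - F (V p))\<bar> \<le> \<Lambda> * d"
          unfolding \<Lambda>_def abs_le_iff by (simp add: algebra_simps)
        have q1': "(2 * (z p - V p) * f (z p) - 2 * (F (z p) - F (V p))) * \<phi>x p \<le> \<Lambda> * d * \<bar>\<phi>x p\<bar>"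
          using mult_right_mono[OF q1, of "\<bar>\<phi>x p\<bar>"] unfolding abs_mult[symmetric] by linarith
        have "\<bar>(z p - V p) * (g (z p) - g (V p))\<bar> \<le> \<bar>z p - V p\<bar> * (C3 * \<bar>z p - V p\<bar>)"
          unfolding abs_mult by (intro mult_left_mono C3 zb Vb) auto
        then have q2: "\<bar>(z p - V p) * (g (z p) - g (V p))\<bar> \<le> C3 * d"
          by (simp add: d_def abs_mult_scaled_abs)
        have "\<bar>(f (z p) - f (V p) - f' (V p) * (z p - V p)) * vx p\<bar> \<le> (C2 * d) * \<bar>Bx\<bar>"
          unfolding abs_mult
        proof (intro mult_mono)
          show "\<bar>f (z p) - f (V p) - f' (V p) * (z p - V p)\<bar> \<le> C2 * d"
            unfolding d_def by (rule first_order_remainder[OF f C2(2,1) Vb zb])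
          show "\<bar>vx p\<bar> \<le> \<bar>Bx\<bar>" using vx_bound[OF A(5)[OF True]] by linarith
        qed (use C2 d0 in auto)
        then have "2 * ((z p - V p) * (g (z p) - g (V p))) - 2 * ((f (z p) - f (V p) - f' (V p) * (z p - V p)) * vx p) \<le> 2 * (C3 * d) + 2 * (C2 * d * \<bar>Bx\<bar>)"
          using q2 by linarith
        also have "\<dots> = C * d" by (simp add: C_def algebra_simps)
        finally have "(2 * ((z p - V p) * (g (z p) - g (V p))) - 2 * ((f (z p) - f (V p) - f' (V p) * (z p - V p)) * vx p)) * \<phi> p \<le> C * d * \<phi> p"
          using A(7)[of p] by (intro mult_right_mono)
        then have "d * \<phi>t p + (2 * (z p - V p) * f (z p) - 2 * (F (z p) - F (V p))) * \<phi>x p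
          + (2 * ((z p - V p) * (g (z p) - g (V p))) - 2 * ((f (z p) - f (V p) - f' (V p) * (z p - V p)) * vx p)) * \<phi> p
          \<le> d * \<phi>t p + \<Lambda> * d * \<bar>\<phi>x p\<bar> + C * d * \<phi> p"
          by (intro add_mono order_refl q1')
        also have "\<dots> = d * (\<phi>t p + \<Lambda> * \<bar>\<phi>x p\<bar> + C * \<phi> p)" by (simp add: distrib_left mult_ac)
        finally show ?thesis unfolding d_def[symmetric] by (simp only: mult.assoc)
      qed (use A in simp)
    qed
    finally show ?thesis .
  qed
  then show ?thesis using pos by (intro that[of \<Lambda> C])
qed

section \<open>Energy in a shrinking cone\<close>

lemma half_plane_C1_fst: "half_plane_C1 fst (\<lambda>_. 1) (\<lambda>_. 0)"
  and half_plane_C1_snd: "half_plane_C1 snd (\<lambda>_. 0) (\<lambda>_. 1)"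
  by (auto simp: half_plane_C1_def intro!: derivative_eq_intros)

context
  fixes R \<Lambda> C :: real
  assumes R: "0 < R" and \<Lambda>: "0 \<le> \<Lambda>" and C: "0 \<le> C"
begin

text \<open>\<open>sqrt (1 + x\<^sup>2)\<close> replaces \<open>\<bar>x\<bar>\<close>: it is smooth
  and its slope is at most 1 in modulus. The set where \<open>arg\<close> is positive is a rounded
  cone that shrinks at least with speed \<open>\<Lambda>\<close>.\<close>

definition arg :: "real \<times> real \<Rightarrow> real" where
  "arg p = R - \<Lambda> * fst p - sqrt (1 + (snd p)\<^sup>2)"

definition \<psi> :: "real \<times> real \<Rightarrow> real" where
  "\<psi> p = exp (- C * fst p) * ramp2 (arg p)"

definition \<psi>t :: "real \<times> real \<Rightarrow> real" where
  "\<psi>t p = - C * \<psi> p - \<Lambda> * (exp (- C * fst p) * (2 * max (arg p) 0))"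

definition \<psi>x :: "real \<times> real \<Rightarrow> real" where
  "\<psi>x p = - (exp (- C * fst p) * (2 * max (arg p) 0)) * (snd p / sqrt (1 + (snd p)\<^sup>2))"

lemma sqrt_pos1: "0 < sqrt (1 + x\<^sup>2)" "\<bar>x\<bar> \<le> sqrt (1 + x\<^sup>2)"
proof -
  show "0 < sqrt (1 + x\<^sup>2)" by (simp add: add_pos_nonneg)
  show "\<bar>x\<bar> \<le> sqrt (1 + x\<^sup>2)" by (rule real_le_rsqrt) simp
qed

lemma \<psi>_C1: "half_plane_C1 \<psi> \<psi>t \<psi>x"
proof -
  have 1: "half_plane_C1 (\<lambda>p. exp (- C * fst p)) (\<lambda>p. - C * exp (- C * fst p) * 1) (\<lambda>p. - C * exp (- C * fst p) * 0)"
    by (rule half_plane_C1_comp[OF half_plane_C1_fst]) (auto intro!: derivative_eq_intros continuous_intros)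
  have 2: "half_plane_C1 (\<lambda>p. R - \<Lambda> * fst p) (\<lambda>p. - \<Lambda> * 1) (\<lambda>p. - \<Lambda> * 0)"
    by (rule half_plane_C1_comp[OF half_plane_C1_fst]) (auto intro!: derivative_eq_intros continuous_intros)
  have d: "((\<lambda>x::real. - sqrt (1 + x\<^sup>2)) has_real_derivative - (x / sqrt (1 + x\<^sup>2))) (at x)" for x
    using sqrt_pos1(1)[of x] by (auto intro!: derivative_eq_intros simp: field_simps)
  have c: "continuous_on UNIV (\<lambda>x::real. - (x / sqrt (1 + x\<^sup>2)))"
    using sqrt_pos1(1) by (intro continuous_intros) (metis less_irrefl)
  note 3 = half_plane_C1_comp[OF half_plane_C1_snd d c]
  have m: "continuous_on UNIV (\<lambda>r::real. 2 * max r 0)" by (intro continuous_intros)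
  note 4 = half_plane_C1_mult[OF 1 half_plane_C1_comp[OF half_plane_C1_add[OF 2 3] ramp2_deriv m]]
  show ?thesis
    by (rule back_subst[where P="\<lambda>(a, b, c). half_plane_C1 a b c", of "(_, _, _)" "(_, _, _)", simplified prod.case, OF 4])
       (auto simp: fun_eq_iff \<psi>_def \<psi>t_def \<psi>x_def arg_def algebra_simps)
qed

lemma \<psi>_cont: "continuous_on UNIV \<psi>"
  unfolding \<psi>_def ramp2_def arg_def by (intro continuous_intros)

lemma \<psi>_nonneg: "0 \<le> \<psi> p"
  by (simp add: \<psi>_def ramp2_def)

lemma arg_le: "0 \<le> fst p \<Longrightarrow> arg p \<le> R - \<bar>snd p\<bar>"
  using sqrt_pos1(2)[of "snd p"] mult_nonneg_nonneg[OF \<Lambda>, of "fst p"] unfolding arg_def by linarith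

lemma \<psi>_outside:
  assumes "0 \<le> fst p" "R < \<bar>snd p\<bar>"
  shows "\<psi> p = 0" "\<psi>t p = 0" "\<psi>x p = 0"
proof -
  have "arg p \<le> 0" using arg_le[of p] assms by linarith
  then show "\<psi> p = 0" "\<psi>t p = 0" "\<psi>x p = 0" by (auto simp: \<psi>_def \<psi>t_def \<psi>x_def ramp2_def)
qed

lemma \<psi>_bounds:
  assumes "0 \<le> fst p"
  shows "\<psi> p \<le> R\<^sup>2" "\<bar>\<psi>t p\<bar> \<le> C * R\<^sup>2 + \<Lambda> * (2 * R)"
proof -
  have a: "max (arg p) 0 \<le> R" using arg_le[OF assms] R by auto
  have e: "exp (- C * fst p) \<le> 1" using assms C by simp
  have "\<psi> p \<le> 1 * R\<^sup>2" unfolding \<psi>_def ramp2_def using a e by (intro mult_mono power_mono) auto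
  then show 1: "\<psi> p \<le> R\<^sup>2" by simp
  have "exp (- C * fst p) * (2 * max (arg p) 0) \<le> 1 * (2 * R)" using a e by (intro mult_mono) auto
  then have 2: "\<Lambda> * (exp (- C * fst p) * (2 * max (arg p) 0)) \<le> \<Lambda> * (2 * R)" using \<Lambda> by (intro mult_left_mono) auto
  have 3: "0 \<le> \<Lambda> * (exp (- C * fst p) * (2 * max (arg p) 0))" using \<Lambda> by simp
  have 4: "0 \<le> C * \<psi> p" "C * \<psi> p \<le> C * R\<^sup>2" using C \<psi>_nonneg[of p] 1 by (auto intro: mult_left_mono)
  show "\<bar>\<psi>t p\<bar> \<le> C * R\<^sup>2 + \<Lambda> * (2 * R)" unfolding \<psi>t_def using 2 3 4 by linarith
qed

text \<open>The decrease of \<open>arg\<close> in time at rate \<open>\<Lambda>\<close> absorbs the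
  spatial derivative, because the spatial slope of \<open>arg\<close> is at most 1; the exponential
  factor absorbs the growth term.\<close>

lemma \<psi>_subsolution: "\<psi>t p + \<Lambda> * \<bar>\<psi>x p\<bar> + C * \<psi> p \<le> 0"
proof -
  define E where "E = exp (- C * fst p) * (2 * max (arg p) 0)"
  have E: "0 \<le> E" by (simp add: E_def)
  have "\<bar>snd p / sqrt (1 + (snd p)\<^sup>2)\<bar> \<le> 1"
    using sqrt_pos1[of "snd p"] by (simp add: abs_div)
  then have "E * \<bar>snd p / sqrt (1 + (snd p)\<^sup>2)\<bar> \<le> E" by (rule mult_left_le[OF _ E])
  moreover have "\<bar>\<psi>x p\<bar> = E * \<bar>snd p / sqrt (1 + (snd p)\<^sup>2)\<bar>"
    unfolding \<psi>x_def E_def[symmetric] using E by (simp add: abs_mult)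
  ultimately have "\<bar>\<psi>x p\<bar> \<le> E" by simp
  then have "\<Lambda> * \<bar>\<psi>x p\<bar> \<le> \<Lambda> * E" using \<Lambda> by (intro mult_left_mono)
  then show ?thesis by (simp add: \<psi>t_def E_def)
qed

lemma \<psi>_lipschitz_time:
  assumes "0 \<le> s" "0 \<le> t"
  shows "\<bar>\<psi> (t, x) - \<psi> (s, x)\<bar> \<le> (C * R\<^sup>2 + \<Lambda> * (2 * R)) * \<bar>t - s\<bar>"
proof -
  have d: "((\<lambda>t. \<psi> (t, x)) has_real_derivative \<psi>t (t, x)) (at t)" for t
  proof -
    have a: "((\<lambda>t. ramp2 (arg (t, x))) has_real_derivative 2 * max (arg (t, x)) 0 * (- \<Lambda>)) (at t)"
      by (rule DERIV_chain2[OF ramp2_deriv]) (auto simp: arg_def intro!: derivative_eq_intros)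
    have b: "((\<lambda>t. exp (- C * t)) has_real_derivative - C * exp (- C * t)) (at t)"
      by (auto intro!: derivative_eq_intros)
    show ?thesis
      unfolding \<psi>_def \<psi>t_def fst_conv
      by (rule DERIV_cong[OF DERIV_mult[OF b a]]) (simp add: algebra_simps)
  qed
  have "norm (\<psi> (t, x) - \<psi> (s, x)) \<le> (C * R\<^sup>2 + \<Lambda> * (2 * R)) * norm (t - s)"
  proof (rule field_differentiable_bound[of "{0..}" "\<lambda>t. \<psi> (t, x)" "\<lambda>t. \<psi>t (t, x)"])
    show "((\<lambda>t. \<psi> (t, x)) has_field_derivative \<psi>t (t, x)) (at t within {0..})" if "t \<in> {0..}" for t
      using d by (auto intro: has_field_derivative_at_within)
    show "norm (\<psi>t (t, x)) \<le> C * R\<^sup>2 + \<Lambda> * (2 * R)" if "t \<in> {0..}" for t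
      using \<psi>_bounds(2)[of "(t, x)"] that by simp
  qed (use assms in auto)
  then show ?thesis by simp
qed

definition W :: "real \<times> real \<Rightarrow> real" where
  "W p = (z p - V p)\<^sup>2 * \<psi> p"

definition energy :: "real \<Rightarrow> real" where
  "energy t = (LINT x|lborel. W (t, x))"

lemma W_meas [measurable]: "W \<in> borel_measurable borel"
proof -
  have [measurable]: "\<psi> \<in> borel_measurable borel" by (rule borel_measurable_continuous_onI[OF \<psi>_cont])
  show ?thesis unfolding W_def by measurable
qed

lemma slice_meas: "h \<in> borel_measurable borel \<Longrightarrow> (\<lambda>x. h (t, x)) \<in> borel_measurable borel"
  for h :: "real \<times> real \<Rightarrow> real" and t :: real
  by (rule measurable_compose[of "\<lambda>x. (t, x)" _ borel])
     (auto intro!: borel_measurable_continuous_onI continuous_intros)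

lemma zV_sq: "(z p - V p)\<^sup>2 \<le> (2 * M)\<^sup>2"
  using z_bound[of p] VM[of p] power_mono[of "\<bar>z p - V p\<bar>" "2 * M" 2] by simp

lemma W_nonneg: "0 \<le> W p"
  by (simp add: W_def \<psi>_nonneg)

lemma W_outside: "0 \<le> fst p \<Longrightarrow> R < \<bar>snd p\<bar> \<Longrightarrow> W p = 0"
  by (simp add: W_def \<psi>_outside)

lemma W_bound: "0 \<le> fst p \<Longrightarrow> \<bar>W p\<bar> \<le> (2 * M)\<^sup>2 * R\<^sup>2"
  unfolding W_def abs_mult using zV_sq[of p] \<psi>_bounds(1)[of p] \<psi>_nonneg[of p] by (intro mult_mono) auto

lemma W_slice_integrable: "0 \<le> t \<Longrightarrow> integrable lborel (\<lambda>x. W (t, x))"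
proof (rule integrable_bounded_compact[OF slice_meas[OF W_meas], of "{-R..R}" t "(2 * M)\<^sup>2 * R\<^sup>2"])
  show "\<bar>W (t, x)\<bar> \<le> (2 * M)\<^sup>2 * R\<^sup>2" if "0 \<le> t" for x using that by (intro W_bound) simp
qed (auto intro!: W_outside)

text \<open>By a^2 - b^2 = (a + b)(a - b) the increment of the energy density splits into the
  increment of \<open>z\<close>, controlled by the L^1 continuity of \<open>u\<close> in time, and
  increments of \<open>V\<close> and \<open>\<psi>\<close>, which are Lipschitz in time. Uniform
  bounds handle the other factors.\<close>

lemma energy_modulus:
  assumes s: "0 \<le> s" "s \<le> T"
  obtains D where "0 \<le> D" "\<And>t. 0 \<le> t \<Longrightarrow> t \<le> T \<Longrightarrow>
    \<bar>energy t - energy s\<bar> \<le> D * ((LINT x:{-R..R}|lborel. \<bar>u t x - u s x\<bar>) + \<bar>t - s\<bar>)"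
proof -
  define D1 where "D1 = 4 * M * R\<^sup>2"
  define D2 where "D2 = 4 * M * R\<^sup>2 * \<bar>Bt\<bar> + (2 * M)\<^sup>2 * (C * R\<^sup>2 + \<Lambda> * (2 * R))"
  define D where "D = D1 + D2 * (2 * R)"
  have D12: "0 \<le> D1" "0 \<le> D2" using M_pos R C \<Lambda> by (auto simp: D1_def D2_def intro!: add_nonneg_nonneg mult_nonneg_nonneg)
  have "\<bar>energy t - energy s\<bar> \<le> D * ((LINT x:{-R..R}|lborel. \<bar>u t x - u s x\<bar>) + \<bar>t - s\<bar>)"
    if t: "0 \<le> t" "t \<le> T" for t
  proof -
    have pw: "\<bar>W (t, x) - W (s, x)\<bar> \<le> indicator {-R..R} x * (D1 * \<bar>z (t, x) - z (s, x)\<bar>) + indicator {-R..R} x * (D2 * \<bar>t - s\<bar>)" for x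
    proof (cases "\<bar>x\<bar> \<le> R")
      case True
      define a where "a = z (t, x) - V (t, x)"
      define b where "b = z (s, x) - V (s, x)"
      have "\<bar>v t x - v s x\<bar> \<le> Bt * \<bar>t - s\<bar>" by (rule v_lipschitz[OF t(1) s(1)])
      also have "\<dots> \<le> \<bar>Bt\<bar> * \<bar>t - s\<bar>" by (intro mult_right_mono) auto
      finally have ab: "\<bar>a - b\<bar> \<le> \<bar>z (t, x) - z (s, x)\<bar> + \<bar>Bt\<bar> * \<bar>t - s\<bar>"
        using s t by (simp add: a_def b_def V_eq)
      have "\<bar>a + b\<bar> \<le> 4 * M"
        using z_bound[of "(t, x)"] VM[of "(t, x)"] z_bound[of "(s, x)"] VM[of "(s, x)"] unfolding a_def b_def by linarith
      then have "\<bar>(a + b) * \<psi> (t, x)\<bar> \<le> (4 * M) * R\<^sup>2"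
        unfolding abs_mult using \<psi>_bounds(1)[of "(t, x)"] \<psi>_nonneg[of "(t, x)"] t by (intro mult_mono) auto
      then have 1: "\<bar>(a + b) * \<psi> (t, x)\<bar> * \<bar>a - b\<bar> \<le> (4 * M * R\<^sup>2) * (\<bar>z (t, x) - z (s, x)\<bar> + \<bar>Bt\<bar> * \<bar>t - s\<bar>)"
        using ab by (intro mult_mono) auto
      have 2: "\<bar>b\<^sup>2\<bar> * \<bar>\<psi> (t, x) - \<psi> (s, x)\<bar> \<le> (2 * M)\<^sup>2 * ((C * R\<^sup>2 + \<Lambda> * (2 * R)) * \<bar>t - s\<bar>)"
        using zV_sq[of "(s, x)"] \<psi>_lipschitz_time[OF s(1) t(1), of x] unfolding b_def by (intro mult_mono) auto
      have "W (t, x) - W (s, x) = ((a + b) * \<psi> (t, x)) * (a - b) + b\<^sup>2 * (\<psi> (t, x) - \<psi> (s, x))"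
        by (simp add: W_def a_def[symmetric] b_def[symmetric] power2_eq_square algebra_simps)
      then have "\<bar>W (t, x) - W (s, x)\<bar> \<le> \<bar>(a + b) * \<psi> (t, x)\<bar> * \<bar>a - b\<bar> + \<bar>b\<^sup>2\<bar> * \<bar>\<psi> (t, x) - \<psi> (s, x)\<bar>"
        unfolding abs_mult[symmetric] by (simp only: abs_triangle_ineq)
      also have "\<dots> \<le> (4 * M * R\<^sup>2) * (\<bar>z (t, x) - z (s, x)\<bar> + \<bar>Bt\<bar> * \<bar>t - s\<bar>) + (2 * M)\<^sup>2 * ((C * R\<^sup>2 + \<Lambda> * (2 * R)) * \<bar>t - s\<bar>)"
        using 1 2 by (rule add_mono)
      also have "\<dots> = D1 * \<bar>z (t, x) - z (s, x)\<bar> + D2 * \<bar>t - s\<bar>" by (simp add: D1_def D2_def algebra_simps)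
      finally show ?thesis using True by (simp add: abs_le_iff)
    next
      case False
      then have "W (t, x) = 0" "W (s, x) = 0" using s t by (auto intro!: W_outside)
      then show ?thesis using D12 by simp
    qed
    have zm: "(\<lambda>x. z (t, x)) \<in> borel_measurable borel" for t by (rule slice_meas) simp
    have zi: "integrable lborel (\<lambda>x. indicator {-R..R} x * (D1 * \<bar>z (t, x) - z (s, x)\<bar>))"
    proof (rule integrable_bounded_compact[of _ "{-R..R}" "D1 * (2 * M)"])
      show "(\<lambda>x. indicator {-R..R} x * (D1 * \<bar>z (t, x) - z (s, x)\<bar>)) \<in> borel_measurable borel"
        using zm[of t] zm[of s] by measurable
      fix x assume "x \<in> {-R..R}"
      then show "\<bar>indicator {-R..R} x * (D1 * \<bar>z (t, x) - z (s, x)\<bar>)\<bar> \<le> D1 * (2 * M)"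
        using z_bound[of "(t, x)"] z_bound[of "(s, x)"] D12 by (auto simp: abs_mult intro!: mult_left_mono)
    qed auto
    have ci: "integrable lborel (\<lambda>x. indicator {-R..R} x * (D2 * \<bar>t - s\<bar>))"
      by (rule integrable_bounded_compact[of _ "{-R..R}" "D2 * \<bar>t - s\<bar>"]) (use D12 in auto)
    have zu: "(LINT x|lborel. indicator {-R..R} x * (D1 * \<bar>z (t, x) - z (s, x)\<bar>)) = D1 * (LINT x:{-R..R}|lborel. \<bar>u t x - u s x\<bar>)"
    proof -
      have "(LINT x|lborel. indicator {-R..R} x * (D1 * \<bar>z (t, x) - z (s, x)\<bar>)) = (LINT x|lborel. D1 * (indicator {-R..R} x * \<bar>u t x - u s x\<bar>))"
      proof (rule integral_cong_AE)
        show "AE x in lborel. indicator {-R..R} x * (D1 * \<bar>z (t, x) - z (s, x)\<bar>) = D1 * (indicator {-R..R} x * \<bar>u t x - u s x\<bar>)"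
          using z_slice[OF t] z_slice[OF s] by eventually_elim simp
      qed (use zi u_slice_meas[OF t(1)] u_slice_meas[OF s(1)] in auto)
      then show ?thesis by (simp add: set_lebesgue_integral_def)
    qed
    have "\<bar>energy t - energy s\<bar> = norm (LINT x|lborel. W (t, x) - W (s, x))"
      using W_slice_integrable s t by (simp add: energy_def)
    also have "\<dots> \<le> (LINT x|lborel. indicator {-R..R} x * (D1 * \<bar>z (t, x) - z (s, x)\<bar>) + indicator {-R..R} x * (D2 * \<bar>t - s\<bar>))"
      by (rule Bochner_Integration.integral_norm_bound_integral)
         (use W_slice_integrable s t zi ci pw in auto)
    also have "\<dots> = D1 * (LINT x:{-R..R}|lborel. \<bar>u t x - u s x\<bar>) + (D2 * \<bar>t - s\<bar>) * (2 * R)"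
      using zi ci zu R by simp
    also have "\<dots> \<le> D * ((LINT x:{-R..R}|lborel. \<bar>u t x - u s x\<bar>) + \<bar>t - s\<bar>)"
    proof -
      have "0 \<le> (LINT x:{-R..R}|lborel. \<bar>u t x - u s x\<bar>)"
        by (simp add: set_lebesgue_integral_def Bochner_Integration.integral_nonneg)
      moreover have "0 \<le> D2 * (2 * R)" using D12 R by simp
      ultimately have "0 \<le> D2 * (2 * R) * (LINT x:{-R..R}|lborel. \<bar>u t x - u s x\<bar>)" "0 \<le> D1 * \<bar>t - s\<bar>"
        using D12 by auto
      then show ?thesis by (simp add: D_def algebra_simps)
    qed
    finally show ?thesis .
  qed
  moreover have "0 \<le> D" using D12 R by (simp add: D_def)
  ultimately show ?thesis by (rule that[rotated])
qed

lemma energy_tendsto: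
  assumes s: "0 \<le> s" "s \<le> T" and "0 < e"
  obtains d where "0 < d" "\<And>t. 0 \<le> t \<Longrightarrow> t \<le> T \<Longrightarrow> \<bar>t - s\<bar> < d \<Longrightarrow> \<bar>energy t - energy s\<bar> < e"
proof -
  obtain D where D: "0 \<le> D" "\<And>t. 0 \<le> t \<Longrightarrow> t \<le> T \<Longrightarrow>
    \<bar>energy t - energy s\<bar> \<le> D * ((LINT x:{-R..R}|lborel. \<bar>u t x - u s x\<bar>) + \<bar>t - s\<bar>)"
    using energy_modulus[OF s] by blast
  have "((\<lambda>t. LINT x:{-R..R}|lborel. \<bar>u t x - u s x\<bar>) \<longlongrightarrow> 0) (at s within {0..})"
    using u s unfolding entropy_solution_def by blast
  then have "((\<lambda>t. D * ((LINT x:{-R..R}|lborel. \<bar>u t x - u s x\<bar>) + \<bar>t - s\<bar>)) \<longlongrightarrow> D * (0 + \<bar>s - s\<bar>)) (at s within {0..})"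
    by (intro tendsto_intros)
  from tendstoD[OF this \<open>0 < e\<close>]
  obtain d where d: "0 < d" "\<And>t. 0 \<le> t \<Longrightarrow> t \<noteq> s \<Longrightarrow> \<bar>t - s\<bar> < d \<Longrightarrow>
      \<bar>D * ((LINT x:{-R..R}|lborel. \<bar>u t x - u s x\<bar>) + \<bar>t - s\<bar>)\<bar> < e"
    unfolding eventually_at by (auto simp: dist_real_def)
  show ?thesis
  proof (rule that[OF d(1)])
    fix t assume t: "0 \<le> t" "t \<le> T" "\<bar>t - s\<bar> < d"
    show "\<bar>energy t - energy s\<bar> < e"
    proof (cases "t = s")
      case False
      then show ?thesis using d(2)[OF t(1) False t(3)] D(2)[OF t(1,2)] by linarith
    qed (use \<open>0 < e\<close> in simp)
  qed
qed

lemma energy_0: "energy 0 = 0"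
proof -
  have "AE x in lborel. u 0 x = u0 x" using u unfolding entropy_solution_def by blast
  then have "AE x in lborel. W (0, x) = 0"
    using z_slice[OF order_refl less_imp_le[OF T_pos]]
    by eventually_elim (simp add: W_def V_eq v_init)
  then show ?thesis unfolding energy_def by (rule integral_eq_zero_AE)
qed

text \<open>Rises on [\<epsilon>, 2 \<epsilon>] and falls on [s, s + \<epsilon>], so its derivative
  compares averages of the energy just after time 0 and just after \<open>s\<close>. It vanishes
  before \<open>\<epsilon>\<close> because test functions are supported in positive times.\<close>

definition cutoff :: "real \<Rightarrow> real \<Rightarrow> real \<Rightarrow> real" where
  "cutoff \<epsilon> s t = step2 ((t - \<epsilon>) / \<epsilon>) - step2 ((t - s) / \<epsilon>)"

definition cutoff' :: "real \<Rightarrow> real \<Rightarrow> real \<Rightarrow> real" where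
  "cutoff' \<epsilon> s t = hat ((t - \<epsilon>) / \<epsilon>) / \<epsilon> - hat ((t - s) / \<epsilon>) / \<epsilon>"

lemma cutoff_facts:
  assumes \<epsilon>: "0 < \<epsilon>" "2 * \<epsilon> \<le> s"
  shows "(cutoff \<epsilon> s has_real_derivative cutoff' \<epsilon> s t) (at t)" "continuous_on UNIV (cutoff' \<epsilon> s)"
    "0 \<le> cutoff \<epsilon> s t" "t \<notin> {\<epsilon>..s + \<epsilon>} \<Longrightarrow> cutoff \<epsilon> s t = 0 \<and> cutoff' \<epsilon> s t = 0"
proof -
  have d: "((\<lambda>t. step2 ((t - a) / \<epsilon>)) has_real_derivative hat ((t - a) / \<epsilon>) * (1 / \<epsilon>)) (at t)" for a
    by (rule DERIV_chain2[OF step2_deriv]) (use \<epsilon> in \<open>auto intro!: derivative_eq_intros\<close>)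
  show "(cutoff \<epsilon> s has_real_derivative cutoff' \<epsilon> s t) (at t)"
    using DERIV_diff[OF d[of \<epsilon>] d[of s]] by (simp add: cutoff_def[abs_def] cutoff'_def)
  show "continuous_on UNIV (cutoff' \<epsilon> s)"
    unfolding cutoff'_def[abs_def]
    by (intro continuous_intros continuous_on_compose2[OF hat_cont[of UNIV]]) (use \<epsilon> in auto)
  show "0 \<le> cutoff \<epsilon> s t"
    using step2_mono[of "(t - s) / \<epsilon>" "(t - \<epsilon>) / \<epsilon>"] \<epsilon> by (simp add: cutoff_def divide_right_mono)
  show "cutoff \<epsilon> s t = 0 \<and> cutoff' \<epsilon> s t = 0" if "t \<notin> {\<epsilon>..s + \<epsilon>}"
  proof (cases "t < \<epsilon>")
    case True
    then have "(t - \<epsilon>) / \<epsilon> \<le> 0" "(t - s) / \<epsilon> \<le> 0" using \<epsilon> by (auto simp: divide_le_0_iff)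
    then show ?thesis using step2_low hat_zero by (simp add: cutoff_def cutoff'_def)
  next
    case False
    then have "1 \<le> (t - \<epsilon>) / \<epsilon>" "1 \<le> (t - s) / \<epsilon>" using \<epsilon> that by auto
    then show ?thesis using step2_high hat_zero by (simp add: cutoff_def cutoff'_def)
  qed
qed

text \<open>Test with the product of cutoff and cone weight: all terms that contain the cutoff
  undifferentiated are nonpositive by \<open>\<psi>_subsolution\<close>. Only its time derivative is
  left, and Fubini reduces the integral to one over time.\<close>

lemma energy_inequality:
  assumes key: "\<And>K \<phi> \<phi>t \<phi>x. admissible K \<phi> \<phi>t \<phi>x \<Longrightarrow>
      0 \<le> (LINT p|lborel. (z p - V p)\<^sup>2 * (\<phi>t p + \<Lambda> * \<bar>\<phi>x p\<bar> + C * \<phi> p))"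
    and \<epsilon>: "0 < \<epsilon>" "2 * \<epsilon> \<le> s" "s + \<epsilon> \<le> T"
  shows "integrable lborel (\<lambda>t. cutoff' \<epsilon> s t * energy t)"
    and "0 \<le> (LINT t|lborel. cutoff' \<epsilon> s t * energy t)"
proof -
  note cf = cutoff_facts[OF \<epsilon>(1,2)]
  define K where "K = {\<epsilon>..s + \<epsilon>} \<times> {-R..R}"
  have K: "compact K" "K \<subseteq> {0<..} \<times> UNIV" "K \<subseteq> {0<..T} \<times> UNIV"
    using \<epsilon> by (auto simp: K_def intro!: compact_Times)
  define \<phi> where "\<phi> p = cutoff \<epsilon> s (fst p) * \<psi> p" for p
  define \<phi>t where "\<phi>t p = cutoff' \<epsilon> s (fst p) * \<psi> p + cutoff \<epsilon> s (fst p) * \<psi>t p" for p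
  define \<phi>x where "\<phi>x p = cutoff \<epsilon> s (fst p) * \<psi>x p" for p
  have "half_plane_C1 (\<lambda>p. cutoff \<epsilon> s (fst p)) (\<lambda>p. cutoff' \<epsilon> s (fst p) * 1) (\<lambda>p. cutoff' \<epsilon> s (fst p) * 0)"
    by (rule half_plane_C1_comp[OF half_plane_C1_fst cf(1,2)])
  from half_plane_C1_mult[OF this \<psi>_C1]
  have hp: "half_plane_C1 \<phi> \<phi>t \<phi>x" by (simp add: \<phi>_def[abs_def] \<phi>t_def[abs_def] \<phi>x_def[abs_def])
  have zero: "\<phi> p = 0 \<and> \<phi>t p = 0 \<and> \<phi>x p = 0 \<and> cutoff' \<epsilon> s (fst p) * \<psi> p = 0" if "p \<notin> K" for p
  proof (cases "fst p \<in> {\<epsilon>..s + \<epsilon>}")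
    case True
    then have "R < \<bar>snd p\<bar>" "0 \<le> fst p" using that \<epsilon> by (auto simp: K_def mem_Times_iff)
    then show ?thesis using \<psi>_outside[of p] by (simp add: \<phi>_def \<phi>t_def \<phi>x_def)
  next
    case False
    then show ?thesis using cf(4)[OF False] by (simp add: \<phi>_def \<phi>t_def \<phi>x_def)
  qed
  have cc: "compact_C1 K \<phi> \<phi>t \<phi>x"
    by (rule compact_C1_I[OF hp K(1,2)]) (use zero in blast)
  have adm: "admissible K \<phi> \<phi>t \<phi>x"
    unfolding admissible_def using cc K(3) cf(3) \<psi>_nonneg by (simp add: \<phi>_def)
  note A = admissibleD[OF adm]
  have sqm: "(\<lambda>p. (z p - V p)\<^sup>2) \<in> borel_measurable borel" by measurable
  have sqb: "\<bar>(z p - V p)\<^sup>2\<bar> \<le> (2 * M)\<^sup>2" for p using zV_sq[of p] by simp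
  have c1: "continuous_on UNIV (\<lambda>p. \<phi>t p + \<Lambda> * \<bar>\<phi>x p\<bar> + C * \<phi> p)" by (intro continuous_intros A)
  have i1: "integrable lborel (\<lambda>p. (z p - V p)\<^sup>2 * (\<phi>t p + \<Lambda> * \<bar>\<phi>x p\<bar> + C * \<phi> p))"
    by (rule integrable_weighted[OF A(1) c1 _ sqm sqb]) (use zero in auto)
  have c2: "continuous_on UNIV (\<lambda>p. cutoff' \<epsilon> s (fst p) * \<psi> p)"
    by (intro continuous_intros continuous_on_compose2[OF cf(2)] \<psi>_cont) auto
  have i2: "integrable lborel (\<lambda>p. (z p - V p)\<^sup>2 * (cutoff' \<epsilon> s (fst p) * \<psi> p))"
    by (rule integrable_weighted[OF A(1) c2 _ sqm sqb]) (use zero in auto)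
  have "0 \<le> (LINT p|lborel. (z p - V p)\<^sup>2 * (\<phi>t p + \<Lambda> * \<bar>\<phi>x p\<bar> + C * \<phi> p))" by (rule key[OF adm])
  also have "\<dots> \<le> (LINT p|lborel. (z p - V p)\<^sup>2 * (cutoff' \<epsilon> s (fst p) * \<psi> p))"
  proof (rule integral_mono[OF i1 i2], intro mult_left_mono)
    fix p
    have "cutoff \<epsilon> s (fst p) * (\<psi>t p + \<Lambda> * \<bar>\<psi>x p\<bar> + C * \<psi> p) \<le> 0"
      using cf(3) \<psi>_subsolution[of p] by (rule mult_nonneg_nonpos)
    moreover have "\<bar>\<phi>x p\<bar> = cutoff \<epsilon> s (fst p) * \<bar>\<psi>x p\<bar>" using cf(3) by (simp add: \<phi>x_def abs_mult)
    ultimately show "\<phi>t p + \<Lambda> * \<bar>\<phi>x p\<bar> + C * \<phi> p \<le> cutoff' \<epsilon> s (fst p) * \<psi> p"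
      by (simp add: \<phi>t_def \<phi>_def algebra_simps)
  qed simp
  finally have pos: "0 \<le> (LINT p|lborel. (z p - V p)\<^sup>2 * (cutoff' \<epsilon> s (fst p) * \<psi> p))" .
  have i3: "integrable (lborel \<Otimes>\<^sub>M lborel) (\<lambda>p. (z p - V p)\<^sup>2 * (cutoff' \<epsilon> s (fst p) * \<psi> p))"
    using i2 by (simp add: lborel_prod)
  have inner: "(LINT x|lborel. (z (t, x) - V (t, x))\<^sup>2 * (cutoff' \<epsilon> s (fst (t, x)) * \<psi> (t, x))) = cutoff' \<epsilon> s t * energy t" for t
  proof -
    have "(LINT x|lborel. (z (t, x) - V (t, x))\<^sup>2 * (cutoff' \<epsilon> s (fst (t, x)) * \<psi> (t, x))) = (LINT x|lborel. cutoff' \<epsilon> s t * W (t, x))"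
      by (rule Bochner_Integration.integral_cong[OF refl]) (simp add: W_def)
    then show ?thesis by (simp add: energy_def)
  qed
  show "integrable lborel (\<lambda>t. cutoff' \<epsilon> s t * energy t)"
    using lborel_pair.integrable_fst'[OF i3] unfolding inner .
  show "0 \<le> (LINT t|lborel. cutoff' \<epsilon> s t * energy t)"
    using lborel_pair.integral_fst'[OF i3] pos unfolding inner lborel_prod by simp
qed

text \<open>By continuity the energy is close to 0 where the cutoff rises and close to
  \<open>energy s\<close> where it falls. If the latter were positive, the integral in
  \<open>energy_inequality\<close> would be negative for small \<open>\<epsilon>\<close>.\<close>

lemma energy_vanishes:
  assumes key: "\<And>K \<phi> \<phi>t \<phi>x. admissible K \<phi> \<phi>t \<phi>x \<Longrightarrow>
      0 \<le> (LINT p|lborel. (z p - V p)\<^sup>2 * (\<phi>t p + \<Lambda> * \<bar>\<phi>x p\<bar> + C * \<phi> p))"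
    and s: "0 < s" "s < T"
  shows "energy s = 0"
proof (rule ccontr)
  assume "energy s \<noteq> 0"
  moreover have "0 \<le> energy s" unfolding energy_def by (rule Bochner_Integration.integral_nonneg) (rule W_nonneg)
  ultimately have pos: "0 < energy s" by simp
  \<comment> \<open>A third suffices: the rising part contributes at most \<open>a\<close>, the
    falling part at least 3 a - a = 2 a with the opposite sign.\<close>
  define a where "a = energy s / 3"
  have a: "0 < a" using pos by (simp add: a_def)
  obtain d1 where d1: "0 < d1" "\<And>t. 0 \<le> t \<Longrightarrow> t \<le> T \<Longrightarrow> \<bar>t - 0\<bar> < d1 \<Longrightarrow> \<bar>energy t - energy 0\<bar> < a"
    using energy_tendsto[OF order_refl less_imp_le[OF T_pos] a] by blast
  obtain d2 where d2: "0 < d2" "\<And>t. 0 \<le> t \<Longrightarrow> t \<le> T \<Longrightarrow> \<bar>t - s\<bar> < d2 \<Longrightarrow> \<bar>energy t - energy s\<bar> < a"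
    using energy_tendsto[of s, OF _ _ a] s by auto
  define \<epsilon> where "\<epsilon> = min (min (d1 / 3) (d2 / 2)) (min (s / 2) (T - s))"
  have \<epsilon>: "0 < \<epsilon>" "2 * \<epsilon> \<le> s" "s + \<epsilon> \<le> T" "2 * \<epsilon> < d1" "\<epsilon> < d2"
    using d1 d2 s by (auto simp: \<epsilon>_def min_def)
  note E = energy_inequality[OF key \<epsilon>(1-3)]
  note h = hat_scaled_integral[OF \<epsilon>(1)]
  have "(LINT t|lborel. cutoff' \<epsilon> s t * energy t) \<le> (LINT t|lborel. a * (hat ((t - \<epsilon>) / \<epsilon>) / \<epsilon>) - 2 * a * (hat ((t - s) / \<epsilon>) / \<epsilon>))"
  proof (rule integral_mono[OF E(1)])
    show "integrable lborel (\<lambda>t. a * (hat ((t - \<epsilon>) / \<epsilon>) / \<epsilon>) - 2 * a * (hat ((t - s) / \<epsilon>) / \<epsilon>))"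
      by (intro Bochner_Integration.integrable_diff integrable_mult_right h)
    fix t
    have "(hat ((t - \<epsilon>) / \<epsilon>) / \<epsilon>) * energy t \<le> (hat ((t - \<epsilon>) / \<epsilon>) / \<epsilon>) * a"
    proof (cases "t \<in> {\<epsilon>..2 * \<epsilon>}")
      case True
      then have "energy t \<le> a" using d1(2)[of t] energy_0 \<epsilon> s by auto
      then show ?thesis using hat_nonneg \<epsilon> by (intro mult_left_mono) auto
    next
      case False
      then have "(t - \<epsilon>) / \<epsilon> \<le> 0 \<or> 1 \<le> (t - \<epsilon>) / \<epsilon>" using \<epsilon> by (auto simp: divide_le_0_iff)
      then show ?thesis by (simp add: hat_zero)
    qed
    moreover have "(hat ((t - s) / \<epsilon>) / \<epsilon>) * (2 * a) \<le> (hat ((t - s) / \<epsilon>) / \<epsilon>) * energy t"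
    proof (cases "t \<in> {s..s + \<epsilon>}")
      case True
      then have "\<bar>energy t - energy s\<bar> < a" using d2(2)[of t] \<epsilon> s by auto
      then have "2 * a \<le> energy t" unfolding a_def by linarith
      then show ?thesis using hat_nonneg \<epsilon> by (intro mult_left_mono) auto
    next
      case False
      then have "(t - s) / \<epsilon> \<le> 0 \<or> 1 \<le> (t - s) / \<epsilon>" using \<epsilon> by (auto simp: divide_le_0_iff)
      then show ?thesis by (simp add: hat_zero)
    qed
    ultimately show "cutoff' \<epsilon> s t * energy t \<le> a * (hat ((t - \<epsilon>) / \<epsilon>) / \<epsilon>) - 2 * a * (hat ((t - s) / \<epsilon>) / \<epsilon>)"
      unfolding cutoff'_def left_diff_distrib by (simp only: mult.commute[of a] mult.commute[of "2 * a"] diff_mono)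
  qed
  also have "\<dots> = a * 1 - 2 * a * 1"
    using h by (simp del: times_divide_eq_left times_divide_eq_right)
  also have "\<dots> < 0" using a by simp
  finally show False using E(2) by simp
qed

lemma agree_in_cone:
  assumes key: "\<And>K \<phi> \<phi>t \<phi>x. admissible K \<phi> \<phi>t \<phi>x \<Longrightarrow>
      0 \<le> (LINT p|lborel. (z p - V p)\<^sup>2 * (\<phi>t p + \<Lambda> * \<bar>\<phi>x p\<bar> + C * \<phi> p))"
    and s: "0 < s" "s < T"
  shows "AE x in lborel. \<Lambda> * s + sqrt (1 + x\<^sup>2) < R \<longrightarrow> u s x = v s x"
proof -
  have "(LINT x|lborel. W (s, x)) = 0" using energy_vanishes[OF key s] by (simp add: energy_def)
  then have "AE x in lborel. W (s, x) = 0"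
    using integral_nonneg_eq_0_iff_AE[OF W_slice_integrable, of s] W_nonneg s by simp
  moreover have "AE x in lborel. z (s, x) = u s x" using z_slice[of s] s by simp
  ultimately show ?thesis
  proof eventually_elim
    case (elim x)
    show ?case
    proof
      assume "\<Lambda> * s + sqrt (1 + x\<^sup>2) < R"
      then have "0 < \<psi> (s, x)" by (simp add: \<psi>_def ramp2_def arg_def)
      then have "z (s, x) = V (s, x)" using elim(1) by (simp add: W_def)
      then show "u s x = v s x" using elim(2) s by (simp add: V_eq)
    qed
  qed
qed

end

lemma slab_uniqueness:
  assumes s: "0 < s" "s < T"
  shows "AE x in lborel. u s x = v s x"
proof (rule relative_entropy_bound)
  fix \<Lambda> C assume c: "0 \<le> \<Lambda>" "0 \<le> C" and key: "\<And>K \<phi> \<phi>t \<phi>x. admissible K \<phi> \<phi>t \<phi>x \<Longrightarrow>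
      0 \<le> (LINT p|lborel. (z p - V p)\<^sup>2 * (\<phi>t p + \<Lambda> * \<bar>\<phi>x p\<bar> + C * \<phi> p))"
  \<comment> \<open>Countably many cones of growing radius cover the line at time \<open>s\<close>,
    so the exceptional sets can be united; \<open>Suc\<close> keeps the radius positive.\<close>
  have "AE x in lborel. \<forall>n. \<Lambda> * s + sqrt (1 + x\<^sup>2) < real (Suc n) \<longrightarrow> u s x = v s x"
    unfolding AE_all_countable
    by (intro allI agree_in_cone[OF _ c key s]) auto
  then show ?thesis
  proof eventually_elim
    case (elim x)
    obtain n where "\<Lambda> * s + sqrt (1 + x\<^sup>2) < real n" using reals_Archimedean2 by blast
    then have "\<Lambda> * s + sqrt (1 + x\<^sup>2) < real (Suc n)" by simp
    then show ?case using elim by blast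
  qed
qed

end

context weak_strong
begin

theorem weak_strong_uniqueness:
  assumes "0 \<le> t"
  shows "AE x in lborel. u t x = v t x"
proof (cases "t = 0")
  case True
  have "AE x in lborel. u 0 x = u0 x" using u unfolding entropy_solution_def by blast
  then show ?thesis using True by (simp add: v_init)
next
  case False
  then have t: "0 < t" using assms by simp
  \<comment> \<open>The slab is longer than \<open>t\<close>, because the cutoff needs room after
    the time considered.\<close>
  obtain M0 where M0: "\<forall>s\<in>{0..t + 1}. AE x in lborel. \<bar>u s x\<bar> \<le> M0"
    using u unfolding entropy_solution_def by blast
  define M where "M = max (max M0 Mv) 1"
  have "AE x in lborel. \<bar>u s x\<bar> \<le> M" if "0 \<le> s" "s \<le> t + 1" for s
  proof -
    have "AE x in lborel. \<bar>u s x\<bar> \<le> M0" using M0 that by simp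
    then show ?thesis by eventually_elim (simp add: M_def)
  qed
  then interpret weak_strong_slab f f' f'' g g' F u0 u v vt vx Mv Bx Bt M "t + 1"
    by unfold_locales (use t in \<open>simp_all add: M_def\<close>)
  show ?thesis by (rule slab_uniqueness) (use t in auto)
qed

end

section \<open>Points of open sets satisfying almost everywhere properties\<close>

lemma AE_lborel_open_ex:
  fixes S :: "'a::euclidean_space set"
  assumes "AE x in lborel. P x" "open S" "S \<noteq> {}"
  shows "\<exists>x\<in>S. P x"
proof (rule ccontr)
  assume "\<not> ?thesis"
  then have "AE x in lborel. x \<notin> S" using assms(1) by (auto elim: eventually_mono)
  then have "S \<in> null_sets lborel" using assms(2) by (subst AE_iff_null_sets) auto
  then have "negligible S" unfolding negligible_iff_null_sets by (rule null_sets_completionI)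
  then show False using open_not_negligible[OF assms(2,3)] by simp
qed

lemma integral_pos_continuous:
  fixes h :: "'a::euclidean_space \<Rightarrow> real"
  assumes "integrable lborel h" "\<And>x. 0 \<le> h x" "open S" "S \<noteq> {}" "\<And>x. x \<in> S \<Longrightarrow> 0 < h x"
  shows "0 < (LINT x|lborel. h x)"
proof (rule ccontr)
  assume "\<not> ?thesis"
  then have "(LINT x|lborel. h x) = 0"
    using Bochner_Integration.integral_nonneg[of lborel h] assms(2) by (simp add: antisym)
  then have "AE x in lborel. h x = 0"
    using integral_nonneg_eq_0_iff_AE[OF assms(1)] assms(2) by simp
  then show False using AE_lborel_open_ex[OF _ assms(3,4)] assms(5) by fastforce
qed

section \<open>Weighted norms of continuously differentiable functions\<close>

lemma W1inf_norm_nonneg: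
  assumes "\<And>x. 0 < W x"
  shows "0 \<le> W1inf_norm W v"
  unfolding W1inf_norm_def
proof (rule INF_greatest)
  fix w
  obtain x where x: "ereal (norm (v x, w x) / W x) \<le> esssup lborel (\<lambda>x. ereal (norm (v x, w x) / W x))"
    using AE_lborel_open_ex[OF esssup_AE[of "\<lambda>x. ereal (norm (v x, w x) / W x)" lborel] open_UNIV UNIV_not_empty] by blast
  have "0 \<le> ereal (norm (v x, w x) / W x)" using assms[of x] by simp
  also note x
  finally show "0 \<le> esssup lborel (\<lambda>x. ereal (norm (v x, w x) / W x))" .
qed

text \<open>A violation at \<open>x\<close> persists, by continuity of \<open>v\<close> and
  \<open>v'\<close>, on an interval to the right of \<open>x\<close>, where the weight is no larger
  than at \<open>x\<close>. Monotonicity thus replaces continuity of the weight. Working with any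
  \<open>E' > E\<close> extracts an actual weak derivative from the infimum.\<close>

lemma W1inf_norm_imp_pointwise:
  fixes v v' W :: "real \<Rightarrow> real"
  assumes W: "\<And>x. 0 < W x" "antimono W"
    and v: "\<And>x. (v has_real_derivative v' x) (at x)" "continuous_on UNIV v'"
    and E: "W1inf_norm W v \<le> ereal E"
  shows "\<bar>v x\<bar> \<le> E * W x" "\<bar>v' x\<bar> \<le> E * W x"
proof -
  have vc: "continuous_on UNIV v" using v(1) by (meson DERIV_isCont continuous_at_imp_continuous_on)
  have main: "\<bar>v x\<bar> \<le> E' * W x \<and> \<bar>v' x\<bar> \<le> E' * W x" if "E < E'" for E'
  proof -
    have "W1inf_norm W v < ereal E'" using E that by (simp add: le_less_trans)
    then obtain w where w: "weak_deriv v w" "esssup lborel (\<lambda>x. ereal (norm (v x, w x) / W x)) < ereal E'"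
      unfolding W1inf_norm_def INF_less_iff by blast
    have ae: "AE x in lborel. norm (v x, w x) \<le> E' * W x"
      using esssup_AE[of "\<lambda>x. ereal (norm (v x, w x) / W x)" lborel]
    proof eventually_elim
      case (elim x)
      then have "ereal (norm (v x, w x) / W x) \<le> ereal E'" using w(2) by (meson le_less_trans less_imp_le)
      then show ?case using W(1)[of x] by (simp add: pos_divide_le_eq)
    qed
    obtain x1 where "norm (v x1, w x1) \<le> E' * W x1" using AE_lborel_open_ex[OF ae open_UNIV UNIV_not_empty] by blast
    then have "0 \<le> E' * W x1" using norm_ge_zero order_trans by blast
    then have E': "0 \<le> E'" using W(1)[of x1] by (simp add: zero_le_mult_iff)
    define c where "c = E' * W x"
    have Wc: "E' * W y \<le> c" if "x \<le> y" for y
      unfolding c_def using W(2) that E' by (intro mult_left_mono) (auto simp: antimono_def)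
    have near: "\<exists>h>0. \<forall>y\<in>{x..x + h}. c + e \<le> k y" if k: "continuous_on UNIV k" "c + e < k x" for k e
    proof -
      have "open {y. c + e < k y}" using k(1) by (intro open_Collect_less continuous_intros)
      then obtain h where h: "0 < h" "ball x h \<subseteq> {y. c + e < k y}"
        using k(2) open_contains_ball[of "{y. c + e < k y}"] by auto
      have "c + e \<le> k y" if "y \<in> {x..x + h / 2}" for y
      proof -
        have "y \<in> ball x h" using that h by (auto simp: dist_real_def)
        then show ?thesis using h by auto
      qed
      then show ?thesis using h by (intro exI[of _ "h / 2"]) auto
    qed
    have "\<bar>v x\<bar> \<le> c"
    proof (rule ccontr)
      assume "\<not> \<bar>v x\<bar> \<le> c"
      then have gt: "c + (\<bar>v x\<bar> - c) / 2 < \<bar>v x\<bar>" "0 < \<bar>v x\<bar> - c" by (auto simp: field_simps)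
      have "continuous_on UNIV (\<lambda>y. \<bar>v y\<bar>)" by (intro continuous_intros vc)
      from near[OF this gt(1)] obtain h where h: "0 < h" "\<And>y. y \<in> {x..x + h} \<Longrightarrow> c + (\<bar>v x\<bar> - c) / 2 \<le> \<bar>v y\<bar>" by blast
      obtain y where y: "y \<in> {x<..<x + h}" "norm (v y, w y) \<le> E' * W y"
        using AE_lborel_open_ex[OF ae, of "{x<..<x + h}"] h by auto
      have "\<bar>v y\<bar> \<le> norm (v y, w y)" using norm_fst_le[of "v y" "w y"] by simp
      then have "\<bar>v y\<bar> \<le> c" using y Wc[of y] by auto
      moreover have "c + (\<bar>v x\<bar> - c) / 2 \<le> \<bar>v y\<bar>" using h(2)[of y] y by auto
      moreover have "0 < (\<bar>v x\<bar> - c) / 2" using gt(2) by simp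
      ultimately show False by (meson add_pos_pos le_less_trans less_add_same_cancel1 not_le order_trans)
    qed
    moreover have "\<bar>v' x\<bar> \<le> c"
    proof (rule ccontr)
      assume n: "\<not> \<bar>v' x\<bar> \<le> c"
      define s where "s = (if 0 \<le> v' x then 1 else - 1 :: real)"
      have s: "s * v' x = \<bar>v' x\<bar>" "\<bar>s\<bar> = 1" by (auto simp: s_def)
      define e where "e = (\<bar>v' x\<bar> - c) / 2"
      have e: "0 < e" "c + e < s * v' x" using n by (auto simp: e_def s field_simps)
      have "continuous_on UNIV (\<lambda>y. s * v' y)" by (intro continuous_intros v)
      from near[OF this e(2)] obtain h where h: "0 < h" "\<And>y. y \<in> {x..x + h} \<Longrightarrow> c + e \<le> s * v' y" by blast
      \<comment> \<open>A bump on \<open>[x, x + h]\<close>, where \<open>s * v'\<close> exceeds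
        \<open>c\<close> by \<open>e\<close>. Testing with it compares \<open>v'\<close> with the
        weak derivative \<open>w\<close> directly, without an appeal to uniqueness of weak
        derivatives.\<close>
      define \<phi> where "\<phi> y = ramp2 (y - x) * ramp2 (x + h - y)" for y
      define \<phi>' where "\<phi>' y = 2 * max (y - x) 0 * ramp2 (x + h - y) - ramp2 (y - x) * (2 * max (x + h - y) 0)" for y
      have d1: "((\<lambda>y. ramp2 (y - x)) has_real_derivative 2 * max (y - x) 0 * 1) (at y)" for y
        by (rule DERIV_chain2[OF ramp2_deriv]) (auto intro!: derivative_eq_intros)
      have d2: "((\<lambda>y. ramp2 (x + h - y)) has_real_derivative 2 * max (x + h - y) 0 * - 1) (at y)" for y
        by (rule DERIV_chain2[OF ramp2_deriv]) (auto intro!: derivative_eq_intros)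
      have \<phi>d: "(\<phi> has_real_derivative \<phi>' y) (at y)" for y
        unfolding \<phi>_def[abs_def] \<phi>'_def by (rule DERIV_cong[OF DERIV_mult[OF d1 d2]]) (simp add: algebra_simps)
      have \<phi>'c: "continuous_on UNIV \<phi>'" unfolding \<phi>'_def ramp2_def by (intro continuous_intros)
      have \<phi>c: "continuous_on UNIV \<phi>" unfolding \<phi>_def ramp2_def by (intro continuous_intros)
      have \<phi>0: "0 \<le> \<phi> y" for y by (simp add: \<phi>_def ramp2_def)
      have out: "\<phi> y = 0 \<and> \<phi>' y = 0" if "y \<notin> {x..x + h}" for y
        using that by (auto simp: \<phi>_def \<phi>'_def ramp2_def)
      define R where "R = \<bar>x\<bar> + h"
      have R: "0 \<le> R" "{x..x + h} \<subseteq> {-R..R}" using h by (auto simp: R_def)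
      have outR: "\<phi> y = 0 \<and> \<phi>' y = 0" if "R < \<bar>y\<bar>" for y
        by (rule out) (use R that in \<open>auto simp: subset_iff\<close>)
      have wd: "(LINT y|lborel. v y * \<phi>' y) = - (LINT y|lborel. w y * \<phi> y)"
        using w(1) \<phi>d \<phi>'c outR unfolding weak_deriv_def by blast
      have int: "integrable lborel (\<lambda>y. k y * j y)" if "continuous_on UNIV k" "continuous_on UNIV j" "\<And>y. y \<notin> {x..x + h} \<Longrightarrow> j y = 0" for k j :: "real \<Rightarrow> real"
      proof -
        have "integrable lborel (\<lambda>y. indicator {x..x + h} y *\<^sub>R (k y * j y))"
          by (rule borel_integrable_compact) (auto intro!: continuous_intros continuous_on_subset[OF that(1)] continuous_on_subset[OF that(2)])
        moreover have "indicator {x..x + h} y *\<^sub>R (k y * j y) = k y * j y" for y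
          using that(3)[of y] by (auto simp: indicator_def)
        ultimately show ?thesis by (simp only:)
      qed
      have i1: "integrable lborel (\<lambda>y. v' y * \<phi> y)" "integrable lborel (\<lambda>y. v y * \<phi>' y)" "integrable lborel (\<lambda>y. 1 * \<phi> y)"
        using int[OF v(2) \<phi>c] int[OF vc \<phi>'c] int[OF continuous_on_const \<phi>c, of 1] out by auto
      have "(LINT y|lborel. v' y * \<phi> y + \<phi>' y * v y) = 0"
        by (rule integral_deriv_compact_support[of "\<lambda>y. v y * \<phi> y" _ R])
           (use R outR in \<open>auto intro!: DERIV_mult v \<phi>d continuous_intros vc \<phi>c \<phi>'c\<close>)
      then have "(LINT y|lborel. v' y * \<phi> y) = (LINT y|lborel. w y * \<phi> y)"
        using i1 wd by (simp add: mult.commute)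
      moreover have "(LINT y|lborel. (c + e) * \<phi> y) \<le> s * (LINT y|lborel. v' y * \<phi> y)"
      proof -
        have "(LINT y|lborel. (c + e) * \<phi> y) \<le> (LINT y|lborel. s * (v' y * \<phi> y))"
        proof (rule integral_mono)
          fix y
          show "(c + e) * \<phi> y \<le> s * (v' y * \<phi> y)"
            using mult_right_mono[OF h(2) \<phi>0, of y] out[of y] by (cases "y \<in> {x..x + h}") (auto simp: mult.assoc)
        qed (use i1 in auto)
        then show ?thesis by simp
      qed
      moreover have "s * (LINT y|lborel. w y * \<phi> y) \<le> (LINT y|lborel. c * \<phi> y)"
      proof -
        have "set_integrable lborel {-R..R} w" using w(1) unfolding weak_deriv_def by blast
        then have wi: "integrable lborel (\<lambda>y. indicator {-R..R} y *\<^sub>R w y)" by (simp add: set_integrable_def)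
        have weq: "w y * \<phi> y = (indicator {-R..R} y *\<^sub>R w y) * \<phi> y" for y
          using outR[of y] by (cases "R < \<bar>y\<bar>") (auto simp: indicator_def)
        have wm: "(\<lambda>y. w y * \<phi> y) \<in> borel_measurable lborel"
          unfolding weq using wi borel_measurable_continuous_onI[OF \<phi>c] by (intro borel_measurable_times) auto
        have ae2: "AE y in lborel. \<bar>w y * \<phi> y\<bar> \<le> c * \<phi> y"
          using ae
        proof eventually_elim
          case (elim y)
          show ?case
          proof (cases "y \<in> {x..x + h}")
            case True
            have "\<bar>w y\<bar> \<le> norm (v y, w y)" using norm_snd_le[of "w y" "v y"] by simp
            then have "\<bar>w y\<bar> \<le> c" using elim Wc[of y] True by auto
            then show ?thesis using \<phi>0[of y] by (simp add: abs_mult mult_right_mono)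
          qed (use out in simp)
        qed
        have wi2: "integrable lborel (\<lambda>y. w y * \<phi> y)"
          by (rule Bochner_Integration.integrable_bound[of _ "\<lambda>y. c * \<phi> y"])
             (use i1 wm ae2 in \<open>auto elim!: eventually_mono\<close>)
        have "(LINT y|lborel. s * (w y * \<phi> y)) \<le> (LINT y|lborel. c * \<phi> y)"
        proof (rule integral_mono_AE)
          show "AE y in lborel. s * (w y * \<phi> y) \<le> c * \<phi> y"
            using ae2 by eventually_elim (auto simp: s_def)
        qed (use wi2 i1 in auto)
        then show ?thesis using wi2 by simp
      qed
      ultimately have "(c + e) * (LINT y|lborel. \<phi> y) \<le> c * (LINT y|lborel. \<phi> y)" by simp
      then have "e * (LINT y|lborel. \<phi> y) \<le> 0" by (simp add: distrib_right)
      moreover have "0 < (LINT y|lborel. \<phi> y)"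
        by (rule integral_pos_continuous[of _ "{x<..<x + h}"]) (use i1 \<phi>0 h in \<open>auto simp: \<phi>_def ramp2_def\<close>)
      ultimately show False using e by (simp add: mult_le_0_iff)
    qed
    ultimately show ?thesis by (simp add: c_def)
  qed
  have "\<bar>v x\<bar> / W x \<le> E"
    by (rule dense_ge) (use main W(1)[of x] in \<open>auto simp: pos_divide_le_eq\<close>)
  then show "\<bar>v x\<bar> \<le> E * W x" using W(1)[of x] by (simp add: pos_divide_le_eq)
  have "\<bar>v' x\<bar> / W x \<le> E"
    by (rule dense_ge) (use main W(1)[of x] in \<open>auto simp: pos_divide_le_eq\<close>)
  then show "\<bar>v' x\<bar> \<le> E * W x" using W(1)[of x] by (simp add: pos_divide_le_eq)
qed

text \<open>Since \<open>u\<close> and \<open>V\<close> agree almost everywhere, the classical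
  derivative of \<open>V\<close> is a weak derivative of \<open>u\<close> and therefore competes in
  the infimum.\<close>

lemma W1inf_norm_le:
  fixes u V V' W :: "real \<Rightarrow> real"
  assumes u[measurable]: "u \<in> borel_measurable borel" and uV: "AE x in lborel. u x = V x"
    and V: "\<And>x. (V has_real_derivative V' x) (at x)" "continuous_on UNIV V'"
    and W: "\<And>x. 0 < W x" and Wm[measurable]: "W \<in> borel_measurable borel"
    and B: "\<And>x. \<bar>V x\<bar> + \<bar>V' x\<bar> \<le> B * W x"
  shows "W1inf_norm W u \<le> ereal B"
proof -
  have Vc: "continuous_on UNIV V" using V(1) by (meson DERIV_isCont continuous_at_imp_continuous_on)
  have [measurable]: "V \<in> borel_measurable borel" "V' \<in> borel_measurable borel"
    using Vc V(2) by (auto intro: borel_measurable_continuous_onI)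
  have "weak_deriv u V'"
    unfolding weak_deriv_def
  proof (intro conjI allI impI)
    fix R :: real
    have "set_integrable lborel {-R..R} V"
      by (rule borel_integrable_atLeastAtMost'[OF continuous_on_subset[OF Vc]]) simp
    then show "set_integrable lborel {-R..R} u"
      unfolding set_integrable_def
    proof (subst integrable_cong_AE)
      show "AE x in lborel. indicator {-R..R} x *\<^sub>R u x = indicator {-R..R} x *\<^sub>R V x"
        using uV by eventually_elim simp
    qed measurable
    show "set_integrable lborel {-R..R} V'"
      by (rule borel_integrable_atLeastAtMost'[OF continuous_on_subset[OF V(2)]]) simp
  next
    fix \<phi> \<phi>' :: "real \<Rightarrow> real"
    assume *: "(\<forall>x. (\<phi> has_real_derivative \<phi>' x) (at x)) \<and> continuous_on UNIV \<phi>' \<and> (\<exists>R. \<forall>x. R < \<bar>x\<bar> \<longrightarrow> \<phi> x = 0)"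
    then obtain R0 where R0: "\<And>x. R0 < \<bar>x\<bar> \<Longrightarrow> \<phi> x = 0" by blast
    define R where "R = max R0 0"
    have R: "0 \<le> R" and \<phi>0: "\<And>x. R < \<bar>x\<bar> \<Longrightarrow> \<phi> x = 0" using R0 by (auto simp: R_def)
    have \<phi>'0: "\<phi>' x = 0" if "R < \<bar>x\<bar>" for x
    proof -
      have "open {x::real. R < \<bar>x\<bar>}" by (intro open_Collect_less continuous_intros)
      then have "(\<phi> has_real_derivative 0) (at x)"
        by (rule has_field_derivative_transform_within_open[OF DERIV_const[of 0]]) (use \<phi>0 that in auto)
      then show ?thesis using * DERIV_unique by blast
    qed
    have \<phi>c: "continuous_on UNIV \<phi>" using * by (meson DERIV_isCont continuous_at_imp_continuous_on)
    have [measurable]: "\<phi> \<in> borel_measurable borel" "\<phi>' \<in> borel_measurable borel"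
      using \<phi>c * by (auto intro: borel_measurable_continuous_onI)
    have int: "integrable lborel (\<lambda>y. k y * j y)" if "continuous_on UNIV k" "continuous_on UNIV j" "\<And>y. R < \<bar>y\<bar> \<Longrightarrow> j y = 0" for k j :: "real \<Rightarrow> real"
    proof -
      have "integrable lborel (\<lambda>y. indicator {-R..R} y *\<^sub>R (k y * j y))"
        by (rule borel_integrable_compact) (auto intro!: continuous_intros continuous_on_subset[OF that(1)] continuous_on_subset[OF that(2)])
      moreover have "indicator {-R..R} y *\<^sub>R (k y * j y) = k y * j y" for y
        using that(3)[of y] by (cases "R < \<bar>y\<bar>") (auto simp: indicator_def)
      ultimately show ?thesis by (simp only:)
    qed
    have i: "integrable lborel (\<lambda>y. V' y * \<phi> y)" "integrable lborel (\<lambda>y. V y * \<phi>' y)"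
      using int[OF V(2) \<phi>c] int[OF Vc] * \<phi>0 \<phi>'0 by auto
    have "(LINT y|lborel. V' y * \<phi> y + \<phi>' y * V y) = 0"
      by (rule integral_deriv_compact_support[of "\<lambda>y. V y * \<phi> y" _ R])
         (use R \<phi>0 \<phi>'0 * in \<open>auto intro!: DERIV_mult V continuous_intros Vc \<phi>c\<close>)
    then have "(LINT y|lborel. V y * \<phi>' y) = - (LINT y|lborel. V' y * \<phi> y)"
      using i by (simp add: mult.commute)
    moreover have "(LINT y|lborel. u y * \<phi>' y) = (LINT y|lborel. V y * \<phi>' y)"
    proof (rule integral_cong_AE)
      show "AE y in lborel. u y * \<phi>' y = V y * \<phi>' y" using uV by eventually_elim simp
    qed measurable
    ultimately show "(LINT y|lborel. u y * \<phi>' y) = - (LINT y|lborel. V' y * \<phi> y)" by simp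
  qed
  then have "W1inf_norm W u \<le> esssup lborel (\<lambda>x. ereal (norm (u x, V' x) / W x))"
    unfolding W1inf_norm_def by (intro INF_lower) simp
  also have "\<dots> \<le> ereal B"
  proof (rule esssup_I)
    show "AE x in lborel. ereal (norm (u x, V' x) / W x) \<le> ereal B"
      using uV
    proof eventually_elim
      case (elim x)
      have "norm (u x, V' x) \<le> \<bar>V x\<bar> + \<bar>V' x\<bar>" using norm_Pair_le[of "u x" "V' x"] elim by simp
      also have "\<dots> \<le> B * W x" by (rule B)
      finally show ?case using W[of x] by (simp add: pos_divide_le_eq)
    qed
  qed measurable
  finally show ?thesis .
qed

section \<open>The profile equation\<close>

text \<open>With \<open>k\<close> beyond the range of \<open>U\<close> the entropy formulation is
  the weak equation. For the C^1 profile it says that the residual \<open>h\<close> of the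
  differential equation, transported with speed \<open>\<sigma>\<close>, integrates to zero against
  all nonnegative test functions; a bump placed where \<open>h\<close> has a sign excludes a nonzero
  value.\<close>

lemma traveling_wave_profile_ode:
  fixes f f' g U U' :: "real \<Rightarrow> real"
  assumes tw: "traveling_wave f g \<sigma> U"
    and f: "\<And>z. (f has_real_derivative f' z) (at z)" "continuous_on UNIV f'" and g: "continuous_on UNIV g"
    and U: "\<And>y. (U has_real_derivative U' y) (at y)" "continuous_on UNIV U'"
    and bdd: "\<And>y. \<bar>U y\<bar> \<le> M"
  shows "(f' (U y) - \<sigma>) * U' y = g (U y)"
proof -
  have Uc: "continuous_on UNIV U" using U(1) by (meson DERIV_isCont continuous_at_imp_continuous_on)
  define h where "h y = g (U y) - (f' (U y) - \<sigma>) * U' y" for y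
  have hc: "continuous_on UNIV h"
    unfolding h_def by (intro continuous_intros continuous_on_compose2[OF g] continuous_on_compose2[OF f(2)] Uc U) auto
  have lin: "half_plane_C1 (\<lambda>p. snd p - \<sigma> * fst p) (\<lambda>p. - \<sigma>) (\<lambda>p. 1)"
    unfolding half_plane_C1_def by (auto intro!: derivative_eq_intros)
  define A where "A p = U (snd p - \<sigma> * fst p)" for p :: "real \<times> real"
  define A' where "A' p = U' (snd p - \<sigma> * fst p)" for p :: "real \<times> real"
  have A: "half_plane_C1 A (\<lambda>p. A' p * - \<sigma>) (\<lambda>p. A' p * 1)"
    unfolding A_def[abs_def] A'_def by (rule half_plane_C1_comp[OF lin U])
  have fA: "half_plane_C1 (\<lambda>p. f (A p)) (\<lambda>p. f' (A p) * (A' p * - \<sigma>)) (\<lambda>p. f' (A p) * (A' p * 1))"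
    by (rule half_plane_C1_comp[OF A f])
  have zero: "(LINT p|lborel. h (snd p - \<sigma> * fst p) * \<phi> p) = 0" if F: "compact_C1 K \<phi> \<phi>t \<phi>x" and pos: "\<And>p. 0 \<le> \<phi> p" for K \<phi> \<phi>t \<phi>x
  proof -
    have KT: "K \<subseteq> {0<..} \<times> UNIV" and Kz: "\<And>p. p \<notin> K \<Longrightarrow> \<phi> p = 0 \<and> \<phi>t p = 0 \<and> \<phi>x p = 0" and Kc: "compact K"
      using F unfolding compact_C1_def by blast+
    have \<phi>c: "continuous_on UNIV \<phi>" by (rule compact_C1_cont[OF F])
    have tf: "test_function \<phi> \<phi>t \<phi>x" by (rule compact_C1_test_function[OF F pos])
    note dA = half_plane_C1_divergence[OF A F] and dF = half_plane_C1_divergence[OF fA F] and dc = compact_C1_integral[OF F]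
    have hint: "integrable lborel (\<lambda>p. h (snd p - \<sigma> * fst p) * \<phi> p)"
      by (rule integrable_continuous_on_compact[OF Kc])
         (use Kz in \<open>auto intro!: continuous_intros continuous_on_compose2[OF hc] continuous_on_subset[OF \<phi>c]\<close>)
    have ineq: "0 \<le> s * (LINT p|lborel. h (snd p - \<sigma> * fst p) * \<phi> p)" if s: "\<And>p. sgn (A p - k) = s" for k s
    proof -
      have "0 \<le> (LINT (t, x):{0..} \<times> UNIV|lborel.
                \<bar>U (x - \<sigma> * t) - k\<bar> * \<phi>t (t, x)
                + sgn (U (x - \<sigma> * t) - k) * (f (U (x - \<sigma> * t)) - f k) * \<phi>x (t, x)
                + sgn (U (x - \<sigma> * t) - k) * g (U (x - \<sigma> * t)) * \<phi> (t, x))"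
        using tw tf unfolding traveling_wave_def entropy_solution_def by blast
      also have "\<dots> = (LINT p|lborel. \<bar>U (snd p - \<sigma> * fst p) - k\<bar> * \<phi>t (fst p, snd p)
                + sgn (U (snd p - \<sigma> * fst p) - k) * (f (U (snd p - \<sigma> * fst p)) - f k) * \<phi>x (fst p, snd p)
                + sgn (U (snd p - \<sigma> * fst p) - k) * g (U (snd p - \<sigma> * fst p)) * \<phi> (fst p, snd p))"
        by (rule set_integral_half_plane[OF KT]) (use Kz in auto)
      also have "\<dots> = (LINT p|lborel. s * (h (snd p - \<sigma> * fst p) * \<phi> p + (A' p * - \<sigma> * \<phi> p + A p * \<phi>t p)
           + (f' (A p) * (A' p * 1) * \<phi> p + f (A p) * \<phi>x p) - k * \<phi>t p - f k * \<phi>x p))"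
      proof (rule Bochner_Integration.integral_cong[OF refl])
        fix p :: "real \<times> real"
        have e: "U (snd p - \<sigma> * fst p) = A p" "U' (snd p - \<sigma> * fst p) = A' p" by (simp_all add: A_def A'_def)
        have a: "\<bar>A p - k\<bar> = s * (A p - k)" using s[of p] by (metis abs_sgn mult.commute)
        show "\<bar>U (snd p - \<sigma> * fst p) - k\<bar> * \<phi>t (fst p, snd p)
                + sgn (U (snd p - \<sigma> * fst p) - k) * (f (U (snd p - \<sigma> * fst p)) - f k) * \<phi>x (fst p, snd p)
                + sgn (U (snd p - \<sigma> * fst p) - k) * g (U (snd p - \<sigma> * fst p)) * \<phi> (fst p, snd p)
          = s * (h (snd p - \<sigma> * fst p) * \<phi> p + (A' p * - \<sigma> * \<phi> p + A p * \<phi>t p)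
           + (f' (A p) * (A' p * 1) * \<phi> p + f (A p) * \<phi>x p) - k * \<phi>t p - f k * \<phi>x p)"
          unfolding h_def e a s prod.collapse by (simp add: algebra_simps)
      qed
      also have "\<dots> = s * (LINT p|lborel. h (snd p - \<sigma> * fst p) * \<phi> p)"
        using hint dA(1,2) dF(3,4) dc by simp
      finally show ?thesis .
    qed
    have "sgn (A p - (- M - 1)) = 1" for p using bdd[of "snd p - \<sigma> * fst p"] by (auto simp: A_def sgn_real_def)
    from ineq[OF this] have 1: "0 \<le> (LINT p|lborel. h (snd p - \<sigma> * fst p) * \<phi> p)" by simp
    have "sgn (A p - (M + 1)) = - 1" for p
    proof -
      have "A p - (M + 1) < 0" using bdd[of "snd p - \<sigma> * fst p"] by (simp add: A_def)
      then show ?thesis by simp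
    qed
    from ineq[OF this] have "(LINT p|lborel. h (snd p - \<sigma> * fst p) * \<phi> p) \<le> 0" by simp
    with 1 show ?thesis by simp
  qed
  have "h y = 0"
  proof (rule ccontr)
    assume hy: "h y \<noteq> 0"
    define s where "s = sgn (h y)"
    have s: "0 < s * h y" "s \<noteq> 0" using hy by (auto simp: s_def sgn_real_def)
    \<comment> \<open>The point with time 1 and phase \<open>y\<close>; the radius
      \<open>r \<le> 1 / 2\<close> chosen below keeps the ball in positive times.\<close>
    define x0 where "x0 = y + \<sigma>"
    define S where "S = {p :: real \<times> real. 0 < s * h (snd p - \<sigma> * fst p)}"
    have "open S" unfolding S_def
      by (intro open_Collect_less continuous_intros continuous_on_compose2[OF hc]) auto
    moreover have "(1, x0) \<in> S" using s by (simp add: S_def x0_def)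
    ultimately obtain r0 where r0: "0 < r0" "ball (1, x0) r0 \<subseteq> S" using open_contains_ball by blast
    define r where "r = min (r0 / 2) (1 / 2)"
    have r: "0 < r" "r < r0" "r < 1" using r0 by (auto simp: r_def)
    define Q where "Q p = r\<^sup>2 - (fst p - 1)\<^sup>2 - (snd p - x0)\<^sup>2" for p :: "real \<times> real"
    have dist_eq: "(dist (1, x0) p)\<^sup>2 = (fst p - 1)\<^sup>2 + (snd p - x0)\<^sup>2" for p :: "real \<times> real"
      by (cases p) (simp add: dist_Pair_Pair dist_real_def power2_commute)
    have Qpos: "0 < Q p \<longleftrightarrow> p \<in> ball (1, x0) r" for p
    proof -
      have "0 < Q p \<longleftrightarrow> (dist (1, x0) p)\<^sup>2 < r\<^sup>2" unfolding dist_eq by (auto simp: Q_def)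
      also have "\<dots> \<longleftrightarrow> dist (1, x0) p < r"
        using r power2_less_imp_less[of "dist (1, x0) p" r] power_strict_mono[of "dist (1, x0) p" r 2] by auto
      finally show ?thesis by simp
    qed
    have Q1: "half_plane_C1 Q (\<lambda>p. - 2 * (fst p - 1)) (\<lambda>p. - 2 * (snd p - x0))"
      unfolding half_plane_C1_def Q_def[abs_def] by (auto intro!: derivative_eq_intros continuous_intros simp: algebra_simps)
    have m: "continuous_on UNIV (\<lambda>r::real. 2 * max r 0)" by (intro continuous_intros)
    note \<phi>1 = half_plane_C1_comp[OF Q1 ramp2_deriv m]
    define K where "K = cball (1 :: real, x0) r"
    have K: "compact K" "K \<subseteq> {0<..} \<times> UNIV"
    proof -
      have "0 < fst p" if "p \<in> K" for p
        using that r dist_fst_le[of "(1, x0)" p] by (auto simp: K_def dist_real_def)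
      then show "compact K" "K \<subseteq> {0<..} \<times> UNIV" by (auto simp: K_def)
    qed
    have Q0: "Q p \<le> 0" if "p \<notin> K" for p
      using Qpos[of p] that by (auto simp: K_def not_less)
    have F: "compact_C1 K (\<lambda>p. ramp2 (Q p)) (\<lambda>p. 2 * max (Q p) 0 * (- 2 * (fst p - 1))) (\<lambda>p. 2 * max (Q p) 0 * (- 2 * (snd p - x0)))"
      by (rule compact_C1_I[OF \<phi>1 K]) (use Q0 in \<open>auto simp: ramp2_def max_def\<close>)
    have \<phi>p: "0 \<le> ramp2 (Q p)" for p by (simp add: ramp2_def)
    have "0 < (LINT p|lborel. s * (h (snd p - \<sigma> * fst p) * ramp2 (Q p)))"
    proof (rule integral_pos_continuous[of _ "ball (1 :: real, x0) r"])
      have "integrable lborel (\<lambda>p. h (snd p - \<sigma> * fst p) * ramp2 (Q p))"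
        by (rule integrable_continuous_on_compact[OF K(1)])
           (use Q0 in \<open>auto intro!: continuous_intros continuous_on_compose2[OF hc] simp: ramp2_def Q_def[abs_def]\<close>)
      then show "integrable lborel (\<lambda>p. s * (h (snd p - \<sigma> * fst p) * ramp2 (Q p)))" by simp
      have pp: "0 < s * (h (snd p - \<sigma> * fst p) * ramp2 (Q p))" if "p \<in> ball (1, x0) r" for p
      proof -
        have "p \<in> ball (1, x0) r0" using that r by simp
        then have "p \<in> S" using r0(2) by blast
        moreover have "0 < ramp2 (Q p)" using that Qpos[of p] by (simp add: ramp2_def)
        ultimately show ?thesis by (simp add: S_def mult.assoc[symmetric])
      qed
      then show "0 < s * (h (snd p - \<sigma> * fst p) * ramp2 (Q p))" if "p \<in> ball (1, x0) r" for p using that .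
      show "0 \<le> s * (h (snd p - \<sigma> * fst p) * ramp2 (Q p))" for p
        using pp[of p] Qpos[of p] by (cases "p \<in> ball (1, x0) r") (auto simp: ramp2_def max_def)
    qed (use r in auto)
    moreover have "(LINT p|lborel. s * (h (snd p - \<sigma> * fst p) * ramp2 (Q p))) = 0"
      unfolding Bochner_Integration.integral_mult_right_zero zero[OF F \<phi>p] by simp
    ultimately show False by linarith
  qed
  then show ?thesis by (simp add: h_def)
qed

section \<open>Smooth clamping\<close>

text \<open>A C^1 saturation in a single formula: the identity on the negative half-line, with
  values in [0, 1] on the positive one.\<close>

definition sat :: "real \<Rightarrow> real" where
  "sat r = r - ramp2 r / sqrt (1 + r\<^sup>2)"

definition sat' :: "real \<Rightarrow> real" where
  "sat' r = 1 - (2 * max r 0 * sqrt (1 + r\<^sup>2) - ramp2 r * (r / sqrt (1 + r\<^sup>2))) / (1 + r\<^sup>2)"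

lemma one_plus_square_pos: "0 < 1 + (r::real)\<^sup>2"
  by (simp add: add_pos_nonneg)

lemma sat_deriv: "(sat has_real_derivative sat' r) (at r)"
proof -
  have p: "0 < sqrt (1 + r\<^sup>2)" using one_plus_square_pos[of r] by simp
  have d: "((\<lambda>r. sqrt (1 + r\<^sup>2)) has_real_derivative r / sqrt (1 + r\<^sup>2)) (at r)"
    using one_plus_square_pos[of r] by (auto intro!: derivative_eq_intros simp: field_simps)
  have "(sat has_real_derivative 1 - (2 * max r 0 * sqrt (1 + r\<^sup>2) - ramp2 r * (r / sqrt (1 + r\<^sup>2))) / (sqrt (1 + r\<^sup>2) * sqrt (1 + r\<^sup>2))) (at r)"
    unfolding sat_def[abs_def] using p by (intro DERIV_diff DERIV_ident DERIV_divide ramp2_deriv d) auto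
  then show ?thesis using one_plus_square_pos[of r] by (simp add: sat'_def)
qed

lemma sat'_cont: "continuous_on UNIV sat'"
  unfolding sat'_def[abs_def] ramp2_def
  using one_plus_square_pos by (intro continuous_intros) (auto simp: less_imp_neq[symmetric])

lemma sat_id: "r \<le> 0 \<Longrightarrow> sat r = r"
  by (simp add: sat_def ramp2_def)

lemma sat_bounds: "0 \<le> r \<Longrightarrow> 0 \<le> sat r" "sat r \<le> 1"
proof -
  define q where "q = sqrt (1 + r\<^sup>2)"
  have q: "0 < q" "q\<^sup>2 = 1 + r\<^sup>2" "1 \<le> q" using one_plus_square_pos[of r] by (auto simp: q_def)
  have rq: "\<bar>r\<bar> \<le> q" unfolding q_def by (rule real_le_rsqrt) simp
  show 0: "0 \<le> sat r" if "0 \<le> r"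
  proof -
    have "r\<^sup>2 \<le> r * q" using that rq by (simp add: power2_eq_square mult_left_mono)
    then show ?thesis using that q by (simp add: sat_def ramp2_def q_def[symmetric] pos_divide_le_eq)
  qed
  show "sat r \<le> 1"
  proof (cases "0 \<le> r")
    case True
    have "(r - 1) * q \<le> r\<^sup>2"
    proof (cases "1 \<le> r")
      case False
      then have "(r - 1) * q \<le> 0" using q by (intro mult_nonpos_nonneg) auto
      then show ?thesis using zero_le_power2[of r] by linarith
    next
      case T1: True
      have "q \<le> 1 + r" unfolding q_def using True by (intro real_le_lsqrt) (auto simp: power2_eq_square algebra_simps)
      then have "(r - 1) * q \<le> (r - 1) * (1 + r)" using T1 by (intro mult_left_mono) auto
      then show ?thesis by (simp add: power2_eq_square algebra_simps)
    qed
    then have "r - 1 \<le> r\<^sup>2 / q" using q by (simp add: pos_le_divide_eq)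
    then show ?thesis using True by (simp add: sat_def ramp2_def q_def)
  qed (simp add: sat_id)
qed

lemma sat'_bound: "\<bar>sat' r\<bar> \<le> 4"
proof -
  define q where "q = sqrt (1 + r\<^sup>2)"
  have q: "0 < q" "q * q = 1 + r\<^sup>2" using one_plus_square_pos[of r] by (auto simp: q_def)
  have rq: "\<bar>r\<bar> \<le> q" unfolding q_def by (rule real_le_rsqrt) simp
  have "max r 0 * q \<le> q * q" using rq q by (intro mult_right_mono) auto
  then have 1: "0 \<le> 2 * max r 0 * q" "2 * max r 0 * q \<le> 2 * (q * q)" using q by auto
  have "\<bar>ramp2 r * (r / q)\<bar> \<le> (q * q) * 1"
    unfolding abs_mult
  proof (intro mult_mono)
    show "\<bar>ramp2 r\<bar> \<le> q * q"
      using q zero_le_power2[of r] by (auto simp: ramp2_def max_def)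
    show "\<bar>r / q\<bar> \<le> 1" using rq q by (simp add: abs_div)
  qed (use q in auto)
  then have "\<bar>2 * max r 0 * q - ramp2 r * (r / q)\<bar> \<le> 3 * (q * q)" using 1 by linarith
  moreover have "\<bar>X / (q * q)\<bar> \<le> 3" if "\<bar>X\<bar> \<le> 3 * (q * q)" for X
  proof -
    have "0 < q * q" using q(1) by simp
    then show ?thesis using that by (simp add: abs_div pos_divide_le_eq)
  qed
  ultimately have "\<bar>(2 * max r 0 * q - ramp2 r * (r / q)) / (q * q)\<bar> \<le> 3" by blast
  moreover have "sat' r = 1 - (2 * max r 0 * q - ramp2 r * (r / q)) / (q * q)"
    by (simp only: sat'_def q_def[symmetric] q(2))
  ultimately show ?thesis by linarith
qed

text \<open>One saturation at each end; each has slope at most 4, which explains 16.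
  Differentiability at the ends is paid for by an overshoot of at most \<open>\<eta>\<close> beyond
  the interval.\<close>

lemma C1_clamp:
  fixes a b \<eta> :: real
  assumes "a \<le> b" "0 < \<eta>"
  obtains cl cl' where "\<And>w. (cl has_real_derivative cl' w) (at w)" "continuous_on UNIV cl'"
    "\<And>w. \<bar>cl' w\<bar> \<le> 16" "\<And>w. a \<le> w \<Longrightarrow> w \<le> b \<Longrightarrow> cl w = w" "\<And>w. a < w \<Longrightarrow> w < b \<Longrightarrow> cl' w = 1"
    "\<And>w. cl w \<in> {a - \<eta>..b + \<eta>}"
proof -
  define p where "p w = b + \<eta> * sat ((w - b) / \<eta>)" for w
  define p' where "p' w = sat' ((w - b) / \<eta>)" for w
  define n where "n w = a - \<eta> * sat ((a - w) / \<eta>)" for w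
  define n' where "n' w = sat' ((a - w) / \<eta>)" for w
  have pd: "(p has_real_derivative p' w) (at w)" for w
  proof -
    have "((\<lambda>w. sat ((w - b) / \<eta>)) has_real_derivative sat' ((w - b) / \<eta>) * (1 / \<eta>)) (at w)"
      by (rule DERIV_chain2[OF sat_deriv]) (use assms in \<open>auto intro!: derivative_eq_intros\<close>)
    from DERIV_add[OF DERIV_const DERIV_cmult[OF this, of \<eta>], of b] show ?thesis
      using assms by (simp add: p_def[abs_def] p'_def)
  qed
  have nd: "(n has_real_derivative n' w) (at w)" for w
  proof -
    have "((\<lambda>w. sat ((a - w) / \<eta>)) has_real_derivative sat' ((a - w) / \<eta>) * (- 1 / \<eta>)) (at w)"
      by (rule DERIV_chain2[OF sat_deriv]) (use assms in \<open>auto intro!: derivative_eq_intros\<close>)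
    from DERIV_diff[OF DERIV_const DERIV_cmult[OF this, of \<eta>], of a] show ?thesis
      using assms by (simp add: n_def[abs_def] n'_def)
  qed
  have pc: "continuous_on UNIV p" using pd by (meson DERIV_isCont continuous_at_imp_continuous_on)
  have pid: "p w = w" if "w \<le> b" for w using that assms by (simp add: p_def sat_id divide_le_0_iff)
  have nid: "n w = w" if "a \<le> w" for w using that assms by (simp add: n_def sat_id divide_le_0_iff)
  have pu: "p w \<le> b + \<eta>" for w using mult_left_mono[OF sat_bounds(2), of \<eta> "(w - b) / \<eta>"] assms by (simp add: p_def)
  define cl where "cl w = n (p w)" for w
  define cl' where "cl' w = n' (p w) * p' w" for w
  have d: "(cl has_real_derivative cl' w) (at w)" for w
    unfolding cl_def[abs_def] cl'_def by (rule DERIV_chain2[OF nd pd])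
  have id: "cl w = w" if "a \<le> w" "w \<le> b" for w using that by (simp add: cl_def pid nid)
  show ?thesis
  proof (rule that[OF d])
    show "continuous_on UNIV cl'"
      unfolding cl'_def n'_def p'_def
      by (intro continuous_intros continuous_on_compose2[OF sat'_cont] pc) (use assms in auto)
    show "\<bar>cl' w\<bar> \<le> 16" for w
      using mult_mono[OF sat'_bound[of "(a - p w) / \<eta>"] sat'_bound[of "(w - b) / \<eta>"]]
      by (simp add: cl'_def n'_def p'_def abs_mult)
    show "cl w = w" if "a \<le> w" "w \<le> b" for w using id that .
    show "cl' w = 1" if "a < w" "w < b" for w
    proof -
      have "((\<lambda>w. w) has_real_derivative cl' w) (at w)"
        by (rule has_field_derivative_transform_within_open[OF d, of "{a<..<b}"]) (use that id in auto)
      then show ?thesis using DERIV_ident DERIV_unique by blast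
    qed
    show "cl w \<in> {a - \<eta>..b + \<eta>}" for w
    proof (cases "a \<le> p w")
      case True
      then show ?thesis using pu[of w] assms by (simp add: cl_def nid)
    next
      case False
      then have "0 \<le> sat ((a - p w) / \<eta>)" using assms by (intro sat_bounds) auto
      moreover have "sat ((a - p w) / \<eta>) \<le> 1" by (rule sat_bounds)
      ultimately have "0 \<le> \<eta> * sat ((a - p w) / \<eta>)" "\<eta> * sat ((a - p w) / \<eta>) \<le> \<eta> * 1"
        using assms by (auto intro: mult_left_mono)
      then show ?thesis using assms by (simp add: cl_def n_def)
    qed
  qed
qed

section \<open>Global solutions near the profile\<close>

context wave_data
begin

text \<open>\<open>Y\<close> is the foot of the characteristic through \<open>(t, y)\<close>: the perturbation at \<open>(t, y)\<close> is
  the weighted initial perturbation at \<open>Y\<close>, damped if the characteristic has spent a positive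
  fraction of the time in the stable region.\<close>

definition tracks_profile ::
  "real \<Rightarrow> real \<Rightarrow> real \<Rightarrow> (real \<Rightarrow> real) \<Rightarrow> (real \<Rightarrow> real) \<Rightarrow>
   (real \<Rightarrow> real \<Rightarrow> real) \<Rightarrow> (real \<Rightarrow> real \<Rightarrow> real) \<Rightarrow> (real \<Rightarrow> real \<Rightarrow> real) \<Rightarrow> bool" where
  "tracks_profile C3 \<theta> \<eta> u0 u0' v vt vy \<longleftrightarrow>
         (\<forall>y. v 0 y = u0 y) \<and> (\<forall>y. vy 0 y = u0' y) \<and>
         continuous_on ({0..} \<times> UNIV) (\<lambda>p. v (fst p) (snd p)) \<and>
         continuous_on ({0..} \<times> UNIV) (\<lambda>p. vt (fst p) (snd p)) \<and>
         continuous_on ({0..} \<times> UNIV) (\<lambda>p. vy (fst p) (snd p)) \<and>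
         (\<forall>t>0. \<forall>y. ((\<lambda>p. v (fst p) (snd p)) has_derivative (\<lambda>h. vt t y * fst h + vy t y * snd h)) (at (t, y))) \<and>
         (\<forall>t y. b (v t y) * vt t y - vy t y = G (v t y)) \<and>
         (\<forall>t\<ge>0. \<forall>y. \<bar>v t y - U y\<bar> \<le> \<eta>) \<and>
         (\<forall>t\<ge>0. \<forall>y. \<exists>Y d. 0 \<le> d \<and> d \<le> 1 \<and> (\<theta> * t \<le> Y \<or> d \<le> exp (- \<theta> * t)) \<and>
            \<bar>v t y - U y\<bar> + \<bar>vy t y + G (U y)\<bar>
              \<le> C3 * exp_weight \<kappa> y * (d * ((\<bar>u0 Y - U Y\<bar> + \<bar>u0' Y + G (U Y)\<bar>) / exp_weight \<kappa> Y)))"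

text \<open>Packages the construction by characteristics with constants fixed before the datum: they
  depend on the profile, the coefficients and the prescribed distance \<open>\<eta>\<close>
  only.\<close>

lemma perturbed_solution:
  assumes \<eta>: "0 < \<eta>"
  obtains \<epsilon> C3 \<theta> where "0 < \<epsilon>" "0 < C3" "0 < \<theta>"
    "\<And>u0 u0' :: real \<Rightarrow> real. \<lbrakk>\<And>y. (u0 has_real_derivative u0' y) (at y); continuous_on UNIV u0';
       \<And>y. \<bar>u0 y - U y\<bar> + \<bar>u0' y + G (U y)\<bar> \<le> \<epsilon> * exp_weight \<kappa> y\<rbrakk> \<Longrightarrow>
       \<exists>v vt vy. tracks_profile C3 \<theta> \<eta> u0 u0' v vt vy"
proof -
  obtain \<delta> C \<mu> where c: "0 < \<delta>" "1 \<le> C" "0 < \<mu>" and Jw: "\<And>y0 w r. 0 \<le> r \<Longrightarrow> \<bar>w - U y0\<bar> \<le> \<delta> * exp_weight \<kappa> y0 \<Longrightarrow>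
       J r w * exp_weight \<kappa> y0 \<le> C * exp_weight \<kappa> (y0 - r) * decay \<mu> (y0 - r) y0"
    using J_weighted_bound by blast
  have b1: "0 < b1" using b_bounds[of 0] b0_pos by linarith
  define C3 where "C3 = C * ((1 + L) + 2 * b1 / b0 * (1 + L))"
  have C3: "0 < C3" unfolding C3_def using c L_pos b1 b0_pos by (intro mult_pos_pos add_pos_pos divide_pos_pos) auto
  define A where "A = (\<bar>Lb\<bar> + 1) * (C * (1 + L)) * (1 / \<kappa> + 1 / \<mu>)"
  have A: "0 < A" unfolding A_def using c L_pos \<kappa>_pos
    by (intro mult_pos_pos add_nonneg_pos[of "\<bar>Lb\<bar>"] add_pos_pos[of "1 / \<kappa>"]) auto
  \<comment> \<open>The three entries keep the datum in the tube where \<open>J\<close> is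
    controlled, ensure the lower bound on \<open>m\<close>, and keep the solution within
    \<open>\<eta>\<close> of the profile. The summand 1 in \<open>A\<close> permits division when
    \<open>Lb\<close> is 0.\<close>
  define \<epsilon> where "\<epsilon> = min (min \<delta> (b0 / 2 / A)) (\<eta> / C3)"
  have eps: "0 < \<epsilon>" "\<epsilon> \<le> \<delta>" "\<epsilon> \<le> b0 / 2 / A" "\<epsilon> \<le> \<eta> / C3"
    using c b0_pos A C3 \<eta> by (auto simp: \<epsilon>_def)
  have small: "Lb * (C * ((1 + L) * \<epsilon>)) * (1 / \<kappa> + 1 / \<mu>) \<le> b0 / 2"
  proof -
    have "Lb * (C * ((1 + L) * \<epsilon>)) * (1 / \<kappa> + 1 / \<mu>) \<le> (\<bar>Lb\<bar> + 1) * (C * ((1 + L) * \<epsilon>)) * (1 / \<kappa> + 1 / \<mu>)"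
      using c L_pos \<kappa>_pos eps by (intro mult_right_mono) auto
    also have "\<dots> = A * \<epsilon>" by (simp add: A_def mult_ac)
    also have "\<dots> \<le> b0 / 2" using eps(3) A by (simp add: pos_le_divide_eq mult_ac)
    finally show ?thesis .
  qed
  \<comment> \<open>One rate for both alternatives of \<open>foot_dichotomy\<close>: how far right
    the foot lies, and how strong the damping is.\<close>
  define \<theta> where "\<theta> = min (1 / (2 * b1)) (\<mu> / (2 * b1))"
  have \<theta>: "0 < \<theta>" "\<theta> \<le> 1 / (2 * b1)" "\<theta> \<le> \<mu> / (2 * b1)" using c b1 by (auto simp: \<theta>_def)
  show ?thesis
  proof (rule that[OF eps(1) C3 \<theta>(1)])
    fix u0 u0' :: "real \<Rightarrow> real"
    assume u0: "\<And>y. (u0 has_real_derivative u0' y) (at y)" "continuous_on UNIV u0'"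
      "\<And>y. \<bar>u0 y - U y\<bar> + \<bar>u0' y + G (U y)\<bar> \<le> \<epsilon> * exp_weight \<kappa> y"
    interpret wave_solution G G' L M U um up \<kappa> d K b b' b0 b1 Lb \<delta> C \<mu> \<epsilon> u0 u0'
      by unfold_locales (fact c Jw u0 eps small)+
    have C2: "C2 = C3" by (simp add: C2_def C3_def)
    have est: "\<bar>v t y - U y\<bar> + \<bar>vy t y + G (U y)\<bar> \<le> C3 * exp_weight \<kappa> y * (decay \<mu> y (foot t y) * ((\<bar>u0 (foot t y) - U (foot t y)\<bar> + \<bar>u0' (foot t y) + G (U (foot t y))\<bar>) / exp_weight \<kappa> (foot t y)))"
      if "0 \<le> t" for t y
      using v_estimate[OF that, of y] by (simp add: C2 D_def)
    have near: "\<bar>v t y - U y\<bar> \<le> \<eta>" if t: "0 \<le> t" for t y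
    proof -
      let ?Y = "foot t y"
      have "(\<bar>u0 ?Y - U ?Y\<bar> + \<bar>u0' ?Y + G (U ?Y)\<bar>) / exp_weight \<kappa> ?Y \<le> \<epsilon>"
        using u0(3)[of ?Y] \<Omega>_pos[of ?Y] by (simp add: pos_divide_le_eq)
      then have a: "decay \<mu> y ?Y * ((\<bar>u0 ?Y - U ?Y\<bar> + \<bar>u0' ?Y + G (U ?Y)\<bar>) / exp_weight \<kappa> ?Y) \<le> 1 * \<epsilon>"
        using decay_bounds(1)[of y ?Y] decay_bounds(2)[OF foot_ge[OF t]] \<Omega>_pos[of ?Y] by (intro mult_mono) auto
      have "C3 * exp_weight \<kappa> y \<le> C3 * 1" using C3 \<kappa>_pos by (intro mult_left_mono) (auto simp: exp_weight_def)
      then have "C3 * exp_weight \<kappa> y * (decay \<mu> y ?Y * ((\<bar>u0 ?Y - U ?Y\<bar> + \<bar>u0' ?Y + G (U ?Y)\<bar>) / exp_weight \<kappa> ?Y)) \<le> C3 * 1 * (1 * \<epsilon>)"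
        by (rule mult_mono[OF _ a]) (use C3 decay_bounds(1)[of y ?Y] \<Omega>_pos[of ?Y] in auto)
      also have "\<dots> \<le> \<eta>" using eps(4) C3 by (simp add: pos_le_divide_eq mult.commute)
      finally show ?thesis using est[OF t, of y] by linarith
    qed
    have dich: "\<theta> * t \<le> foot t y \<or> decay \<mu> y (foot t y) \<le> exp (- \<theta> * t)" if t: "0 \<le> t" for t y
    proof -
      have 1: "\<theta> * t \<le> t / (2 * b1)" using mult_right_mono[OF \<theta>(2) t] by simp
      have "\<theta> * t \<le> \<mu> / (2 * b1) * t" using mult_right_mono[OF \<theta>(3) t] .
      then have "exp (- (\<mu> / (2 * b1)) * t) \<le> exp (- \<theta> * t)" by simp
      then show ?thesis using foot_dichotomy[OF t, of y] 1 by (meson order_trans)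
    qed
    have "tracks_profile C3 \<theta> \<eta> u0 u0' v vt vy"
      unfolding tracks_profile_def
    proof (intro conjI)
      show "\<forall>t\<ge>0. \<forall>y. \<exists>Y d. 0 \<le> d \<and> d \<le> 1 \<and> (\<theta> * t \<le> Y \<or> d \<le> exp (- \<theta> * t)) \<and>
            \<bar>v t y - U y\<bar> + \<bar>vy t y + G (U y)\<bar>
              \<le> C3 * exp_weight \<kappa> y * (d * ((\<bar>u0 Y - U Y\<bar> + \<bar>u0' Y + G (U Y)\<bar>) / exp_weight \<kappa> Y))"
      proof (intro allI impI)
        fix t y :: real assume t: "0 \<le> t"
        show "\<exists>Y d. 0 \<le> d \<and> d \<le> 1 \<and> (\<theta> * t \<le> Y \<or> d \<le> exp (- \<theta> * t)) \<and>
            \<bar>v t y - U y\<bar> + \<bar>vy t y + G (U y)\<bar>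
              \<le> C3 * exp_weight \<kappa> y * (d * ((\<bar>u0 Y - U Y\<bar> + \<bar>u0' Y + G (U Y)\<bar>) / exp_weight \<kappa> Y))"
          using est[OF t, of y] dich[OF t, of y] decay_bounds(1)[of y "foot t y"] decay_bounds(2)[OF foot_ge[OF t]]
          by (intro exI[of _ "foot t y"] exI[of _ "decay \<mu> y (foot t y)"]) auto
      qed
    qed (use v_0 vy_0 v_cont vt_cont vy_cont v_has_derivative near in \<open>auto simp: vy_def[abs_def]\<close>)
    then show "\<exists>v vt vy. tracks_profile C3 \<theta> \<eta> u0 u0' v vt vy" by blast
  qed
qed

end

section \<open>The sign of the characteristic speed\<close>

lemma tendsto_derivative_limit_zero:
  fixes h h' :: "real \<Rightarrow> real"
  assumes d: "\<And>y. (h has_real_derivative h' y) (at y)"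
    and h: "(h \<longlongrightarrow> a) at_top" and h': "(h' \<longlongrightarrow> l) at_top"
  shows "l = 0"
proof (rule ccontr)
  assume "l \<noteq> 0"
  then have l: "0 < \<bar>l\<bar> / 4" by simp
  obtain y1 where y1: "\<And>y. y1 \<le> y \<Longrightarrow> \<bar>h y - a\<bar> < \<bar>l\<bar> / 4"
    using tendstoD[OF h l] by (auto simp: eventually_at_top_linorder dist_real_def)
  obtain y2 where y2: "\<And>y. y2 \<le> y \<Longrightarrow> \<bar>h' y - l\<bar> < \<bar>l\<bar> / 4"
    using tendstoD[OF h' l] by (auto simp: eventually_at_top_linorder dist_real_def)
  define y where "y = max y1 y2"
  obtain z where z: "y < z" "z < y + 1" "h (y + 1) - h y = (y + 1 - y) * h' z"
    using MVT2[of y "y + 1" h h'] d by auto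
  have "\<bar>h y - a\<bar> < \<bar>l\<bar> / 4" "\<bar>h (y + 1) - a\<bar> < \<bar>l\<bar> / 4" "\<bar>h' z - l\<bar> < \<bar>l\<bar> / 4"
    using y1[of y] y1[of "y + 1"] y2[of z] z(1) by (auto simp: y_def)
  moreover have "h (y + 1) - h y = h' z" using z(3) by simp
  ultimately show False by linarith
qed

lemma endstates_are_equilibria:
  fixes U U' k :: "real \<Rightarrow> real"
  assumes U: "\<And>y. (U has_real_derivative U' y) (at y)" and ode: "\<And>y. U' y = k (U y)"
  shows "(U \<longlongrightarrow> a) at_top \<Longrightarrow> isCont k a \<Longrightarrow> k a = 0"
    and "(U \<longlongrightarrow> a) at_bot \<Longrightarrow> isCont k a \<Longrightarrow> k a = 0"
proof -
  show "k a = 0" if "(U \<longlongrightarrow> a) at_top" "isCont k a"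
    by (rule tendsto_derivative_limit_zero[OF U that(1)])
       (use isCont_tendsto_compose[OF that(2,1)] ode in simp)
  assume a: "(U \<longlongrightarrow> a) at_bot" "isCont k a"
  have d: "((\<lambda>y. U (- y)) has_real_derivative - U' (- y)) (at y)" for y
    using DERIV_chain2[OF U DERIV_minus[OF DERIV_ident], of y] by simp
  have l: "((\<lambda>y. U (- y)) \<longlongrightarrow> a) at_top" using a(1) by (simp add: filterlim_at_bot_mirror)
  have "- k a = 0"
    by (rule tendsto_derivative_limit_zero[OF d l])
       (use tendsto_minus[OF isCont_tendsto_compose[OF a(2) l]] ode in simp)
  then show "k a = 0" by simp
qed

text \<open>Read from \<open>y1\<close> to the left, U' solves a linear equation with zero initial
  value. So \<open>U\<close> is constant on that half-line and equals its limit there.\<close>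

lemma equilibrium_reached_imp_constant:
  fixes U U' k k' :: "real \<Rightarrow> real"
  assumes U: "\<And>y. (U has_real_derivative U' y) (at y)" and ode: "\<And>y. U' y = k (U y)"
    and k: "\<And>y. (k has_real_derivative k' (U y)) (at (U y))" "continuous_on UNIV (\<lambda>y. k' (U y))"
    and y1: "k (U y1) = 0" and bot: "(U \<longlongrightarrow> a) at_bot"
  shows "U y1 = a"
proof -
  have "U' (y1 - r) = 0" if "0 \<le> r" for r
  proof -
    have "U' (y1 - r) = U' (y1 - 0) * exp (integral {0..r} (\<lambda>r. - k' (U (y1 - r))))"
    proof (rule linear_ode_unique[where e="\<lambda>r. U' (y1 - r)", OF _ _ that])
      show "continuous_on {0..} (\<lambda>r. - k' (U (y1 - r)))"
        by (intro continuous_intros continuous_on_compose2[OF k(2)]) auto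
      fix r :: real
      have "((\<lambda>r. U (y1 - r)) has_real_derivative U' (y1 - r) * (0 - 1)) (at r within {0..})"
        by (rule DERIV_chain2[OF U]) (intro DERIV_diff DERIV_const DERIV_ident)
      from DERIV_chain2[OF k(1) this]
      show "((\<lambda>r. U' (y1 - r)) has_real_derivative - k' (U (y1 - r)) * U' (y1 - r)) (at r within {0..})"
        by (simp add: ode)
    qed
    then show ?thesis by (simp add: ode y1)
  qed
  then have z: "U' y = 0" if "y \<le> y1" for y
  proof -
    have "U' (y1 - (y1 - y)) = 0" by (rule \<open>\<And>r. 0 \<le> r \<Longrightarrow> U' (y1 - r) = 0\<close>) (use that in simp)
    then show ?thesis by simp
  qed
  have const: "U y = U y1" if "y \<le> y1" for y
  proof (cases "y = y1")
    case False
    then have "y < y1" using that by simp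
    then obtain x where "x < y1" "U y1 - U y = (y1 - y) * U' x" using MVT2[of y y1 U U'] U by auto
    then show ?thesis using z[of x] by simp
  qed simp
  have "eventually (\<lambda>y. U y1 = U y) at_bot"
    unfolding eventually_at_bot_linorder by (intro exI[of _ y1] allI impI const[symmetric])
  then have "(U \<longlongrightarrow> U y1) at_bot" by (rule Lim_transform_eventually[OF tendsto_const])
  then show ?thesis using bot tendsto_unique[OF trivial_limit_at_bot_linorder] by blast
qed

text \<open>If the characteristics went to the right in the moving frame, \<open>up\<close> would repel the profile
  as \<open>y\<close> increases.\<close>

lemma characteristic_speed_sign:
  fixes U U' c c' g g' :: "real \<Rightarrow> real"
  assumes U: "\<And>y. (U has_real_derivative U' y) (at y)" and ode: "\<And>y. c (U y) * U' y = - g (U y)"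
    and c: "\<And>w. (c has_real_derivative c' w) (at w)" "continuous_on UNIV c'"
    and g: "\<And>w. (g has_real_derivative g' w) (at w)" "continuous_on UNIV g'"
    and lims: "(U \<longlongrightarrow> um) at_bot" "(U \<longlongrightarrow> up) at_top" and neq: "um \<noteq> up"
    and nz: "\<And>y. c (U y) \<noteq> 0" "c up \<noteq> 0" "c um \<noteq> 0" and g'up: "0 < g' up"
  shows "0 < c (U y)" "g um = 0" "g up = 0"
proof -
  have cc: "continuous_on A c" for A using c(1) by (meson DERIV_isCont continuous_at_imp_continuous_on)
  have gc: "continuous_on A g" for A using g(1) by (meson DERIV_isCont continuous_at_imp_continuous_on)
  have Uc: "continuous_on A U" for A using U by (meson DERIV_isCont continuous_at_imp_continuous_on)
  define k where "k w = - g w / c w" for w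
  define k' where "k' w = (- g' w * c w - - g w * c' w) / (c w * c w)" for w
  have ode': "U' y = k (U y)" for y using ode[of y] nz(1)[of y] by (simp add: k_def field_simps)
  have kc: "isCont k a" if "c a \<noteq> 0" for a
    unfolding k_def[abs_def] using that cc[of UNIV] gc[of UNIV]
    by (intro continuous_intros) (auto simp: continuous_on_eq_continuous_at)
  have kd: "(k has_real_derivative k' (U y)) (at (U y))" for y
    using DERIV_divide[OF DERIV_minus[OF g(1)] c(1) nz(1)[of y]] unfolding k_def[abs_def] k'_def .
  have k'c: "continuous_on UNIV (\<lambda>y. k' (U y))"
    unfolding k'_def using nz(1)
    by (intro continuous_intros continuous_on_compose2[OF cc[of UNIV] Uc] continuous_on_compose2[OF gc[of UNIV] Uc]
        continuous_on_compose2[OF c(2) Uc] continuous_on_compose2[OF g(2) Uc]) auto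
  have "k up = 0" "k um = 0"
    using endstates_are_equilibria[of U U' k, OF U ode'] lims kc nz by auto
  then show gz: "g um = 0" "g up = 0" using nz by (auto simp: k_def)
  have sign: "(\<forall>y. 0 < c (U y)) \<or> (\<forall>y. c (U y) < 0)"
  proof (rule ccontr)
    assume "\<not> ?thesis"
    then obtain p q where pq: "c (U p) < 0" "0 < c (U q)" using nz(1) by (metis linorder_neqE_linordered_idom)
    have "connected (range (\<lambda>y. c (U y)))"
      by (rule connected_continuous_image[OF continuous_on_compose2[OF cc[of UNIV] Uc] connected_UNIV]) auto
    then have "{c (U p)..c (U q)} \<subseteq> range (\<lambda>y. c (U y))" by (rule connected_contains_Icc) auto
    moreover have "0 \<in> {c (U p)..c (U q)}" using pq by simp
    ultimately have "0 \<in> range (\<lambda>y. c (U y))" by blast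
    then obtain y where "c (U y) = 0" by auto
    then show False using nz(1) by blast
  qed
  have "\<not> (\<forall>y. c (U y) < 0)"
  proof
    assume neg: "\<forall>y. c (U y) < 0"
    have "isCont g' up" using g(2) by (simp add: continuous_on_eq_continuous_at)
    then obtain e where e: "0 < e" "\<And>w. dist w up < e \<Longrightarrow> dist (g' w) (g' up) < g' up"
      using g'up unfolding continuous_at_eps_delta by blast
    have g'pos: "0 < g' w" if "\<bar>w - up\<bar> < e" for w using e(2)[of w] that by (auto simp: dist_real_def)
    have gs: "0 \<le> (w - up) * g w" if w: "\<bar>w - up\<bar> < e" for w
    proof (cases w up rule: linorder_cases)
      case less
      obtain z where z: "w < z" "z < up" "g up - g w = (up - w) * g' z" using MVT2[OF less g(1)] by blast
      then have "0 \<le> (up - w) * g' z" using g'pos[of z] w by (intro mult_nonneg_nonneg) auto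
      then show ?thesis using z gz less by (intro mult_nonpos_nonpos) auto
    next
      case greater
      obtain z where z: "up < z" "z < w" "g w - g up = (w - up) * g' z" using MVT2[OF greater g(1)] by blast
      then have "0 \<le> (w - up) * g' z" using g'pos[of z] w by (intro mult_nonneg_nonneg) auto
      then show ?thesis using z gz greater by (intro mult_nonneg_nonneg) auto
    qed simp
    obtain y1 where y1: "\<And>y. y1 \<le> y \<Longrightarrow> \<bar>U y - up\<bar> < e"
      using tendstoD[OF lims(2) e(1)] by (auto simp: eventually_at_top_linorder dist_real_def)
    \<comment> \<open>With \<open>c < 0\<close> the profile moves away from \<open>up\<close> as
      \<open>y\<close> increases, yet it converges to \<open>up\<close>. This is possible only if
      \<open>U y1 = up\<close> already, and then the profile is constant to the left of
      \<open>y1\<close>, against \<open>um \<noteq> up\<close>.\<close>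
    have mono: "(U y1 - up)\<^sup>2 \<le> (U y - up)\<^sup>2" if "y1 \<le> y" for y
    proof (rule DERIV_nonneg_imp_nondecreasing[OF that])
      fix x assume x: "y1 \<le> x" "x \<le> y"
      have d: "((\<lambda>y. (U y - up)\<^sup>2) has_real_derivative 2 * (U x - up) * U' x) (at x)"
        by (auto intro!: derivative_eq_intros U)
      have "(U x - up) * U' x = ((U x - up) * g (U x)) / (- c (U x))"
        using nz(1)[of x] by (simp add: ode' k_def field_simps)
      moreover have "0 \<le> ((U x - up) * g (U x)) / (- c (U x))"
        using gs[OF y1[OF x(1)]] neg by (intro divide_nonneg_pos) auto
      ultimately have "0 \<le> 2 * ((U x - up) * U' x)" by simp
      then have "0 \<le> 2 * (U x - up) * U' x" by (simp only: mult.assoc)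
      then show "\<exists>z. ((\<lambda>y. (U y - up)\<^sup>2) has_real_derivative z) (at x) \<and> 0 \<le> z" using d by blast
    qed
    have "((\<lambda>y. (U y - up)\<^sup>2) \<longlongrightarrow> (up - up)\<^sup>2) at_top" by (intro tendsto_intros lims)
    then have "(U y1 - up)\<^sup>2 \<le> (up - up)\<^sup>2"
      by (rule tendsto_lowerbound) (use mono in \<open>auto simp: eventually_at_top_linorder\<close>)
    then have "U y1 = up" by simp
    then have "k (U y1) = 0" by (simp add: k_def gz)
    from equilibrium_reached_imp_constant[of U U' k k', OF U ode' kd k'c this lims(1)]
    show False using \<open>U y1 = up\<close> neq by simp
  qed
  then show "0 < c (U y)" using sign by blast
qed

section \<open>Clamped coefficients around the profile\<close>

lemma smooth_DERIV: "smooth h \<Longrightarrow> (h has_real_derivative deriv h x) (at x)"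
  unfolding smooth_def DERIV_deriv_iff_field_differentiable by (metis funpow_0)

lemma smooth_deriv:
  assumes "smooth h"
  shows "smooth (deriv h)"
  unfolding smooth_def
proof (intro allI)
  fix n x
  have "(deriv ^^ Suc n) h field_differentiable at x" using assms unfolding smooth_def by blast
  then show "(deriv ^^ n) (deriv h) field_differentiable at x" by (simp add: funpow_swap1)
qed

lemma smooth_cont: "smooth h \<Longrightarrow> continuous_on A h"
  using smooth_DERIV by (meson DERIV_isCont continuous_at_imp_continuous_on)

lemma continuous_bounded_on_Icc:
  fixes h :: "real \<Rightarrow> real"
  assumes "continuous_on {p..q} h"
  shows "\<exists>B\<ge>0. \<forall>w\<in>{p..q}. \<bar>h w\<bar> \<le> B"
proof -
  have "bounded (h ` {p..q})" by (intro compact_imp_bounded compact_continuous_image assms) auto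
  then obtain B where B: "\<forall>x\<in>h ` {p..q}. norm x \<le> B" unfolding bounded_iff by blast
  have "\<bar>h w\<bar> \<le> \<bar>B\<bar>" if "w \<in> {p..q}" for w
  proof -
    have "norm (h w) \<le> B" using B that by blast
    then show ?thesis by simp
  qed
  then show ?thesis by (intro exI[of _ "\<bar>B\<bar>"]) simp
qed

lemma DERIV_imp_local_lipschitz_at:
  fixes k :: "real \<Rightarrow> real"
  assumes "(k has_real_derivative D) (at p)"
  obtains e where "0 < e" "\<And>w. \<bar>w - p\<bar> < e \<Longrightarrow> \<bar>k w - k p\<bar> \<le> (\<bar>D\<bar> + 1) * \<bar>w - p\<bar>"
proof -
  have "((\<lambda>w. (k w - k p) / (w - p)) \<longlongrightarrow> D) (at p)"
    using assms by (simp add: has_field_derivative_iff)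
  from tendstoD[OF this zero_less_one]
  obtain e where e: "0 < e" "\<And>w. w \<noteq> p \<Longrightarrow> \<bar>w - p\<bar> < e \<Longrightarrow> \<bar>(k w - k p) / (w - p) - D\<bar> < 1"
    unfolding eventually_at by (auto simp: dist_real_def)
  have "\<bar>k w - k p\<bar> \<le> (\<bar>D\<bar> + 1) * \<bar>w - p\<bar>" if "\<bar>w - p\<bar> < e" for w
  proof (cases "w = p")
    case False
    then have "\<bar>(k w - k p) / (w - p)\<bar> \<le> \<bar>D\<bar> + 1" using e(2)[OF False that] by linarith
    then show ?thesis using False by (simp add: abs_div pos_divide_le_eq)
  qed simp
  then show ?thesis using e(1) by (rule that[rotated])
qed

text \<open>The closure of the range of \<open>U\<close> is a compact interval on which
  \<open>c\<close> has a positive lower bound; half of it survives on a slightly larger interval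
  \<open>N\<close>. Composing g / c and 1 / c with a clamp into \<open>N\<close> gives globally
  bounded C^1 coefficients that are unchanged within \<open>\<eta>\<close> of the profile.\<close>

lemma wave_data_exists:
  fixes f g U :: "real \<Rightarrow> real"
  assumes f: "smooth f" and g: "smooth g" and U: "smooth U"
    and tw: "traveling_wave f g \<sigma> U"
    and ends: "has_endstates U um up"
    and nc: "noncharacteristic f \<sigma> U um up"
    and um: "deriv g um < 0" and up: "0 < deriv g up"
  defines "\<kappa> \<equiv> deriv g up / \<bar>deriv f up - \<sigma>\<bar>"
  obtains G G' L M d K b b' b0 b1 Lb \<eta> where
    "wave_data G G' L M U um up \<kappa> d K b b' b0 b1 Lb" "0 < \<eta>"
    "\<And>w y. \<bar>w - U y\<bar> \<le> \<eta> \<Longrightarrow> b w * (\<sigma> - deriv f w) = 1 \<and> G w = b w * g w"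
proof -
  define c where "c w = \<sigma> - deriv f w" for w
  define c' where "c' w = - deriv (deriv f) w" for w
  note f1 = smooth_deriv[OF f] and f2 = smooth_deriv[OF smooth_deriv[OF f]] and g1 = smooth_deriv[OF g]
  have cd: "(c has_real_derivative c' w) (at w)" for w
    unfolding c_def[abs_def] c'_def using DERIV_diff[OF DERIV_const smooth_DERIV[OF f1]] by simp
  have c'c: "continuous_on A c'" for A unfolding c'_def[abs_def] by (intro continuous_intros smooth_cont f2)
  have cc: "continuous_on A c" for A using cd by (meson DERIV_isCont continuous_at_imp_continuous_on)
  note gd = smooth_DERIV[OF g] and gc = smooth_cont[OF g] and g'c = smooth_cont[OF g1]
  note Ud = smooth_DERIV[OF U] and Uc = smooth_cont[OF U] and U'c = smooth_cont[OF smooth_deriv[OF U]]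
  have bot: "(U \<longlongrightarrow> um) at_bot" and top: "(U \<longlongrightarrow> up) at_top" using ends by (auto simp: has_endstates_def)
  have neq: "um \<noteq> up" using um up by auto
  have nz: "c (U y) \<noteq> 0" "c up \<noteq> 0" "c um \<noteq> 0" for y
    using nc by (auto simp: noncharacteristic_def c_def)
  obtain BU where BU: "\<And>y. \<bar>U y\<bar> \<le> BU" using continuous_with_limits_bounded[OF Uc bot top] by blast
  have ode: "c (U y) * deriv U y = - g (U y)" for y
    using traveling_wave_profile_ode[OF tw smooth_DERIV[OF f] smooth_cont[OF f1] gc Ud U'c BU, of y]
    by (simp add: c_def algebra_simps)
  note sign = characteristic_speed_sign[of U "deriv U" c g c' "deriv g", OF Ud ode cd c'c gd g'c bot top neq nz up]
  have icc: "isCont c w" for w using cd DERIV_isCont by blast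
  have lim: "((\<lambda>y. c (U y)) \<longlongrightarrow> c um) at_bot" "((\<lambda>y. c (U y)) \<longlongrightarrow> c up) at_top"
    using isCont_tendsto_compose[OF icc bot] isCont_tendsto_compose[OF icc top] by auto
  \<comment> \<open>The function 1 / c(U) is continuous with finite limits at both ends, because
    \<open>c\<close> is nonzero at the endstates; its bound yields the uniform lower bound
    \<open>c0\<close> for \<open>c\<close> on the profile.\<close>
  obtain B where B: "\<And>y. \<bar>inverse (c (U y))\<bar> \<le> B"
  proof -
    have "continuous_on UNIV (\<lambda>y. inverse (c (U y)))"
      using nz by (intro continuous_intros continuous_on_compose2[OF cc[of UNIV] Uc]) auto
    from continuous_with_limits_bounded[OF this tendsto_inverse[OF lim(1) nz(3)] tendsto_inverse[OF lim(2) nz(2)]]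
    show ?thesis using that by blast
  qed
  define c0 where "c0 = inverse B"
  have "0 < \<bar>inverse (c (U 0))\<bar>" using nz(1)[of 0] by simp
  then have Bpos: "0 < B" using B[of 0] by linarith
  have c0: "0 < c0" "c0 \<le> c (U y)" for y
  proof -
    show "0 < c0" using Bpos by (simp add: c0_def)
    have "inverse (c (U y)) \<le> B" using B[of y] by (rule abs_le_D1)
    then have "inverse B \<le> inverse (inverse (c (U y)))" using sign(1)[of y] by (intro le_imp_inverse_le) auto
    then show "c0 \<le> c (U y)" by (simp add: c0_def)
  qed
  define S where "S = closure (range U)"
  have "bounded (range U)" unfolding bounded_iff using BU by auto
  then have "compact S" unfolding S_def by simp
  moreover have "connected S"
    unfolding S_def by (intro connected_imp_connected_closure connected_continuous_image Uc connected_UNIV)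
  ultimately obtain a e where ae: "S = {a..e}" using connected_compact_interval_1[of S] by auto
  have US: "U y \<in> {a..e}" for y using closure_subset[of "range U"] unfolding ae[symmetric] S_def by blast
  have ale: "a \<le> e" using US[of 0] by simp
  have upS: "up \<in> {a..e}"
    by (rule Lim_in_closed_set[OF _ _ _ top]) (use US in auto)
  have umS: "um \<in> {a..e}"
    by (rule Lim_in_closed_set[OF _ _ _ bot]) (use US in auto)
  have cS: "c0 \<le> c w" if "w \<in> {a..e}" for w
  proof -
    have "closed {w. c0 \<le> c w}" by (intro closed_Collect_le continuous_intros cc)
    then have "S \<subseteq> {w. c0 \<le> c w}" unfolding S_def using c0 by (intro closure_minimal) auto
    then show ?thesis using that ae by auto
  qed
  have loc: "\<exists>r>0. \<forall>w. \<bar>w - p\<bar> < r \<longrightarrow> c0 / 2 \<le> c w" if "p \<in> {a..e}" for p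
  proof -
    obtain r where "0 < r" "\<And>w. dist w p < r \<Longrightarrow> dist (c w) (c p) < c0 / 2"
      using icc[of p] c0(1) unfolding continuous_at_eps_delta by (meson half_gt_zero)
    moreover have "c0 / 2 \<le> c w" if "\<bar>c w - c p\<bar> < c0 / 2" for w
      using cS[OF \<open>p \<in> {a..e}\<close>] that by linarith
    ultimately show ?thesis by (intro exI[of _ r]) (auto simp: dist_real_def)
  qed
  obtain ra re where r: "0 < ra" "0 < re" "\<And>w. \<bar>w - a\<bar> < ra \<Longrightarrow> c0 / 2 \<le> c w" "\<And>w. \<bar>w - e\<bar> < re \<Longrightarrow> c0 / 2 \<le> c w"
    using loc[of a] loc[of e] ale by auto
  define \<eta> where "\<eta> = min ra re / 3"
  have \<eta>: "0 < \<eta>" "2 * \<eta> < ra" "2 * \<eta> < re" using r by (auto simp: \<eta>_def)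
  \<comment> \<open>One \<open>\<eta>\<close> for the zone where the clamp is the identity, a second
    one for its overshoot.\<close>
  define N where "N = {a - \<eta> - \<eta>..e + \<eta> + \<eta>}"
  have cN: "c0 / 2 \<le> c w" "0 < c w" if "w \<in> N" for w
  proof -
    consider "w < a" | "w \<in> {a..e}" | "e < w" by fastforce
    then show 1: "c0 / 2 \<le> c w"
    proof cases
      case 1 then show ?thesis using r(3)[of w] that \<eta> by (auto simp: N_def)
    next
      case 2 then show ?thesis using cS[of w] c0(1) by simp
    next
      case 3 then show ?thesis using r(4)[of w] that \<eta> by (auto simp: N_def)
    qed
    show "0 < c w" using 1 c0(1) by linarith
  qed
  have le: "a - \<eta> \<le> e + \<eta>" using ale \<eta> by simp
  show ?thesis
  proof (rule C1_clamp[OF le \<eta>(1), folded N_def])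
    fix cl cl'
    assume cl: "\<And>w. (cl has_real_derivative cl' w) (at w)" "continuous_on UNIV cl'"
      "\<And>w. \<bar>cl' w\<bar> \<le> 16" "\<And>w. a - \<eta> \<le> w \<Longrightarrow> w \<le> e + \<eta> \<Longrightarrow> cl w = w"
      "\<And>w. a - \<eta> < w \<Longrightarrow> w < e + \<eta> \<Longrightarrow> cl' w = 1" "\<And>w. cl w \<in> N"
    have clc: "continuous_on A cl" for A using cl(1) by (meson DERIV_isCont continuous_at_imp_continuous_on)
    \<comment> \<open>\<open>k\<close> and \<open>j\<close> are the derivatives of g / c and of 1 /
      c by the quotient rule.\<close>
    define k where "k w = (deriv g w * c w - g w * c' w) / (c w * c w)" for w
    define j where "j w = - c' w / (c w * c w)" for w
    have cnz: "c w \<noteq> 0" if "w \<in> N" for w using cN(2)[OF that] by simp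
    have kN: "continuous_on N k" unfolding k_def using cnz by (intro continuous_intros cc c'c gc g'c) auto
    have jN: "continuous_on N j" unfolding j_def using cnz by (intro continuous_intros cc c'c) auto
    define G where "G w = g (cl w) / c (cl w)" for w
    define G' where "G' w = k (cl w) * cl' w" for w
    define b where "b w = 1 / c (cl w)" for w
    define b' where "b' w = j (cl w) * cl' w" for w
    have bd: "\<exists>B\<ge>0. \<forall>w\<in>N. \<bar>h w\<bar> \<le> B" if "continuous_on N h" for h :: "real \<Rightarrow> real"
      using continuous_bounded_on_Icc that unfolding N_def by blast
    obtain Bk where Bk: "0 \<le> Bk" "\<And>w. w \<in> N \<Longrightarrow> \<bar>k w\<bar> \<le> Bk" using bd[OF kN] by blast
    obtain Bj where Bj: "0 \<le> Bj" "\<And>w. w \<in> N \<Longrightarrow> \<bar>j w\<bar> \<le> Bj" using bd[OF jN] by blast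
    have "continuous_on N (\<lambda>w. g w / c w)" using cnz by (intro continuous_intros cc gc) auto
    then obtain BG where BG: "0 \<le> BG" "\<And>w. w \<in> N \<Longrightarrow> \<bar>g w / c w\<bar> \<le> BG" using bd by blast
    obtain Bc where Bc: "0 \<le> Bc" "\<And>w. w \<in> N \<Longrightarrow> \<bar>c w\<bar> \<le> Bc" using bd[OF cc] by blast
    have Bcpos: "0 < Bc" using Bc(2)[OF cl(6)[of 0]] cN(2)[OF cl(6)[of 0]] by linarith
    have near: "cl w = w" "w \<in> N" if "\<bar>w - U y\<bar> \<le> \<eta>" for w y
      using that US[of y] \<eta> by (auto intro!: cl(4) simp: N_def)
    have upN: "up \<in> N" "umN \<in> N" if "umN = um" for umN using upS umS that \<eta> by (auto simp: N_def)
    have inner: "cl w = w" "cl' w = 1" if "\<bar>w - p\<bar> < \<eta>" "p \<in> {a..e}" for w p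
      using that by (auto intro!: cl(4,5))
    \<comment> \<open>Differentiability of \<open>k\<close> at \<open>up\<close>, thus second
      derivatives of \<open>g\<close> and third derivatives of \<open>f\<close>, provides the
      Lipschitz type bound on \<open>G'\<close> at \<open>up\<close>.\<close>
    have kd: "\<exists>D. (k has_real_derivative D) (at up)"
    proof -
      have "k field_differentiable (at up)"
        unfolding k_def[abs_def] c_def[abs_def] c'_def[abs_def]
        using f f1 f2 g g1 nz(2) unfolding c_def
        by (intro derivative_intros) (use smooth_DERIV in \<open>auto simp: field_differentiable_def\<close>)
      then show ?thesis by (simp add: field_differentiable_def)
    qed
    then obtain D r where r: "0 < r" "\<And>w. \<bar>w - up\<bar> < r \<Longrightarrow> \<bar>k w - k up\<bar> \<le> (\<bar>D\<bar> + 1) * \<bar>w - up\<bar>"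
      using DERIV_imp_local_lipschitz_at by metis
    have cup: "0 < c up" "0 < c um" using cS[OF upS] cS[OF umS] c0(1) by auto
    \<comment> \<open>Since \<open>g up = 0\<close>, only g'(up) / c(up) remains of the quotient
      rule, and \<open>c up > 0\<close> identifies the denominator with the modulus in the
      definition of \<open>\<kappa>\<close>.\<close>
    have kup: "k up = \<kappa>"
      using cup sign(3) by (simp add: k_def \<kappa>_def c_def)
    have kum: "k um < 0"
      using cup sign(2) um by (simp add: k_def divide_less_0_iff mult_less_0_iff)
    have \<kappa>pos: "0 < \<kappa>" unfolding \<kappa>_def using up nz(2) by (simp add: c_def)
    define d where "d = min r \<eta> / 2"
    \<comment> \<open>The factor 16 is the slope of the clamp; the added 1 makes the Lipschitz
      constant of \<open>G\<close> positive. The slowness lies between \<open>1 / Bc\<close> and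
      \<open>2 / c0\<close> because \<open>c\<close> lies between \<open>c0 / 2\<close> and
      \<open>Bc\<close> on \<open>N\<close>.\<close>
    have wd: "wave_data G G' (16 * Bk + 1) BG U um up \<kappa> d (\<bar>D\<bar> + 1) b b' (1 / Bc) (2 / c0) (16 * Bj)"
    proof unfold_locales
      show "(G has_real_derivative G' w) (at w)" for w
      proof -
        have "((\<lambda>w. g w / c w) has_real_derivative k (cl w)) (at (cl w))"
          unfolding k_def using cnz[OF cl(6)] by (intro DERIV_divide gd cd)
        from DERIV_chain2[OF this cl(1)] show ?thesis by (simp add: G_def[abs_def] G'_def)
      qed
      show "continuous_on UNIV G'" unfolding G'_def
        by (intro continuous_intros continuous_on_compose2[OF kN] clc cl(2)) (use cl(6) in auto)
      show "\<bar>G' w\<bar> \<le> 16 * Bk + 1" for w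
        using mult_mono[OF Bk(2)[OF cl(6)[of w]] cl(3)[of w]] Bk(1) by (simp add: G'_def abs_mult)
      show "\<bar>G w\<bar> \<le> BG" for w using BG(2)[OF cl(6)[of w]] by (simp add: G_def)
      show "0 < 16 * Bk + 1" using Bk(1) by simp
      show "(U has_real_derivative - G (U y)) (at y)" for y
      proof -
        have "cl (U y) = U y" using near(1)[of "U y" y] \<eta> by simp
        then have "- G (U y) = deriv U y" using ode[of y] nz(1)[of y] by (simp add: G_def field_simps)
        then show ?thesis using Ud by simp
      qed
      show "(U \<longlongrightarrow> um) at_bot" "(U \<longlongrightarrow> up) at_top" "um \<noteq> up" by (fact bot top neq)+
      show "G um = 0" "G up = 0" using inner(1)[of um um] inner(1)[of up up] umS upS \<eta> sign by (auto simp: G_def)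
      show "G' um < 0" using inner[of um um] umS \<eta> kum by (simp add: G'_def)
      show "0 < \<kappa>" by (fact \<kappa>pos)
      show "0 < d" using r \<eta> by (simp add: d_def)
      show "\<bar>G' w - \<kappa>\<bar> \<le> (\<bar>D\<bar> + 1) * \<bar>w - up\<bar>" if "\<bar>w - up\<bar> \<le> d" for w
      proof -
        have "\<bar>w - up\<bar> < \<eta>" "\<bar>w - up\<bar> < r" using that r(1) \<eta>(1) by (auto simp: d_def min_def split: if_splits)
        then show ?thesis using inner[of w up] upS r(2)[of w] by (simp add: G'_def kup)
      qed
      show "(b has_real_derivative b' w) (at w)" for w
      proof -
        have "((\<lambda>w. 1 / c w) has_real_derivative (0 * c (cl w) - 1 * c' (cl w)) / (c (cl w) * c (cl w))) (at (cl w))"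
          using cnz[OF cl(6)] by (intro DERIV_divide DERIV_const cd)
        from DERIV_chain2[OF this cl(1)] show ?thesis by (simp add: b_def[abs_def] b'_def j_def)
      qed
      show "continuous_on UNIV b'" unfolding b'_def
        by (intro continuous_intros continuous_on_compose2[OF jN] clc cl(2)) (use cl(6) in auto)
      show "\<bar>b' w\<bar> \<le> 16 * Bj" for w
        using mult_mono[OF Bj(2)[OF cl(6)[of w]] cl(3)[of w]] Bj(1) by (simp add: b'_def abs_mult)
      show "1 / Bc \<le> b w" for w
        unfolding b_def using Bc(2)[OF cl(6)[of w]] cN(2)[OF cl(6)[of w]] by (intro divide_left_mono) auto
      show "b w \<le> 2 / c0" for w
      proof -
        have "1 / c (cl w) \<le> 1 / (c0 / 2)"
          using cN[OF cl(6)[of w]] c0(1) by (intro divide_left_mono) auto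
        then show ?thesis by (simp add: b_def)
      qed
      show "0 < 1 / Bc" using Bcpos by simp
    qed
    show ?thesis
    proof (rule that[OF wd \<eta>(1)])
      fix w y assume "\<bar>w - U y\<bar> \<le> \<eta>"
      from near[OF this] cnz show "b w * (\<sigma> - deriv f w) = 1 \<and> G w = b w * g w"
        by (simp add: b_def G_def c_def[symmetric])
    qed
  qed
qed

section \<open>Return to the original frame\<close>

lemma AE_lborel_eq_shift:
  fixes h k :: "real \<Rightarrow> real"
  assumes [measurable]: "h \<in> borel_measurable borel" "k \<in> borel_measurable borel"
    and "AE x in lborel. h x = k x"
  shows "AE x in lborel. h (x + c) = k (x + c)"
proof -
  have "AE x in distr lborel borel ((+) c). h x = k x"
    by (subst lborel_distr_plus) (rule assms(3))
  then have "AE x in lborel. h (c + x) = k (c + x)"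
    by (subst (asm) AE_distr_iff) measurable
  then show ?thesis by (simp add: add.commute)
qed

lemma lipschitz_half_line:
  fixes k k' :: "real \<Rightarrow> real"
  assumes c: "continuous_on {0..} k" and d: "\<And>t. 0 < t \<Longrightarrow> (k has_real_derivative k' t) (at t)"
    and b: "\<And>t. 0 < t \<Longrightarrow> \<bar>k' t\<bar> \<le> B" and st: "0 \<le> s" "0 \<le> t"
  shows "\<bar>k s - k t\<bar> \<le> B * \<bar>s - t\<bar>"
proof -
  have *: "\<bar>k s - k t\<bar> \<le> B * \<bar>s - t\<bar>" if st: "s < t" "0 \<le> s" for s t
  proof -
    have cst: "continuous_on {s..t} k" by (rule continuous_on_subset[OF c]) (use st in auto)
    obtain x where x: "x \<in> {s<..<t}" "k t - k s = k' x * (t - s)"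
      using mvt[OF st(1) cst, of "\<lambda>x h. k' x * h"] d st(2) by (auto simp: has_field_derivative_def)
    have "\<bar>k s - k t\<bar> = \<bar>k' x\<bar> * \<bar>s - t\<bar>" using x(2) by (metis abs_minus_commute abs_mult)
    also have "\<dots> \<le> B * \<bar>s - t\<bar>" using x(1) st(2) by (intro mult_right_mono b) auto
    finally show ?thesis .
  qed
  show ?thesis
    using *[of s t] *[of t s] st by (cases s t rule: linorder_cases) (auto simp: abs_minus_commute)
qed

text \<open>The shear x - \<sigma> t turns the moving frame equation into the conservation law, and
  the bounds on both derivatives combine to a Lipschitz bound in time at fixed x. Comparison with
  other entropy solutions takes place in the fixed frame, where they are defined; its almost
  everywhere conclusion is then translated.\<close>

lemma moving_frame_solution:
  fixes f g u0 :: "real \<Rightarrow> real" and v vt vy :: "real \<Rightarrow> real \<Rightarrow> real"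
  assumes f: "smooth f" and g: "smooth g"
    and vc: "continuous_on ({0..} \<times> UNIV) (\<lambda>p. v (fst p) (snd p))"
    and vtc: "continuous_on ({0..} \<times> UNIV) (\<lambda>p. vt (fst p) (snd p))"
    and vyc: "continuous_on ({0..} \<times> UNIV) (\<lambda>p. vy (fst p) (snd p))"
    and der: "\<And>t y. 0 < t \<Longrightarrow> ((\<lambda>p. v (fst p) (snd p)) has_derivative (\<lambda>h. vt t y * fst h + vy t y * snd h)) (at (t, y))"
    and pde: "\<And>t y. 0 \<le> t \<Longrightarrow> vt t y - (\<sigma> - deriv f (v t y)) * vy t y = g (v t y)"
    and init: "\<And>y. v 0 y = u0 y"
    and Mv: "\<And>t y. 0 \<le> t \<Longrightarrow> \<bar>v t y\<bar> \<le> Mv"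
    and Bt: "\<And>t y. 0 \<le> t \<Longrightarrow> \<bar>vt t y\<bar> \<le> Bt"
    and Bx: "\<And>t y. 0 \<le> t \<Longrightarrow> \<bar>vy t y\<bar> \<le> Bx"
  shows "entropy_solution f g u0 (\<lambda>t x. v t (x - \<sigma> * t))"
    and "\<And>u t. entropy_solution f g u0 u \<Longrightarrow> 0 \<le> t \<Longrightarrow> AE x in lborel. u t (x + \<sigma> * t) = v t x"
proof -
  define w where "w t x = v t (x - \<sigma> * t)" for t x
  define wt where "wt p = vt (fst p) (snd p - \<sigma> * fst p) - \<sigma> * vy (fst p) (snd p - \<sigma> * fst p)" for p
  define wx where "wx p = vy (fst p) (snd p - \<sigma> * fst p)" for p
  have shift: "continuous_on ({0..} \<times> UNIV) (\<lambda>p. k (fst p) (snd p - \<sigma> * fst p))"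
    if "continuous_on ({0..} \<times> UNIV) (\<lambda>p. k (fst p) (snd p))" for k :: "real \<Rightarrow> real \<Rightarrow> real"
  proof -
    have "continuous_on ({0..} \<times> UNIV) (\<lambda>p::real \<times> real. (fst p, snd p - \<sigma> * fst p))" by (intro continuous_intros)
    from continuous_on_compose2[OF that this] show ?thesis by (auto simp: image_subset_iff)
  qed
  have wc: "continuous_on ({0..} \<times> UNIV) (\<lambda>p. w (fst p) (snd p))" unfolding w_def by (rule shift[OF vc])
  have sub: "{0<..} \<times> UNIV \<subseteq> ({0..} \<times> UNIV :: (real \<times> real) set)" by auto
  have hp: "half_plane_C1 (\<lambda>p. w (fst p) (snd p)) wt wx"
    unfolding half_plane_C1_def
  proof (intro conjI ballI)
    fix p :: "real \<times> real" assume "p \<in> {0<..} \<times> UNIV"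
    then have t: "0 < fst p" by auto
    have 1: "((\<lambda>p. (fst p, snd p - \<sigma> * fst p)) has_derivative (\<lambda>h. (fst h, snd h - \<sigma> * fst h))) (at p)"
      by (auto intro!: derivative_eq_intros)
    note hd = has_derivative_compose[OF 1 der[OF t, of "snd p - \<sigma> * fst p"], unfolded fst_conv snd_conv]
    show "((\<lambda>p. w (fst p) (snd p)) has_derivative (\<lambda>h. wt p * fst h + wx p * snd h)) (at p)"
      unfolding w_def wt_def wx_def by (rule has_derivative_eq_rhs[OF hd]) (auto simp: algebra_simps)
  next
    show "continuous_on ({0<..} \<times> UNIV) wt" unfolding wt_def
      by (intro continuous_intros continuous_on_subset[OF shift[OF vtc] sub] continuous_on_subset[OF shift[OF vyc] sub])
    show "continuous_on ({0<..} \<times> UNIV) wx" unfolding wx_def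
      by (rule continuous_on_subset[OF shift[OF vyc] sub])
  qed
  have eq: "wt p + deriv f (w (fst p) (snd p)) * wx p = g (w (fst p) (snd p))" if "p \<in> {0<..} \<times> UNIV" for p
    using pde[of "fst p" "snd p - \<sigma> * fst p"] that by (auto simp: w_def wt_def wx_def algebra_simps)
  have wlip: "\<bar>w s x - w t x\<bar> \<le> (Bt + \<bar>\<sigma>\<bar> * Bx) * \<bar>s - t\<bar>" if "0 \<le> s" "0 \<le> t" for s t x
  proof (rule lipschitz_half_line[of "\<lambda>t. w t x" "\<lambda>t. wt (t, x)", OF _ _ _ that])
    have "continuous_on {0..} (\<lambda>t. (t, x))" by (intro continuous_intros)
    from continuous_on_compose2[OF wc this] show "continuous_on {0..} (\<lambda>t. w t x)" by auto
    fix t :: real assume t: "0 < t"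
    have 1: "((\<lambda>t. (t, x)) has_derivative (\<lambda>h. (h, 0))) (at t)" by (auto intro!: derivative_eq_intros)
    have 2: "((\<lambda>p. w (fst p) (snd p)) has_derivative (\<lambda>h. wt (t, x) * fst h + wx (t, x) * snd h)) (at (t, x))"
      by (rule half_plane_C1D[OF hp]) (use t in auto)
    from has_derivative_compose[OF 1 2] show "((\<lambda>t. w t x) has_real_derivative wt (t, x)) (at t)"
      by (simp add: has_field_derivative_def)
    have "\<bar>\<sigma> * vy t (x - \<sigma> * t)\<bar> \<le> \<bar>\<sigma>\<bar> * Bx"
      unfolding abs_mult using Bx[of t] t by (intro mult_left_mono) auto
    then show "\<bar>wt (t, x)\<bar> \<le> Bt + \<bar>\<sigma>\<bar> * Bx" using Bt[of t "x - \<sigma> * t"] t unfolding wt_def fst_conv snd_conv by linarith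
  qed
  show "entropy_solution f g u0 (\<lambda>t x. v t (x - \<sigma> * t))"
    unfolding w_def[symmetric]
    by (rule classical_imp_entropy_solution[OF hp smooth_DERIV[OF f] smooth_cont[OF smooth_deriv[OF f]] smooth_cont[OF g] eq wc _ wlip])
       (use Mv init in \<open>auto simp: w_def\<close>)
  fix u t assume u: "entropy_solution f g u0 u" and t: "(0::real) \<le> t"
  \<comment> \<open>The primitive of the flux that enters the quadratic entropy flux.\<close>
  have "\<exists>F. \<forall>z. - \<infinity> < ereal z \<longrightarrow> ereal z < \<infinity> \<longrightarrow> (F has_vector_derivative f z) (at z)"
    by (rule einterval_antiderivative)
       (use smooth_DERIV[OF f] DERIV_isCont in auto)
  then obtain F where F: "\<And>z. (F has_real_derivative f z) (at z)"
    by (auto simp: has_real_derivative_iff_has_vector_derivative)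
  interpret weak_strong f "deriv f" "deriv (deriv f)" g "deriv g" F u0 u w wt wx Mv Bx "Bt + \<bar>\<sigma>\<bar> * Bx"
  proof unfold_locales
    show "\<bar>wx p\<bar> \<le> Bx" if "p \<in> {0<..} \<times> UNIV" for p using that by (auto simp: wx_def intro!: Bx)
    show "\<bar>w t x\<bar> \<le> Mv" if "0 \<le> t" for t x using that by (simp add: w_def Mv)
    show "w 0 x = u0 x" for x by (simp add: w_def init)
  qed (fact u F smooth_DERIV[OF f] smooth_DERIV[OF smooth_deriv[OF f]] smooth_cont[OF smooth_deriv[OF smooth_deriv[OF f]]]
       smooth_DERIV[OF g] smooth_cont[OF smooth_deriv[OF g]] hp eq wc wlip)+
  have "AE x in lborel. u t x = w t x" by (rule weak_strong_uniqueness[OF t])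
  moreover have "(\<lambda>x. w t x) \<in> borel_measurable borel"
  proof (rule borel_measurable_continuous_onI)
    have "continuous_on UNIV (\<lambda>x. (t, x))" by (intro continuous_intros)
    from continuous_on_compose2[OF wc this] t show "continuous_on UNIV (\<lambda>x. w t x)" by auto
  qed
  ultimately have "AE x in lborel. u t (x + \<sigma> * t) = w t (x + \<sigma> * t)"
    by (intro AE_lborel_eq_shift entropy_solution_slice_measurable[OF u t])
  then show "AE x in lborel. u t (x + \<sigma> * t) = v t x" by (simp add: w_def)
qed

section \<open>The two decay assertions\<close>

lemma exp_weight_facts:
  assumes "0 < \<kappa>"
  shows "0 < exp_weight \<kappa> x" "exp_weight \<kappa> x \<le> 1" "antimono (exp_weight \<kappa>)" "continuous_on A (exp_weight \<kappa>)"
  using assms by (auto simp: exp_weight_def[abs_def] antimono_def intro!: continuous_intros)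

theorem theorem2:
  fixes f g U :: "real \<Rightarrow> real" and \<sigma> um up \<kappa> :: real
  assumes "smooth f" and "smooth g" and "smooth U"
    and "traveling_wave f g \<sigma> U"
    and "has_endstates U um up"
    and "noncharacteristic f \<sigma> U um up"
    and "deriv g um < 0" and "0 < deriv g up"
    and "\<kappa> = deriv g up / \<bar>deriv f up - \<sigma>\<bar>"
  shows "\<exists>\<delta>0>0. \<forall>\<rho>. subexponential_weight \<rho> \<longrightarrow>
    (\<exists>C>0. \<exists>\<theta>>0. \<forall>u0 :: real \<Rightarrow> real.
      BUC1 u0 \<and>
      BUC0 (\<lambda>x. (u0 x - U x) / exp_weight \<kappa> x) \<and>
      BUC0 (\<lambda>x. deriv (\<lambda>y. u0 y - U y) x / exp_weight \<kappa> x) \<and>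
      W1inf_exp_norm \<kappa> (\<lambda>x. u0 x - U x) \<le> ereal \<delta>0 \<longrightarrow>
      (\<exists>u. entropy_solution f g u0 u) \<and>
      (\<forall>u. entropy_solution f g u0 u \<longrightarrow>
        (((\<lambda>x. exp (\<kappa> * x) *\<^sub>R (u0 x - U x, deriv (\<lambda>y. u0 y - U y) x)) \<longlongrightarrow> (0, 0)) at_top \<longrightarrow>
          ((\<lambda>t. W1inf_exp_norm \<kappa> (\<lambda>x. u t (x + \<sigma> * t) - U x)) \<longlongrightarrow> 0) at_top) \<and>
        (W1inf_subexp_norm \<kappa> \<rho> (\<lambda>x. u0 x - U x) < \<infinity> \<longrightarrow>
          (\<forall>t\<ge>0. W1inf_exp_norm \<kappa> (\<lambda>x. u t (x + \<sigma> * t) - U x)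
             \<le> ereal C * W1inf_subexp_norm \<kappa> \<rho> (\<lambda>x. u0 x - U x) * ereal (\<rho> (\<theta> * t))))))"
proof -
  note Usm = assms(3)
  obtain G G' L M d K b b' b0 b1 Lb \<eta> where
    wd: "wave_data G G' L M U um up \<kappa> d K b b' b0 b1 Lb" and \<eta>: "0 < \<eta>"
    and bG: "\<And>w y. \<bar>w - U y\<bar> \<le> \<eta> \<Longrightarrow> b w * (\<sigma> - deriv f w) = 1 \<and> G w = b w * g w"
    by (rule wave_data_exists[OF assms(1-8), folded assms(9)]) (rule that; assumption)
  interpret wave_data G G' L M U um up \<kappa> d K b b' b0 b1 Lb by (rule wd)
  note W = exp_weight_facts[OF \<kappa>_pos]
  show ?thesis
  proof (rule perturbed_solution[OF \<eta>])
    fix \<epsilon> C3 \<theta> :: real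
    assume eps: "0 < \<epsilon>" "0 < C3" "0 < \<theta>" and sol:
      "\<And>u0 u0' :: real \<Rightarrow> real. \<lbrakk>\<And>y. (u0 has_real_derivative u0' y) (at y); continuous_on UNIV u0';
         \<And>y. \<bar>u0 y - U y\<bar> + \<bar>u0' y + G (U y)\<bar> \<le> \<epsilon> * exp_weight \<kappa> y\<rbrakk> \<Longrightarrow>
         \<exists>v vt vy. tracks_profile C3 \<theta> \<eta> u0 u0' v vt vy"
    have dU: "deriv U y = - G (U y)" for y using U_deriv DERIV_imp_deriv by blast
    have Uc: "continuous_on A U" for A by (rule U_cont)
    have GUc: "continuous_on A (\<lambda>y. G (U y))" for A
      by (rule continuous_on_compose2[OF G_cont[of UNIV] Uc]) auto
    obtain BU where BU: "\<And>y. \<bar>U y\<bar> \<le> BU" using U_bounded by blast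
    \<comment> \<open>Everything both assertions need about one datum. \<open>D Y\<close> is the
      weighted perturbation at the foot \<open>Y\<close>; a bound \<open>R\<close> for the norm at
      time \<open>t\<close> only has to dominate the undamped contribution of feet beyond
      \<open>\<theta> * t\<close> and the damped contribution of all feet. The last clause converts
      a norm with another weight into a bound on \<open>D\<close>.\<close>
    have main: "\<exists>D. (\<forall>Y. D Y = (\<bar>u0 Y - U Y\<bar> + \<bar>deriv (\<lambda>y. u0 y - U y) Y\<bar>) / exp_weight \<kappa> Y) \<and> (\<forall>Y. D Y \<le> \<epsilon>) \<and>
        (\<exists>u. entropy_solution f g u0 u) \<and>
        (\<forall>u t R. entropy_solution f g u0 u \<longrightarrow> 0 \<le> t \<longrightarrow>
           (\<forall>Y. \<theta> * t \<le> Y \<longrightarrow> C3 * D Y \<le> R) \<longrightarrow> (\<forall>Y. C3 * (exp (- \<theta> * t) * D Y) \<le> R) \<longrightarrow>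
           W1inf_exp_norm \<kappa> (\<lambda>x. u t (x + \<sigma> * t) - U x) \<le> ereal R) \<and>
        (\<forall>W E. (\<forall>x. 0 < W x) \<longrightarrow> antimono W \<longrightarrow> W1inf_norm W (\<lambda>x. u0 x - U x) \<le> ereal E \<longrightarrow>
           (\<forall>Y. D Y \<le> 2 * E * (W Y / exp_weight \<kappa> Y)))"
      if u0: "BUC1 u0" "W1inf_exp_norm \<kappa> (\<lambda>x. u0 x - U x) \<le> ereal (\<epsilon> / 2)" for u0
    proof -
      have u0d: "(u0 has_real_derivative deriv u0 y) (at y)" for y
        using u0(1) by (simp add: BUC1_def DERIV_deriv_iff_field_differentiable)
      have u0'c: "continuous_on UNIV (deriv u0)"
        using u0(1) unfolding BUC1_def BUC0_def by (blast intro: uniformly_continuous_imp_continuous)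
      have dd: "((\<lambda>y. u0 y - U y) has_real_derivative deriv u0 y + G (U y)) (at y)" for y
        using DERIV_diff[OF u0d U_deriv] by simp
      have ddc: "continuous_on UNIV (\<lambda>y. deriv u0 y + G (U y))" by (intro continuous_intros u0'c GUc)
      have ddd: "deriv (\<lambda>y. u0 y - U y) y = deriv u0 y + G (U y)" for y using dd DERIV_imp_deriv by blast
      have pw: "\<bar>u0 x - U x\<bar> \<le> E * W x" "\<bar>deriv u0 x + G (U x)\<bar> \<le> E * W x"
        if "\<And>x. 0 < W x" "antimono W" "W1inf_norm W (\<lambda>x. u0 x - U x) \<le> ereal E" for W E x
        using W1inf_norm_imp_pointwise[OF that(1,2) dd ddc that(3)] by auto
      have "W1inf_norm (exp_weight \<kappa>) (\<lambda>x. u0 x - U x) \<le> ereal (\<epsilon> / 2)"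
        using u0(2) by (simp add: W1inf_exp_norm_def)
      note p = pw[OF W(1,3) this]
      \<comment> \<open>The norm bounds value and derivative separately, each by
        \<open>\<epsilon> / 2\<close>; this is why \<open>\<delta>0\<close> is taken as half of
        \<open>\<epsilon>\<close>.\<close>
      have close: "\<bar>u0 y - U y\<bar> + \<bar>deriv u0 y + G (U y)\<bar> \<le> \<epsilon> * exp_weight \<kappa> y" for y
        using p[of y] by linarith
      define D where "D Y = (\<bar>u0 Y - U Y\<bar> + \<bar>deriv u0 Y + G (U Y)\<bar>) / exp_weight \<kappa> Y" for Y
      have D: "0 \<le> D Y" "D Y \<le> \<epsilon>" for Y
        using close[of Y] W(1)[of Y] by (auto simp: D_def pos_divide_le_eq)
      obtain v vt vy where "tracks_profile C3 \<theta> \<eta> u0 (deriv u0) v vt vy"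
        using sol[OF u0d u0'c close] by blast
      then have v:
        "\<And>y. v 0 y = u0 y" "\<And>y. vy 0 y = deriv u0 y"
        "continuous_on ({0..} \<times> UNIV) (\<lambda>p. v (fst p) (snd p))"
        "continuous_on ({0..} \<times> UNIV) (\<lambda>p. vt (fst p) (snd p))"
        "continuous_on ({0..} \<times> UNIV) (\<lambda>p. vy (fst p) (snd p))"
        "\<And>t y. 0 < t \<Longrightarrow> ((\<lambda>p. v (fst p) (snd p)) has_derivative (\<lambda>h. vt t y * fst h + vy t y * snd h)) (at (t, y))"
        "\<And>t y. b (v t y) * vt t y - vy t y = G (v t y)"
        "\<And>t y. 0 \<le> t \<Longrightarrow> \<bar>v t y - U y\<bar> \<le> \<eta>"
        and est: "\<And>t y. 0 \<le> t \<Longrightarrow> \<exists>Y d. 0 \<le> d \<and> d \<le> 1 \<and> (\<theta> * t \<le> Y \<or> d \<le> exp (- \<theta> * t)) \<and>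
              \<bar>v t y - U y\<bar> + \<bar>vy t y + G (U y)\<bar> \<le> C3 * exp_weight \<kappa> y * (d * D Y)"
        unfolding tracks_profile_def D_def by blast+
      \<comment> \<open>Since \<open>v\<close> stays within \<open>\<eta>\<close> of the profile,
        the clamp is inactive there and b c = 1, so multiplication by \<open>c\<close> restores the
        original equation.\<close>
      have pde: "vt t y - (\<sigma> - deriv f (v t y)) * vy t y = g (v t y)" if "0 \<le> t" for t y
      proof -
        define c where "c = \<sigma> - deriv f (v t y)"
        have 1: "b (v t y) * c = 1" "G (v t y) = b (v t y) * g (v t y)"
          using bG[OF v(8)[OF that, of y]] by (auto simp: c_def)
        have "c * (b (v t y) * vt t y - vy t y) = c * (b (v t y) * g (v t y))" using v(7)[of t y] 1(2) by simp
        then have "(b (v t y) * c) * vt t y - c * vy t y = (b (v t y) * c) * g (v t y)" by (simp add: algebra_simps)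
        then show ?thesis using 1(1) by (simp add: c_def)
      qed
      have vbd: "\<bar>v t y\<bar> \<le> BU + \<eta>" if "0 \<le> t" for t y using v(8)[OF that, of y] BU[of y] by linarith
      have vybd: "\<bar>vy t y\<bar> \<le> M + C3 * \<epsilon>" if t: "0 \<le> t" for t y
      proof -
        obtain Y d where Yd: "0 \<le> d" "d \<le> 1" "\<bar>v t y - U y\<bar> + \<bar>vy t y + G (U y)\<bar> \<le> C3 * exp_weight \<kappa> y * (d * D Y)"
          using est[OF t, of y] by blast
        have 1: "d * D Y \<le> 1 * \<epsilon>" using Yd D[of Y] by (intro mult_mono) auto
        have "C3 * exp_weight \<kappa> y \<le> C3 * 1" using eps W(2) by (intro mult_left_mono) auto
        then have "C3 * exp_weight \<kappa> y * (d * D Y) \<le> C3 * 1 * (1 * \<epsilon>)"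
          by (rule mult_mono[OF _ 1]) (use eps Yd(1) D(1)[of Y] in auto)
        then show ?thesis using Yd(3) G_bound[of "U y"] by simp
      qed
      have vtbd: "\<bar>vt t y\<bar> \<le> (M + (M + C3 * \<epsilon>)) / b0" if "0 \<le> t" for t y
      proof -
        have "b (v t y) * vt t y = G (v t y) + vy t y" using v(7)[of t y] by linarith
        then have "b (v t y) * \<bar>vt t y\<bar> = \<bar>G (v t y) + vy t y\<bar>"
          using b_bounds(1)[of "v t y"] b0_pos by (metis abs_mult abs_of_pos less_le_trans)
        also have "\<dots> \<le> M + (M + C3 * \<epsilon>)" using vybd[OF that, of y] G_bound[of "v t y"] by linarith
        finally have "b0 * \<bar>vt t y\<bar> \<le> M + (M + C3 * \<epsilon>)"
          using mult_right_mono[OF b_bounds(1)[of "v t y"], of "\<bar>vt t y\<bar>"] by simp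
        then show ?thesis using b0_pos by (simp add: pos_le_divide_eq mult.commute)
      qed
      have existence: "entropy_solution f g u0 (\<lambda>t x. v t (x - \<sigma> * t))"
        by (rule moving_frame_solution(1)[OF assms(1,2) v(3,4,5,6) pde v(1) vbd vtbd vybd])
      have uniqueness: "AE x in lborel. u t (x + \<sigma> * t) = v t x"
        if "entropy_solution f g u0 u" "0 \<le> t" for u t
        by (rule moving_frame_solution(2)[where u=u and t=t, OF assms(1,2) v(3,4,5,6) pde v(1) vbd vtbd vybd])
           (use that in auto)
      have slice: "(v t has_real_derivative vy t y) (at y)" if "0 \<le> t" for t y
      proof (cases "t = 0")
        case True
        have "v 0 = u0" using v(1) by auto
        then show ?thesis using True u0d v(2) by simp
      next
        case False
        then have t: "0 < t" using that by simp
        have 1: "((\<lambda>y. (t, y)) has_derivative (\<lambda>h. (0, h))) (at y)" by (auto intro!: derivative_eq_intros)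
        from has_derivative_compose[OF 1 v(6)[OF t]] show ?thesis by (simp add: has_field_derivative_def)
      qed
      have slicec: "continuous_on UNIV (vy t)" if "0 \<le> t" for t
      proof -
        have "continuous_on UNIV (\<lambda>y. (t, y))" by (intro continuous_intros)
        from continuous_on_compose2[OF v(5) this] that show ?thesis by auto
      qed
      have norm: "W1inf_exp_norm \<kappa> (\<lambda>x. u t (x + \<sigma> * t) - U x) \<le> ereal R"
        if u: "entropy_solution f g u0 u" and t: "0 \<le> t"
          and R1: "\<And>Y. \<theta> * t \<le> Y \<Longrightarrow> C3 * D Y \<le> R" and R2: "\<And>Y. C3 * (exp (- \<theta> * t) * D Y) \<le> R" for u t R
        unfolding W1inf_exp_norm_def
      proof (rule W1inf_norm_le[where V="\<lambda>y. v t y - U y" and V'="\<lambda>y. vy t y + G (U y)"])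
        have [measurable]: "(\<lambda>x. u t x) \<in> borel_measurable borel" by (rule entropy_solution_slice_measurable[OF u t])
        have [measurable]: "U \<in> borel_measurable borel" by (rule borel_measurable_continuous_onI[OF Uc])
        show "(\<lambda>x. u t (x + \<sigma> * t) - U x) \<in> borel_measurable borel" by measurable
        show "AE x in lborel. u t (x + \<sigma> * t) - U x = v t x - U x"
          using uniqueness[OF u t] by eventually_elim simp
        show "((\<lambda>y. v t y - U y) has_real_derivative vy t x + G (U x)) (at x)" for x
          using DERIV_diff[OF slice[OF t] U_deriv] by simp
        show "continuous_on UNIV (\<lambda>y. vy t y + G (U y))" by (intro continuous_intros slicec[OF t] GUc)
        show "exp_weight \<kappa> \<in> borel_measurable borel" by (rule borel_measurable_continuous_onI[OF W(4)])
        show "\<bar>v t x - U x\<bar> + \<bar>vy t x + G (U x)\<bar> \<le> R * exp_weight \<kappa> x" for x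
        proof -
          obtain Y d where Yd: "0 \<le> d" "d \<le> 1" "\<theta> * t \<le> Y \<or> d \<le> exp (- \<theta> * t)"
            "\<bar>v t x - U x\<bar> + \<bar>vy t x + G (U x)\<bar> \<le> C3 * exp_weight \<kappa> x * (d * D Y)"
            using est[OF t, of x] by blast
          have "C3 * (d * D Y) \<le> R"
            using Yd(3)
          proof
            assume "\<theta> * t \<le> Y"
            have "C3 * (d * D Y) \<le> C3 * (1 * D Y)" using Yd D[of Y] eps by (intro mult_left_mono mult_right_mono) auto
            then show ?thesis using R1[OF \<open>\<theta> * t \<le> Y\<close>] by simp
          next
            assume "d \<le> exp (- \<theta> * t)"
            then have "C3 * (d * D Y) \<le> C3 * (exp (- \<theta> * t) * D Y)" using D[of Y] eps by (intro mult_left_mono mult_right_mono) auto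
            then show ?thesis using R2[of Y] by simp
          qed
          from mult_right_mono[OF this less_imp_le[OF W(1)[of x]]]
          have "C3 * exp_weight \<kappa> x * (d * D Y) \<le> R * exp_weight \<kappa> x" by (simp add: mult_ac)
          then show ?thesis using Yd(4) by linarith
        qed
      qed (rule W(1))
      have DW: "D Y \<le> 2 * E * (W Y / exp_weight \<kappa> Y)"
        if "\<And>x. 0 < W x" "antimono W" "W1inf_norm W (\<lambda>x. u0 x - U x) \<le> ereal E" for W E Y
      proof -
        have "\<bar>u0 Y - U Y\<bar> + \<bar>deriv u0 Y + G (U Y)\<bar> \<le> 2 * E * W Y" using pw[OF that, of Y] by linarith
        then show ?thesis using divide_right_mono[OF _ less_imp_le[OF W(1)[of Y]]] unfolding D_def by fastforce
      qed
      show ?thesis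
      proof (intro exI[of _ D] conjI allI impI)
        show "D Y = (\<bar>u0 Y - U Y\<bar> + \<bar>deriv (\<lambda>y. u0 y - U y) Y\<bar>) / exp_weight \<kappa> Y" for Y
          by (simp add: D_def ddd)
        show "\<exists>u. entropy_solution f g u0 u" using existence by blast
      qed (use D norm DW in blast)+
    qed
    show ?thesis
    proof (rule exI[of _ "\<epsilon> / 2"], rule conjI[OF half_gt_zero[OF eps(1)]], rule allI, rule impI)
      fix \<rho> assume \<rho>: "subexponential_weight \<rho>"
      have \<rho>pos: "\<And>t. 0 \<le> t \<Longrightarrow> 0 < \<rho> t" and \<rho>anti: "\<And>s t. 0 \<le> s \<Longrightarrow> s \<le> t \<Longrightarrow> \<rho> t \<le> \<rho> s"
        using \<rho> by (auto simp: subexponential_weight_def monotone_on_def)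
      obtain \<omega> c where \<omega>: "0 < \<omega>" "0 < c" "\<And>t. 0 \<le> t \<Longrightarrow> c * exp (- \<omega> * t) \<le> \<rho> t"
        using \<rho> unfolding subexponential_weight_def by blast
      \<comment> \<open>\<open>\<theta>\<rho> \<le> \<theta>\<close> serves the feet beyond
        \<open>\<theta> * t\<close>. The entry \<open>\<theta> / \<omega>\<close> slows the clock of
        \<open>\<rho>\<close> so that exp(-\<theta> t) is below a multiple of
        \<open>\<rho> (\<theta>\<rho> * t)\<close>, by the exponential lower bound on the
        weight.\<close>
      define \<theta>\<rho> where "\<theta>\<rho> = min \<theta> (\<theta> / \<omega>)"
      have \<theta>\<rho>: "0 < \<theta>\<rho>" "\<theta>\<rho> \<le> \<theta>" "\<omega> * \<theta>\<rho> \<le> \<theta>"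
      proof -
        show "0 < \<theta>\<rho>" "\<theta>\<rho> \<le> \<theta>" using eps \<omega> by (auto simp: \<theta>\<rho>_def)
        have "\<theta>\<rho> \<le> \<theta> / \<omega>" by (simp add: \<theta>\<rho>_def)
        then show "\<omega> * \<theta>\<rho> \<le> \<theta>" using \<omega>(1) by (simp add: pos_le_divide_eq mult.commute)
      qed
      \<comment> \<open>The factor 2 comes from adding value and derivative; the summands 1 and
        \<open>\<rho> 0 / c\<close> cover feet far to the right and damped characteristics,
        respectively.\<close>
      define C\<rho> where "C\<rho> = 2 * C3 * (1 + \<rho> 0 / c)"
      have \<rho>0c: "0 \<le> \<rho> 0 / c" using \<rho>pos[of 0] \<omega> by simp
      have C\<rho>: "0 < C\<rho>" "2 * C3 \<le> C\<rho>" "2 * C3 * (\<rho> 0 / c) \<le> C\<rho>"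
      proof -
        show "0 < C\<rho>" unfolding C\<rho>_def using eps \<rho>0c by (intro mult_pos_pos add_pos_nonneg) auto
        have "2 * C3 * 1 \<le> C\<rho>" unfolding C\<rho>_def by (rule mult_left_mono) (use eps \<rho>0c in auto)
        then show "2 * C3 \<le> C\<rho>" by simp
        show "2 * C3 * (\<rho> 0 / c) \<le> C\<rho>" unfolding C\<rho>_def by (rule mult_left_mono) (use eps in auto)
      qed
      show "\<exists>C>0. \<exists>\<theta>>0. \<forall>u0 :: real \<Rightarrow> real.
        BUC1 u0 \<and>
        BUC0 (\<lambda>x. (u0 x - U x) / exp_weight \<kappa> x) \<and>
        BUC0 (\<lambda>x. deriv (\<lambda>y. u0 y - U y) x / exp_weight \<kappa> x) \<and>
        W1inf_exp_norm \<kappa> (\<lambda>x. u0 x - U x) \<le> ereal (\<epsilon> / 2) \<longrightarrow>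
        (\<exists>u. entropy_solution f g u0 u) \<and>
        (\<forall>u. entropy_solution f g u0 u \<longrightarrow>
          (((\<lambda>x. exp (\<kappa> * x) *\<^sub>R (u0 x - U x, deriv (\<lambda>y. u0 y - U y) x)) \<longlongrightarrow> (0, 0)) at_top \<longrightarrow>
            ((\<lambda>t. W1inf_exp_norm \<kappa> (\<lambda>x. u t (x + \<sigma> * t) - U x)) \<longlongrightarrow> 0) at_top) \<and>
          (W1inf_subexp_norm \<kappa> \<rho> (\<lambda>x. u0 x - U x) < \<infinity> \<longrightarrow>
            (\<forall>t\<ge>0. W1inf_exp_norm \<kappa> (\<lambda>x. u t (x + \<sigma> * t) - U x)
               \<le> ereal C * W1inf_subexp_norm \<kappa> \<rho> (\<lambda>x. u0 x - U x) * ereal (\<rho> (\<theta> * t)))))"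
      proof (rule exI[of _ C\<rho>], rule conjI[OF C\<rho>(1)], rule exI[of _ \<theta>\<rho>], rule conjI[OF \<theta>\<rho>(1)], rule allI, rule impI)
        fix u0 :: "real \<Rightarrow> real"
        assume H: "BUC1 u0 \<and>
          BUC0 (\<lambda>x. (u0 x - U x) / exp_weight \<kappa> x) \<and>
          BUC0 (\<lambda>x. deriv (\<lambda>y. u0 y - U y) x / exp_weight \<kappa> x) \<and>
          W1inf_exp_norm \<kappa> (\<lambda>x. u0 x - U x) \<le> ereal (\<epsilon> / 2)"
        then have H1: "BUC1 u0" "W1inf_exp_norm \<kappa> (\<lambda>x. u0 x - U x) \<le> ereal (\<epsilon> / 2)" by auto
        from main[OF H1] obtain D where D: "\<And>Y. D Y = (\<bar>u0 Y - U Y\<bar> + \<bar>deriv (\<lambda>y. u0 y - U y) Y\<bar>) / exp_weight \<kappa> Y"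
          "\<And>Y. D Y \<le> \<epsilon>" and ex: "\<exists>u. entropy_solution f g u0 u"
          and norm: "\<And>u t R. \<lbrakk>entropy_solution f g u0 u; 0 \<le> t; \<And>Y. \<theta> * t \<le> Y \<Longrightarrow> C3 * D Y \<le> R;
            \<And>Y. C3 * (exp (- \<theta> * t) * D Y) \<le> R\<rbrakk> \<Longrightarrow> W1inf_exp_norm \<kappa> (\<lambda>x. u t (x + \<sigma> * t) - U x) \<le> ereal R"
          and DW: "\<And>W E Y. \<lbrakk>\<And>x. 0 < W x; antimono W; W1inf_norm W (\<lambda>x. u0 x - U x) \<le> ereal E\<rbrakk> \<Longrightarrow>
            D Y \<le> 2 * E * (W Y / exp_weight \<kappa> Y)"
          by blast
        show "(\<exists>u. entropy_solution f g u0 u) \<and>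
        (\<forall>u. entropy_solution f g u0 u \<longrightarrow>
          (((\<lambda>x. exp (\<kappa> * x) *\<^sub>R (u0 x - U x, deriv (\<lambda>y. u0 y - U y) x)) \<longlongrightarrow> (0, 0)) at_top \<longrightarrow>
            ((\<lambda>t. W1inf_exp_norm \<kappa> (\<lambda>x. u t (x + \<sigma> * t) - U x)) \<longlongrightarrow> 0) at_top) \<and>
          (W1inf_subexp_norm \<kappa> \<rho> (\<lambda>x. u0 x - U x) < \<infinity> \<longrightarrow>
            (\<forall>t\<ge>0. W1inf_exp_norm \<kappa> (\<lambda>x. u t (x + \<sigma> * t) - U x)
               \<le> ereal C\<rho> * W1inf_subexp_norm \<kappa> \<rho> (\<lambda>x. u0 x - U x) * ereal (\<rho> (\<theta>\<rho> * t)))))"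
        proof (intro conjI allI impI)
          show "\<exists>u. entropy_solution f g u0 u" by (rule ex)
        next
          fix u assume u: "entropy_solution f g u0 u"
            and lim: "((\<lambda>x. exp (\<kappa> * x) *\<^sub>R (u0 x - U x, deriv (\<lambda>y. u0 y - U y) x)) \<longlongrightarrow> (0, 0)) at_top"
          \<comment> \<open>Feet beyond \<open>\<theta> * t\<close> see only the tail of the datum,
            which is small by the hypothesis at +\<infinity>; every other contribution is at most C3
            \<epsilon> exp(-\<theta> t).\<close>
          have small: "eventually (\<lambda>t. W1inf_exp_norm \<kappa> (\<lambda>x. u t (x + \<sigma> * t) - U x) \<le> ereal e) at_top" if e: "0 < e" for e
          proof -
            have "0 < e / C3 / 2" using e eps by simp
            from tendstoD[OF lim this]
            obtain X0 where X0: "\<And>x. X0 \<le> x \<Longrightarrow> norm (exp (\<kappa> * x) *\<^sub>R (u0 x - U x, deriv (\<lambda>y. u0 y - U y) x)) < e / C3 / 2"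
              by (auto simp: eventually_at_top_linorder dist_norm zero_prod_def[symmetric])
            define X where "X = max X0 0"
            have DX: "C3 * D Y \<le> e" if "X \<le> Y" for Y
            proof -
              have Y: "X0 \<le> Y" "0 \<le> Y" using that by (auto simp: X_def)
              define q where "q = (u0 Y - U Y, deriv (\<lambda>y. u0 y - U y) Y)"
              have "\<bar>u0 Y - U Y\<bar> \<le> norm q" "\<bar>deriv (\<lambda>y. u0 y - U y) Y\<bar> \<le> norm q"
                using norm_fst_le[of "u0 Y - U Y" "deriv (\<lambda>y. u0 y - U y) Y"]
                  norm_snd_le[of "deriv (\<lambda>y. u0 y - U y) Y" "u0 Y - U Y"] by (auto simp: q_def)
              then have s: "\<bar>u0 Y - U Y\<bar> + \<bar>deriv (\<lambda>y. u0 y - U y) Y\<bar> \<le> 2 * norm q" by linarith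
              have "D Y = exp (\<kappa> * Y) * (\<bar>u0 Y - U Y\<bar> + \<bar>deriv (\<lambda>y. u0 y - U y) Y\<bar>)"
                using Y by (simp add: D(1) exp_weight_def exp_minus field_simps)
              also have "\<dots> \<le> exp (\<kappa> * Y) * (2 * norm q)" using s by (intro mult_left_mono) auto
              also have "\<dots> = 2 * norm (exp (\<kappa> * Y) *\<^sub>R q)" by simp
              also have "\<dots> \<le> e / C3" using X0[OF Y(1)] by (simp add: q_def)
              finally show ?thesis using eps by (simp add: pos_le_divide_eq mult.commute)
            qed
            have "((\<lambda>t. C3 * (exp (- \<theta> * t) * \<epsilon>)) \<longlongrightarrow> C3 * (0 * \<epsilon>)) at_top"
            proof (intro tendsto_intros)
              have "filterlim (\<lambda>t. - \<theta> * t) at_bot at_top"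
                by (rule filterlim_tendsto_neg_mult_at_bot[OF tendsto_const _ filterlim_ident]) (use eps in simp)
              then show "((\<lambda>t. exp (- \<theta> * t)) \<longlongrightarrow> 0) at_top" by (rule filterlim_compose[OF exp_at_bot])
            qed
            then have ev: "eventually (\<lambda>t. C3 * (exp (- \<theta> * t) * \<epsilon>) < e) at_top"
              using e by (intro order_tendstoD(2)) auto
            have ev2: "eventually (\<lambda>t. X / \<theta> \<le> t \<and> 0 \<le> t) at_top"
              using eventually_ge_at_top[of "X / \<theta>"] eventually_ge_at_top[of "0::real"] by eventually_elim simp
            show ?thesis
              using ev ev2
            proof eventually_elim
              case (elim t)
              then have Xt: "X \<le> \<theta> * t" using eps by (simp add: pos_divide_le_eq mult.commute)
              show ?case
              proof (rule norm[OF u])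
                show "0 \<le> t" using elim by simp
                show "C3 * D Y \<le> e" if "\<theta> * t \<le> Y" for Y using DX[of Y] Xt that by linarith
                show "C3 * (exp (- \<theta> * t) * D Y) \<le> e" for Y
                proof -
                  have "C3 * (exp (- \<theta> * t) * D Y) \<le> C3 * (exp (- \<theta> * t) * \<epsilon>)"
                    using D(2)[of Y] eps by (intro mult_left_mono) auto
                  then show ?thesis using elim by linarith
                qed
              qed
            qed
          qed
          show "((\<lambda>t. W1inf_exp_norm \<kappa> (\<lambda>x. u t (x + \<sigma> * t) - U x)) \<longlongrightarrow> 0) at_top"
          proof (rule order_tendstoI)
            fix a :: ereal assume "a < 0"
            then show "eventually (\<lambda>t. a < W1inf_exp_norm \<kappa> (\<lambda>x. u t (x + \<sigma> * t) - U x)) at_top"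
              using W1inf_norm_nonneg[OF W(1)] unfolding W1inf_exp_norm_def
              by (intro always_eventually allI) (meson less_le_trans)
          next
            fix a :: ereal assume "0 < a"
            then obtain e where e: "0 < ereal e" "ereal e < a" using ereal_dense2 by blast
            have "0 < e" using e(1) by simp
            from small[OF this] show "eventually (\<lambda>t. W1inf_exp_norm \<kappa> (\<lambda>x. u t (x + \<sigma> * t) - U x) < a) at_top"
              by eventually_elim (use e(2) le_less_trans in blast)
          qed
        next
          fix u t assume u: "entropy_solution f g u0 u"
            and fin: "W1inf_subexp_norm \<kappa> \<rho> (\<lambda>x. u0 x - U x) < \<infinity>" and t: "(0::real) \<le> t"
          define Wr where "Wr x = \<rho> (max x 0) * exp_weight \<kappa> x" for x
          have Wpos: "0 < Wr x" for x using \<rho>pos[of "max x 0"] W(1)[of x] by (simp add: Wr_def)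
          have Wanti: "antimono Wr"
            unfolding antimono_def Wr_def
          proof (intro allI impI mult_mono)
            fix x y :: real assume "x \<le> y"
            then show "\<rho> (max y 0) \<le> \<rho> (max x 0)" by (intro \<rho>anti) auto
            show "exp_weight \<kappa> y \<le> exp_weight \<kappa> x" using W(3) \<open>x \<le> y\<close> by (simp add: antimono_def)
          qed (use \<rho>pos W(1) in \<open>auto intro: less_imp_le\<close>)
          define Nr where "Nr = W1inf_subexp_norm \<kappa> \<rho> (\<lambda>x. u0 x - U x)"
          have Nr: "Nr = W1inf_norm Wr (\<lambda>x. u0 x - U x)" unfolding Nr_def W1inf_subexp_norm_def Wr_def[abs_def] ..
          have "0 \<le> Nr" unfolding Nr by (rule W1inf_norm_nonneg[OF Wpos])
          then obtain E where E: "Nr = ereal E" "0 \<le> E" using fin unfolding Nr_def[symmetric] by (cases Nr) auto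
          have DE: "D Y \<le> 2 * E * \<rho> (max Y 0)" for Y
            using DW[OF Wpos Wanti, of E Y] E(1) W(1)[of Y] unfolding Nr Wr_def by simp
          define R where "R = C\<rho> * E * \<rho> (\<theta>\<rho> * t)"
          have \<theta>t: "0 \<le> \<theta>\<rho> * t" "\<theta>\<rho> * t \<le> \<theta> * t" using \<theta>\<rho> t by (auto intro: mult_right_mono)
          have "W1inf_exp_norm \<kappa> (\<lambda>x. u t (x + \<sigma> * t) - U x) \<le> ereal R"
          proof (rule norm[OF u t])
            fix Y
            assume Y: "\<theta> * t \<le> Y"
            have "C3 * D Y \<le> C3 * (2 * E * \<rho> (max Y 0))" using DE eps by (intro mult_left_mono) auto
            also have "\<dots> \<le> C3 * (2 * E * \<rho> (\<theta>\<rho> * t))"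
              using eps E(2) Y \<theta>t by (intro mult_left_mono \<rho>anti) auto
            also have "\<dots> = (2 * C3) * (E * \<rho> (\<theta>\<rho> * t))" by simp
            also have "\<dots> \<le> C\<rho> * (E * \<rho> (\<theta>\<rho> * t))"
              using C\<rho>(2) E(2) \<rho>pos[OF \<theta>t(1)] by (intro mult_right_mono mult_nonneg_nonneg) auto
            finally show "C3 * D Y \<le> R" by (simp add: R_def mult.assoc)
          next
            fix Y
            have "exp (- \<theta> * t) \<le> exp (- \<omega> * (\<theta>\<rho> * t))"
              using mult_right_mono[OF \<theta>\<rho>(3) t] by (simp add: mult.assoc)
            also have "\<dots> \<le> \<rho> (\<theta>\<rho> * t) / c" using \<omega>(3)[OF \<theta>t(1)] \<omega>(2) by (simp add: pos_le_divide_eq mult.commute)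
            finally have ex: "exp (- \<theta> * t) \<le> \<rho> (\<theta>\<rho> * t) / c" .
            \<comment> \<open>In the damped alternative the foot may be anywhere, so only the
              largest value \<open>\<rho> 0\<close> of the weight is available, and the decay in
              time comes from the exponential.\<close>
            have "D Y \<le> 2 * E * \<rho> 0"
              using DE[of Y] mult_left_mono[OF \<rho>anti[of 0 "max Y 0"], of "2 * E"] E(2) by simp
            then have "exp (- \<theta> * t) * D Y \<le> exp (- \<theta> * t) * (2 * E * \<rho> 0)" by (intro mult_left_mono) auto
            also have "\<dots> \<le> (\<rho> (\<theta>\<rho> * t) / c) * (2 * E * \<rho> 0)"
              using ex E(2) \<rho>pos[of 0] by (intro mult_right_mono) auto
            finally have "C3 * (exp (- \<theta> * t) * D Y) \<le> C3 * ((\<rho> (\<theta>\<rho> * t) / c) * (2 * E * \<rho> 0))"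
              using eps by (intro mult_left_mono) auto
            also have "\<dots> = (2 * C3 * (\<rho> 0 / c)) * (E * \<rho> (\<theta>\<rho> * t))" by simp
            also have "\<dots> \<le> C\<rho> * (E * \<rho> (\<theta>\<rho> * t))"
              using C\<rho>(3) E(2) \<rho>pos[OF \<theta>t(1)] by (intro mult_right_mono mult_nonneg_nonneg) auto
            finally show "C3 * (exp (- \<theta> * t) * D Y) \<le> R" by (simp add: R_def mult.assoc)
          qed
          then show "W1inf_exp_norm \<kappa> (\<lambda>x. u t (x + \<sigma> * t) - U x)
               \<le> ereal C\<rho> * W1inf_subexp_norm \<kappa> \<rho> (\<lambda>x. u0 x - U x) * ereal (\<rho> (\<theta>\<rho> * t))"
            unfolding Nr_def[symmetric] E(1) by (simp add: R_def)
        qed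
      qed
    qed
  qed
qed

end
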